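(* Let $X$ be one of the compact connected symmetric spaces of rank one $\mathbb R\mathbb S^n$ ($n\ge1$), $\mathbb R\mathbb P^n$, $\mathbb C\mathbb P^n$, $\mathbb H\mathbb P^n$ ($n\ge2$) or $\mathbb O\mathbb P^2$, with the distance $d$ and the invariant probability measure described below, and let $L\in(0,\frac\pi2)$. Let $A(N,L)$ be the adjacency matrix of the random geometric graph with $N$ independent uniform vertices on $X$ and edges between distinct vertices at distance $\le L$. In the Giné--Koltchinskii sense (padding both spectra with zeros, listing nonnegative values decreasingly and negative values increasingly, the $\ell^2$ distance between the ordered sequences tends to $0$ almost surely), the limit of $\mathrm{Spec}(A(N,L)/N)$ consists of one eigenvalue $c_k$ for each integer $k\ge0$, with multiplicity $d_{k\omega_0}$, where: - $\mathbb R\mathbb S^n$: $d_{k\omega_0}=\frac{2k+n-1}{k+n-1}\binom{k+n-1}{n-1}$, $c_0=\frac{\int_0^L\sin^{n-1}\theta\,d\theta}{\int_0^\pi\sin^{n-1}\theta\,d\theta}$, $c_{k\ge1}=\frac{(\sin L)^n}{n\int_0^\pi\sin^{n-1}\theta\,d\theta}P^{n+2,k-1}(\cos L)$; - $\mathbb R\mathbb P^n$: $d_{k\omega_0}=\frac{4k+n-1}{2k+n-1}\binom{2k+n-1}{n-1}$, $c_0=\frac{\int_0^L\sin^{n-1}\theta\,d\theta}{\int_0^{\pi/2}\sin^{n-1}\theta\,d\theta}$, $c_{k\ge1}=\frac{\Gamma(\frac{n+1}2)}{\Gamma(\frac12)\Gamma(\frac{n+2}2)}\cos L\,(\sin L)^nJ^{(\frac32,\frac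 n2+1),k-1}(\cos^2L)$; - $\mathbb C\mathbb P^n$: $d_{k\omega_0}=\frac{2k+n}{n}\binom{k+n-1}{n-1}^2$, $c_0=(\sin L)^{2n}$, $c_{k\ge1}=(\cos L)^2(\sin L)^{2n}J^{(2,n+1),k-1}(\cos^2L)$; - $\mathbb H\mathbb P^n$: $d_{k\omega_0}=\frac{2k+2n+1}{(2n+1)(k+1)}\binom{k+2n}{2n}\binom{k+2n-1}{2n-1}$, $c_0=(\sin L)^{4n}(1+2n\cos^2L)$, $c_{k\ge1}=(2n+1)(\cos L)^4(\sin L)^{4n}J^{(3,2n+1),k-1}(\cos^2L)$; - $\mathbb O\mathbb P^2$: $d_{k\omega_0}=\frac{2k+11}{385}\binom{k+7}{4}\binom{k+10}{10}$, $c_0=(\sin L)^{16}(1+8\cos^2L+36\cos^4L+120\cos^6L)$, $c_{k\ge1}=165(\cos L)^8(\sin L)^{16}J^{(5,9),k-1}(\cos^2L)$.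
   Context: Coordinates: $\mathbb R\mathbb S^n=\{(x_1,\dots,x_{n+1})\in\mathbb R^{n+1}:\sum x_i^2=1\}$ with base point $b=(0,\dots,0,1)$ and $d(x,b)=\arccos(x_{n+1})$; for the projective spaces $\mathbb K\mathbb P^n$ ($\mathbb K=\mathbb R,\mathbb C,\mathbb H$, and $\mathbb O\mathbb P^2$ with homogeneous octonionic coordinates $[\theta_1:\theta_2:\theta_3]$ in an associative chart), base point $b=[0:\dots:0:1]$ and $d(x,b)=\arccos\big(|x_{n+1}|/\sqrt{|x_1|^2+\dots+|x_{n+1}|^2}\big)$; the distance between arbitrary points is obtained by invariance under the isometry group $G$ ($\mathrm{SO}(n+1)$, $\mathrm{SO}(n+1)$, $\mathrm{SU}(n+1)$, $\mathrm{USp}(n+1)$, $\mathrm F_4$ respectively), which acts transitively. Vertices are distributed according to the unique $G$-invariant probability measure on $X$. Legendre polynomials: $P^{n,k}(x)=\frac{(-1)^k\Gamma(\frac n2)}{2^k\Gamma(\frac n2+k)}\frac{1}{(1-x^2)^{\frac n2-1}}\frac{d^k}{dx^k}(1-x^2)^{\frac n2+k-1}$. Jacobi polynomials: $J^{(a,b),k}(s)=\frac{(-1)^k\Gamma(b)}{\Gamma(b+k)}\frac{1}{s^{a-1}(1-s)^{b-1}}\frac{d^k}{ds^k}\big(s^{a+k-1}(1-s)^{b+k-1}\big)$.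
   Formalization: For the sphere, the multiplicity at k=0 is taken to be 1, since the stated formula reads 0/0 when n=1 (it gives 1 for all n≥2); the invariant measure is described as invariant under all isometries of (X,d). *)

theory Defs
  imports "HOL-Probability.Probability" "Jordan_Normal_Form.Char_Poly"
begin

section \<open>Cayley--Dickson algebras: level 0 = R, 1 = C, 2 = H, 3 = O\<close>

text \<open>An element of the level-m algebra is a function nat => real supported on {0..<2^m};
  coordinate 0 is the real part.  Doubling convention: (a,b)(c,d) = (ac - d*b, da + bc*),
  (a,b)* = (a*, -b).\<close>

definition cd_lo :: "nat \<Rightarrow> (nat \<Rightarrow> real) \<Rightarrow> nat \<Rightarrow> real" where
  "cd_lo m a = (\<lambda>i. if i < 2^m then a i else 0)"

definition cd_hi :: "nat \<Rightarrow> (nat \<Rightarrow> real) \<Rightarrow> nat \<Rightarrow> real" where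
  "cd_hi m a = (\<lambda>i. if i < 2^m then a (i + 2^m) else 0)"

definition cd_join :: "nat \<Rightarrow> (nat \<Rightarrow> real) \<Rightarrow> (nat \<Rightarrow> real) \<Rightarrow> nat \<Rightarrow> real" where
  "cd_join m x y = (\<lambda>i. if i < 2^m then x i else if i < 2^(Suc m) then y (i - 2^m) else 0)"

fun cd_conj :: "nat \<Rightarrow> (nat \<Rightarrow> real) \<Rightarrow> nat \<Rightarrow> real" where
  "cd_conj 0 a = (\<lambda>i. if i = 0 then a 0 else 0)"
| "cd_conj (Suc m) a = cd_join m (cd_conj m (cd_lo m a)) (\<lambda>i. - cd_hi m a i)"

fun cd_mult :: "nat \<Rightarrow> (nat \<Rightarrow> real) \<Rightarrow> (nat \<Rightarrow> real) \<Rightarrow> nat \<Rightarrow> real" where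
  "cd_mult 0 a b = (\<lambda>i. if i = 0 then a 0 * b 0 else 0)"
| "cd_mult (Suc m) a b =
     cd_join m
       (\<lambda>i. cd_mult m (cd_lo m a) (cd_lo m b) i - cd_mult m (cd_conj m (cd_hi m b)) (cd_hi m a) i)
       (\<lambda>i. cd_mult m (cd_hi m b) (cd_lo m a) i + cd_mult m (cd_hi m a) (cd_conj m (cd_lo m b)) i)"

section \<open>Projective spaces KP^n (and OP^2) as rank-one idempotents of the Jordan algebra
  of Hermitian (n+1)x(n+1) matrices over the level-m Cayley--Dickson algebra\<close>

type_synonym hmat = "nat \<Rightarrow> nat \<Rightarrow> nat \<Rightarrow> real"

definition herm_ok :: "nat \<Rightarrow> nat \<Rightarrow> hmat \<Rightarrow> bool" where
  "herm_ok m n M \<longleftrightarrow>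
     (\<forall>i j. (n < i \<or> n < j) \<longrightarrow> M i j = (\<lambda>_. 0)) \<and>
     (\<forall>i j a. 2^m \<le> a \<longrightarrow> M i j a = 0) \<and>
     (\<forall>i j. M j i = cd_conj m (M i j))"

definition jordan_prod :: "nat \<Rightarrow> nat \<Rightarrow> hmat \<Rightarrow> hmat \<Rightarrow> hmat" where
  "jordan_prod m n M N =
     (\<lambda>i j a. (\<Sum>k\<le>n. cd_mult m (M i k) (N k j) a + cd_mult m (N i k) (M k j) a) / 2)"

definition jtrace :: "nat \<Rightarrow> hmat \<Rightarrow> real" where
  "jtrace n M = (\<Sum>i\<le>n. M i i 0)"

text \<open>Points of KP^n: Hermitian idempotents of trace 1 (the point [x] corresponds to x x^*/|x|^2).\<close>
definition proj_space :: "nat \<Rightarrow> nat \<Rightarrow> hmat set" where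
  "proj_space m n = {M. herm_ok m n M \<and> jordan_prod m n M M = M \<and> jtrace n M = 1}"

text \<open>d(P,Q) = arccos sqrt(tr(P o Q)); from the base point diag(0,..,0,1) this is
  arccos(|x_(n+1)|/|x|).\<close>
definition proj_dist :: "nat \<Rightarrow> nat \<Rightarrow> hmat \<Rightarrow> hmat \<Rightarrow> real" where
  "proj_dist m n P Q = arccos (sqrt (jtrace n (jordan_prod m n P Q)))"

definition sphere_pts :: "nat \<Rightarrow> (nat \<Rightarrow> real) set" where
  "sphere_pts n = {x. (\<forall>i. n < i \<longrightarrow> x i = 0) \<and> (\<Sum>i\<le>n. (x i)^2) = 1}"

definition sphere_dist :: "nat \<Rightarrow> (nat \<Rightarrow> real) \<Rightarrow> (nat \<Rightarrow> real) \<Rightarrow> real" where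
  "sphere_dist n x y = arccos (\<Sum>i\<le>n. x i * y i)"

definition ball_sigma :: "'p set \<Rightarrow> ('p \<Rightarrow> 'p \<Rightarrow> real) \<Rightarrow> 'p measure" where
  "ball_sigma X d = sigma X {{y\<in>X. d x y < r} | x r. x \<in> X}"

definition invariant_prob :: "'p set \<Rightarrow> ('p \<Rightarrow> 'p \<Rightarrow> real) \<Rightarrow> 'p measure \<Rightarrow> bool" where
  "invariant_prob X d \<mu> \<longleftrightarrow>
     prob_space \<mu> \<and> sets \<mu> = sets (ball_sigma X d) \<and>
     (\<forall>g. bij_betw g X X \<and> (\<forall>x\<in>X. \<forall>y\<in>X. d (g x) (g y) = d x y)
          \<longrightarrow> distr \<mu> (ball_sigma X d) g = \<mu>)"

definition iid_sample :: "'p set \<Rightarrow> ('p \<Rightarrow> 'p \<Rightarrow> real) \<Rightarrow> 'w measure \<Rightarrow> 'p measure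
    \<Rightarrow> (nat \<Rightarrow> 'w \<Rightarrow> 'p) \<Rightarrow> bool" where
  "iid_sample X d P \<mu> Y \<longleftrightarrow>
     prob_space P \<and> prob_space.indep_vars P (\<lambda>_. ball_sigma X d) Y UNIV \<and>
     (\<forall>i. Y i \<in> measurable P (ball_sigma X d) \<and> distr P (ball_sigma X d) (Y i) = \<mu>)"

definition rgg_adj :: "('p \<Rightarrow> 'p \<Rightarrow> real) \<Rightarrow> real \<Rightarrow> nat \<Rightarrow> (nat \<Rightarrow> 'p) \<Rightarrow> real mat" where
  "rgg_adj d L N v = mat N N (\<lambda>(i,j). if i \<noteq> j \<and> d (v i) (v j) \<le> L then 1 else 0)"

definition spec :: "real mat \<Rightarrow> real multiset" where
  "spec A = proots (char_poly A)"

text \<open>A spectrum is given as an indexed family f on an index set I (each eigenvalue listed with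
  its multiplicity).  pos_rearr: nonnegative values in decreasing order padded with zeros;
  neg_rearr: negative values in increasing order padded with zeros.\<close>
definition pos_rearr :: "'i set \<Rightarrow> ('i \<Rightarrow> real) \<Rightarrow> nat \<Rightarrow> real" where
  "pos_rearr I f k = Sup ({t. 0 < t \<and> (infinite {x\<in>I. t \<le> f x} \<or> k < card {x\<in>I. t \<le> f x})} \<union> {0})"

definition neg_rearr :: "'i set \<Rightarrow> ('i \<Rightarrow> real) \<Rightarrow> nat \<Rightarrow> real" where
  "neg_rearr I f k = - Sup ({t. 0 < t \<and> (infinite {x\<in>I. f x \<le> - t} \<or> k < card {x\<in>I. f x \<le> - t})} \<union> {0})"

definition gk_dist :: "'i set \<Rightarrow> ('i \<Rightarrow> real) \<Rightarrow> 'j set \<Rightarrow> ('j \<Rightarrow> real) \<Rightarrow> real" where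
  "gk_dist I f J g = sqrt ((\<Sum>k. (pos_rearr I f k - pos_rearr J g k)^2)
                        + (\<Sum>k. (neg_rearr I f k - neg_rearr J g k)^2))"

definition mset_index :: "real multiset \<Rightarrow> (real \<times> nat) set" where
  "mset_index S = {(x, j). j < count S x}"

text \<open>Limit spectrum: eigenvalue c k with multiplicity dm k (a nonnegative integer), k = 0,1,...\<close>
definition lim_index :: "(nat \<Rightarrow> real) \<Rightarrow> (nat \<times> nat) set" where
  "lim_index dm = {(k, j). real j < dm k}"

definition gk_to_limit :: "real multiset \<Rightarrow> (nat \<Rightarrow> real) \<Rightarrow> (nat \<Rightarrow> real) \<Rightarrow> real" where
  "gk_to_limit S c dm = gk_dist (mset_index S) fst (lim_index dm) (\<lambda>(k, j). c k)"

definition rgg_converges ::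
    "'p set \<Rightarrow> ('p \<Rightarrow> 'p \<Rightarrow> real) \<Rightarrow> real \<Rightarrow> 'w measure \<Rightarrow> (nat \<Rightarrow> 'w \<Rightarrow> 'p)
     \<Rightarrow> (nat \<Rightarrow> real) \<Rightarrow> (nat \<Rightarrow> real) \<Rightarrow> bool" where
  "rgg_converges X d L P Y c dm \<longleftrightarrow>
     (AE \<omega> in P. (\<lambda>N. gk_to_limit (spec ((1 / real N) \<cdot>\<^sub>m rgg_adj d L N (\<lambda>i. Y i \<omega>))) c dm)
                   \<longlonglongrightarrow> 0)"

section \<open>Legendre and Jacobi polynomials (Rodrigues formulas)\<close>

definition legendreP :: "real \<Rightarrow> nat \<Rightarrow> real \<Rightarrow> real" where
  "legendreP n k x = (-1)^k * Gamma (n/2) / (2^k * Gamma (n/2 + real k))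
     * (1 / (1 - x^2) powr (n/2 - 1))
     * (deriv ^^ k) (\<lambda>y. (1 - y^2) powr (n/2 + real k - 1)) x"

definition jacobiJ :: "real \<Rightarrow> real \<Rightarrow> nat \<Rightarrow> real \<Rightarrow> real" where
  "jacobiJ a b k s = (-1)^k * Gamma b / Gamma (b + real k)
     * (1 / (s powr (a - 1) * (1 - s) powr (b - 1)))
     * (deriv ^^ k) (\<lambda>t. t powr (a + real k - 1) * (1 - t) powr (b + real k - 1)) s"

definition dim_RS :: "nat \<Rightarrow> nat \<Rightarrow> real" where
  "dim_RS n k = (if k = 0 then 1 else
     (2*real k + real n - 1) / (real k + real n - 1) * real ((k + n - 1) choose (n - 1)))"

definition eig_RS :: "nat \<Rightarrow> real \<Rightarrow> nat \<Rightarrow> real" where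
  "eig_RS n L k = (if k = 0 then
       integral {0..L} (\<lambda>\<theta>. sin \<theta> ^ (n - 1)) / integral {0..pi} (\<lambda>\<theta>. sin \<theta> ^ (n - 1))
     else (sin L)^n / (real n * integral {0..pi} (\<lambda>\<theta>. sin \<theta> ^ (n - 1)))
          * legendreP (real n + 2) (k - 1) (cos L))"

definition dim_RP :: "nat \<Rightarrow> nat \<Rightarrow> real" where
  "dim_RP n k = (4*real k + real n - 1) / (2*real k + real n - 1)
     * real ((2*k + n - 1) choose (n - 1))"

definition eig_RP :: "nat \<Rightarrow> real \<Rightarrow> nat \<Rightarrow> real" where
  "eig_RP n L k = (if k = 0 then
       integral {0..L} (\<lambda>\<theta>. sin \<theta> ^ (n - 1)) / integral {0..pi/2} (\<lambda>\<theta>. sin \<theta> ^ (n - 1))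
     else Gamma ((real n + 1)/2) / (Gamma (1/2) * Gamma ((real n + 2)/2))
          * cos L * (sin L)^n * jacobiJ (3/2) (real n/2 + 1) (k - 1) ((cos L)^2))"

definition dim_CP :: "nat \<Rightarrow> nat \<Rightarrow> real" where
  "dim_CP n k = (2*real k + real n) / real n * (real ((k + n - 1) choose (n - 1)))^2"

definition eig_CP :: "nat \<Rightarrow> real \<Rightarrow> nat \<Rightarrow> real" where
  "eig_CP n L k = (if k = 0 then (sin L)^(2*n)
     else (cos L)^2 * (sin L)^(2*n) * jacobiJ 2 (real n + 1) (k - 1) ((cos L)^2))"

definition dim_HP :: "nat \<Rightarrow> nat \<Rightarrow> real" where
  "dim_HP n k = (2*real k + 2*real n + 1) / ((2*real n + 1) * (real k + 1))
     * real ((k + 2*n) choose (2*n)) * real ((k + 2*n - 1) choose (2*n - 1))"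

definition eig_HP :: "nat \<Rightarrow> real \<Rightarrow> nat \<Rightarrow> real" where
  "eig_HP n L k = (if k = 0 then (sin L)^(4*n) * (1 + 2*real n * (cos L)^2)
     else (2*real n + 1) * (cos L)^4 * (sin L)^(4*n) * jacobiJ 3 (2*real n + 1) (k - 1) ((cos L)^2))"

definition dim_OP :: "nat \<Rightarrow> real" where
  "dim_OP k = (2*real k + 11) / 385 * real ((k + 7) choose 4) * real ((k + 10) choose 10)"

definition eig_OP :: "real \<Rightarrow> nat \<Rightarrow> real" where
  "eig_OP L k = (if k = 0 then
       (sin L)^16 * (1 + 8*(cos L)^2 + 36*(cos L)^4 + 120*(cos L)^6)
     else 165 * (cos L)^8 * (sin L)^16 * jacobiJ 5 9 (k - 1) ((cos L)^2))"

end

theory Submission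
  imports Defs "Jordan_Normal_Form.Schur_Decomposition" "HOL-Probability.Hoeffding"
begin

text \<open>Put \<open>t(x,y) = (1 + \<langle>x,y\<rangle>)/2\<close> on a sphere and \<open>t(x,y) = tr(x \<circ> y)\<close> on a projective space. Explicit
  isometries show that \<open>t(x,\<cdot>)\<close> is Beta distributed under the invariant measure, and that the convolution of
  \<open>t\<^sup>i\<close> and \<open>t\<^sup>j\<close> is a polynomial in \<open>t\<close> of degree at most \<open>min i j\<close>. Hence the Jacobi polynomials of the Beta weight,
  evaluated at \<open>t\<close>, are up to a scalar orthogonal idempotents for convolution; the trace of the \<open>k\<close>-th idempotent is
  the multiplicity. The edge indicator is a function of \<open>t\<close>; approximate it in \<open>L\<^sup>2\<close> by finite
  Jacobi sums with coefficients \<open>c\<^sub>k\<close> and control the error by Frobenius norms. Along almost every sample, the power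
  sums of order \<open>r \<ge> 2\<close> of the spectrum of \<open>A/N\<close> then converge to \<open>\<Sum>\<^sub>k d\<^sub>k c\<^sub>k\<^sup>r\<close> by the strong law of large
  numbers, and power sums determine the limit of the ordered spectra in \<open>\<ell>\<^sup>2\<close>. By the Rodrigues formula, \<open>c\<^sub>k\<close> is the
  integral of an exact derivative.\<close>

section \<open>Jacobi polynomials and the Beta distribution\<close>

text \<open>The obstacle is the octonionic plane, where matrices do not associate. So the projective
  geometry rests on one kind of isometry, rotations that mix (y_jj - y_kk)/2 with a single real
  coordinate of y_jk, together with one sign change. They give two-point homogeneity, the moment
  recursion and the measurability of coordinates. A convolution is polynomial because a pair of
  points has two normal forms that differ only in the sign of s = sqrt(T (1 - T)), so odd powers of
  s cancel. It is also symmetric and does not raise degrees, hence diagonal in the orthogonal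
  polynomials. Power sums start at order 2 because a trace of at least two factors is controlled by
  Frobenius norms, a single trace is not. The indicator is enclosed between two polynomials, not
  merely approximated, because only averages of polynomials are known to converge along a sample.
  That the multiplicities are integers is read off from sampled matrices as well: the spectrum of a
  sampled idempotent has power sums tending to its trace.\<close>

definition beta_density :: "real \<Rightarrow> real \<Rightarrow> real \<Rightarrow> real" where
  "beta_density a b s = (if 0 < s \<and> s < 1 then s powr (a - 1) * (1 - s) powr (b - 1) / Beta a b else 0)"

definition beta_measure :: "real \<Rightarrow> real \<Rightarrow> real measure" where
  "beta_measure a b = density lborel (\<lambda>s. ennreal (beta_density a b s))"

text \<open>The recursion is the Rodrigues formula with one derivative carried out.\<close>
fun jac :: "real \<Rightarrow> real \<Rightarrow> nat \<Rightarrow> real poly" where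
  "jac a b 0 = 1"
| "jac a b (Suc k) = Polynomial.smult (- 1 / b)
     ([:0, 1, -1:] * pderiv (jac (a + 1) (b + 1) k) + [:a, - (a + b):] * jac (a + 1) (b + 1) k)"

text \<open>The reciprocal of the squared norm of \<open>jac a b k\<close> in the Beta law. Since
  \<open>jac\<close> equals 1 at 1, it is also the diagonal value of the reproducing kernel, hence
  the dimension of an eigenspace. Index 0 stands apart because the general formula would contain
  \<open>pochhammer (a + b)\<close> with index -1.\<close>

fun jac_dim :: "real \<Rightarrow> real \<Rightarrow> nat \<Rightarrow> real" where
  "jac_dim a b 0 = 1"
| "jac_dim a b (Suc k) = pochhammer b (Suc k) * pochhammer (a + b) k * (a + b + 2 * real k + 1)
     / (fact (Suc k) * pochhammer a (Suc k))"

section \<open>The Beta law: normalisation and integrability\<close>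

lemma beta_pos: "0 < Beta a b" if "0 < a" "0 < b" for a b :: real
  using that by (simp add: Beta_def Gamma_real_pos)

lemma beta_density_nonneg: "0 < a \<Longrightarrow> 0 < b \<Longrightarrow> 0 \<le> beta_density a b s"
  using beta_pos[of a b] by (auto simp: beta_density_def)

lemma beta_density_measurable [measurable]: "beta_density a b \<in> borel_measurable borel"
  unfolding beta_density_def by measurable

lemma space_beta_measure [simp]: "space (beta_measure a b) = UNIV"
  and sets_beta_measure [measurable_cong, simp]: "sets (beta_measure a b) = sets borel"
  by (simp_all add: beta_measure_def)

lemma has_integral_beta_density:
  assumes "0 < a" "0 < b"
  shows "(beta_density a b has_integral 1) UNIV"
proof -
  have "((\<lambda>t. t powr (a - 1) * (1 - t) powr (b - 1) / Beta a b) has_integral Beta a b / Beta a b) {0<..<1}"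
    using has_integral_Beta_real[OF assms] by (intro has_integral_divide) (simp add: has_integral_Icc_iff_Ioo)
  then have "((\<lambda>t. if t \<in> {0<..<1} then t powr (a - 1) * (1 - t) powr (b - 1) / Beta a b else 0) has_integral Beta a b / Beta a b) UNIV"
    by (subst has_integral_restrict_UNIV)
  then show ?thesis
    using beta_pos[OF assms] by (auto simp: beta_density_def[abs_def])
qed

lemma prob_space_beta_measure:
  assumes "0 < a" "0 < b"
  shows "prob_space (beta_measure a b)"
proof
  have "(\<integral>\<^sup>+s. ennreal (beta_density a b s) \<partial>lborel) = ennreal 1"
    by (rule nn_integral_has_integral_lborel) (use assms in \<open>auto intro: beta_density_nonneg has_integral_beta_density\<close>)
  then show "emeasure (beta_measure a b) (space (beta_measure a b)) = 1"
    by (simp add: beta_measure_def emeasure_density)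
qed

lemma AE_beta_measure: "AE s in beta_measure a b. 0 < s \<and> s < 1"
  unfolding beta_measure_def by (subst AE_density) (auto simp: beta_density_def)

lemma integrable_beta_measure:
  fixes f :: "real \<Rightarrow> real"
  assumes "0 < a" "0 < b" and [measurable]: "f \<in> borel_measurable borel"
    and bd: "\<And>s. 0 < s \<Longrightarrow> s < 1 \<Longrightarrow> \<bar>f s\<bar> \<le> C"
  shows "integrable (beta_measure a b) f"
proof -
  interpret prob_space "beta_measure a b" by (rule prob_space_beta_measure[OF assms(1,2)])
  show ?thesis
    by (rule integrable_const_bound[where B = C]) (use AE_beta_measure[of a b] bd in auto)
qed

lemma poly_bounded_unit_interval: "\<exists>C. \<forall>s\<in>{0..1}. \<bar>poly p s\<bar> \<le> (C::real)"
proof -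
  have "compact (poly p ` {0..1::real})"
    by (intro compact_continuous_image continuous_intros) auto
  then show ?thesis
    by (auto dest!: compact_imp_bounded simp: bounded_iff)
qed

lemma poly_borel_measurable [measurable]: "poly p \<in> borel_measurable (borel :: real measure)"
  by (intro borel_measurable_continuous_onI continuous_intros)

lemma integrable_beta_poly:
  assumes "0 < a" "0 < b"
  shows "integrable (beta_measure a b) (poly p)"
proof -
  obtain C where "\<forall>s\<in>{0..1}. \<bar>poly p s\<bar> \<le> (C::real)" using poly_bounded_unit_interval by blast
  then show ?thesis by (intro integrable_beta_measure[where C = C] assms) auto
qed

lemma integrable_beta_poly_tail:
  assumes "0 < a" "0 < b"
  shows "integrable (beta_measure a b) (\<lambda>s. if s0 \<le> s then poly p s else 0)"
proof -
  obtain C where C: "\<forall>s\<in>{0..1}. \<bar>poly p s\<bar> \<le> (C::real)" using poly_bounded_unit_interval by blast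
  from C have "0 \<le> C" by (auto dest!: bspec[of _ _ 0])
  with C show ?thesis by (intro integrable_beta_measure[where C = C] assms) auto
qed

lemma integral_beta_measure:
  assumes "0 < a" "0 < b" "integrable (beta_measure a b) f" and [measurable]: "f \<in> borel_measurable borel"
  shows "((\<lambda>s. beta_density a b s * f s) has_integral (\<integral>s. f s \<partial>beta_measure a b)) UNIV"
    and "(\<integral>s. f s \<partial>beta_measure a b) = (\<integral>s. beta_density a b s * f s \<partial>lborel)"
proof -
  show eq: "(\<integral>s. f s \<partial>beta_measure a b) = (\<integral>s. beta_density a b s * f s \<partial>lborel)"
    using assms(1,2) beta_density_nonneg unfolding beta_measure_def
    by (subst integral_real_density) (auto simp: )
  have "integrable lborel (\<lambda>s. beta_density a b s * f s)"
    using assms(3) beta_density_nonneg assms(1,2) unfolding beta_measure_def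
    by (subst (asm) integrable_real_density) auto
  from has_integral_integral_lborel[OF this]
  show "((\<lambda>s. beta_density a b s * f s) has_integral (\<integral>s. f s \<partial>beta_measure a b)) UNIV"
    by (simp add: eq)
qed

section \<open>Expectations of polynomials and Stein's identity\<close>

definition beta_exp :: "real \<Rightarrow> real \<Rightarrow> real poly \<Rightarrow> real" where
  "beta_exp a b p = (\<integral>s. poly p s \<partial>beta_measure a b)"

lemma beta_exp_diff: "0 < a \<Longrightarrow> 0 < b \<Longrightarrow> beta_exp a b (p - q) = beta_exp a b p - beta_exp a b q"
  by (simp add: beta_exp_def integrable_beta_poly)

lemma beta_exp_smult: "beta_exp a b (Polynomial.smult c p) = c * beta_exp a b p"
  by (simp add: beta_exp_def)

lemma beta_exp_sum:
  "0 < a \<Longrightarrow> 0 < b \<Longrightarrow> beta_exp a b (\<Sum>i\<in>A. p i) = (\<Sum>i\<in>A. beta_exp a b (p i))"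
  by (simp add: beta_exp_def integrable_beta_poly poly_sum)

lemma beta_exp_1: "0 < a \<Longrightarrow> 0 < b \<Longrightarrow> beta_exp a b 1 = 1"
  using prob_space.prob_space[OF prob_space_beta_measure[of a b]] by (simp add: beta_exp_def)

lemma beta_exp_0: "beta_exp a b 0 = 0"
  by (simp add: beta_exp_def)

text \<open>The polynomial factor is s (1 - s) g' + (a - (a + b) s) g, up to sign the adjoint of
  differentiation with respect to the weights. For g = \<open>jac (a + 1) (b + 1) k\<close> it is -b
  times \<open>jac a b (Suc k)\<close>.\<close>

lemma DERIV_beta_weight:
  fixes a b s :: real
  assumes "0 < s" "s < 1"
  shows "((\<lambda>s. s powr a * (1 - s) powr b * poly g s) has_real_derivative
     s powr (a - 1) * (1 - s) powr (b - 1) * poly ([:0, 1, -1:] * pderiv g + [:a, - (a + b):] * g) s) (at s)"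
proof -
  have e: "s powr a = s * s powr (a - 1)" "(1 - s) powr b = (1 - s) * (1 - s) powr (b - 1)"
    using assms by (auto simp: powr_mult_base)
  show ?thesis
    using assms
    by (auto intro!: derivative_eq_intros simp: poly_DERIV) (auto simp: e algebra_simps)
qed

text \<open>The integrand times the weight is the exact derivative of s^a (1 - s)^b g(s), which
  vanishes at 1 because b > 0. Taking s0 = 0 gives Stein's identity; taking g to be a Jacobi
  polynomial gives the eigenvalues.\<close>

lemma beta_tail_integral:
  assumes ab: "0 < a" "0 < b" and s0: "0 \<le> s0" "s0 < 1"
  shows "(\<integral>s. (if s0 \<le> s then poly ([:0, 1, -1:] * pderiv g + [:a, - (a + b):] * g) s else 0) \<partial>beta_measure a b)
     = - (s0 powr a * (1 - s0) powr b * poly g s0 / Beta a b)" (is "?L = ?R")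
proof -
  let ?q = "[:0, 1, -1:] * pderiv g + [:a, - (a + b):] * g"
  let ?V = "\<lambda>s. s powr a * (1 - s) powr b * poly g s"
  have "((\<lambda>s. beta_density a b s * (if s0 \<le> s then poly ?q s else 0)) has_integral ?L) UNIV"
    by (rule integral_beta_measure[OF ab integrable_beta_poly_tail[OF ab]]) measurable
  \<comment> \<open>The weight is singular at an endpoint when a or b is below 1, hence the form of
    the fundamental theorem that asks for a derivative only in the interior.\<close>
  moreover have "((\<lambda>s. s powr (a - 1) * (1 - s) powr (b - 1) * poly ?q s) has_integral (?V 1 - ?V s0)) {s0..1}"
  proof (rule fundamental_theorem_of_calculus_interior)
    show "continuous_on {s0..1} ?V"
      using ab s0 by (intro continuous_intros continuous_on_powr') auto
    show "(?V has_vector_derivative s powr (a - 1) * (1 - s) powr (b - 1) * poly ?q s) (at s)" if "s \<in> {s0<..<1}" for s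
      using DERIV_beta_weight[of s a b g] that s0 by (simp add: has_real_derivative_iff_has_vector_derivative)
  qed (use s0 in auto)
  then have "((\<lambda>s. s powr (a - 1) * (1 - s) powr (b - 1) * poly ?q s / Beta a b) has_integral (?V 1 - ?V s0) / Beta a b) {s0<..<1}"
    by (intro has_integral_divide) (simp add: has_integral_Icc_iff_Ioo)
  then have "((\<lambda>s. if s \<in> {s0<..<1} then s powr (a - 1) * (1 - s) powr (b - 1) * poly ?q s / Beta a b else 0) has_integral (?V 1 - ?V s0) / Beta a b) UNIV"
    by (subst has_integral_restrict_UNIV)
  then have "((\<lambda>s. beta_density a b s * (if s0 \<le> s then poly ?q s else 0)) has_integral (?V 1 - ?V s0) / Beta a b) UNIV"
    by (rule has_integral_spike[of "{s0}", rotated 2]) (use s0 in \<open>auto simp: beta_density_def\<close>)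
  ultimately have "?L = (?V 1 - ?V s0) / Beta a b"
    by (rule has_integral_unique)
  then show ?thesis using ab by simp
qed

lemma beta_exp_stein:
  assumes "0 < a" "0 < b"
  shows "beta_exp a b ([:0, 1, -1:] * pderiv g + [:a, - (a + b):] * g) = 0"
proof -
  let ?q = "[:0, 1, -1:] * pderiv g + [:a, - (a + b):] * g"
  have "beta_exp a b ?q = (\<integral>s. (if 0 \<le> s then poly ?q s else 0) \<partial>beta_measure a b)"
    unfolding beta_exp_def
    by (rule Bochner_Integration.integral_cong_AE, measurable) (use AE_beta_measure[of a b] in auto)
  also have "\<dots> = 0"
    by (subst beta_tail_integral) (use assms in auto)
  finally show ?thesis .
qed

text \<open>A factor s (1 - s) raises both parameters of the weight by one, at the price of Beta(a +
  1, b + 1) / Beta(a, b). This is the parameter shift that occurs in the recursion of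
  \<open>jac\<close>.\<close>

lemma beta_exp_shift:
  assumes ab: "0 < a" "0 < b"
  shows "beta_exp a b ([:0, 1, -1:] * f) = a * b / ((a + b) * (a + b + 1)) * beta_exp (a + 1) (b + 1) f"
proof -
  have B: "Beta (a + 1) (b + 1) = a * b / ((a + b) * (a + b + 1)) * Beta a b"
  proof -
    have "a \<notin> \<int>\<^sub>\<le>\<^sub>0" "b \<notin> \<int>\<^sub>\<le>\<^sub>0" using ab by (auto elim!: nonpos_Ints_cases)
    then have "(a + (b + 1)) * Beta (a + 1) (b + 1) = a * Beta a (b + 1)" "(a + b) * Beta a (b + 1) = b * Beta a b"
      using Beta_plus1_left[of a "b + 1"] Beta_plus1_right[of b a] by auto
    then have 1: "(a + b + 1) * Beta (a + 1) (b + 1) = a * Beta a (b + 1)" and 2: "(a + b) * Beta a (b + 1) = b * Beta a b"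
      by (simp_all add: add.assoc)
    have "((a + b) * (a + b + 1)) * Beta (a + 1) (b + 1) = (a + b) * ((a + b + 1) * Beta (a + 1) (b + 1))"
      by simp
    also have "\<dots> = a * ((a + b) * Beta a (b + 1))" unfolding 1 by simp
    finally have "((a + b) * (a + b + 1)) * Beta (a + 1) (b + 1) = a * b * Beta a b" unfolding 2 by simp
    moreover have "(a + b) * (a + b + 1) \<noteq> 0" using ab by simp
    ultimately show ?thesis by (simp add: eq_divide_eq mult_ac)
  qed
  have "beta_density a b s * poly ([:0, 1, -1:] * f) s =
      a * b / ((a + b) * (a + b + 1)) * (beta_density (a + 1) (b + 1) s * poly f s)" for s
  proof (cases "0 < s \<and> s < 1")
    case True
    have e: "s powr a = s * s powr (a - 1)" "(1 - s) powr b = (1 - s) * (1 - s) powr (b - 1)"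
      using True by (auto simp: powr_mult_base)
    have "a * b \<noteq> 0" "(a + b) * (a + b + 1) \<noteq> 0" "Beta a b \<noteq> 0" using ab beta_pos[OF ab] by auto
    then show ?thesis using True unfolding beta_density_def B
      by (simp add: e divide_simps) (simp add: algebra_simps)
  qed (auto simp: beta_density_def)
  then show ?thesis
    unfolding beta_exp_def
    by (subst (1 2) integral_beta_measure(2)) (use ab in \<open>auto intro!: integrable_beta_poly simp del: mult_pCons_left\<close>)
qed

section \<open>Orthogonality and norms of the Jacobi polynomials\<close>

lemma jac_at_1: "0 < b \<Longrightarrow> poly (jac a b k) 1 = 1"
  by (induction k arbitrary: a b) (auto simp: field_simps)

lemma degree_jac_le: "degree (jac a b k) \<le> k"
proof (induction k arbitrary: a b)
  case (Suc k)
  let ?P = "jac (a + 1) (b + 1) k"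
  have "degree ([:a, - (a + b):] * ?P) \<le> Suc k"
    using Suc[of "a + 1" "b + 1"] degree_mult_le[of "[:a, - (a + b):]" ?P] by (auto split: if_splits)
  moreover have "degree ([:0, 1, -1:] * pderiv ?P) \<le> Suc k"
  proof (cases "degree ?P = 0")
    case True
    then have "pderiv ?P = 0" by (simp add: pderiv_eq_0_iff)
    then show ?thesis by (metis degree_0 mult_zero_right zero_le)
  next
    case False
    then have "degree (pderiv ?P) + 1 \<le> k" using Suc[of "a + 1" "b + 1"] by (simp add: degree_pderiv)
    moreover have "degree [:0, 1, -1::real:] = 2" by simp
    ultimately show ?thesis using degree_mult_le[of "[:0, 1, -1:]" "pderiv ?P"] by linarith
  qed
  ultimately show ?case
    by (simp del: mult_pCons_left) (meson degree_add_le degree_smult_le order_trans)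
qed simp

text \<open>The leading coefficient of \<open>jac a b k\<close>, obtained by following the top
  coefficient through the recursion.\<close>

fun jac_lc :: "real \<Rightarrow> real \<Rightarrow> nat \<Rightarrow> real" where
  "jac_lc a b 0 = 1"
| "jac_lc a b (Suc k) = (a + b + k) / b * jac_lc (a + 1) (b + 1) k"

text \<open>The expectation of \<open>jac a b k\<close> times the monomial of degree k.\<close>

fun jac_mom :: "real \<Rightarrow> real \<Rightarrow> nat \<Rightarrow> real" where
  "jac_mom a b 0 = 1"
| "jac_mom a b (Suc k) = a * (real k + 1) / ((a + b) * (a + b + 1)) * jac_mom (a + 1) (b + 1) k"

lemma coeff_beta_stein:
  fixes P :: "real poly"
  shows "coeff ([:0, 1, -1:] * pderiv P + [:a, c:] * P) (Suc k)
     = real (Suc k) * coeff P (Suc k) - real k * coeff P k + a * coeff P (Suc k) + c * coeff P k"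
  by (cases k) (simp_all add: coeff_pderiv)

lemma coeff_jac: "0 < b \<Longrightarrow> coeff (jac a b k) k = jac_lc a b k"
proof (induction k arbitrary: a b)
  case (Suc k)
  let ?P = "jac (a + 1) (b + 1) k"
  have z: "coeff ?P (Suc k) = 0" using degree_jac_le[of "a + 1" "b + 1" k] by (intro coeff_eq_0) auto
  have "coeff (jac a b (Suc k)) (Suc k) = - 1 / b * (real (Suc k) * coeff ?P (Suc k) - real k * coeff ?P k
      + a * coeff ?P (Suc k) - (a + b) * coeff ?P k)"
    by (simp only: jac.simps coeff_smult coeff_beta_stein) (simp add: algebra_simps)
  also have "\<dots> = (a + b + k) / b * coeff ?P k"
    using Suc.prems by (simp add: z divide_simps) (simp add: algebra_simps)
  also have "\<dots> = jac_lc a b (Suc k)"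
    using Suc.prems by (simp add: Suc.IH)
  finally show ?case .
qed simp

text \<open>One integration by parts: Stein's identity throws the derivative on f, the remaining
  factor s (1 - s) shifts the weight to (a + 1, b + 1), and the claim for k and f' applies. If f has
  degree below k the coefficient is 0, which is orthogonality.\<close>

lemma beta_exp_jac_mult:
  assumes "0 < a" "0 < b" "degree f \<le> k"
  shows "beta_exp a b (jac a b k * f) = coeff f k * jac_mom a b k"
  using assms
proof (induction k arbitrary: a b f)
  case 0
  then have "f = [:coeff f 0:]" by (metis degree_eq_zeroE le_zero_eq coeff_pCons_0)
  then have "jac a b 0 * f = Polynomial.smult (coeff f 0) 1" by (metis jac.simps(1) mult.left_neutral smult_one)
  then have "beta_exp a b (jac a b 0 * f) = beta_exp a b (Polynomial.smult (coeff f 0) 1)" by (rule arg_cong)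
  then show ?case unfolding beta_exp_smult using 0 by (simp add: beta_exp_1)
next
  case (Suc k)
  let ?P = "jac (a + 1) (b + 1) k"
  \<comment> \<open>The bracket is the Stein expression of \<open>?P * f\<close>; the subtracted
    term is the part of the product rule that falls on f.\<close>
  have "jac a b (Suc k) * f = Polynomial.smult (- 1 / b) (([:0, 1, -1:] * pderiv (?P * f) + [:a, - (a + b):] * (?P * f)) - [:0, 1, -1:] * (?P * pderiv f))"
  proof -
    have "(A * B + C * D) * f = A * (D * g + f * B) + C * (D * f) - A * (D * g)" for A B C D f g :: "real poly"
      by (simp add: algebra_simps)
    then show ?thesis by (simp only: jac.simps pderiv_mult mult_smult_left)
  qed
  then have "beta_exp a b (jac a b (Suc k) * f) = (1 / b) * beta_exp a b ([:0, 1, -1:] * (?P * pderiv f))"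
    using Suc.prems by (simp only: beta_exp_smult beta_exp_diff beta_exp_stein) simp
  also have "\<dots> = a / ((a + b) * (a + b + 1)) * beta_exp (a + 1) (b + 1) (?P * pderiv f)"
    using Suc.prems by (simp only: beta_exp_shift) simp
  also have "beta_exp (a + 1) (b + 1) (?P * pderiv f) = coeff (pderiv f) k * jac_mom (a + 1) (b + 1) k"
    using Suc.prems by (intro Suc.IH) (auto simp: degree_pderiv)
  finally show ?case by (simp only: coeff_pderiv jac_mom.simps) (simp add: field_simps)
qed

lemma jac_dim_pos: "0 < a \<Longrightarrow> 0 < b \<Longrightarrow> 0 < jac_dim a b k"
  by (cases k) (auto intro!: divide_pos_pos mult_pos_pos pochhammer_pos)

text \<open>Brings the closed formula into the shape of the recursions of \<open>jac_lc\<close> and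
  \<open>jac_mom\<close>, so that \<open>jac_dim_inverse\<close> becomes an induction.\<close>

lemma jac_dim_Suc:
  assumes "0 < a" "0 < b"
  shows "jac_dim a b (Suc k) = b * (a + b) * (a + b + 1) / (a * (real k + 1) * (a + b + real k)) * jac_dim (a + 1) (b + 1) k"
proof (cases k)
  case 0
  have "a + b \<noteq> 0" "a \<noteq> 0" using assms by auto
  then show ?thesis using 0 by (simp add: divide_simps)
next
  case (Suc l)
  have p: "pochhammer x (Suc (Suc l)) = x * pochhammer (x + 1) (Suc l)" for x :: real
    by (rule pochhammer_rec)
  \<comment> \<open>The same symbol is peeled once from its lower and once from its upper end;
    comparing both moves its base from a + b to a + b + 2.\<close>
  have "pochhammer (a + b) (Suc (Suc l)) = (a + b) * ((a + b + 1) * pochhammer (a + b + 2) l)"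
    by (simp add: pochhammer_rec add.assoc)
  moreover have "pochhammer (a + b) (Suc (Suc l)) = pochhammer (a + b) (Suc l) * (a + b + real (Suc l))"
    by (rule pochhammer_Suc)
  ultimately have q: "pochhammer (a + b) (Suc l) = (a + b) * (a + b + 1) * pochhammer (a + b + 2) l / (a + b + real (Suc l))"
    using assms by (simp add: field_simps)
  have pa: "0 < pochhammer (a + 1) (Suc l)" "0 < (fact (Suc l) :: real)" using assms by (auto intro: pochhammer_pos)
  have e: "a + 1 + (b + 1) = a + b + 2" by simp
  have f: "fact (Suc (Suc l)) = (real l + 2) * (fact (Suc l) :: real)" by (simp add: algebra_simps)
  have "pochhammer (a + 1) (Suc l) \<noteq> 0" "(fact (Suc l) :: real) \<noteq> 0" "real l + 2 \<noteq> 0" "a \<noteq> 0" "a + b + real (Suc l) \<noteq> 0"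
    using pa assms by auto
  then show ?thesis
    unfolding Suc jac_dim.simps p q e f by (simp add: divide_simps del: fact_Suc)
qed

lemma jac_dim_inverse:
  assumes "0 < a" "0 < b"
  shows "jac_lc a b k * jac_mom a b k = 1 / jac_dim a b k"
  using assms
proof (induction k arbitrary: a b)
  case (Suc k)
  have "jac_lc a b (Suc k) * jac_mom a b (Suc k)
     = (a + b + k) / b * (a * (real k + 1) / ((a + b) * (a + b + 1))) * (jac_lc (a + 1) (b + 1) k * jac_mom (a + 1) (b + 1) k)"
    by simp
  also have "\<dots> = 1 / jac_dim a b (Suc k)"
    using Suc.prems Suc.IH[of "a + 1" "b + 1"] by (simp add: jac_dim_Suc mult_ac del: jac_dim.simps)
  finally show ?case .
qed simp

lemma beta_exp_jac_jac:
  assumes "0 < a" "0 < b"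
  shows "beta_exp a b (jac a b k * jac a b l) = (if k = l then 1 / jac_dim a b k else 0)"
proof -
  have *: "beta_exp a b (jac a b k * jac a b l) = 0" if "l < k" for k l
    using that assms degree_jac_le[of a b l] by (subst beta_exp_jac_mult) (auto intro: coeff_eq_0)
  show ?thesis
    using *[of l k] *[of k l] assms
    by (cases k l rule: linorder_cases) (auto simp: mult.commute beta_exp_jac_mult degree_jac_le coeff_jac jac_dim_inverse)
qed

lemma jac_lc_pos: "0 < a \<Longrightarrow> 0 < b \<Longrightarrow> 0 < jac_lc a b k"
  by (induction k arbitrary: a b) auto

text \<open>Existence comes from removing leading terms, possible since \<open>jac_lc\<close> is
  positive; the coefficients are then identified by orthogonality.\<close>

lemma poly_jac_expansion:
  assumes "0 < a" "0 < b" "degree p \<le> K"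
  shows "p = (\<Sum>k\<le>K. Polynomial.smult (jac_dim a b k * beta_exp a b (p * jac a b k)) (jac a b k))"
proof -
  have "\<exists>\<alpha>. p = (\<Sum>k\<le>K. Polynomial.smult (\<alpha> k) (jac a b k))" if "degree p \<le> K" for p K
    using that
  proof (induction K arbitrary: p)
    case 0
    then have "p = [:coeff p 0:]" by (metis degree_eq_zeroE le_zero_eq coeff_pCons_0)
    then have "p = Polynomial.smult (coeff p 0) 1" by (metis smult_one)
    then show ?case by (intro exI[of _ "\<lambda>_. coeff p 0"]) auto
  next
    case (Suc K)
    define c where "c = coeff p (Suc K) / jac_lc a b (Suc K)"
    define q where "q = p - Polynomial.smult c (jac a b (Suc K))"
    have "degree q \<le> K"
    proof (rule degree_le, safe)
      fix i assume "K < i"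
      show "coeff q i = 0"
      proof (cases "i = Suc K")
        case True
        have "jac_lc a b (Suc K) \<noteq> 0" using jac_lc_pos[OF assms(1,2), of "Suc K"] by (metis less_numeral_extra(3))
        then show ?thesis using assms
          by (simp add: q_def True c_def coeff_jac del: jac.simps jac_lc.simps)
      next
        case False
        with \<open>K < i\<close> have "Suc K < i" by simp
        then show ?thesis using Suc.prems degree_jac_le[of a b "Suc K"]
          by (simp add: q_def coeff_eq_0 del: jac.simps)
      qed
    qed
    from Suc.IH[OF this] obtain \<alpha> where \<alpha>: "q = (\<Sum>k\<le>K. Polynomial.smult (\<alpha> k) (jac a b k))" by blast
    have "p = q + Polynomial.smult c (jac a b (Suc K))" by (simp add: q_def)
    then have "p = (\<Sum>k\<le>Suc K. Polynomial.smult ((\<alpha>(Suc K := c)) k) (jac a b k))"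
      by (simp add: \<alpha> del: jac.simps)
    then show ?case by blast
  qed
  from this[OF assms(3)] obtain \<alpha> where \<alpha>: "p = (\<Sum>k\<le>K. Polynomial.smult (\<alpha> k) (jac a b k))" by blast
  have "jac_dim a b l * beta_exp a b (p * jac a b l) = \<alpha> l" if "l \<le> K" for l
  proof -
    have "beta_exp a b (p * jac a b l) = (\<Sum>k\<le>K. \<alpha> k * (if k = l then 1 / jac_dim a b k else 0))"
      using assms by (subst \<alpha>) (simp add: sum_distrib_right beta_exp_sum beta_exp_smult beta_exp_jac_jac)
    also have "\<dots> = (\<Sum>k\<le>K. if k = l then \<alpha> k / jac_dim a b k else 0)" by (intro sum.cong) auto
    also have "\<dots> = \<alpha> l / jac_dim a b l" using that by simp
    finally show ?thesis using jac_dim_pos[OF assms(1,2), of l] by simp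
  qed
  then show ?thesis by (subst \<alpha>) (auto intro!: sum.cong)
qed

section \<open>Tail integrals and Rodrigues formulas\<close>

text \<open>By its recursion \<open>jac a b (Suc k)\<close> is -1/b times a Stein expression, so its
  tail integral is a boundary value. The closed form of the eigenvalues with positive index
  originates here.\<close>

lemma jac_tail_integral:
  assumes "0 < a" "0 < b" "0 \<le> s0" "s0 < 1"
  shows "(\<integral>s. (if s0 \<le> s then poly (jac a b (Suc k)) s else 0) \<partial>beta_measure a b)
     = s0 powr a * (1 - s0) powr b * poly (jac (a + 1) (b + 1) k) s0 / (b * Beta a b)"
proof -
  let ?g = "jac (a + 1) (b + 1) k"
  let ?q = "[:0, 1, -1:] * pderiv ?g + [:a, - (a + b):] * ?g"
  have "(\<integral>s. (if s0 \<le> s then poly (jac a b (Suc k)) s else 0) \<partial>beta_measure a b)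
      = (\<integral>s. (- 1 / b) * (if s0 \<le> s then poly ?q s else 0) \<partial>beta_measure a b)"
    by (intro Bochner_Integration.integral_cong) (simp_all del: mult_pCons_left)
  also have "\<dots> = (- 1 / b) * (\<integral>s. (if s0 \<le> s then poly ?q s else 0) \<partial>beta_measure a b)"
    by (rule integral_mult_right_zero)
  also have "\<dots> = (- 1 / b) * - (s0 powr a * (1 - s0) powr b * poly ?g s0 / Beta a b)"
    by (subst beta_tail_integral) (use assms in auto)
  finally show ?thesis by simp
qed

text \<open>Induction with shifted parameters: the function differentiated k + 1 times for (a, b) is
  the one differentiated k times for (a + 1, b + 1), and the last derivative is
  \<open>DERIV_beta_weight\<close>.\<close>

lemma jacobi_rodrigues:
  assumes "0 < a" "0 < b" "0 < s" "s < 1"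
  shows "(deriv ^^ k) (\<lambda>t. t powr (a + real k - 1) * (1 - t) powr (b + real k - 1)) s
    = (-1) ^ k * Gamma (b + real k) / Gamma b * (s powr (a - 1) * (1 - s) powr (b - 1) * poly (jac a b k) s)"
  using assms
proof (induction k arbitrary: a b s)
  case 0
  then show ?case by (simp add: Gamma_real_pos less_imp_neq[symmetric])
next
  case (Suc k)
  let ?F = "\<lambda>t. t powr (a + real (Suc k) - 1) * (1 - t) powr (b + real (Suc k) - 1)"
  let ?P = "jac (a + 1) (b + 1) k"
  let ?C = "(-1) ^ k * Gamma (b + 1 + real k) / Gamma (b + 1)"
  have F: "?F = (\<lambda>t. t powr (a + 1 + real k - 1) * (1 - t) powr (b + 1 + real k - 1))"
    by (simp add: algebra_simps)
  \<comment> \<open>The induction hypothesis is needed on a neighbourhood of s, because one more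
    derivative is taken.\<close>
  have "eventually (\<lambda>x. x \<in> {0<..<1}) (nhds s)"
    using Suc.prems by (intro eventually_nhds_in_open) auto
  then have "eventually (\<lambda>x. (deriv ^^ k) ?F x = ?C * (x powr a * (1 - x) powr b * poly ?P x)) (nhds s)"
    by eventually_elim (unfold F, subst Suc.IH, use Suc.prems in auto)
  then have "deriv ((deriv ^^ k) ?F) s = deriv (\<lambda>x. ?C * (x powr a * (1 - x) powr b * poly ?P x)) s"
    by (rule deriv_cong_ev) simp
  also have "\<dots> = ?C * (s powr (a - 1) * (1 - s) powr (b - 1) * poly ([:0, 1, -1:] * pderiv ?P + [:a, - (a + b):] * ?P) s)"
    by (intro DERIV_imp_deriv DERIV_cmult DERIV_beta_weight) (use Suc.prems in auto)
  also have "\<dots> = (-1) ^ Suc k * Gamma (b + real (Suc k)) / Gamma b * (s powr (a - 1) * (1 - s) powr (b - 1) * poly (jac a b (Suc k)) s)"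
  proof -
    have "Gamma (b + 1) = b * Gamma b" using Suc.prems by (intro Gamma_plus1) (auto elim!: nonpos_Ints_cases)
    moreover have "b + 1 + real k = b + real (Suc k)" by simp
    moreover have "Gamma b \<noteq> 0" using Gamma_real_pos[of b] Suc.prems by (metis less_irrefl)
    ultimately show ?thesis using Suc.prems by (simp del: mult_pCons_left add: field_simps)
  qed
  finally show ?case by simp
qed

lemma jacobiJ_eq_jac:
  assumes "0 < a" "0 < b" "0 < s" "s < 1"
  shows "jacobiJ a b k s = poly (jac a b k) s"
proof -
  have "0 < Gamma b" "0 < Gamma (b + real k)" using assms by (auto intro!: Gamma_real_pos)
  then have "Gamma b \<noteq> 0" "Gamma (b + real k) \<noteq> 0" by linarith+
  then show ?thesis
    using assms by (simp add: jacobiJ_def jacobi_rodrigues[OF assms] power_mult_distrib[symmetric])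
qed

text \<open>The same induction in the variable x = 2 s - 1, where 1 - x^2 = 4 s (1 - s). Raising n
  by 2 raises both Jacobi parameters by 1, and each derivative contributes a factor 2.\<close>

lemma legendre_rodrigues:
  assumes "0 < n" "-1 < x" "x < 1"
  shows "(deriv ^^ k) (\<lambda>y. (1 - y\<^sup>2) powr (n / 2 + real k - 1)) x
    = (-1) ^ k * 2 ^ k * Gamma (n / 2 + real k) / Gamma (n / 2) * ((1 - x\<^sup>2) powr (n / 2 - 1) * poly (jac (n / 2) (n / 2) k) ((1 + x) / 2))"
  using assms
proof (induction k arbitrary: n x)
  case 0
  then have "Gamma (n / 2) \<noteq> 0" using Gamma_real_pos[of "n / 2"] by (metis less_irrefl half_gt_zero)
  then show ?case by simp
next
  case (Suc k)
  let ?F = "\<lambda>y. (1 - y\<^sup>2) powr (n / 2 + real (Suc k) - 1)"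
  let ?P = "jac (n / 2 + 1) (n / 2 + 1) k"
  let ?C = "(-1) ^ k * 2 ^ k * Gamma (n / 2 + 1 + real k) / Gamma (n / 2 + 1)"
  have F: "?F = (\<lambda>y. (1 - y\<^sup>2) powr ((n + 2) / 2 + real k - 1))"
    by (simp add: add_divide_distrib algebra_simps)
  have "eventually (\<lambda>x. x \<in> {-1<..<1}) (nhds x)"
    using Suc.prems by (intro eventually_nhds_in_open) auto
  then have "eventually (\<lambda>x. (deriv ^^ k) ?F x = ?C * ((1 - x\<^sup>2) powr (n / 2) * poly ?P ((1 + x) / 2))) (nhds x)"
    by eventually_elim (unfold F, subst Suc.IH, use Suc.prems in \<open>auto simp: add_divide_distrib\<close>)
  then have "deriv ((deriv ^^ k) ?F) x = deriv (\<lambda>x. ?C * ((1 - x\<^sup>2) powr (n / 2) * poly ?P ((1 + x) / 2))) x"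
    by (rule deriv_cong_ev) simp
  also have "\<dots> = ?C * ((1 - x\<^sup>2) powr (n / 2 - 1) * (2 * poly ([:0, 1, -1:] * pderiv ?P + [:n/2, - (n/2 + n/2):] * ?P) ((1 + x) / 2)))"
  proof (intro DERIV_imp_deriv DERIV_cmult)
    have pos: "0 < 1 - x\<^sup>2" using Suc.prems by (simp add: abs_square_less_1 abs_less_iff)
    have e: "(1 - x\<^sup>2) powr (n / 2) = (1 - x\<^sup>2) * (1 - x\<^sup>2) powr (n / 2 - 1)"
      using pos by (auto simp: powr_mult_base)
    have d: "((\<lambda>x. poly ?P ((1 + x) / 2)) has_real_derivative poly (pderiv ?P) ((1 + x) / 2) * (1 / 2)) (at x)"
      by (rule DERIV_chain'[OF _ poly_DERIV]) (auto intro!: derivative_eq_intros)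
    show "((\<lambda>x. (1 - x\<^sup>2) powr (n / 2) * poly ?P ((1 + x) / 2)) has_real_derivative
        (1 - x\<^sup>2) powr (n / 2 - 1) * (2 * poly ([:0, 1, -1:] * pderiv ?P + [:n/2, - (n/2 + n/2):] * ?P) ((1 + x) / 2))) (at x)"
    proof -
      have "((\<lambda>x. (1 - x\<^sup>2) powr (n / 2)) has_real_derivative (n / 2) * (1 - x\<^sup>2) powr (n / 2 - 1) * (- 2 * x)) (at x)"
        using pos by (auto intro!: derivative_eq_intros)
      from DERIV_mult[OF this d] show ?thesis
        by (rule DERIV_cong) (simp add: e, simp add: field_simps power2_eq_square)
    qed
  qed
  also have "\<dots> = (-1) ^ Suc k * 2 ^ Suc k * Gamma (n / 2 + real (Suc k)) / Gamma (n / 2) * ((1 - x\<^sup>2) powr (n / 2 - 1) * poly (jac (n / 2) (n / 2) (Suc k)) ((1 + x) / 2))"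
  proof -
    have "Gamma (n / 2 + 1) = n / 2 * Gamma (n / 2)" using Suc.prems by (intro Gamma_plus1) (auto elim!: nonpos_Ints_cases)
    moreover have "n / 2 + 1 + real k = n / 2 + real (Suc k)" by simp
    moreover have "Gamma (n / 2) \<noteq> 0" using Gamma_real_pos[of "n / 2"] Suc.prems by (metis less_irrefl half_gt_zero)
    moreover have "poly (jac (n / 2) (n / 2) (Suc k)) y = - (2 / n) * poly ([:0, 1, -1:] * pderiv ?P + [:n/2, - (n/2 + n/2):] * ?P) y" for y
      by (simp only: jac.simps poly_smult) simp
    ultimately show ?thesis using Suc.prems by (simp only:) (simp del: mult_pCons_left poly_add poly_mult add: field_simps)
  qed
  finally show ?case by simp
qed

lemma legendreP_eq_jac:
  assumes "0 < n" "-1 < x" "x < 1"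
  shows "legendreP n k x = poly (jac (n / 2) (n / 2) k) ((1 + x) / 2)"
proof -
  have "0 < Gamma (n / 2)" "0 < Gamma (n / 2 + real k)" using assms by (auto intro!: Gamma_real_pos)
  then have "Gamma (n / 2) \<noteq> 0" "Gamma (n / 2 + real k) \<noteq> 0" by linarith+
  moreover have "0 < 1 - x\<^sup>2" using assms by (simp add: abs_square_less_1 abs_less_iff)
  moreover have "(- 1) ^ k * (- 1) ^ k = (1::real)" by (simp add: power_mult_distrib[symmetric])
  ultimately show ?thesis
    unfolding legendreP_def legendre_rodrigues[OF assms] by (simp add: field_simps)
qed

section \<open>Approximation of the indicator in the Beta law and Bessel's inequality\<close>

lemma Weierstrass_real_poly:
  fixes f :: "real \<Rightarrow> real"
  assumes "continuous_on {u..v} f" "0 < e"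
  shows "\<exists>p. \<forall>x\<in>{u..v}. \<bar>f x - poly p x\<bar> < e"
proof -
  obtain g where g: "real_polynomial_function g" "\<And>x. x \<in> {u..v} \<Longrightarrow> \<bar>f x - g x\<bar> < e"
    using Stone_Weierstrass_real_polynomial_function[OF _ assms] by (metis compact_Icc)
  then obtain a n where "g = (\<lambda>x. \<Sum>i\<le>n. a i * x ^ i)" using real_polynomial_function_iff_sum by auto
  then have "g x = poly (\<Sum>i\<le>n. monom (a i) i) x" for x by (simp add: poly_sum poly_monom)
  with g show ?thesis by (intro exI[of _ "\<Sum>i\<le>n. monom (a i) i"]) auto
qed

text \<open>Bounds from both sides are wanted because errors will be measured at sample points:
  there the squared error of p is at most (q - p)^2, which is a polynomial, so its sample averages
  converge.\<close>

lemma threshold_sandwich: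
  assumes ab: "0 < a" "0 < b" and "0 < e"
  shows "\<exists>p q. (\<forall>s\<in>{0..1}. poly p s \<le> (if s0 \<le> s then 1 else 0) \<and> (if s0 \<le> s then 1 else 0) \<le> poly q s
     \<and> \<bar>poly p s\<bar> \<le> 2) \<and> beta_exp a b ((q - p) ^ 2) < e"
proof -
  \<comment> \<open>Two continuous ramps of width 1/m that enclose the indicator. At every point
    other than s0 they agree for large m, and s0 is a null set.\<close>
  define up where "up m s = min 1 (max 0 (1 + real m * (s - s0)))" for m s
  define lo where "lo m s = min 1 (max 0 (real m * (s - s0)))" for m s
  interpret prob_space "beta_measure a b" by (rule prob_space_beta_measure[OF ab])
  have [measurable]: "up m \<in> borel_measurable borel" "lo m \<in> borel_measurable borel" for m
    unfolding up_def lo_def by measurable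
  have bd: "lo m s \<le> up m s" "0 \<le> lo m s" "up m s \<le> 1" for m s
    by (auto simp: up_def lo_def)
  have "(\<lambda>m. \<integral>s. (up m s - lo m s)\<^sup>2 \<partial>beta_measure a b) \<longlonglongrightarrow> (\<integral>s. 0 \<partial>beta_measure a b)"
  proof (rule integral_dominated_convergence[where w = "\<lambda>_. 1"])
    have "AE s in beta_measure a b. s \<noteq> s0"
      unfolding beta_measure_def using AE_lborel_singleton[of s0] by (subst AE_density) auto
    then show "AE s in beta_measure a b. (\<lambda>m. (up m s - lo m s)\<^sup>2) \<longlonglongrightarrow> 0"
    proof eventually_elim
      case (elim s)
      obtain m0 :: nat where m0: "1 < real m0 * \<bar>s - s0\<bar>"
        using reals_Archimedean3[of "\<bar>s - s0\<bar>"] elim by auto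
      have "eventually (\<lambda>m. (up m s - lo m s)\<^sup>2 = 0) sequentially"
        using eventually_ge_at_top[of m0]
      proof eventually_elim
        case (elim m)
        then have "real m0 * \<bar>s - s0\<bar> \<le> real m * \<bar>s - s0\<bar>" by (intro mult_right_mono) auto
        with m0 have "1 < \<bar>real m * (s - s0)\<bar>" by (simp add: abs_mult)
        then show ?case by (auto simp: up_def lo_def min_def max_def)
      qed
      then show ?case by (rule tendsto_eventually)
    qed
    show "AE s in beta_measure a b. norm ((up m s - lo m s)\<^sup>2) \<le> 1" for m
    proof (intro AE_I2)
      fix s show "norm ((up m s - lo m s)\<^sup>2) \<le> 1"
        using bd[of m s] by (simp add: abs_le_iff power_le_one)
    qed
  qed auto
  then have "eventually (\<lambda>m. (\<integral>s. (up m s - lo m s)\<^sup>2 \<partial>beta_measure a b) < e / 4) sequentially"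
    using \<open>0 < e\<close> by (intro order_tendstoD(2)) auto
  then obtain m where m: "(\<integral>s. (up m s - lo m s)\<^sup>2 \<partial>beta_measure a b) < e / 4"
    by (auto dest: eventually_happens)
  \<comment> \<open>Shifting by \<delta> makes uniform approximations one-sided; then q - p is at
    most the ramp gap g plus 4 \<delta>, and (g + 4 \<delta>)^2 \<le> 2 g^2 + 32 \<delta>^2. With 32
    \<delta>^2 \<le> e/4 the total stays below 2 (e/4) + e/4 < e. The bound \<delta> \<le> 1/2
    serves the estimate of p.\<close>
  define \<delta> where "\<delta> = min (1 / 2) (sqrt (e / 128))"
  have \<delta>: "0 < \<delta>" "\<delta> \<le> 1 / 2" "32 * \<delta>\<^sup>2 \<le> e / 4"
  proof -
    show "0 < \<delta>" "\<delta> \<le> 1 / 2" using \<open>0 < e\<close> by (auto simp: \<delta>_def)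
    have "\<delta>\<^sup>2 \<le> (sqrt (e / 128))\<^sup>2" using \<open>0 < \<delta>\<close> by (intro power_mono) (auto simp: \<delta>_def)
    then show "32 * \<delta>\<^sup>2 \<le> e / 4" using \<open>0 < e\<close> by simp
  qed
  have "continuous_on {0..1} (lo m)" "continuous_on {0..1} (up m)"
    unfolding lo_def up_def by (intro continuous_intros)+
  then obtain p' q' where p': "\<And>s. s \<in> {0..1} \<Longrightarrow> \<bar>lo m s - poly p' s\<bar> < \<delta>"
      and q': "\<And>s. s \<in> {0..1} \<Longrightarrow> \<bar>up m s - poly q' s\<bar> < \<delta>"
    using Weierstrass_real_poly[of 0 1 "lo m" \<delta>] Weierstrass_real_poly[of 0 1 "up m" \<delta>] \<delta>(1) by metis
  define p where "p = p' - [:\<delta>:]"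
  define q where "q = q' + [:\<delta>:]"
  have P: "poly p s \<le> lo m s" "lo m s - 2 * \<delta> \<le> poly p s" "up m s \<le> poly q s" "poly q s \<le> up m s + 2 * \<delta>"
    if "s \<in> {0..1}" for s
    using p'[OF that] q'[OF that] by (auto simp: p_def q_def abs_less_iff)
  have hl: "lo m s \<le> (if s0 \<le> s then 1 else 0)" "(if s0 \<le> s then 1 else 0) \<le> up m s" for s
    using mult_nonneg_nonpos[of "real m" "s - s0"] mult_nonneg_nonneg[of "real m" "s - s0"]
    by (auto simp: lo_def up_def max_def)
  have sq: "integrable (beta_measure a b) (\<lambda>s. (up m s - lo m s)\<^sup>2)"
  proof (intro integrable_beta_measure[where C = 1] ab)
    fix s show "\<bar>(up m s - lo m s)\<^sup>2\<bar> \<le> 1" using bd[of m s] by (simp add: abs_le_iff power_le_one)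
  qed auto
  have "beta_exp a b ((q - p) ^ 2) \<le> (\<integral>s. 2 * (up m s - lo m s)\<^sup>2 + 32 * \<delta>\<^sup>2 \<partial>beta_measure a b)"
    unfolding beta_exp_def
  proof (rule integral_mono_AE)
    show "AE s in beta_measure a b. poly ((q - p)\<^sup>2) s \<le> 2 * (up m s - lo m s)\<^sup>2 + 32 * \<delta>\<^sup>2"
      using AE_beta_measure[of a b]
    proof eventually_elim
      case (elim s)
      then have s: "s \<in> {0..1}" by auto
      have "0 \<le> poly q s - poly p s" "poly q s - poly p s \<le> (up m s - lo m s) + 4 * \<delta>"
        using P[OF s] bd[of m s] by auto
      then have "(poly q s - poly p s)\<^sup>2 \<le> ((up m s - lo m s) + 4 * \<delta>)\<^sup>2" by (intro power_mono) auto
      also have "\<dots> \<le> 2 * (up m s - lo m s)\<^sup>2 + 32 * \<delta>\<^sup>2"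
        using sum_squares_bound[of "up m s - lo m s" "4 * \<delta>"] by (simp add: power2_eq_square algebra_simps)
      finally show ?case by simp
    qed
    show "integrable (beta_measure a b) (poly ((q - p)\<^sup>2))" by (rule integrable_beta_poly[OF ab])
    show "integrable (beta_measure a b) (\<lambda>s. 2 * (up m s - lo m s)\<^sup>2 + 32 * \<delta>\<^sup>2)"
      using sq by simp
  qed
  also have "\<dots> = 2 * (\<integral>s. (up m s - lo m s)\<^sup>2 \<partial>beta_measure a b) + 32 * \<delta>\<^sup>2"
    using sq prob_space by simp
  also have "\<dots> < e" using m \<delta> \<open>0 < e\<close> by linarith
  finally have e: "beta_exp a b ((q - p) ^ 2) < e" .
  show ?thesis
  proof (intro exI conjI ballI)
    fix s :: real assume s: "s \<in> {0..1}"
    show "poly p s \<le> (if s0 \<le> s then 1 else 0)" using P(1)[OF s] hl(1)[of s] by linarith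
    show "(if s0 \<le> s then 1 else 0) \<le> poly q s" using P(3)[OF s] hl(2)[of s] by linarith
    show "\<bar>poly p s\<bar> \<le> 2" using P(1,2)[OF s] bd[of m s] \<delta> by auto
  qed (rule e)
qed

text \<open>The Funk-Hecke formula: the eigenvalue on the k-th eigenspace of integration against the
  indicator of s0 \<le> t. No normalising factor occurs because \<open>jac\<close> is 1 at
  1.\<close>

definition threshold_coeff :: "real \<Rightarrow> real \<Rightarrow> real \<Rightarrow> nat \<Rightarrow> real" where
  "threshold_coeff a b s0 k = (\<integral>s. (if s0 \<le> s then poly (jac a b k) s else 0) \<partial>beta_measure a b)"

text \<open>Bessel's inequality for the residual of the indicator after subtracting p: the
  difference on the left is its k-th coefficient, and \<open>jac_dim\<close> is the inverse squared
  norm.\<close>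

lemma threshold_bessel:
  assumes ab: "0 < a" "0 < b"
  shows "(\<Sum>k\<le>K. jac_dim a b k * (threshold_coeff a b s0 k - beta_exp a b (p * jac a b k))\<^sup>2)
     \<le> (\<integral>s. ((if s0 \<le> s then 1 else 0) - poly p s)\<^sup>2 \<partial>beta_measure a b)"
proof -
  define f where "f k = threshold_coeff a b s0 k - beta_exp a b (p * jac a b k)" for k
  \<comment> \<open>The orthogonal projection of the residual g onto degrees up to K, so that the
    pairings of g with P and of P with P are both S.\<close>
  define P where "P = (\<Sum>k\<le>K. Polynomial.smult (jac_dim a b k * f k) (jac a b k))"
  define g where "g s = (if s0 \<le> s then 1 else 0) - poly p s" for s
  define S where "S = (\<Sum>k\<le>K. jac_dim a b k * (f k)\<^sup>2)"
  interpret prob_space "beta_measure a b" by (rule prob_space_beta_measure[OF ab])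
  have [measurable]: "g \<in> borel_measurable borel" unfolding g_def by measurable
  have I1: "integrable (beta_measure a b) (\<lambda>s. g s * poly q s)" for q
  proof -
    have "(\<lambda>s. g s * poly q s) = (\<lambda>s. (if s0 \<le> s then poly q s else 0) - poly (p * q) s)"
      by (auto simp: g_def algebra_simps)
    then show ?thesis
      by (simp only:) (intro Bochner_Integration.integrable_diff integrable_beta_poly integrable_beta_poly_tail ab)
  qed
  have I2: "integrable (beta_measure a b) (\<lambda>s. (g s)\<^sup>2)"
  proof -
    have "(\<lambda>s. (g s)\<^sup>2) = (\<lambda>s. (if s0 \<le> s then poly (1 - Polynomial.smult 2 p) s else 0) + poly (p\<^sup>2) s)"
      by (auto simp: g_def power2_eq_square algebra_simps)
    then show ?thesis
      by (simp only:) (intro Bochner_Integration.integrable_add integrable_beta_poly integrable_beta_poly_tail ab)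
  qed
  have gj: "(\<integral>s. g s * poly (jac a b k) s \<partial>beta_measure a b) = f k" for k
  proof -
    have "(\<lambda>s. g s * poly (jac a b k) s) = (\<lambda>s. (if s0 \<le> s then poly (jac a b k) s else 0) - poly (p * jac a b k) s)"
      by (auto simp: g_def algebra_simps)
    then show ?thesis
      by (simp only: f_def threshold_coeff_def beta_exp_def)
         (intro Bochner_Integration.integral_diff integrable_beta_poly integrable_beta_poly_tail ab)
  qed
  have gP: "(\<integral>s. g s * poly P s \<partial>beta_measure a b) = S"
  proof -
    have "(\<integral>s. g s * poly P s \<partial>beta_measure a b) = (\<integral>s. (\<Sum>k\<le>K. (jac_dim a b k * f k) * (g s * poly (jac a b k) s)) \<partial>beta_measure a b)"
      by (intro Bochner_Integration.integral_cong) (auto simp: P_def poly_sum sum_distrib_left mult_ac)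
    also have "\<dots> = (\<Sum>k\<le>K. (jac_dim a b k * f k) * (\<integral>s. g s * poly (jac a b k) s \<partial>beta_measure a b))"
      by (subst Bochner_Integration.integral_sum) (auto intro!: I1)
    finally show ?thesis by (simp add: gj S_def power2_eq_square mult_ac)
  qed
  have PP: "beta_exp a b (P * P) = S"
  proof -
    have "beta_exp a b (P * P) = (\<Sum>k\<le>K. \<Sum>l\<le>K. (jac_dim a b k * f k) * (jac_dim a b l * f l) * beta_exp a b (jac a b k * jac a b l))"
      using ab by (simp add: P_def sum_product beta_exp_sum beta_exp_smult mult_ac)
    also have "\<dots> = (\<Sum>k\<le>K. \<Sum>l\<le>K. if l = k then jac_dim a b k * (f k)\<^sup>2 else 0)"
      using jac_dim_pos[OF ab] by (intro sum.cong refl) (auto simp: beta_exp_jac_jac[OF ab] power2_eq_square less_imp_neq[symmetric])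
    finally show ?thesis by (simp add: S_def)
  qed
  have "0 \<le> (\<integral>s. (g s - poly P s)\<^sup>2 \<partial>beta_measure a b)" by simp
  also have "\<dots> = (\<integral>s. (g s)\<^sup>2 - 2 * (g s * poly P s) + poly (P * P) s \<partial>beta_measure a b)"
    by (intro Bochner_Integration.integral_cong) (auto simp: power2_eq_square algebra_simps)
  also have "\<dots> = (\<integral>s. (g s)\<^sup>2 \<partial>beta_measure a b) - 2 * (\<integral>s. g s * poly P s \<partial>beta_measure a b) + beta_exp a b (P * P)"
    unfolding beta_exp_def
    by (subst Bochner_Integration.integral_add Bochner_Integration.integral_diff
          | intro Bochner_Integration.integrable_diff integrable_mult_right I1 I2 integrable_beta_poly ab)+ simp
  finally have "S \<le> (\<integral>s. (g s)\<^sup>2 \<partial>beta_measure a b)" by (simp add: gP PP)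
  then show ?thesis unfolding S_def g_def f_def .
qed

section \<open>Spectra of real symmetric matrices\<close>

text \<open>Matrix powers of a function of two indices, free of carrier conditions;
  \<open>pow_mat_fpow\<close> is the link to matrices.\<close>

fun fpow :: "nat \<Rightarrow> (nat \<Rightarrow> nat \<Rightarrow> real) \<Rightarrow> nat \<Rightarrow> nat \<Rightarrow> nat \<Rightarrow> real" where
  "fpow N f 0 = (\<lambda>i j. if i = j then 1 else 0)"
| "fpow N f (Suc r) = (\<lambda>i j. \<Sum>k<N. fpow N f r i k * f k j)"

lemma pow_mat_fpow:
  "(mat N N (\<lambda>(i, j). f i j)) ^\<^sub>m r = mat N N (\<lambda>(i, j). fpow N f r i j)"
proof (induction r)
  case 0
  show ?case by (intro eq_matI) auto
next
  case (Suc r)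
  show ?case
    by (intro eq_matI) (auto simp: Suc scalar_prod_def lessThan_atLeast0)
qed

text \<open>Over the complex numbers the polynomial factors. A root with eigenvector v is the
  quotient of the Hermitian form of A at v by the squared norm of v, and the form is real by
  symmetry; so the factorisation descends to the reals.\<close>

lemma symmetric_char_poly_splits:
  fixes A :: "real mat"
  assumes A: "A \<in> carrier_mat N N" and sym: "\<And>i j. i < N \<Longrightarrow> j < N \<Longrightarrow> A $$ (i, j) = A $$ (j, i)"
  shows "\<exists>es. char_poly A = (\<Prod>e\<leftarrow>es. [:- e, 1:])"
proof -
  define B where "B = map_mat complex_of_real A"
  have B: "B \<in> carrier_mat N N" using A by (simp add: B_def)
  obtain as where as: "char_poly B = (\<Prod>a\<leftarrow>as. [:- a, 1:])"
    using char_poly_factorized[OF B] by blast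
  have real: "Im a = 0" if "a \<in> set as" for a
  proof -
    have "poly (char_poly B) a = 0" using that by (auto simp: as poly_prod_list prod_list_zero_iff)
    then have "eigenvalue B a" by (simp add: eigenvalue_root_char_poly[OF B])
    then obtain v where v: "v \<in> carrier_vec N" "v \<noteq> 0\<^sub>v N" "B *\<^sub>v v = a \<cdot>\<^sub>v v"
      using B by (auto simp: eigenvalue_def eigenvector_def)
    \<comment> \<open>The Hermitian form at v, evaluated once by the eigenvalue equation and once by
      symmetry of A.\<close>
    define q where "q = (\<Sum>i<N. \<Sum>j<N. cnj (v $ i) * complex_of_real (A $$ (i, j)) * v $ j)"
    have Bv: "(\<Sum>j<N. complex_of_real (A $$ (i, j)) * v $ j) = a * v $ i" if "i < N" for i
    proof -
      have "(B *\<^sub>v v) $ i = (\<Sum>j<N. complex_of_real (A $$ (i, j)) * v $ j)"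
        using that v(1) A by (auto simp: B_def scalar_prod_def lessThan_atLeast0)
      then show ?thesis using v(1,3) that by simp
    qed
    have "q = (\<Sum>i<N. cnj (v $ i) * (a * v $ i))"
      unfolding q_def by (intro sum.cong refl) (simp add: Bv[symmetric] sum_distrib_left mult.assoc)
    also have "\<dots> = a * of_real (\<Sum>i<N. (cmod (v $ i))\<^sup>2)"
      by (simp only: of_real_sum complex_norm_square sum_distrib_left mult_ac)
    finally have q: "q = a * of_real (\<Sum>i<N. (cmod (v $ i))\<^sup>2)" .
    have "cnj q = (\<Sum>i<N. \<Sum>j<N. cnj (v $ j) * complex_of_real (A $$ (j, i)) * v $ i)"
      unfolding q_def cnj_sum using sym by (intro sum.cong refl) (auto simp: mult_ac)
    also have "\<dots> = q" unfolding q_def by (rule sum.swap)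
    finally have "Im q = 0" by (metis Reals_cnj_iff complex_is_Real_iff)
    moreover have "(\<Sum>i<N. (cmod (v $ i))\<^sup>2) \<noteq> 0"
    proof
      assume "(\<Sum>i<N. (cmod (v $ i))\<^sup>2) = 0"
      then have "\<forall>i<N. v $ i = 0" by (subst (asm) sum_nonneg_eq_0_iff) auto
      then have "v = 0\<^sub>v N" using v(1) by (intro eq_vecI) auto
      with v(2) show False by simp
    qed
    moreover have "Im q = Im a * (\<Sum>i<N. (cmod (v $ i))\<^sup>2)"
      unfolding q by (simp only: times_complex.sel Im_complex_of_real Re_complex_of_real mult_zero_right add_0)
    ultimately show ?thesis by simp
  qed
  have "map_poly complex_of_real (char_poly A) = (\<Prod>a\<leftarrow>as. [:- a, 1:])"
    using of_real_hom.char_poly_hom[OF A, where ?'a = complex] as by (simp add: B_def)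
  also have "as = map complex_of_real (map Re as)"
    using real by (simp add: map_idI complex_eq_iff o_def)
  also have "(\<Prod>a\<leftarrow>map complex_of_real (map Re as). [:- a, 1:]) = map_poly complex_of_real (\<Prod>a\<leftarrow>map Re as. [:- a, 1:])"
  proof -
    interpret mp: map_poly_inj_comm_ring_hom complex_of_real ..
    show ?thesis by (simp add: mp.hom_prod_list o_def)
  qed
  finally have "char_poly A = (\<Prod>a\<leftarrow>map Re as. [:- a, 1:])"
    by (simp add: poly_eq_iff coeff_map_poly)
  then show ?thesis by blast
qed

lemma upper_triangular_pow_mat:
  fixes B :: "real mat"
  assumes B: "B \<in> carrier_mat N N" and ut: "upper_triangular B"
  shows "(\<forall>i<N. \<forall>j<i. (B ^\<^sub>m r) $$ (i, j) = 0) \<and> (\<forall>i<N. (B ^\<^sub>m r) $$ (i, i) = (B $$ (i, i)) ^ r)"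
proof (induction r)
  case 0
  show ?case using B by auto
next
  case (Suc r)
  have u: "B $$ (i, j) = 0" if "i < N" "j < i" for i j using ut that B by auto
  have e: "(B ^\<^sub>m Suc r) $$ (i, j) = (\<Sum>k<N. (B ^\<^sub>m r) $$ (i, k) * B $$ (k, j))" if "i < N" "j < N" for i j
    using that B by (auto simp: scalar_prod_def lessThan_atLeast0)
  show ?case
  proof (intro conjI allI impI)
    fix i j assume "i < N" "j < i"
    then show "(B ^\<^sub>m Suc r) $$ (i, j) = 0"
    proof (subst e)
      show "(\<Sum>k<N. (B ^\<^sub>m r) $$ (i, k) * B $$ (k, j)) = 0"
      proof (rule sum.neutral, safe)
        fix k assume "k < N"
        then show "(B ^\<^sub>m r) $$ (i, k) * B $$ (k, j) = 0"
          using Suc \<open>i < N\<close> \<open>j < i\<close> u[of k j] by (cases "k < i") auto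
      qed
    qed auto
  next
    fix i assume "i < N"
    have "(B ^\<^sub>m Suc r) $$ (i, i) = (\<Sum>k<N. (B ^\<^sub>m r) $$ (i, k) * B $$ (k, i))" using \<open>i < N\<close> by (intro e)
    also have "\<dots> = (\<Sum>k<N. if k = i then (B $$ (i, i)) ^ Suc r else 0)"
    proof (intro sum.cong refl)
      fix k assume "k \<in> {..<N}"
      then show "(B ^\<^sub>m r) $$ (i, k) * B $$ (k, i) = (if k = i then (B $$ (i, i)) ^ Suc r else 0)"
        using Suc \<open>i < N\<close> u[of k i] by (cases k i rule: linorder_cases) auto
    qed
    also have "\<dots> = (B $$ (i, i)) ^ Suc r" using \<open>i < N\<close> by simp
    finally show "(B ^\<^sub>m Suc r) $$ (i, i) = (B $$ (i, i)) ^ Suc r" .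
  qed
qed

lemma sum_diag_mult_comm:
  fixes A B :: "real mat"
  assumes "A \<in> carrier_mat N N" "B \<in> carrier_mat N N"
  shows "(\<Sum>i<N. (A * B) $$ (i, i)) = (\<Sum>i<N. (B * A) $$ (i, i))"
proof -
  have "(\<Sum>i<N. (A * B) $$ (i, i)) = (\<Sum>i<N. \<Sum>k<N. A $$ (i, k) * B $$ (k, i))"
    using assms by (intro sum.cong refl) (auto simp: scalar_prod_def lessThan_atLeast0)
  also have "\<dots> = (\<Sum>k<N. \<Sum>i<N. B $$ (k, i) * A $$ (i, k))"
    by (subst sum.swap) (simp add: mult.commute)
  also have "\<dots> = (\<Sum>i<N. (B * A) $$ (i, i))"
    using assms by (intro sum.cong refl) (auto simp: scalar_prod_def lessThan_atLeast0)
  finally show ?thesis .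
qed

text \<open>The trace is invariant under similarity, and the diagonal of a power of a triangular
  matrix consists of the powers of its diagonal. The Schur form places the roots of the
  characteristic polynomial there.\<close>

lemma spec_power_sum:
  assumes A: "A \<in> carrier_mat N N" and sym: "\<And>i j. i < N \<Longrightarrow> j < N \<Longrightarrow> A $$ (i, j) = A $$ (j, i)"
  shows "(\<Sum>x\<in>#spec A. x ^ r) = (\<Sum>i<N. (A ^\<^sub>m r) $$ (i, i))"
proof -
  obtain es where es: "char_poly A = (\<Prod>e\<leftarrow>es. [:- e, 1:])"
    using symmetric_char_poly_splits[OF assms] by blast
  obtain B P Q where s: "schur_decomposition A es = (B, P, Q)" by (metis prod_cases3)
  from schur_decomposition[OF A es s]
  have wit: "similar_mat_wit A B P Q" and ut: "upper_triangular B" and dg: "diag_mat B = es" by auto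
  from similar_mat_witD2[OF A wit]
  have c: "B \<in> carrier_mat N N" "P \<in> carrier_mat N N" "Q \<in> carrier_mat N N" and QP: "Q * P = 1\<^sub>m N" by auto
  have "(\<Sum>i<N. (A ^\<^sub>m r) $$ (i, i)) = (\<Sum>i<N. (P * (B ^\<^sub>m r * Q)) $$ (i, i))"
    using c by (subst similar_mat_wit_pow_id[OF wit]) (simp add: assoc_mult_mat[of _ N N _ N _ N])
  also have "\<dots> = (\<Sum>i<N. (B ^\<^sub>m r * Q * P) $$ (i, i))"
    using c by (intro sum_diag_mult_comm) auto
  also have "B ^\<^sub>m r * Q * P = B ^\<^sub>m r" using c QP by (simp add: assoc_mult_mat[of _ N N _ N _ N])
  also have "(\<Sum>i<N. (B ^\<^sub>m r) $$ (i, i)) = (\<Sum>i<N. (B $$ (i, i)) ^ r)"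
    using upper_triangular_pow_mat[OF c(1) ut] by (intro sum.cong) auto
  also have "\<dots> = (\<Sum>x\<leftarrow>es. x ^ r)"
    using c(1) by (simp add: dg[symmetric] diag_mat_def o_def interv_sum_list_conv_sum_set_nat lessThan_atLeast0)
  also have "\<dots> = (\<Sum>x\<in>#spec A. x ^ r)"
  proof -
    have "spec A = mset es"
      unfolding spec_def es
    proof (induction es)
      case (Cons e es)
      have "(\<Prod>e\<leftarrow>es. [:- e, 1:]) \<noteq> 0" by (auto simp: prod_list_zero_iff)
      then show ?case using Cons by (simp add: proots_mult del: mult_pCons_left)
    qed simp
    then show ?thesis by (simp add: sum_mset_sum_list flip: mset_map)
  qed
  finally show ?thesis by simp
qed

lemma spec_bounded:
  assumes A: "A \<in> carrier_mat N N" and sym: "\<And>i j. i < N \<Longrightarrow> j < N \<Longrightarrow> A $$ (i, j) = A $$ (j, i)"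
    and x: "x \<in># spec A" and R: "(\<Sum>i<N. (A ^\<^sub>m 2) $$ (i, i)) \<le> R\<^sup>2" "0 \<le> R"
  shows "\<bar>x\<bar> \<le> R"
proof -
  have "x\<^sup>2 \<le> (\<Sum>x\<in>#spec A. x ^ 2)"
  proof -
    have nn: "0 \<le> (\<Sum>x\<in>#M. x ^ 2)" for M :: "real multiset" by (induction M) auto
    obtain M where "spec A = add_mset x M" using x by (metis multi_member_split)
    with nn[of M] show ?thesis by simp
  qed
  also have "\<dots> \<le> R\<^sup>2" using spec_power_sum[OF A sym, of 2] R by simp
  finally show ?thesis using R by (metis abs_le_square_iff abs_of_nonneg)
qed

section \<open>Convergence of power sums implies convergence of ordered spectra\<close>

text \<open>The factor x^2 turns both sides into integrals against measures whose masses are the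
  second power sums, so uniform approximation of g suffices; and x^2 times a polynomial only
  involves power sums of order at least 2.\<close>

lemma power_sums_imp_test_functions:
  fixes S :: "nat \<Rightarrow> real multiset" and w c :: "nat \<Rightarrow> real"
  assumes S: "\<And>N x. x \<in># S N \<Longrightarrow> \<bar>x\<bar> \<le> R" and c: "\<And>k. \<bar>c k\<bar> \<le> R" and w: "\<And>k. 0 \<le> w k"
    and sm: "summable (\<lambda>k. w k * (c k)\<^sup>2)"
    and mom: "\<And>r. 2 \<le> r \<Longrightarrow> (\<lambda>N. \<Sum>x\<in>#S N. x ^ r) \<longlonglongrightarrow> (\<Sum>k. w k * c k ^ r)"
    and g: "continuous_on {-R..R} g"
  shows "(\<lambda>N. \<Sum>x\<in>#S N. x\<^sup>2 * g x) \<longlonglongrightarrow> (\<Sum>k. w k * ((c k)\<^sup>2 * g (c k)))"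
proof (rule tendstoI)
  fix e :: real assume "0 < e"
  have "0 \<le> R" using c[of 0] by linarith
  define T where "T = (\<Sum>k. w k * (c k)\<^sup>2)"
  have T: "0 \<le> T" unfolding T_def using sm w by (intro suminf_nonneg) auto
  \<comment> \<open>Three errors of size e/3: replacing g on the spectrum, convergence for the
    polynomial, replacing g in the limit. The mass of the limit is T, that of the spectra is
    eventually below T + 1.\<close>
  define \<delta> where "\<delta> = e / (3 * (T + 1))"
  have cancel: "e / (3 * x) * x = e / 3" if "x \<noteq> 0" for x using that by simp
  have "T + 1 \<noteq> 0" using T by simp
  from cancel[OF this] have \<delta>2: "\<delta> * (T + 1) = e / 3" unfolding \<delta>_def .
  have "0 < \<delta>" unfolding \<delta>_def using \<open>0 < e\<close> T by (intro divide_pos_pos mult_pos_pos) auto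
  note \<delta> = this \<delta>2
  obtain p where p: "\<And>x. x \<in> {-R..R} \<Longrightarrow> \<bar>g x - poly p x\<bar> < \<delta>"
    using Weierstrass_real_poly[OF g \<delta>(1)] by blast
  have sg: "summable (\<lambda>k. w k * ((c k)\<^sup>2 * h (c k)))" if "\<And>x. x \<in> {-R..R} \<Longrightarrow> \<bar>h x\<bar> \<le> C" for h C
  proof (rule summable_comparison_test'[OF summable_mult[OF sm, of C]])
    fix k
    have "\<bar>h (c k)\<bar> \<le> C" using c[of k] by (intro that) (auto simp: abs_le_iff)
    then have "w k * (c k)\<^sup>2 * \<bar>h (c k)\<bar> \<le> w k * (c k)\<^sup>2 * C" using w by (intro mult_left_mono) auto
    then show "norm (w k * ((c k)\<^sup>2 * h (c k))) \<le> C * (w k * (c k)\<^sup>2)" using w[of k] by (simp add: abs_mult mult_ac)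
  qed
  have bdd: "\<exists>C. \<forall>x\<in>{-R..R}. \<bar>h x\<bar> \<le> C" if "continuous_on {-R..R} h" for h :: "real \<Rightarrow> real"
    using compact_continuous_image[OF that] by (auto dest!: compact_imp_bounded simp: bounded_iff)
  obtain Cg where Cg: "\<And>x. x \<in> {-R..R} \<Longrightarrow> \<bar>g x\<bar> \<le> Cg" using bdd[OF g] by blast
  have "continuous_on {-R..R} (poly p)" by (intro continuous_intros)
  from bdd[OF this] obtain Cp where Cp: "\<And>x. x \<in> {-R..R} \<Longrightarrow> \<bar>poly p x\<bar> \<le> Cp" by blast
  have sr: "summable (\<lambda>k. w k * c k ^ (i + 2))" for i
  proof -
    have "continuous_on {-R..R} (\<lambda>x. x ^ i)" by (intro continuous_intros)
    from bdd[OF this] obtain C where "\<And>x. x \<in> {-R..R} \<Longrightarrow> \<bar>x ^ i\<bar> \<le> C" by blast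
    from sg[of "\<lambda>x. x ^ i", OF this] show ?thesis by (simp add: power_add mult_ac power2_eq_square)
  qed
  have e1: "(\<Sum>x\<in>#M. x\<^sup>2 * poly p x) = (\<Sum>i\<le>degree p. coeff p i * (\<Sum>x\<in>#M. x ^ (i + 2)))" for M :: "real multiset"
  proof (induction M)
    case (add x M)
    have "x\<^sup>2 * poly p x = (\<Sum>i\<le>degree p. coeff p i * x ^ (i + 2))"
      unfolding poly_altdef sum_distrib_left by (intro sum.cong refl) (simp add: power_add mult_ac power2_eq_square)
    then show ?case by (simp add: add sum.distrib distrib_left)
  qed simp
  have e2: "(\<Sum>k. w k * ((c k)\<^sup>2 * poly p (c k))) = (\<Sum>i\<le>degree p. coeff p i * (\<Sum>k. w k * c k ^ (i + 2)))"
  proof -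
    have "(\<Sum>k. w k * ((c k)\<^sup>2 * poly p (c k))) = (\<Sum>k. \<Sum>i\<le>degree p. coeff p i * (w k * c k ^ (i + 2)))"
      by (intro arg_cong[where f = suminf] ext) (simp add: poly_altdef sum_distrib_left power_add mult_ac power2_eq_square)
    also have "\<dots> = (\<Sum>i\<le>degree p. \<Sum>k. coeff p i * (w k * c k ^ (i + 2)))"
      by (rule suminf_sum) (intro summable_mult sr)
    also have "\<dots> = (\<Sum>i\<le>degree p. coeff p i * (\<Sum>k. w k * c k ^ (i + 2)))"
      by (intro sum.cong refl suminf_mult sr)
    finally show ?thesis .
  qed
  have "(\<lambda>N. \<Sum>x\<in>#S N. x\<^sup>2 * poly p x) \<longlonglongrightarrow> (\<Sum>k. w k * ((c k)\<^sup>2 * poly p (c k)))"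
    unfolding e1 e2 by (intro tendsto_sum tendsto_mult tendsto_const mom) auto
  then have ev1: "eventually (\<lambda>N. \<bar>(\<Sum>x\<in>#S N. x\<^sup>2 * poly p x) - (\<Sum>k. w k * ((c k)\<^sup>2 * poly p (c k)))\<bar> < e / 3) sequentially"
    using \<open>0 < e\<close> by (auto dest!: tendstoD[of _ _ _ "e / 3"] simp: dist_real_def)
  have ev2: "eventually (\<lambda>N. (\<Sum>x\<in>#S N. x ^ 2) < T + 1) sequentially"
    using mom[of 2] by (intro order_tendstoD(2)) (auto simp: T_def)
  have L: "\<bar>(\<Sum>k. w k * ((c k)\<^sup>2 * g (c k))) - (\<Sum>k. w k * ((c k)\<^sup>2 * poly p (c k)))\<bar> < e / 3"
  proof -
    have sd: "summable (\<lambda>k. w k * ((c k)\<^sup>2 * (g (c k) - poly p (c k))))"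
      using sg[of "\<lambda>x. g x - poly p x" \<delta>] p less_imp_le by blast
    have "(\<Sum>k. w k * ((c k)\<^sup>2 * g (c k))) - (\<Sum>k. w k * ((c k)\<^sup>2 * poly p (c k))) = (\<Sum>k. w k * ((c k)\<^sup>2 * (g (c k) - poly p (c k))))"
      by (subst suminf_diff) (use sg[OF Cg] sg[OF Cp] in \<open>auto simp: algebra_simps\<close>)
    also have "\<bar>\<dots>\<bar> \<le> (\<Sum>k. \<delta> * (w k * (c k)\<^sup>2))"
    proof -
      have b: "\<bar>w k * ((c k)\<^sup>2 * (g (c k) - poly p (c k)))\<bar> \<le> \<delta> * (w k * (c k)\<^sup>2)" for k
      proof -
        have "\<bar>g (c k) - poly p (c k)\<bar> \<le> \<delta>" using p[of "c k"] c[of k] by (auto simp: abs_le_iff intro: less_imp_le)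
        then have "w k * (c k)\<^sup>2 * \<bar>g (c k) - poly p (c k)\<bar> \<le> w k * (c k)\<^sup>2 * \<delta>" using w by (intro mult_left_mono) auto
        then show ?thesis using w[of k] by (simp add: abs_mult mult_ac)
      qed
      have "summable (\<lambda>k. \<bar>w k * ((c k)\<^sup>2 * (g (c k) - poly p (c k)))\<bar>)"
        by (rule summable_comparison_test'[OF summable_mult[OF sm, of \<delta>]]) (use b in auto)
      then show ?thesis
        by (intro order_trans[OF summable_rabs] suminf_le b summable_mult sm)
    qed
    also have "\<dots> = \<delta> * T" using sm by (simp add: T_def suminf_mult)
    also have "\<dots> < \<delta> * (T + 1)" using \<delta> by simp
    finally show ?thesis using \<delta> by simp
  qed
  show "eventually (\<lambda>N. dist (\<Sum>x\<in>#S N. x\<^sup>2 * g x) (\<Sum>k. w k * ((c k)\<^sup>2 * g (c k))) < e) sequentially"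
    using ev1 ev2
  proof eventually_elim
    case (elim N)
    have "\<bar>(\<Sum>x\<in>#M. x\<^sup>2 * g x) - (\<Sum>x\<in>#M. x\<^sup>2 * poly p x)\<bar> \<le> \<delta> * (\<Sum>x\<in>#M. x ^ 2)" if "\<And>x. x \<in># M \<Longrightarrow> \<bar>x\<bar> \<le> R" for M
      using that
    proof (induction M)
      case (add x M)
      have "\<bar>g x - poly p x\<bar> \<le> \<delta>" using p[of x] add.prems[of x] by (auto simp: abs_le_iff intro: less_imp_le)
      then have "x\<^sup>2 * \<bar>g x - poly p x\<bar> \<le> x\<^sup>2 * \<delta>" by (intro mult_left_mono) auto
      moreover have "\<bar>x\<^sup>2 * g x - x\<^sup>2 * poly p x\<bar> = x\<^sup>2 * \<bar>g x - poly p x\<bar>" unfolding right_diff_distrib[symmetric] abs_mult by simp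
      ultimately have "\<bar>x\<^sup>2 * g x - x\<^sup>2 * poly p x\<bar> \<le> \<delta> * x\<^sup>2" by (simp only: mult.commute)
      moreover have "\<bar>(\<Sum>x\<in>#M. x\<^sup>2 * g x) - (\<Sum>x\<in>#M. x\<^sup>2 * poly p x)\<bar> \<le> \<delta> * (\<Sum>x\<in>#M. x ^ 2)"
        using add by auto
      ultimately show ?case by (simp add: distrib_left)
    qed simp
    from this[OF S] have "\<bar>(\<Sum>x\<in>#S N. x\<^sup>2 * g x) - (\<Sum>x\<in>#S N. x\<^sup>2 * poly p x)\<bar> \<le> \<delta> * (\<Sum>x\<in>#S N. x ^ 2)" .
    also have "\<dots> \<le> \<delta> * (T + 1)" using elim \<delta> by (intro mult_left_mono) auto
    finally have "\<bar>(\<Sum>x\<in>#S N. x\<^sup>2 * g x) - (\<Sum>x\<in>#S N. x\<^sup>2 * poly p x)\<bar> \<le> e / 3" using \<delta> by simp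
    with elim L show ?case unfolding dist_real_def by linarith
  qed
qed

text \<open>A continuous counting function: sums of it lie between the number of values \<ge> v and
  the number of values \<ge> u.\<close>

definition ramp :: "real \<Rightarrow> real \<Rightarrow> real \<Rightarrow> real" where
  "ramp u v x = min 1 (max 0 ((x - u) / (v - u)))"

lemma ramp_bounds: "0 \<le> ramp u v x" "ramp u v x \<le> 1"
  by (auto simp: ramp_def)

lemma ramp_eq_1: "u < v \<Longrightarrow> v \<le> x \<Longrightarrow> ramp u v x = 1"
  by (auto simp: ramp_def min_def max_def field_simps)

lemma ramp_eq_0: "u < v \<Longrightarrow> x \<le> u \<Longrightarrow> ramp u v x = 0"
  by (auto simp: ramp_def min_def max_def field_simps)

text \<open>The ramp vanishes near 0, so x^2 splits off with a continuous cofactor;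
  \<open>max x u\<close> keeps the denominator away from 0 without changing the product.\<close>

lemma ramp_as_square: 
  assumes "0 < u" "u < v"
  shows "ramp u v x = x\<^sup>2 * (ramp u v x / (max x u)\<^sup>2)"
proof (cases "x \<le> u")
  case True
  then show ?thesis using assms by (simp add: ramp_eq_0)
next
  case False
  then show ?thesis using assms by (simp add: max_def)
qed

lemma ramp_square_continuous: "0 < u \<Longrightarrow> u < v \<Longrightarrow> continuous_on A (\<lambda>x. ramp u v x / (max x u)\<^sup>2)"
  unfolding ramp_def by (intro continuous_intros) (auto simp: max_def)

lemma power_sums_imp_ramp:
  fixes S :: "nat \<Rightarrow> real multiset" and w c :: "nat \<Rightarrow> real"
  assumes "\<And>N x. x \<in># S N \<Longrightarrow> \<bar>x\<bar> \<le> R" "\<And>k. \<bar>c k\<bar> \<le> R" "\<And>k. 0 \<le> w k"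
    "summable (\<lambda>k. w k * (c k)\<^sup>2)"
    "\<And>r. 2 \<le> r \<Longrightarrow> (\<lambda>N. \<Sum>x\<in>#S N. x ^ r) \<longlonglongrightarrow> (\<Sum>k. w k * c k ^ r)" "0 < u" "u < v"
  shows "(\<lambda>N. \<Sum>x\<in>#S N. ramp u v x) \<longlonglongrightarrow> (\<Sum>k. w k * ramp u v (c k))"
    and "(\<lambda>N. \<Sum>x\<in>#S N. ramp u v (- x)) \<longlonglongrightarrow> (\<Sum>k. w k * ramp u v (- c k))"
proof -
  have *: "(\<lambda>N. \<Sum>x\<in>#S N. x\<^sup>2 * g x) \<longlonglongrightarrow> (\<Sum>k. w k * ((c k)\<^sup>2 * g (c k)))" if "continuous_on {-R..R} g" for g
    by (rule power_sums_imp_test_functions[of S R c w]) (use assms that in auto)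
  from *[OF ramp_square_continuous[OF assms(6,7)]]
  show "(\<lambda>N. \<Sum>x\<in>#S N. ramp u v x) \<longlonglongrightarrow> (\<Sum>k. w k * ramp u v (c k))"
    by (simp only: ramp_as_square[OF assms(6,7), symmetric])
  have "continuous_on {-R..R} (\<lambda>x. ramp u v (- x) / (max (- x) u)\<^sup>2)"
    by (rule continuous_on_compose2[OF ramp_square_continuous[OF assms(6,7), of UNIV]])
       (auto intro!: continuous_intros)
  have e: "x\<^sup>2 * (ramp u v (- x) / (max (- x) u)\<^sup>2) = ramp u v (- x)" for x
    using ramp_as_square[OF assms(6,7), of "- x", symmetric] by (simp only: power2_minus)
  from *[OF \<open>continuous_on {-R..R} _\<close>]
  show "(\<lambda>N. \<Sum>x\<in>#S N. ramp u v (- x)) \<longlonglongrightarrow> (\<Sum>k. w k * ramp u v (- c k))"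
    by (simp only: e)
qed

text \<open>The number of eigenvalues near 1 is an integer for each matrix, hence so is its limit.\<close>
lemma power_sums_constant_imp_nat:
  fixes S :: "nat \<Rightarrow> real multiset"
  assumes S: "\<And>N x. x \<in># S N \<Longrightarrow> \<bar>x\<bar> \<le> R" and "1 \<le> R" "0 \<le> D"
    and mom: "\<And>r. 2 \<le> r \<Longrightarrow> (\<lambda>N. \<Sum>x\<in>#S N. x ^ r) \<longlonglongrightarrow> D"
  shows "D \<in> \<nat>"
proof -
  define w where "w = (\<lambda>k::nat. if k = 0 then D else 0)"
  define c where "c = (\<lambda>k::nat. if k = 0 then 1 else 0 :: real)"
  have sw: "(\<Sum>k. w k * h (c k)) = D * h 1" "summable (\<lambda>k. w k * h (c k))" for h
  proof -
    have "(\<lambda>k. w k * h (c k)) sums (w 0 * h (c 0))"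
      using sums_finite[of "{0}" "\<lambda>k. w k * h (c k)"] by (simp add: w_def)
    then show "(\<Sum>k. w k * h (c k)) = D * h 1" "summable (\<lambda>k. w k * h (c k))"
      by (auto simp: sums_iff w_def c_def)
  qed
  have R: "(\<lambda>N. \<Sum>x\<in>#S N. ramp u v x) \<longlonglongrightarrow> D" if "0 < u" "u < v" "v < 1" for u v
  proof -
    have "(\<lambda>N. \<Sum>x\<in>#S N. ramp u v x) \<longlonglongrightarrow> (\<Sum>k. w k * ramp u v (c k))"
      by (rule power_sums_imp_ramp(1)[of S R])
         (use S \<open>1 \<le> R\<close> \<open>0 \<le> D\<close> that sw[of "\<lambda>x. x\<^sup>2"] sw[of "\<lambda>x. x ^ r" for r] mom in \<open>auto simp: w_def c_def\<close>)
    then show ?thesis using that by (simp add: sw ramp_eq_1)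
  qed
  \<comment> \<open>The level 1/2 separates the limit eigenvalue 1 from 0; ramps on either side of
    it squeeze this integer count.\<close>
  define n where "n N = size (filter_mset (\<lambda>x. 1 / 2 \<le> x) (S N))" for N
  have n: "real (n N) = (\<Sum>x\<in>#S N. if 1 / 2 \<le> x then 1 else 0)" for N
  proof -
    have "real (size (filter_mset (\<lambda>x. 1 / 2 \<le> x) M)) = (\<Sum>x\<in>#M. if 1 / 2 \<le> x then 1 else 0)" for M :: "real multiset"
      by (induction M) auto
    then show ?thesis by (simp add: n_def)
  qed
  have "(\<lambda>N. real (n N)) \<longlonglongrightarrow> D"
  proof (rule tendsto_sandwich)
    show "(\<lambda>N. \<Sum>x\<in>#S N. ramp (1/2) (3/4) x) \<longlonglongrightarrow> D" "(\<lambda>N. \<Sum>x\<in>#S N. ramp (1/4) (1/2) x) \<longlonglongrightarrow> D" by (rule R; simp)+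
    have "ramp (1/2) (3/4) x \<le> (if 1 / 2 \<le> x then 1 else 0)" "(if 1 / 2 \<le> x then 1 else 0) \<le> ramp (1/4) (1/2) x" for x
      using ramp_bounds[of _ _ x] ramp_eq_0[of "1/2" "3/4" x] ramp_eq_1[of "1/4" "1/2" x] by auto
    then show "eventually (\<lambda>N. (\<Sum>x\<in>#S N. ramp (1/2) (3/4) x) \<le> real (n N)) sequentially"
      "eventually (\<lambda>N. real (n N) \<le> (\<Sum>x\<in>#S N. ramp (1/4) (1/2) x)) sequentially"
      by (auto simp: n intro!: always_eventually sum_mset_mono)
  qed
  moreover have "closed (\<nat> :: real set)" by (rule closed_Nats)
  ultimately show ?thesis
    by (rule Lim_in_closed_set[rotated 3]) auto
qed

section \<open>Ordered rearrangements and counting functions\<close>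

text \<open>A Galois correspondence between rearrangement and counting function. The supremum is
  attained because only finitely many values lie above a positive level.\<close>

lemma pos_rearr_ge_iff:
  assumes fin: "\<And>t. 0 < t \<Longrightarrow> finite {x\<in>I. t \<le> f x}" and "0 < t"
  shows "t \<le> pos_rearr I f k \<longleftrightarrow> k < card {x\<in>I. t \<le> f x}"
proof -
  let ?n = "\<lambda>t. card {x\<in>I. t \<le> f x}"
  let ?A = "{t. 0 < t \<and> (infinite {x\<in>I. t \<le> f x} \<or> k < ?n t)} \<union> {0}"
  have A: "?A = {t. 0 < t \<and> k < ?n t} \<union> {0}" using fin by blast
  have anti: "?n v \<le> ?n u" if "0 < u" "u \<le> v" for u v
    using that by (intro card_mono fin) auto
  have bdd: "bdd_above ?A"
  proof -
    define F where "F = {x\<in>I. 1 \<le> f x}"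
    have "t \<le> Max (insert 1 (f ` F))" if "t \<in> ?A" for t
    proof (cases "t \<le> 1")
      case True
      moreover have "finite F" using fin[of 1] by (simp add: F_def)
      ultimately show ?thesis by (simp add: Max_ge_iff)
    next
      case False
      with that[unfolded A] have "0 < ?n t" by auto
      then obtain x where "x \<in> I" "t \<le> f x" by (auto simp: card_gt_0_iff)
      moreover have "finite F" using fin[of 1] by (simp add: F_def)
      ultimately show ?thesis using False by (auto simp: Max_ge_iff F_def)
    qed
    then show ?thesis by (intro bdd_aboveI)
  qed
  show ?thesis
  proof
    assume "k < ?n t"
    with \<open>0 < t\<close> have "t \<in> ?A" by (auto simp: A)
    then show "t \<le> pos_rearr I f k" unfolding pos_rearr_def using bdd by (rule cSup_upper)
  next
    assume le: "t \<le> pos_rearr I f k"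
    show "k < ?n t"
    proof (rule ccontr)
      assume neg: "\<not> k < ?n t"
      define G where "G = {x\<in>I. t / 2 \<le> f x \<and> f x < t}"
      have fG: "finite G" using fin[of "t / 2"] \<open>0 < t\<close> by (auto intro: finite_subset[rotated] simp: G_def)
      \<comment> \<open>The largest value of f in [t/2, t), or t/2. The counting function is
        constant on (u, t], so a count that is too small at t keeps the supremum at or below
        u.\<close>
      define u where "u = Max (insert (t / 2) (f ` G))"
      have u: "u < t" using fG \<open>0 < t\<close> by (auto simp: u_def) (auto simp: G_def)
      have u2: "t / 2 \<le> u" unfolding u_def using fG by (intro Max_ge) auto
      have "x \<le> u" if "x \<in> ?A" for x
      proof (rule ccontr)
        assume "\<not> x \<le> u"
        have "x < t"
        proof (rule ccontr)
          assume "\<not> x < t"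
          then have "?n x \<le> ?n t" using \<open>0 < t\<close> by (intro anti) auto
          with neg that[unfolded A] \<open>0 < t\<close> \<open>\<not> x < t\<close> show False by auto
        qed
        have "{y\<in>I. x \<le> f y} = {y\<in>I. t \<le> f y}"
        proof safe
          fix y assume y: "y \<in> I" "x \<le> f y"
          show "t \<le> f y"
          proof (rule ccontr)
            assume "\<not> t \<le> f y"
            then have "y \<in> G" using y u u2 \<open>\<not> x \<le> u\<close> by (auto simp: G_def)
            then have "f y \<le> u" using fG by (auto simp: u_def)
            with y \<open>\<not> x \<le> u\<close> show False by simp
          qed
        qed (use \<open>x < t\<close> in auto)
        with neg \<open>\<not> x \<le> u\<close> u u2 \<open>0 < t\<close> that[unfolded A] show False by auto
      qed
      then have "pos_rearr I f k \<le> u" unfolding pos_rearr_def by (intro cSup_least) auto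
      with le u show False by simp
    qed
  qed
qed

lemma pos_rearr_nonneg:
  assumes fin: "\<And>t. 0 < t \<Longrightarrow> finite {x\<in>I. t \<le> f x}"
  shows "0 \<le> pos_rearr I f k"
proof (rule ccontr)
  assume "\<not> 0 \<le> pos_rearr I f k"
  moreover have "card {x\<in>I. 1 \<le> f x} \<le> k \<or> k < card {x\<in>I. 1 \<le> f x}" by linarith
  moreover have "bdd_above ({t. 0 < t \<and> (infinite {x\<in>I. t \<le> f x} \<or> k < card {x\<in>I. t \<le> f x})} \<union> {0})"
  proof -
    define F where "F = {x\<in>I. 1 \<le> f x}"
    have fF: "finite F" using fin[of 1] by (simp add: F_def)
    show ?thesis
    proof (rule bdd_aboveI)
      fix t assume "t \<in> {t. 0 < t \<and> (infinite {x\<in>I. t \<le> f x} \<or> k < card {x\<in>I. t \<le> f x})} \<union> {0}"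
      then have "t = 0 \<or> 0 < t \<and> 0 < card {x\<in>I. t \<le> f x}" using fin by auto
      then show "t \<le> Max (insert 1 (f ` F))"
      proof (elim disjE conjE)
        assume "0 < card {x\<in>I. t \<le> f x}"
        then obtain x where "x \<in> I" "t \<le> f x" by (auto simp: card_gt_0_iff)
        then show ?thesis using fF by (cases "t \<le> 1") (auto simp: Max_ge_iff F_def)
      qed (use fF in \<open>auto simp: Max_ge_iff\<close>)
    qed
  qed
  ultimately show False unfolding pos_rearr_def by (metis (no_types, lifting) UnI2 cSup_upper singletonI)
qed

text \<open>f and its rearrangement take every positive value equally often; bijections of the level
  sets are glued to one reindexing of the sum.\<close>

lemma pos_rearr_square_sum:
  assumes fin: "\<And>t. 0 < t \<Longrightarrow> finite {x\<in>I. t \<le> f x}"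
    and s: "((\<lambda>x. (f x)\<^sup>2) has_sum s) {x\<in>I. 0 < f x}"
  shows "(\<lambda>k. (pos_rearr I f k)\<^sup>2) sums s"
proof -
  define a where "a = pos_rearr I f"
  have ge: "t \<le> a k \<longleftrightarrow> k < card {x\<in>I. t \<le> f x}" if "0 < t" for t k
    unfolding a_def using fin that by (rule pos_rearr_ge_iff)
  have ca: "{k. t \<le> a k} = {..<card {x\<in>I. t \<le> f x}}" if "0 < t" for t
    using ge[OF that] by auto
  have level: "finite {x\<in>I. f x = v} \<and> finite {k. a k = v} \<and> card {x\<in>I. f x = v} = card {k. a k = v}" if "0 < v" for v
  proof -
    define F where "F = {x\<in>I. v / 2 \<le> f x}"
    have fF: "finite F" using fin[of "v / 2"] that by (simp add: F_def)
    define G where "G = {k. v / 2 \<le> a k}"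
    have fG: "finite G" using ca[of "v / 2"] that by (simp add: G_def)
    \<comment> \<open>The next value above v taken by f or by the rearrangement, or v + 1 if that is
      smaller. The level set at v is then the difference of two finite superlevel sets, whose sizes
      are known.\<close>
    define u where "u = Min (insert (v + 1) ({y \<in> f ` F \<union> a ` G. v < y}))"
    have fin': "finite {y \<in> f ` F \<union> a ` G. v < y}" using fF fG by auto
    have u: "v < u" using fin' by (auto simp: u_def)
    have gt: "u \<le> y" if "y \<in> f ` F \<union> a ` G" "v < y" for y using that fin' by (auto simp: u_def)
    have e1: "{x\<in>I. f x = v} = {x\<in>I. v \<le> f x} - {x\<in>I. u \<le> f x}"
    proof (intro equalityI subsetI)
      fix x assume "x \<in> {x\<in>I. v \<le> f x} - {x\<in>I. u \<le> f x}"
      then have x: "x \<in> I" "v \<le> f x" "f x < u" by auto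
      then have "x \<in> F" using \<open>0 < v\<close> by (auto simp: F_def)
      then have "\<not> v < f x" using gt[of "f x"] x by (meson UnI1 imageI not_le)
      then show "x \<in> {x\<in>I. f x = v}" using x by simp
    qed (use u in auto)
    have e2: "{k. a k = v} = {k. v \<le> a k} - {k. u \<le> a k}"
    proof (intro equalityI subsetI)
      fix x assume "x \<in> {k. v \<le> a k} - {k. u \<le> a k}"
      then have x: "v \<le> a x" "a x < u" by auto
      then have "x \<in> G" using \<open>0 < v\<close> by (auto simp: G_def)
      then have "\<not> v < a x" using gt[of "a x"] x by (meson UnI2 imageI not_le)
      then show "x \<in> {k. a k = v}" using x by simp
    qed (use u in auto)
    have "0 < u" using u that by simp
    have sub: "{x\<in>I. u \<le> f x} \<subseteq> {x\<in>I. v \<le> f x}" "{k. u \<le> a k} \<subseteq> {k. v \<le> a k}" using u by auto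
    have "finite {k. u \<le> a k}" unfolding ca[OF \<open>0 < u\<close>] by simp
    then have n2: "card {k. a k = v} = card {k. v \<le> a k} - card {k. u \<le> a k}"
      unfolding e2 using sub(2) by (rule card_Diff_subset)
    have n1: "card {x\<in>I. f x = v} = card {x\<in>I. v \<le> f x} - card {x\<in>I. u \<le> f x}"
      unfolding e1 using fin[OF \<open>0 < u\<close>] sub(1) by (rule card_Diff_subset)
    have "card {x\<in>I. f x = v} = card {k. a k = v}"
      unfolding n1 n2 ca[OF that] ca[OF \<open>0 < u\<close>] card_lessThan ..
    moreover have "finite {x\<in>I. f x = v}" by (rule finite_subset[OF _ fin[OF that]]) auto
    moreover have "finite {k. v \<le> a k}" unfolding ca[OF that] by simp
    then have "finite {k. a k = v}" by (rule rev_finite_subset) auto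
    ultimately show ?thesis by blast
  qed
  have "\<exists>h. bij_betw h {x\<in>I. f x = v} {k. a k = v}" if "0 < v" for v
    using level[OF that] by (intro finite_same_card_bij) auto
  then obtain h where h: "\<And>v. 0 < v \<Longrightarrow> bij_betw (h v) {x\<in>I. f x = v} {k. a k = v}" by metis
  define H where "H x = h (f x) x" for x
  have aH: "a (H x) = f x" if "x \<in> {x\<in>I. 0 < f x}" for x
    using h[of "f x"] that unfolding H_def by (auto dest!: bij_betwE)
  have "bij_betw H {x\<in>I. 0 < f x} {k. 0 < a k}"
  proof (rule bij_betw_imageI)
    show "inj_on H {x\<in>I. 0 < f x}"
    proof (rule inj_onI)
      fix x y assume xy: "x \<in> {x\<in>I. 0 < f x}" "y \<in> {x\<in>I. 0 < f x}" "H x = H y"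
      then have "f x = f y" using aH by metis
      moreover have "inj_on (h (f x)) {y\<in>I. f y = f x}" using h[of "f x"] xy(1) by (auto simp: bij_betw_def)
      ultimately show "x = y" using xy unfolding H_def by (auto intro: inj_onD)
    qed
    show "H ` {x\<in>I. 0 < f x} = {k. 0 < a k}"
    proof safe
      fix k assume k: "0 < a k"
      have "k \<in> h (a k) ` {x\<in>I. f x = a k}" unfolding bij_betw_imp_surj_on[OF h[OF k]] by simp
      then obtain x where xk: "k = h (a k) x" and xI: "x \<in> {x\<in>I. f x = a k}" by (rule imageE)
      from xI have x: "x \<in> I" "f x = a k" by simp_all
      have "x \<in> {x\<in>I. 0 < f x}" using x k by simp
      moreover have "H x = k" unfolding H_def x(2) by (rule xk[symmetric])
      ultimately show "k \<in> H ` {x\<in>I. 0 < f x}" by blast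
    next
      fix x assume "x \<in> I" "0 < f x"
      then show "0 < a (H x)" using aH[of x] by simp
    qed
  qed
  from has_sum_reindex_bij_betw[OF this, of "\<lambda>k. (a k)\<^sup>2" s]
  have "((\<lambda>k. (a k)\<^sup>2) has_sum s) {k. 0 < a k} \<longleftrightarrow> ((\<lambda>x. (a (H x))\<^sup>2) has_sum s) {x\<in>I. 0 < f x}" by simp
  also have "\<dots> \<longleftrightarrow> ((\<lambda>x. (f x)\<^sup>2) has_sum s) {x\<in>I. 0 < f x}"
    by (rule has_sum_cong) (simp add: aH)
  finally have "((\<lambda>k. (a k)\<^sup>2) has_sum s) {k. 0 < a k}" using s by simp
  also have "((\<lambda>k. (a k)\<^sup>2) has_sum s) {k. 0 < a k} \<longleftrightarrow> ((\<lambda>k. (a k)\<^sup>2) has_sum s) UNIV"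
  proof (rule has_sum_cong_neutral)
    have "0 \<le> a k" for k unfolding a_def using fin by (rule pos_rearr_nonneg)
    then have "a k = 0" if "\<not> 0 < a k" for k using that by (metis le_less)
    then show "(a k)\<^sup>2 = 0" if "k \<in> UNIV - {k. 0 < a k}" for k using that by simp
  qed auto
  finally have "((\<lambda>k. (a k)\<^sup>2) has_sum s) UNIV" .
  then show ?thesis unfolding a_def by (rule has_sum_imp_sums)
qed

text \<open>Counts are compared only across a gap u < v, since at a level that is itself a limit
  value they need not converge.\<close>

lemma pos_rearr_tendsto:
  assumes fN: "\<And>N t. 0 < t \<Longrightarrow> finite {x\<in>I N. t \<le> f N x}" and f: "\<And>t. 0 < t \<Longrightarrow> finite {x\<in>J. t \<le> g x}"
    and upper: "\<And>u v. 0 < u \<Longrightarrow> u < v \<Longrightarrow> eventually (\<lambda>N. card {x\<in>I N. v \<le> f N x} \<le> card {x\<in>J. u \<le> g x}) sequentially"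
    and lower: "\<And>u v. 0 < u \<Longrightarrow> u < v \<Longrightarrow> eventually (\<lambda>N. card {x\<in>J. v \<le> g x} \<le> card {x\<in>I N. u \<le> f N x}) sequentially"
  shows "(\<lambda>N. pos_rearr (I N) (f N) k) \<longlonglongrightarrow> pos_rearr J g k"
proof (rule order_tendstoI)
  let ?a = "pos_rearr J g k"
  have geN: "t \<le> pos_rearr (I N) (f N) k \<longleftrightarrow> k < card {x\<in>I N. t \<le> f N x}" if "0 < t" for t N
    using fN that by (rule pos_rearr_ge_iff)
  have ge: "t \<le> ?a \<longleftrightarrow> k < card {x\<in>J. t \<le> g x}" if "0 < t" for t
    using f that by (rule pos_rearr_ge_iff)
  have a0: "0 \<le> ?a" using f by (rule pos_rearr_nonneg)
  fix y assume "?a < y"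
  then have "?a < (?a + y) / 2" "(?a + y) / 2 < y" "0 < (?a + y) / 2" "0 < y" using a0 by auto
  with ge[of "(?a + y) / 2"] have "card {x\<in>J. (?a + y) / 2 \<le> g x} \<le> k" by auto
  note k = this
  show "eventually (\<lambda>N. pos_rearr (I N) (f N) k < y) sequentially"
    using upper[OF \<open>0 < (?a + y) / 2\<close> \<open>(?a + y) / 2 < y\<close>]
  proof eventually_elim
    case (elim N)
    with k have "\<not> k < card {x\<in>I N. y \<le> f N x}" by linarith
    then show ?case using geN[OF \<open>0 < y\<close>, of N] by linarith
  qed
next
  let ?a = "pos_rearr J g k"
  have geN: "t \<le> pos_rearr (I N) (f N) k \<longleftrightarrow> k < card {x\<in>I N. t \<le> f N x}" if "0 < t" for t N
    using fN that by (rule pos_rearr_ge_iff)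
  have ge: "t \<le> ?a \<longleftrightarrow> k < card {x\<in>J. t \<le> g x}" if "0 < t" for t
    using f that by (rule pos_rearr_ge_iff)
  have aN: "0 \<le> pos_rearr (I N) (f N) k" for N using fN by (rule pos_rearr_nonneg)
  fix y assume y: "y < ?a"
  show "eventually (\<lambda>N. y < pos_rearr (I N) (f N) k) sequentially"
  proof (cases "y < 0")
    case True
    then show ?thesis using aN by (intro always_eventually) (metis order_less_le_trans)
  next
    case False
    define z where "z = (y + ?a) / 2"
    have z: "y < z" "z < ?a" "0 < z" "0 < ?a" using y False by (auto simp: z_def)
    from ge[OF z(4)] have "k < card {x\<in>J. ?a \<le> g x}" by simp
    note k = this
    show ?thesis
      using lower[OF z(3,2)]
    proof eventually_elim
      case (elim N)
      with k have "z \<le> pos_rearr (I N) (f N) k" using geN[OF z(3), of N] by linarith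
      with z show ?case by linarith
    qed
  qed
qed

section \<open>Convergence of ordered spectra in the square-sum norm\<close>

text \<open>Coordinatewise convergence together with convergence of the norms gives norm
  convergence. Both halves of the spectrum are treated jointly because only the sum of their squared
  norms is known to converge.\<close>

lemma l2_convergence:
  fixes x y :: "nat \<Rightarrow> nat \<Rightarrow> real" and X Y :: "nat \<Rightarrow> real"
  assumes lim: "\<And>k. (\<lambda>N. x N k) \<longlonglongrightarrow> X k" "\<And>k. (\<lambda>N. y N k) \<longlonglongrightarrow> Y k"
    and sx: "\<And>N. (\<lambda>k. (x N k)\<^sup>2) sums sx N" and sy: "\<And>N. (\<lambda>k. (y N k)\<^sup>2) sums sy N"
    and sX: "(\<lambda>k. (X k)\<^sup>2) sums sX" and sY: "(\<lambda>k. (Y k)\<^sup>2) sums sY"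
    and norm: "(\<lambda>N. sx N + sy N) \<longlonglongrightarrow> sX + sY"
  shows "(\<lambda>N. (\<Sum>k. (x N k - X k)\<^sup>2) + (\<Sum>k. (y N k - Y k)\<^sup>2)) \<longlonglongrightarrow> 0"
proof (rule order_tendstoI)
  define p where "p N k = (x N k)\<^sup>2 + (y N k)\<^sup>2" for N k
  define P where "P k = (X k)\<^sup>2 + (Y k)\<^sup>2" for k
  define g where "g N k = (x N k - X k)\<^sup>2 + (y N k - Y k)\<^sup>2" for N k
  have sq: "(u - v)\<^sup>2 \<le> 2 * u\<^sup>2 + 2 * v\<^sup>2" for u v :: real
    using zero_le_power2[of "u + v"] by (simp add: power2_eq_square algebra_simps)
  have p: "p N sums (sx N + sy N)" for N unfolding p_def using sx sy by (rule sums_add)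
  have P: "P sums (sX + sY)" unfolding P_def using sX sY by (rule sums_add)
  have smx: "summable (\<lambda>k. (x N k - X k)\<^sup>2)" for N
  proof -
    have "summable (\<lambda>k. (x N k)\<^sup>2)" "summable (\<lambda>k. (X k)\<^sup>2)" using sx[of N] sX by (auto simp: sums_iff)
    from summable_add[OF summable_mult[OF this(1), of 2] summable_mult[OF this(2), of 2]]
    show ?thesis by (rule summable_comparison_test') (use sq in auto)
  qed
  have smy: "summable (\<lambda>k. (y N k - Y k)\<^sup>2)" for N
  proof -
    have "summable (\<lambda>k. (y N k)\<^sup>2)" "summable (\<lambda>k. (Y k)\<^sup>2)" using sy[of N] sY by (auto simp: sums_iff)
    from summable_add[OF summable_mult[OF this(1), of 2] summable_mult[OF this(2), of 2]]
    show ?thesis by (rule summable_comparison_test') (use sq in auto)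
  qed
  have g: "g N sums ((\<Sum>k. (x N k - X k)\<^sup>2) + (\<Sum>k. (y N k - Y k)\<^sup>2))" for N
    unfolding g_def using smx[of N] smy[of N] by (intro sums_add) (auto simp: summable_sums)
  have gle: "g N k \<le> 2 * p N k + 2 * P k" for N k
    using sq[of "x N k" "X k"] sq[of "y N k" "Y k"] by (simp add: g_def p_def P_def)
  fix e :: real
  {
    assume "e < 0"
    moreover have "0 \<le> (\<Sum>k. (x N k - X k)\<^sup>2) + (\<Sum>k. (y N k - Y k)\<^sup>2)" for N
      using smx[of N] smy[of N] by (intro add_nonneg_nonneg suminf_nonneg) auto
    ultimately have "e < (\<Sum>k. (x N k - X k)\<^sup>2) + (\<Sum>k. (y N k - Y k)\<^sup>2)" for N
      by (rule order_less_le_trans)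
    then show "eventually (\<lambda>N. e < (\<Sum>k. (x N k - X k)\<^sup>2) + (\<Sum>k. (y N k - Y k)\<^sup>2)) sequentially"
      by (intro always_eventually allI)
  }
  assume "0 < e"
  have "(\<lambda>K. \<Sum>k<K. P k) \<longlonglongrightarrow> sX + sY" using P by (simp add: sums_def)
  then have "eventually (\<lambda>K. sX + sY - e / 4 < (\<Sum>k<K. P k)) sequentially" using \<open>0 < e\<close> by (intro order_tendstoD(1)) auto
  then obtain K where K: "sX + sY - e / 4 < (\<Sum>k<K. P k)" by (auto dest: eventually_happens)
  \<comment> \<open>The first K terms plus a tail estimated by (u - v)^2 \<le> 2 u^2 + 2 v^2. In the
    limit four times the tail of P remains, which is below e by the choice of K.\<close>
  define U where "U N = (\<Sum>k<K. g N k) + 2 * (sx N + sy N - (\<Sum>k<K. p N k)) + 2 * (sX + sY - (\<Sum>k<K. P k))" for N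
  have "U \<longlonglongrightarrow> (\<Sum>k<K. (X k - X k)\<^sup>2 + (Y k - Y k)\<^sup>2) + 2 * (sX + sY - (\<Sum>k<K. P k)) + 2 * (sX + sY - (\<Sum>k<K. P k))"
    unfolding U_def g_def p_def P_def by (intro tendsto_intros lim norm)
  then have "eventually (\<lambda>N. U N < e) sequentially" using K by (intro order_tendstoD(2)) auto
  then show "eventually (\<lambda>N. (\<Sum>k. (x N k - X k)\<^sup>2) + (\<Sum>k. (y N k - Y k)\<^sup>2) < e) sequentially"
  proof eventually_elim
    case (elim N)
    have tail: "(\<lambda>k. f (k + K)) sums (s - (\<Sum>k<K. f k))" if "f sums s" for f :: "nat \<Rightarrow> real" and s
      using sums_split_initial_segment[OF that, of K] .
    have "(\<Sum>k. (x N k - X k)\<^sup>2) + (\<Sum>k. (y N k - Y k)\<^sup>2) - (\<Sum>k<K. g N k)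
        \<le> 2 * (sx N + sy N - (\<Sum>k<K. p N k)) + 2 * (sX + sY - (\<Sum>k<K. P k))"
      by (rule sums_le[OF _ tail[OF g] sums_add[OF sums_mult[OF tail[OF p]] sums_mult[OF tail[OF P]]]]) (rule gle)
    with elim show ?case by (simp add: U_def)
  qed
qed

section \<open>Spectra as indexed families\<close>

lemma sum_mset_as_count_sum:
  fixes h :: "real \<Rightarrow> real"
  assumes "finite A" "set_mset S \<subseteq> A"
  shows "(\<Sum>x\<in>#S. h x) = (\<Sum>x\<in>A. real (count S x) * h x)"
  using assms(2)
proof (induction S)
  case (add y S)
  have "(\<Sum>x\<in>A. real (count (add_mset y S) x) * h x) = (\<Sum>x\<in>A. real (count S x) * h x + (if x = y then h y else 0))"
    by (intro sum.cong) (auto simp: algebra_simps)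
  also have "\<dots> = (\<Sum>x\<in>A. real (count S x) * h x) + h y"
    using add.prems assms(1) by (simp add: sum.distrib)
  finally show ?case using add by simp
qed simp

lemma mset_index_Sigma: "mset_index S = Sigma (set_mset S) (\<lambda>x. {..<count S x})"
  by (auto simp: mset_index_def) (metis count_greater_zero_iff gr_zeroI not_less_zero)

lemma finite_mset_index [simp]: "finite (mset_index S)"
  by (simp add: mset_index_Sigma)

lemma sum_mset_index:
  fixes h :: "real \<Rightarrow> real"
  shows "(\<Sum>p\<in>mset_index S. h (fst p)) = (\<Sum>x\<in>#S. h x)"
proof -
  have "(\<Sum>p\<in>mset_index S. h (fst p)) = (\<Sum>x\<in>set_mset S. \<Sum>j<count S x. h x)"
    unfolding mset_index_Sigma by (subst sum.Sigma) (auto simp: case_prod_unfold)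
  then show ?thesis by (simp add: sum_mset_as_count_sum[OF finite_set_mset subset_refl])
qed

lemma card_mset_index: "real (card {p\<in>mset_index S. Q (fst p)}) = (\<Sum>x\<in>#S. if Q x then 1 else 0)"
proof -
  have "real (card {p\<in>mset_index S. Q (fst p)}) = (\<Sum>p\<in>mset_index S. if Q (fst p) then 1 else 0)"
    by (subst sum.inter_filter[symmetric]) auto
  also have "\<dots> = (\<Sum>x\<in>#S. if Q x then 1 else 0)"
    using sum_mset_index[of "\<lambda>x. if Q x then 1 else 0"] .
  finally show ?thesis .
qed

lemma neg_rearr_eq: "neg_rearr I f k = - pos_rearr I (\<lambda>x. - f x) k"
  by (simp add: neg_rearr_def pos_rearr_def le_minus_iff)

lemma lim_index_count:
  fixes m :: "nat \<Rightarrow> nat" and c :: "nat \<Rightarrow> real"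
  assumes fin: "finite {k. u \<le> c k}"
  shows "finite {p\<in>lim_index (\<lambda>k. real (m k)). u \<le> (\<lambda>(k, j). c k) p}"
    and "card {p\<in>lim_index (\<lambda>k. real (m k)). u \<le> (\<lambda>(k, j). c k) p} = (\<Sum>k | u \<le> c k. m k)"
proof -
  have "{p\<in>lim_index (\<lambda>k. real (m k)). u \<le> (\<lambda>(k, j). c k) p} = Sigma {k. u \<le> c k} (\<lambda>k. {..<m k})"
    by (auto simp: lim_index_def)
  then show "finite {p\<in>lim_index (\<lambda>k. real (m k)). u \<le> (\<lambda>(k, j). c k) p}"
    "card {p\<in>lim_index (\<lambda>k. real (m k)). u \<le> (\<lambda>(k, j). c k) p} = (\<Sum>k | u \<le> c k. m k)"
    using fin by auto
qed

lemma ramp_sum_bounds: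
  fixes m :: "nat \<Rightarrow> nat" and c :: "nat \<Rightarrow> real"
  assumes fin: "finite {k. u \<le> c k}" and uv: "u < v"
  shows "(\<Sum>k. real (m k) * ramp u v (c k)) \<le> real (\<Sum>k | u \<le> c k. m k)"
    and "real (\<Sum>k | v \<le> c k. m k) \<le> (\<Sum>k. real (m k) * ramp u v (c k))"
proof -
  have e: "(\<Sum>k. real (m k) * ramp u v (c k)) = (\<Sum>k | u \<le> c k. real (m k) * ramp u v (c k))"
    using fin uv by (intro suminf_finite) (auto simp: ramp_eq_0)
  show "(\<Sum>k. real (m k) * ramp u v (c k)) \<le> real (\<Sum>k | u \<le> c k. m k)"
    unfolding e of_nat_sum by (intro sum_mono mult_left_le ramp_bounds) auto
  have "real (\<Sum>k | v \<le> c k. m k) = (\<Sum>k | v \<le> c k. real (m k) * ramp u v (c k))"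
    using uv by (simp add: ramp_eq_1)
  also have "\<dots> \<le> (\<Sum>k | u \<le> c k. real (m k) * ramp u v (c k))"
    using uv fin by (intro sum_mono2) (auto simp: ramp_bounds)
  finally show "real (\<Sum>k | v \<le> c k. m k) \<le> (\<Sum>k. real (m k) * ramp u v (c k))" by (simp add: e)
qed

lemma rearr_square_sums:
  assumes s: "((\<lambda>x. (f x)\<^sup>2) has_sum s) I" and fin: "\<And>t. 0 < t \<Longrightarrow> finite {x\<in>I. t \<le> f x}"
    "\<And>t. 0 < t \<Longrightarrow> finite {x\<in>I. t \<le> - f x}"
  shows "\<exists>u v. (\<lambda>k. (pos_rearr I f k)\<^sup>2) sums u \<and> (\<lambda>k. (neg_rearr I f k)\<^sup>2) sums v \<and> u + v = s"
proof -
  have sm: "(\<lambda>x. (f x)\<^sup>2) summable_on I" using s by (auto simp: summable_on_def)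
  define u where "u = infsum (\<lambda>x. (f x)\<^sup>2) {x\<in>I. 0 < f x}"
  define v where "v = infsum (\<lambda>x. (f x)\<^sup>2) {x\<in>I. 0 < - f x}"
  have u: "((\<lambda>x. (f x)\<^sup>2) has_sum u) {x\<in>I. 0 < f x}"
    unfolding u_def by (intro has_sum_infsum summable_on_subset[OF sm]) auto
  have v: "((\<lambda>x. (f x)\<^sup>2) has_sum v) {x\<in>I. 0 < - f x}"
    unfolding v_def by (intro has_sum_infsum summable_on_subset[OF sm]) auto
  have "((\<lambda>x. (f x)\<^sup>2) has_sum (u + v)) ({x\<in>I. 0 < f x} \<union> {x\<in>I. 0 < - f x})"
    by (rule has_sum_Un_disjoint[OF u v]) auto
  also have "((\<lambda>x. (f x)\<^sup>2) has_sum (u + v)) ({x\<in>I. 0 < f x} \<union> {x\<in>I. 0 < - f x}) \<longleftrightarrow> ((\<lambda>x. (f x)\<^sup>2) has_sum (u + v)) I"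
    by (rule has_sum_cong_neutral) auto
  finally have "u + v = s" using s by (rule has_sum_unique)
  moreover have "(\<lambda>k. (pos_rearr I f k)\<^sup>2) sums u" using fin(1) u by (rule pos_rearr_square_sum)
  moreover have "(\<lambda>k. (pos_rearr I (\<lambda>x. - f x) k)\<^sup>2) sums v"
    by (intro pos_rearr_square_sum fin(2)) (simp_all only: power2_minus v)
  ultimately show ?thesis by (auto simp: neg_rearr_eq)
qed

text \<open>Ramps yield the counting inequalities for both signs, hence convergence of every ordered
  eigenvalue; the power sum of order 2 yields convergence of the norms.\<close>

theorem power_sums_imp_gk_to_limit:
  fixes S :: "nat \<Rightarrow> real multiset" and c :: "nat \<Rightarrow> real" and m :: "nat \<Rightarrow> nat"
  assumes S: "\<And>N x. x \<in># S N \<Longrightarrow> \<bar>x\<bar> \<le> R" and c: "\<And>k. \<bar>c k\<bar> \<le> R" and m: "\<And>k. 1 \<le> m k"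
    and sm: "summable (\<lambda>k. real (m k) * (c k)\<^sup>2)"
    and mom: "\<And>r. 2 \<le> r \<Longrightarrow> (\<lambda>N. \<Sum>x\<in>#S N. x ^ r) \<longlonglongrightarrow> (\<Sum>k. real (m k) * c k ^ r)"
  shows "(\<lambda>N. gk_to_limit (S N) c (\<lambda>k. real (m k))) \<longlonglongrightarrow> 0"
proof -
  let ?J = "lim_index (\<lambda>k. real (m k))" and ?g = "\<lambda>(k, j). c k :: real"
  let ?I = "\<lambda>N. mset_index (S N)"
  \<comment> \<open>Multiplicities are at least 1, so summability of the weighted squares leaves
    finitely many values above any positive level.\<close>
  have fabs: "finite {k. u \<le> \<bar>c k\<bar>}" if "0 < u" for u
  proof -
    have "(\<lambda>k. real (m k) * (c k)\<^sup>2) \<longlonglongrightarrow> 0" using sm by (rule summable_LIMSEQ_zero)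
    then have "eventually (\<lambda>k. real (m k) * (c k)\<^sup>2 < u\<^sup>2) sequentially" using that by (intro order_tendstoD(2)) auto
    then have "eventually (\<lambda>k. \<bar>c k\<bar> < u) sequentially"
    proof eventually_elim
      case (elim k)
      have "1 * (c k)\<^sup>2 \<le> real (m k) * (c k)\<^sup>2" using m[of k] by (intro mult_right_mono) auto
      with elim have "\<bar>c k\<bar>\<^sup>2 < u\<^sup>2" by simp
      then show ?case using that by (intro power_less_imp_less_base[of "\<bar>c k\<bar>" 2 u]) auto
    qed
    then obtain K where K: "\<forall>k\<ge>K. \<bar>c k\<bar> < u" by (auto simp: eventually_sequentially)
    have "{k. u \<le> \<bar>c k\<bar>} \<subseteq> {..<K}"
    proof
      fix k assume "k \<in> {k. u \<le> \<bar>c k\<bar>}"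
      then show "k \<in> {..<K}" using K[rule_format, of k] by (cases "K \<le> k") auto
    qed
    then show ?thesis by (rule finite_subset) simp
  qed
  have fc: "finite {k. u \<le> c k}" "finite {k. u \<le> - c k}" if "0 < u" for u
    by (rule finite_subset[OF _ fabs[OF that]]; auto)+
  have g': "- ?g p = (\<lambda>(k, j). - c k) p" for p by (simp add: case_prod_unfold)
  have fg: "finite {p\<in>?J. u \<le> ?g p}" "finite {p\<in>?J. u \<le> - ?g p}" if "0 < u" for u
    unfolding g' by (intro lim_index_count(1) fc that)+
  have w0: "0 \<le> real (m k)" for k by simp
  \<comment> \<open>To be used with h the identity and with h the negation, for the two halves of
    the spectrum.\<close>
  have one: "(\<lambda>N. pos_rearr (?I N) (\<lambda>p. h (fst p)) k) \<longlonglongrightarrow> pos_rearr ?J (\<lambda>(k, j). h (c k)) k"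
    if R: "\<And>u v. 0 < u \<Longrightarrow> u < v \<Longrightarrow> (\<lambda>N. \<Sum>x\<in>#S N. ramp u v (h x)) \<longlonglongrightarrow> (\<Sum>k. real (m k) * ramp u v (h (c k)))"
      and F: "\<And>u. 0 < u \<Longrightarrow> finite {k. u \<le> h (c k)}" for h :: "real \<Rightarrow> real" and k
  proof (rule pos_rearr_tendsto)
    have N1: "real (card {p\<in>?I N. v \<le> h (fst p)}) \<le> (\<Sum>x\<in>#S N. ramp u v (h x))" if "u < v" for u v N
      unfolding card_mset_index[where Q = "\<lambda>x. v \<le> h x"] using that
      by (intro sum_mset_mono) (auto simp: ramp_bounds ramp_eq_1)
    have N2: "(\<Sum>x\<in>#S N. ramp u v (h x)) \<le> real (card {p\<in>?I N. u \<le> h (fst p)})" if "u < v" for u v N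
      unfolding card_mset_index[where Q = "\<lambda>x. u \<le> h x"] using that
      by (intro sum_mset_mono) (auto simp: ramp_bounds ramp_eq_0)
    show "finite {p\<in>?I N. t \<le> h (fst p)}" for N t by simp
    show "finite {p\<in>?J. t \<le> (\<lambda>(k, j). h (c k)) p}" if "0 < t" for t
      by (rule lim_index_count(1)[OF F[OF that]])
    fix u v :: real assume uv: "0 < u" "u < v"
    then have "0 < v" by simp
    \<comment> \<open>Counts are integers, so a strict inequality against a count plus 1 becomes the
      non-strict one.\<close>
    have "(\<Sum>k. real (m k) * ramp u v (h (c k))) < real (\<Sum>k | u \<le> h (c k). m k) + 1"
      using ramp_sum_bounds(1)[OF F[OF uv(1)] uv(2), of m] by linarith
    from order_tendstoD(2)[OF R[OF uv] this]
    show "eventually (\<lambda>N. card {p\<in>?I N. v \<le> h (fst p)} \<le> card {p\<in>?J. u \<le> (\<lambda>(k, j). h (c k)) p}) sequentially"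
    proof eventually_elim
      case (elim N)
      with N1[OF uv(2), of N] show ?case unfolding lim_index_count(2)[OF F[OF uv(1)]] by linarith
    qed
    have "real (\<Sum>k | v \<le> h (c k). m k) - 1 < (\<Sum>k. real (m k) * ramp u v (h (c k)))"
      using ramp_sum_bounds(2)[OF F[OF uv(1)] uv(2), of m] by linarith
    from order_tendstoD(1)[OF R[OF uv] this]
    show "eventually (\<lambda>N. card {p\<in>?J. v \<le> (\<lambda>(k, j). h (c k)) p} \<le> card {p\<in>?I N. u \<le> h (fst p)}) sequentially"
    proof eventually_elim
      case (elim N)
      with N2[OF uv(2), of N] show ?case unfolding lim_index_count(2)[OF F[OF \<open>0 < v\<close>]] by linarith
    qed
  qed
  have rp: "(\<lambda>N. \<Sum>x\<in>#S N. ramp u v x) \<longlonglongrightarrow> (\<Sum>k. real (m k) * ramp u v (c k))"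
    "(\<lambda>N. \<Sum>x\<in>#S N. ramp u v (- x)) \<longlonglongrightarrow> (\<Sum>k. real (m k) * ramp u v (- c k))" if "0 < u" "u < v" for u v
    by (rule power_sums_imp_ramp[of S R c]; use S c sm mom that in auto)+
  have lp: "(\<lambda>N. pos_rearr (?I N) fst k) \<longlonglongrightarrow> pos_rearr ?J ?g k" for k
    by (rule one[of "\<lambda>x. x" k]) (rule rp(1) fc(1); assumption)+
  have ln: "(\<lambda>N. neg_rearr (?I N) fst k) \<longlonglongrightarrow> neg_rearr ?J ?g k" for k
    unfolding neg_rearr_eq g' by (intro tendsto_minus one) (rule rp(2) fc(2); assumption)+
  have sJ: "((\<lambda>p. (?g p)\<^sup>2) has_sum (\<Sum>k. real (m k) * (c k)\<^sup>2)) ?J"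
  proof -
    have J: "?J = Sigma UNIV (\<lambda>k. {..<m k})" by (auto simp: lim_index_def)
    have in1: "((\<lambda>j. (?g (k, j))\<^sup>2) has_sum real (m k) * (c k)\<^sup>2) {..<m k}" for k
      by (rule has_sum_finiteI) auto
    have o1: "((\<lambda>k. real (m k) * (c k)\<^sup>2) has_sum (\<Sum>k. real (m k) * (c k)\<^sup>2)) UNIV"
      using sm by (intro sums_nonneg_imp_has_sum) (auto simp: summable_sums)
    show ?thesis unfolding J
    proof (rule has_sum_SigmaI[OF in1 o1])
      show "(\<lambda>p. (?g p)\<^sup>2) summable_on Sigma UNIV (\<lambda>k. {..<m k})"
        by (rule summable_on_SigmaI[OF in1]) (use o1 in \<open>auto simp: summable_on_def\<close>)
    qed
  qed
  from rearr_square_sums[OF this fg] obtain sX sY where sXY: "(\<lambda>k. (pos_rearr ?J ?g k)\<^sup>2) sums sX" "(\<lambda>k. (neg_rearr ?J ?g k)\<^sup>2) sums sY"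
    "sX + sY = (\<Sum>k. real (m k) * (c k)\<^sup>2)" by blast
  have ex: "\<exists>u v. (\<lambda>k. (pos_rearr (?I N) fst k)\<^sup>2) sums u \<and> (\<lambda>k. (neg_rearr (?I N) fst k)\<^sup>2) sums v \<and> u + v = (\<Sum>x\<in>#S N. x ^ 2)" for N
    by (rule rearr_square_sums) (auto intro!: has_sum_finiteI simp: sum_mset_index[of power2])
  define sx where "sx N = (\<Sum>k. (pos_rearr (?I N) fst k)\<^sup>2)" for N
  define sy where "sy N = (\<Sum>k. (neg_rearr (?I N) fst k)\<^sup>2)" for N
  have sxy: "(\<lambda>k. (pos_rearr (?I N) fst k)\<^sup>2) sums sx N" "(\<lambda>k. (neg_rearr (?I N) fst k)\<^sup>2) sums sy N"
    "sx N + sy N = (\<Sum>x\<in>#S N. x ^ 2)" for N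
    using ex[of N] unfolding sx_def sy_def by (auto simp: sums_iff)
  have "(\<lambda>N. sx N + sy N) \<longlonglongrightarrow> sX + sY" unfolding sxy(3) sXY(3) by (rule mom) simp
  from l2_convergence[OF lp ln sxy(1,2) sXY(1,2) this]
  have "(\<lambda>N. sqrt ((\<Sum>k. (pos_rearr (?I N) fst k - pos_rearr ?J ?g k)\<^sup>2) + (\<Sum>k. (neg_rearr (?I N) fst k - neg_rearr ?J ?g k)\<^sup>2))) \<longlonglongrightarrow> sqrt 0"
    by (rule tendsto_real_sqrt)
  then show ?thesis by (simp add: gk_to_limit_def gk_dist_def)
qed

section \<open>Frobenius norm estimates\<close>

definition frob :: "nat \<Rightarrow> (nat \<Rightarrow> nat \<Rightarrow> real) \<Rightarrow> real" where
  "frob N f = L2_set (\<lambda>(i, j). f i j) ({..<N} \<times> {..<N})"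

definition fmult :: "nat \<Rightarrow> (nat \<Rightarrow> nat \<Rightarrow> real) \<Rightarrow> (nat \<Rightarrow> nat \<Rightarrow> real) \<Rightarrow> nat \<Rightarrow> nat \<Rightarrow> real" where
  "fmult N f g = (\<lambda>i j. \<Sum>k<N. f i k * g k j)"

lemma frob_nonneg [simp]: "0 \<le> frob N f"
  by (simp add: frob_def L2_set_nonneg)

lemma frob_square: "(frob N f)\<^sup>2 = (\<Sum>i<N. \<Sum>j<N. (f i j)\<^sup>2)"
  by (simp add: frob_def L2_set_def sum_nonneg sum.cartesian_product case_prod_unfold)

lemma frob_le_iff: "0 \<le> c \<Longrightarrow> frob N f \<le> c \<longleftrightarrow> (\<Sum>i<N. \<Sum>j<N. (f i j)\<^sup>2) \<le> c\<^sup>2"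
  unfolding frob_square[symmetric] using abs_le_square_iff[of "frob N f" c] by simp

lemma frob_triangle: "frob N (\<lambda>i j. f i j + g i j) \<le> frob N f + frob N g"
  using L2_set_triangle_ineq[of "\<lambda>(i, j). f i j" "\<lambda>(i, j). g i j" "{..<N} \<times> {..<N}"]
  by (simp add: frob_def case_prod_unfold)

lemma frob_inner: "\<bar>\<Sum>i<N. \<Sum>j<N. f i j * g i j\<bar> \<le> frob N f * frob N g"
proof -
  have "\<bar>\<Sum>i<N. \<Sum>j<N. f i j * g i j\<bar> \<le> (\<Sum>p\<in>{..<N} \<times> {..<N}. \<bar>(\<lambda>(i, j). f i j) p\<bar> * \<bar>(\<lambda>(i, j). g i j) p\<bar>)"
    unfolding sum.cartesian_product by (rule order_trans[OF sum_abs]) (simp add: abs_mult case_prod_unfold)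
  also have "\<dots> \<le> frob N f * frob N g" unfolding frob_def by (rule L2_set_mult_ineq)
  finally show ?thesis .
qed

lemma frob_transpose: "frob N (\<lambda>i j. f j i) = frob N f"
proof -
  have "(frob N (\<lambda>i j. f j i))\<^sup>2 = (frob N f)\<^sup>2" unfolding frob_square by (rule sum.swap)
  then show ?thesis by (simp add: power2_eq_iff_nonneg)
qed

lemma frob_fmult: "frob N (fmult N f g) \<le> frob N f * frob N g"
proof -
  have cs: "(\<Sum>k<N. f i k * g k j)\<^sup>2 \<le> (\<Sum>k<N. (f i k)\<^sup>2) * (\<Sum>k<N. (g k j)\<^sup>2)" for i j
  proof -
    have "\<bar>\<Sum>k<N. f i k * g k j\<bar> \<le> (\<Sum>k<N. \<bar>f i k\<bar> * \<bar>g k j\<bar>)"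
      by (rule order_trans[OF sum_abs]) (simp add: abs_mult)
    also have "\<dots> \<le> L2_set (\<lambda>k. f i k) {..<N} * L2_set (\<lambda>k. g k j) {..<N}" by (rule L2_set_mult_ineq)
    finally have "\<bar>\<Sum>k<N. f i k * g k j\<bar>\<^sup>2 \<le> (L2_set (\<lambda>k. f i k) {..<N} * L2_set (\<lambda>k. g k j) {..<N})\<^sup>2"
      by (rule power_mono) simp
    then show ?thesis by (simp add: L2_set_def power_mult_distrib sum_nonneg)
  qed
  have "(frob N (fmult N f g))\<^sup>2 \<le> (\<Sum>i<N. \<Sum>j<N. (\<Sum>k<N. (f i k)\<^sup>2) * (\<Sum>k<N. (g k j)\<^sup>2))"
    unfolding frob_square fmult_def by (intro sum_mono cs)
  also have "\<dots> = (\<Sum>i<N. \<Sum>k<N. (f i k)\<^sup>2) * (\<Sum>j<N. \<Sum>k<N. (g k j)\<^sup>2)" by (simp add: sum_product)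
  also have "(\<Sum>j<N. \<Sum>k<N. (g k j)\<^sup>2) = (\<Sum>k<N. \<Sum>j<N. (g k j)\<^sup>2)" by (rule sum.swap)
  finally have "(frob N (fmult N f g))\<^sup>2 \<le> (frob N f * frob N g)\<^sup>2"
    unfolding frob_square power_mult_distrib .
  then show ?thesis by (rule power2_le_imp_le) simp
qed

lemma fpow_Suc_fmult: "fpow N f (Suc r) = fmult N (fpow N f r) f"
  by (simp add: fmult_def)

declare fpow.simps(2) [simp del]

lemma frob_cong: "(\<And>i j. i < N \<Longrightarrow> j < N \<Longrightarrow> f i j = g i j) \<Longrightarrow> frob N f = frob N g"
  unfolding frob_def by (intro L2_set_cong) auto

lemma fpow_1: "j < N \<Longrightarrow> fpow N f (Suc 0) i j = f i j" if "i < N"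
  using that by (simp add: fpow.simps if_distrib if_distribR cong: if_cong)

lemma frob_fpow_le:
  assumes "frob N f \<le> M" "0 \<le> M"
  shows "frob N (fpow N f (Suc r)) \<le> M ^ Suc r"
proof (induction r)
  case 0
  have "frob N (fpow N f (Suc 0)) = frob N f" by (rule frob_cong) (rule fpow_1)
  then show ?case using assms by simp
next
  case (Suc r)
  have "frob N (fpow N f (Suc (Suc r))) \<le> frob N (fpow N f (Suc r)) * frob N f"
    unfolding fpow_Suc_fmult[of N f "Suc r"] by (rule frob_fmult)
  also have "\<dots> \<le> M ^ Suc r * M" using Suc assms by (intro mult_mono) auto
  finally show ?case by (simp only: power_Suc mult_ac)
qed

text \<open>Telescoping: f^(r+2) - g^(r+2) = (f^(r+1) - g^(r+1)) f + g^(r+1) (f - g).\<close>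

lemma frob_fpow_diff:
  assumes f: "frob N f \<le> M" and g: "frob N g \<le> M" and M: "1 \<le> M"
  shows "frob N (\<lambda>i j. fpow N f (Suc r) i j - fpow N g (Suc r) i j) \<le> real (Suc r) * M ^ r * frob N (\<lambda>i j. f i j - g i j)"
proof (induction r)
  case 0
  have "frob N (\<lambda>i j. fpow N f (Suc 0) i j - fpow N g (Suc 0) i j) = frob N (\<lambda>i j. f i j - g i j)"
    by (rule frob_cong) (simp only: fpow_1)
  then show ?case by simp
next
  case (Suc r)
  let ?E = "frob N (\<lambda>i j. f i j - g i j)"
  let ?F = "fpow N f (Suc r)" and ?G = "fpow N g (Suc r)"
  have "frob N (\<lambda>i j. fpow N f (Suc (Suc r)) i j - fpow N g (Suc (Suc r)) i j)
     = frob N (\<lambda>i j. fmult N (\<lambda>i j. ?F i j - ?G i j) f i j + fmult N ?G (\<lambda>i j. f i j - g i j) i j)"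
    unfolding fpow_Suc_fmult[of N _ "Suc r"] fmult_def
    by (intro frob_cong) (simp add: sum_subtractf[symmetric] sum.distrib[symmetric] algebra_simps del: fpow.simps)
  also have "\<dots> \<le> frob N (\<lambda>i j. ?F i j - ?G i j) * frob N f + frob N ?G * ?E"
    by (intro order_trans[OF frob_triangle] add_mono frob_fmult)
  also have "\<dots> \<le> (real (Suc r) * M ^ r * ?E) * M + M ^ Suc r * ?E"
    using Suc f g M frob_fpow_le[OF g, of r] by (intro add_mono mult_mono) auto
  also have "\<dots> = real (Suc (Suc r)) * M ^ Suc r * ?E" by (simp add: algebra_simps)
  finally show ?case .
qed

text \<open>The trace of f^(r+2) pairs f^(r+1) with the transpose of f in the Frobenius inner
  product, which takes at least two factors. A single trace is not bounded by the Frobenius norm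
  uniformly in N.\<close>

lemma trace_fpow_diff:
  assumes f: "frob N f \<le> M" and g: "frob N g \<le> M" and M: "1 \<le> M"
  shows "\<bar>(\<Sum>i<N. fpow N f (Suc (Suc r)) i i) - (\<Sum>i<N. fpow N g (Suc (Suc r)) i i)\<bar>
    \<le> real (Suc (Suc r)) * M ^ Suc r * frob N (\<lambda>i j. f i j - g i j)"
proof -
  let ?E = "frob N (\<lambda>i j. f i j - g i j)"
  let ?F = "fpow N f (Suc r)" and ?G = "fpow N g (Suc r)"
  have eq: "(\<Sum>i<N. fpow N f (Suc (Suc r)) i i) - (\<Sum>i<N. fpow N g (Suc (Suc r)) i i)
     = (\<Sum>i<N. \<Sum>k<N. (?F i k - ?G i k) * f k i) + (\<Sum>i<N. \<Sum>k<N. ?G i k * (f k i - g k i))"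
    unfolding fpow_Suc_fmult[of N _ "Suc r"] fmult_def
    by (simp add: sum_subtractf[symmetric] sum.distrib[symmetric] algebra_simps del: fpow.simps)
  have "\<bar>(\<Sum>i<N. fpow N f (Suc (Suc r)) i i) - (\<Sum>i<N. fpow N g (Suc (Suc r)) i i)\<bar> \<le> frob N (\<lambda>i j. ?F i j - ?G i j) * frob N (\<lambda>i j. f j i) + frob N ?G * frob N (\<lambda>i j. f j i - g j i)"
    unfolding eq
    using frob_inner[where N = N and f = "\<lambda>i j. ?F i j - ?G i j" and g = "\<lambda>i j. f j i"]
      frob_inner[where N = N and f = ?G and g = "\<lambda>i j. f j i - g j i"] by linarith
  also have "\<dots> = frob N (\<lambda>i j. ?F i j - ?G i j) * frob N f + frob N ?G * ?E"
    by (intro arg_cong2[where f = "(+)"] arg_cong2[where f = times] refl frob_transpose)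
  also have "\<dots> \<le> (real (Suc r) * M ^ r * ?E) * M + M ^ Suc r * ?E"
    using f g M frob_fpow_le[OF g, of r] frob_fpow_diff[OF f g M, of r] by (intro add_mono mult_mono) auto
  also have "\<dots> = real (Suc (Suc r)) * M ^ Suc r * ?E" by (simp add: algebra_simps)
  finally show ?thesis .
qed

text \<open>The right side keeps two small factors, so that after weighting by multiplicities it is
  summable as soon as the weighted squares are.\<close>

lemma power_diff_bound:
  fixes c e :: real
  assumes "\<bar>c\<bar> \<le> 2" "\<bar>e\<bar> \<le> 2"
  shows "\<bar>c ^ (r + 2) - e ^ (r + 2)\<bar> \<le> real (r + 2) * 2 ^ (r + 2) * (\<bar>c - e\<bar> * (\<bar>c\<bar> + \<bar>e\<bar>))"
proof (induction r)
  case 0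
  have "\<bar>c ^ 2 - e ^ 2\<bar> = \<bar>c - e\<bar> * \<bar>c + e\<bar>" by (simp add: abs_mult[symmetric] power2_eq_square algebra_simps)
  also have "\<dots> \<le> \<bar>c - e\<bar> * (\<bar>c\<bar> + \<bar>e\<bar>)" by (intro mult_left_mono) auto
  finally have "\<bar>c ^ 2 - e ^ 2\<bar> \<le> \<bar>c - e\<bar> * (\<bar>c\<bar> + \<bar>e\<bar>)" .
  moreover have "0 \<le> \<bar>c - e\<bar> * (\<bar>c\<bar> + \<bar>e\<bar>)" by simp
  ultimately have "\<bar>c ^ 2 - e ^ 2\<bar> \<le> 8 * (\<bar>c - e\<bar> * (\<bar>c\<bar> + \<bar>e\<bar>))" by linarith
  then show ?case by (simp add: power2_eq_square)
next
  case (Suc r)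
  let ?q = "\<bar>c - e\<bar> * (\<bar>c\<bar> + \<bar>e\<bar>)"
  have "\<bar>c ^ (Suc r + 2) - e ^ (Suc r + 2)\<bar> = \<bar>c * (c ^ (r + 2) - e ^ (r + 2)) + (c - e) * e ^ (r + 2)\<bar>"
    by (simp add: algebra_simps)
  also have "\<dots> \<le> \<bar>c\<bar> * \<bar>c ^ (r + 2) - e ^ (r + 2)\<bar> + \<bar>c - e\<bar> * \<bar>e ^ (r + 2)\<bar>"
    by (rule order_trans[OF abs_triangle_ineq]) (simp add: abs_mult)
  also have "\<dots> \<le> 2 * (real (r + 2) * 2 ^ (r + 2) * ?q) + \<bar>c - e\<bar> * (2 ^ (r + 1) * (\<bar>c\<bar> + \<bar>e\<bar>))"
  proof (intro add_mono mult_mono Suc assms)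
    have "\<bar>e ^ (r + 2)\<bar> = \<bar>e\<bar> ^ (r + 1) * \<bar>e\<bar>" by (simp add: power_abs abs_mult)
    also have "\<dots> \<le> 2 ^ (r + 1) * (\<bar>c\<bar> + \<bar>e\<bar>)" using assms by (intro mult_mono power_mono) auto
    finally show "\<bar>e ^ (r + 2)\<bar> \<le> 2 ^ (r + 1) * (\<bar>c\<bar> + \<bar>e\<bar>)" .
  qed auto
  also have "\<dots> = (2 * real (r + 2) * 2 ^ (r + 2) + 2 ^ (r + 1)) * ?q" by (simp add: algebra_simps)
  also have "\<dots> \<le> (real (Suc r + 2) * 2 ^ (Suc r + 2)) * ?q"
    by (intro mult_right_mono) (auto simp: algebra_simps)
  finally show ?case .
qed

section \<open>Zonal kernels sampled along an equidistributed sequence\<close>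

text \<open>What the five families share. The coordinates \<open>u e\<close> exhibit t as a kernel
  of finite rank, which makes the law of large numbers uniform in the base points. The degree in
  \<open>t_convolution\<close> is bounded by the left exponent; the symmetry of t gives the bound by
  the right one.\<close>

locale zonal_space =
  fixes X :: "'p set" and \<mu> :: "'p measure" and t :: "'p \<Rightarrow> 'p \<Rightarrow> real"
    and a b :: real and D :: nat and u :: "nat \<Rightarrow> 'p \<Rightarrow> real"
  assumes ab: "0 < a" "0 < b"
    and prob_space_\<mu>: "prob_space \<mu>" and space_\<mu>: "space \<mu> = X"
    and t_inner: "\<And>x y. x \<in> X \<Longrightarrow> y \<in> X \<Longrightarrow> t x y = (\<Sum>e<D. u e x * u e y)"
    and u_measurable: "\<And>e. e < D \<Longrightarrow> u e \<in> borel_measurable \<mu>"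
    and u_bounded: "\<And>e x. e < D \<Longrightarrow> x \<in> X \<Longrightarrow> \<bar>u e x\<bar> \<le> 1"
    and t_range: "\<And>x y. x \<in> X \<Longrightarrow> y \<in> X \<Longrightarrow> 0 \<le> t x y \<and> t x y \<le> 1"
    and t_self: "\<And>x. x \<in> X \<Longrightarrow> t x x = 1"
    and t_moment: "\<And>x i. x \<in> X \<Longrightarrow> (\<integral>y. t x y ^ i \<partial>\<mu>) = beta_exp a b (monom 1 i)"
    and t_convolution: "\<And>i j. \<exists>q. degree q \<le> i \<and> (\<forall>x\<in>X. \<forall>z\<in>X. (\<integral>y. t x y ^ i * t y z ^ j \<partial>\<mu>) = poly q (t x z))"
begin

interpretation prob_space \<mu> by (rule prob_space_\<mu>)

section \<open>Convolution of zonal polynomials\<close>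

lemma t_commute: "x \<in> X \<Longrightarrow> y \<in> X \<Longrightarrow> t x y = t y x"
  by (simp add: t_inner mult.commute)

lemma t_measurable: "x \<in> X \<Longrightarrow> t x \<in> borel_measurable \<mu>"
proof -
  assume x: "x \<in> X"
  have "(\<lambda>y. \<Sum>e<D. u e x * u e y) \<in> borel_measurable \<mu>"
    by (intro borel_measurable_sum borel_measurable_times borel_measurable_const u_measurable) auto
  also have "?this \<longleftrightarrow> t x \<in> borel_measurable \<mu>"
    by (intro measurable_cong) (simp add: t_inner x space_\<mu>)
  finally show ?thesis .
qed

lemma t_measurable': "z \<in> X \<Longrightarrow> (\<lambda>y. t y z) \<in> borel_measurable \<mu>"
  using t_measurable[of z] by (subst measurable_cong[of _ _ "t z"]) (auto simp: space_\<mu> t_commute)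

text \<open>Joint measurability, needed for Fubini, comes from the finite expansion in
  \<open>u\<close>; the functions t x alone only give the sections.\<close>

lemma t_measurable_pair: "(\<lambda>(y, z). t y z) \<in> borel_measurable (\<mu> \<Otimes>\<^sub>M \<mu>)"
proof -
  have "(\<lambda>p. \<Sum>e<D. u e (fst p) * u e (snd p)) \<in> borel_measurable (\<mu> \<Otimes>\<^sub>M \<mu>)"
    by (intro borel_measurable_sum borel_measurable_times measurable_compose[OF measurable_fst u_measurable]
          measurable_compose[OF measurable_snd u_measurable]) auto
  also have "?this \<longleftrightarrow> (\<lambda>(y, z). t y z) \<in> borel_measurable (\<mu> \<Otimes>\<^sub>M \<mu>)"
    by (intro measurable_cong) (auto simp: t_inner space_\<mu> space_pair_measure)
  finally show ?thesis .
qed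

lemma poly_t_bounded: "\<exists>C\<ge>0. \<forall>x\<in>X. \<forall>y\<in>X. \<bar>poly p (t x y)\<bar> \<le> C"
proof -
  obtain C where C: "\<forall>s\<in>{0..1}. \<bar>poly p s\<bar> \<le> (C::real)" using poly_bounded_unit_interval by blast
  from C have "0 \<le> C" by (auto dest!: bspec[of _ _ 0])
  with C show ?thesis using t_range by (intro exI[of _ C]) auto
qed

lemma integrable_bounded:
  "f \<in> borel_measurable \<mu> \<Longrightarrow> (\<And>y. y \<in> X \<Longrightarrow> \<bar>f y\<bar> \<le> C) \<Longrightarrow> integrable \<mu> (f :: 'p \<Rightarrow> real)"
  by (intro integrable_const_bound[where B = C]) (auto simp: space_\<mu>[symmetric])

lemma integrable_poly_t:
  assumes "x \<in> X" "z \<in> X"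
  shows "integrable \<mu> (\<lambda>y. poly p (t x y) * poly q (t y z))"
proof -
  obtain C1 where C1: "0 \<le> C1" "\<And>x y. x \<in> X \<Longrightarrow> y \<in> X \<Longrightarrow> \<bar>poly p (t x y)\<bar> \<le> C1" using poly_t_bounded[of p] by blast
  obtain C2 where C2: "0 \<le> C2" "\<And>x y. x \<in> X \<Longrightarrow> y \<in> X \<Longrightarrow> \<bar>poly q (t x y)\<bar> \<le> C2" using poly_t_bounded[of q] by blast
  note [measurable] = t_measurable[OF assms(1)] t_measurable'[OF assms(2)]
  show ?thesis
    by (rule integrable_bounded[where C = "C1 * C2"])
       (use assms C1 C2 in \<open>auto simp: abs_mult intro!: mult_mono\<close>)
qed

lemma integral_poly_t: "x \<in> X \<Longrightarrow> (\<integral>y. poly p (t x y) \<partial>\<mu>) = beta_exp a b p"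
proof -
  assume x: "x \<in> X"
  have int: "integrable \<mu> (\<lambda>y. t x y ^ i)" for i
    using integrable_poly_t[OF x x, of "monom 1 i" 1] by (simp add: poly_monom)
  have "(\<integral>y. poly p (t x y) \<partial>\<mu>) = (\<integral>y. (\<Sum>i\<le>degree p. coeff p i * t x y ^ i) \<partial>\<mu>)" by (simp add: poly_altdef)
  also have "\<dots> = (\<Sum>i\<le>degree p. coeff p i * beta_exp a b (monom 1 i))" by (simp add: int t_moment x)
  also have "\<dots> = beta_exp a b (\<Sum>i\<le>degree p. Polynomial.smult (coeff p i) (monom 1 i))"
    using ab by (simp add: beta_exp_sum beta_exp_smult del: smult_monom)
  also have "(\<Sum>i\<le>degree p. Polynomial.smult (coeff p i) (monom 1 i)) = p"
    by (simp add: smult_monom poly_as_sum_of_monoms)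
  finally show ?thesis .
qed

lemma poly_convolution:
  "\<exists>s. degree s \<le> degree p \<and> (\<forall>x\<in>X. \<forall>z\<in>X. (\<integral>y. poly p (t x y) * poly q (t y z) \<partial>\<mu>) = poly s (t x z))"
proof -
  obtain Q where Q: "\<And>i j. degree (Q i j) \<le> i" "\<And>i j x z. x \<in> X \<Longrightarrow> z \<in> X \<Longrightarrow> (\<integral>y. t x y ^ i * t y z ^ j \<partial>\<mu>) = poly (Q i j) (t x z)"
    using t_convolution by metis
  define s where "s = (\<Sum>i\<le>degree p. \<Sum>j\<le>degree q. Polynomial.smult (coeff p i * coeff q j) (Q i j))"
  have "degree s \<le> degree p"
    unfolding s_def by (intro degree_sum_le) (auto intro!: order_trans[OF degree_smult_le] order_trans[OF Q(1)])
  moreover have "(\<integral>y. poly p (t x y) * poly q (t y z) \<partial>\<mu>) = poly s (t x z)" if x: "x \<in> X" and z: "z \<in> X" for x z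
  proof -
    have int: "integrable \<mu> (\<lambda>y. t x y ^ i * t y z ^ j)" for i j
      using integrable_poly_t[OF x z, of "monom 1 i" "monom 1 j"] by (simp add: poly_monom)
    have "(\<integral>y. poly p (t x y) * poly q (t y z) \<partial>\<mu>)
      = (\<integral>y. (\<Sum>i\<le>degree p. \<Sum>j\<le>degree q. (coeff p i * coeff q j) * (t x y ^ i * t y z ^ j)) \<partial>\<mu>)"
      by (simp add: poly_altdef sum_product mult_ac)
    also have "\<dots> = (\<Sum>i\<le>degree p. \<Sum>j\<le>degree q. (coeff p i * coeff q j) * (\<integral>y. t x y ^ i * t y z ^ j \<partial>\<mu>))"
      by (simp add: int)
    finally show ?thesis by (simp add: s_def poly_sum Q(2)[OF x z])
  qed
  ultimately show ?thesis by blast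
qed

lemma X_nonempty: "X \<noteq> {}"
  using not_empty by (simp add: space_\<mu>)

text \<open>Convolution with \<open>jac a b l\<close> sends \<open>jac a b k\<close> to a polynomial
  \<open>S k\<close> of degree at most k. By Fubini it is symmetric, so \<open>S k\<close> pairs
  with \<open>jac a b i\<close> as \<open>jac a b k\<close> does with \<open>S i\<close>, which
  gives 0 for i < k. Hence \<open>S k\<close> is a multiple of \<open>jac a b k\<close>.\<close>

lemma jac_convolution_le:
  assumes x: "x \<in> X" and z: "z \<in> X" and kl: "k \<le> l"
  shows "(\<integral>y. poly (jac a b k) (t x y) * poly (jac a b l) (t y z) \<partial>\<mu>)
     = (if k = l then 1 / jac_dim a b k else 0) * poly (jac a b k) (t x z)"
proof -
  obtain S where S: "\<And>i. degree (S i) \<le> degree (jac a b i)"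
    "\<And>i x z. x \<in> X \<Longrightarrow> z \<in> X \<Longrightarrow> (\<integral>y. poly (jac a b i) (t x y) * poly (jac a b l) (t y z) \<partial>\<mu>) = poly (S i) (t x z)"
    using poly_convolution[of "jac a b i" "jac a b l" for i] by metis
  have deg: "degree (S i) \<le> i" for i using S(1)[of i] degree_jac_le[of a b i] by linarith
  obtain x0 where x0: "x0 \<in> X" using X_nonempty by blast
  interpret P: pair_prob_space \<mu> \<mu> ..
  have orth: "beta_exp a b (S k * jac a b i) = beta_exp a b (jac a b k * S i)" for i
  proof -
    let ?F = "\<lambda>y z. poly (jac a b k) (t x0 y) * (poly (jac a b l) (t y z) * poly (jac a b i) (t z x0))"
    have int: "integrable (\<mu> \<Otimes>\<^sub>M \<mu>) (\<lambda>(y, z). ?F y z)"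
    proof -
      obtain C1 where C1: "0 \<le> C1" "\<And>x y. x \<in> X \<Longrightarrow> y \<in> X \<Longrightarrow> \<bar>poly (jac a b k) (t x y)\<bar> \<le> C1" using poly_t_bounded by blast
      obtain C2 where C2: "0 \<le> C2" "\<And>x y. x \<in> X \<Longrightarrow> y \<in> X \<Longrightarrow> \<bar>poly (jac a b l) (t x y)\<bar> \<le> C2" using poly_t_bounded by blast
      obtain C3 where C3: "0 \<le> C3" "\<And>x y. x \<in> X \<Longrightarrow> y \<in> X \<Longrightarrow> \<bar>poly (jac a b i) (t x y)\<bar> \<le> C3" using poly_t_bounded by blast
      note [measurable] = t_measurable[OF x0] t_measurable'[OF x0]
      have [measurable]: "(\<lambda>p. t (fst p) (snd p)) \<in> borel_measurable (\<mu> \<Otimes>\<^sub>M \<mu>)"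
        using t_measurable_pair by (simp add: case_prod_unfold)
      show ?thesis
      proof (rule P.integrable_const_bound[where B = "C1 * (C2 * C3)"])
        show "AE p in \<mu> \<Otimes>\<^sub>M \<mu>. norm (case p of (y, z) \<Rightarrow> ?F y z) \<le> C1 * (C2 * C3)"
          by (rule AE_I2) (use x0 C1 C2 C3 in \<open>auto simp: space_pair_measure space_\<mu> abs_mult intro!: mult_mono\<close>)
        have "(\<lambda>p. poly (jac a b k) (t x0 (fst p)) * (poly (jac a b l) (t (fst p) (snd p)) * poly (jac a b i) (t (snd p) x0))) \<in> borel_measurable (\<mu> \<Otimes>\<^sub>M \<mu>)"
          by measurable
        then show "(\<lambda>p. case p of (y, z) \<Rightarrow> ?F y z) \<in> borel_measurable (\<mu> \<Otimes>\<^sub>M \<mu>)" by (simp add: case_prod_unfold)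
      qed
    qed
    have "beta_exp a b (S k * jac a b i) = (\<integral>z. poly (S k) (t x0 z) * poly (jac a b i) (t z x0) \<partial>\<mu>)"
      by (subst integral_poly_t[OF x0, symmetric]) (auto simp: t_commute x0 space_\<mu> intro!: Bochner_Integration.integral_cong)
    also have "\<dots> = (\<integral>z. (\<integral>y. ?F y z \<partial>\<mu>) \<partial>\<mu>)"
      by (intro Bochner_Integration.integral_cong refl) (simp add: S(2)[symmetric] x0 space_\<mu> mult.assoc flip: integral_mult_left_zero)
    also have "\<dots> = (\<integral>y. (\<integral>z. ?F y z \<partial>\<mu>) \<partial>\<mu>)"
      using P.Fubini_integral[OF int] by simp
    also have "\<dots> = (\<integral>y. poly (jac a b k) (t x0 y) * poly (S i) (t x0 y) \<partial>\<mu>)"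
    proof (intro Bochner_Integration.integral_cong refl)
      fix y assume "y \<in> space \<mu>"
      then have y: "y \<in> X" by (simp add: space_\<mu>)
      have "(\<integral>z. poly (jac a b l) (t y z) * poly (jac a b i) (t z x0) \<partial>\<mu>) = (\<integral>z. poly (jac a b i) (t x0 z) * poly (jac a b l) (t z y) \<partial>\<mu>)"
        by (intro Bochner_Integration.integral_cong refl) (simp add: t_commute x0 y space_\<mu>)
      then show "(\<integral>z. ?F y z \<partial>\<mu>) = poly (jac a b k) (t x0 y) * poly (S i) (t x0 y)"
        by (simp add: S(2)[OF x0 y])
    qed
    also have "\<dots> = beta_exp a b (jac a b k * S i)"
      by (subst integral_poly_t[OF x0, symmetric]) simp
    finally show ?thesis .
  qed
  have "beta_exp a b (S k * jac a b i) = 0" if "i < k" for i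
    unfolding orth using deg[of i] that ab by (subst beta_exp_jac_mult) (auto intro: coeff_eq_0)
  then have "S k = (\<Sum>i\<le>k. if i = k then Polynomial.smult (jac_dim a b k * beta_exp a b (S k * jac a b k)) (jac a b k) else 0)"
    by (subst poly_jac_expansion[OF ab deg[of k]]) (intro sum.cong, auto)
  then obtain \<alpha> where \<alpha>: "S k = Polynomial.smult \<alpha> (jac a b k)" by auto
  \<comment> \<open>The factor is found at coincident points, where t = 1, \<open>jac\<close> is 1
    and the convolution is an inner product.\<close>
  have "\<alpha> = poly (S k) (t x0 x0)" using ab by (simp add: \<alpha> t_self x0 jac_at_1)
  also have "\<dots> = (\<integral>y. poly (jac a b k) (t x0 y) * poly (jac a b l) (t y x0) \<partial>\<mu>)" by (simp add: S(2) x0)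
  also have "\<dots> = beta_exp a b (jac a b k * jac a b l)"
    by (subst integral_poly_t[OF x0, symmetric]) (auto simp: t_commute x0 space_\<mu> intro!: Bochner_Integration.integral_cong)
  also have "\<dots> = (if k = l then 1 / jac_dim a b k else 0)" by (rule beta_exp_jac_jac[OF ab])
  finally show ?thesis using S(2)[OF x z, of k] by (simp add: \<alpha>)
qed

lemma jac_convolution:
  assumes x: "x \<in> X" and z: "z \<in> X"
  shows "(\<integral>y. poly (jac a b k) (t x y) * poly (jac a b l) (t y z) \<partial>\<mu>)
     = (if k = l then 1 / jac_dim a b k else 0) * poly (jac a b k) (t x z)"
proof (cases "k \<le> l")
  case False
  have "(\<integral>y. poly (jac a b k) (t x y) * poly (jac a b l) (t y z) \<partial>\<mu>) = (\<integral>y. poly (jac a b l) (t z y) * poly (jac a b k) (t y x) \<partial>\<mu>)"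
    by (intro Bochner_Integration.integral_cong refl) (simp add: t_commute x z space_\<mu>)
  then show ?thesis using False jac_convolution_le[OF z x, of l k] by simp
qed (rule jac_convolution_le[OF assms])

section \<open>Equidistributed sequences and uniform averages\<close>

text \<open>Words in the coordinates are countably many, so almost every sample satisfies all the
  limits at once, and their span contains every polynomial in t x y as a function of y.\<close>

definition equidistributed :: "(nat \<Rightarrow> 'p) \<Rightarrow> bool" where
  "equidistributed v \<longleftrightarrow> (\<forall>i. v i \<in> X) \<and> (\<forall>w. set w \<subseteq> {..<D} \<longrightarrow>
     (\<lambda>N. (\<Sum>i<N. \<Prod>e\<leftarrow>w. u e (v i)) / real N) \<longlonglongrightarrow> (\<integral>y. (\<Prod>e\<leftarrow>w. u e y) \<partial>\<mu>))"

text \<open>Uniformity in x and z is needed because both will be points of the same sample.\<close>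

definition unif_close :: "(nat \<Rightarrow> 'p \<Rightarrow> 'p \<Rightarrow> real) \<Rightarrow> ('p \<Rightarrow> 'p \<Rightarrow> real) \<Rightarrow> bool" where
  "unif_close F G \<longleftrightarrow> (\<exists>\<rho>. \<rho> \<longlonglongrightarrow> 0 \<and> (\<forall>N. \<forall>x\<in>X. \<forall>z\<in>X. \<bar>F N x z - G x z\<bar> \<le> \<rho> N))"

lemma unif_close_sum:
  assumes "finite A" and F: "\<And>e. e \<in> A \<Longrightarrow> unif_close (F e) (G e)"
    and c: "\<And>e x z. e \<in> A \<Longrightarrow> x \<in> X \<Longrightarrow> z \<in> X \<Longrightarrow> \<bar>c e x z\<bar> \<le> C e"
  shows "unif_close (\<lambda>N x z. \<Sum>e\<in>A. c e x z * F e N x z) (\<lambda>x z. \<Sum>e\<in>A. c e x z * G e x z)"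
proof -
  have "\<forall>e\<in>A. \<exists>\<rho>. \<rho> \<longlonglongrightarrow> 0 \<and> (\<forall>N. \<forall>x\<in>X. \<forall>z\<in>X. \<bar>F e N x z - G e x z\<bar> \<le> \<rho> N)"
    using F by (simp add: unif_close_def)
  then obtain \<rho> where \<rho>: "\<forall>e\<in>A. \<rho> e \<longlonglongrightarrow> 0 \<and> (\<forall>N. \<forall>x\<in>X. \<forall>z\<in>X. \<bar>F e N x z - G e x z\<bar> \<le> \<rho> e N)"
    by (rule bchoice[THEN exE])
  have "(\<lambda>N. \<Sum>e\<in>A. \<bar>C e\<bar> * \<rho> e N) \<longlonglongrightarrow> (\<Sum>e\<in>A. \<bar>C e\<bar> * 0)"
    using \<rho> by (intro tendsto_sum tendsto_mult tendsto_const) auto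
  moreover have "\<bar>(\<Sum>e\<in>A. c e x z * F e N x z) - (\<Sum>e\<in>A. c e x z * G e x z)\<bar> \<le> (\<Sum>e\<in>A. \<bar>C e\<bar> * \<rho> e N)"
    if "x \<in> X" "z \<in> X" for N x z
  proof -
    have "(\<Sum>e\<in>A. c e x z * F e N x z) - (\<Sum>e\<in>A. c e x z * G e x z) = (\<Sum>e\<in>A. c e x z * (F e N x z - G e x z))"
      by (simp add: sum_subtractf right_diff_distrib)
    also have "\<bar>\<dots>\<bar> \<le> (\<Sum>e\<in>A. \<bar>c e x z\<bar> * \<bar>F e N x z - G e x z\<bar>)"
      by (rule order_trans[OF sum_abs]) (simp add: abs_mult)
    also have "\<dots> \<le> (\<Sum>e\<in>A. \<bar>C e\<bar> * \<rho> e N)"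
    proof (intro sum_mono mult_mono)
      fix e assume e: "e \<in> A"
      show "\<bar>c e x z\<bar> \<le> \<bar>C e\<bar>" using c[OF e that] by linarith
      show "\<bar>F e N x z - G e x z\<bar> \<le> \<rho> e N" using \<rho> e that by blast
    qed auto
    finally show ?thesis .
  qed
  ultimately show ?thesis unfolding unif_close_def
    by (intro exI[of _ "\<lambda>N. \<Sum>e\<in>A. \<bar>C e\<bar> * \<rho> e N"]) auto
qed

lemma word_measurable: "set w \<subseteq> {..<D} \<Longrightarrow> (\<lambda>y. \<Prod>e\<leftarrow>w. u e y) \<in> borel_measurable \<mu>"
  by (induction w) (auto intro!: borel_measurable_times u_measurable)

lemma word_bounded: "set w \<subseteq> {..<D} \<Longrightarrow> y \<in> X \<Longrightarrow> \<bar>\<Prod>e\<leftarrow>w. u e y\<bar> \<le> 1"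
  by (induction w) (auto simp: abs_mult intro!: mult_le_one u_bounded)

lemma integrable_word:
  assumes w: "set w \<subseteq> {..<D}" and x: "x \<in> X" and z: "z \<in> X"
  shows "integrable \<mu> (\<lambda>y. (\<Prod>e\<leftarrow>w. u e y) * (t x y ^ i * t y z ^ j))"
proof (rule integrable_bounded[where C = 1])
  note [measurable] = t_measurable[OF x] t_measurable'[OF z] word_measurable[OF w]
  show "(\<lambda>y. (\<Prod>e\<leftarrow>w. u e y) * (t x y ^ i * t y z ^ j)) \<in> borel_measurable \<mu>" by measurable
  fix y assume y: "y \<in> X"
  have "\<bar>t x y ^ i * t y z ^ j\<bar> \<le> 1"
    using t_range[OF x y] t_range[OF y z] by (simp add: abs_mult mult_le_one power_le_one)
  then show "\<bar>(\<Prod>e\<leftarrow>w. u e y) * (t x y ^ i * t y z ^ j)\<bar> \<le> 1"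
    using word_bounded[OF w y] unfolding abs_mult[of "\<Prod>e\<leftarrow>w. u e y"] by (intro mult_le_one) auto
qed

definition avg :: "(nat \<Rightarrow> 'p) \<Rightarrow> ('p \<Rightarrow> real) \<Rightarrow> nat \<Rightarrow> real" where
  "avg v f N = (\<Sum>i<N. f (v i)) / real N"

lemma avg_sum: "avg v (\<lambda>y. \<Sum>e\<in>A. c e * f e y) N = (\<Sum>e\<in>A. c e * avg v (f e) N)"
  unfolding avg_def by (subst sum.swap) (simp add: sum_distrib_left sum_divide_distrib)

lemma avg_cong: "(\<And>i. f (v i) = g (v i)) \<Longrightarrow> avg v f N = avg v g N"
  by (simp add: avg_def)

text \<open>Induction on i + j: one factor t is expanded in coordinates, its y-part joins the word,
  and its x-part or z-part becomes a bounded coefficient, harmless for uniformity.\<close>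

lemma word_uniform:
  assumes v: "equidistributed v" and "set w \<subseteq> {..<D}"
  shows "unif_close (\<lambda>N x z. avg v (\<lambda>y. (\<Prod>e\<leftarrow>w. u e y) * (t x y ^ i * t y z ^ j)) N)
     (\<lambda>x z. \<integral>y. (\<Prod>e\<leftarrow>w. u e y) * (t x y ^ i * t y z ^ j) \<partial>\<mu>)"
  using assms(2)
proof (induction "i + j" arbitrary: i j w)
  case 0
  then have "(\<lambda>N. avg v (\<lambda>y. \<Prod>e\<leftarrow>w. u e y) N) \<longlonglongrightarrow> (\<integral>y. (\<Prod>e\<leftarrow>w. u e y) \<partial>\<mu>)"
    using v by (auto simp: equidistributed_def avg_def)
  then have "(\<lambda>N. \<bar>avg v (\<lambda>y. \<Prod>e\<leftarrow>w. u e y) N - (\<integral>y. (\<Prod>e\<leftarrow>w. u e y) \<partial>\<mu>)\<bar>) \<longlonglongrightarrow> 0"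
    by (intro tendsto_rabs_zero LIM_zero)
  then show ?case using 0 unfolding unif_close_def
    by (intro exI[of _ "\<lambda>N. \<bar>avg v (\<lambda>y. \<Prod>e\<leftarrow>w. u e y) N - (\<integral>y. (\<Prod>e\<leftarrow>w. u e y) \<partial>\<mu>)\<bar>"]) auto
next
  case (Suc n)
  note IH = Suc.hyps(1) and n = Suc.hyps(2) and w = Suc.prems
  have vX: "v i \<in> X" for i using v by (simp add: equidistributed_def)
  show ?case
  proof (cases i)
    case (Suc i')
    let ?f = "\<lambda>e x z y. (\<Prod>e\<leftarrow>e # w. u e y) * (t x y ^ i' * t y z ^ j)"
    have eq: "(\<Prod>e\<leftarrow>w. u e y) * (t x y ^ i * t y z ^ j) = (\<Sum>e<D. u e x * ?f e x z y)" if "x \<in> X" "y \<in> X" for x y z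
      unfolding Suc power_Suc t_inner[OF that] by (simp add: sum_distrib_left sum_distrib_right mult_ac)
    have "unif_close (\<lambda>N x z. \<Sum>e<D. u e x * avg v (?f e x z) N) (\<lambda>x z. \<Sum>e<D. u e x * (\<integral>y. ?f e x z y \<partial>\<mu>))"
      by (rule unif_close_sum[where C = "\<lambda>_. 1"]) (use n Suc w u_bounded in \<open>auto simp del: list.map prod_list.Cons intro!: IH\<close>)
    moreover have "avg v (\<lambda>y. (\<Prod>e\<leftarrow>w. u e y) * (t x y ^ i * t y z ^ j)) N = (\<Sum>e<D. u e x * avg v (?f e x z) N)"
      if "x \<in> X" for x z N
      unfolding avg_sum[symmetric] by (rule avg_cong) (rule eq[OF that vX])
    moreover have "(\<integral>y. (\<Prod>e\<leftarrow>w. u e y) * (t x y ^ i * t y z ^ j) \<partial>\<mu>) = (\<Sum>e<D. u e x * (\<integral>y. ?f e x z y \<partial>\<mu>))"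
      if "x \<in> X" "z \<in> X" for x z
    proof -
      have "(\<integral>y. (\<Prod>e\<leftarrow>w. u e y) * (t x y ^ i * t y z ^ j) \<partial>\<mu>) = (\<integral>y. (\<Sum>e<D. u e x * ?f e x z y) \<partial>\<mu>)"
        by (intro Bochner_Integration.integral_cong refl eq that) (simp add: space_\<mu>)
      also have "\<dots> = (\<Sum>e<D. \<integral>y. u e x * ?f e x z y \<partial>\<mu>)"
        using w that by (intro Bochner_Integration.integral_sum integrable_mult_right integrable_word) auto
      finally show ?thesis by simp
    qed
    ultimately show ?thesis by (simp add: unif_close_def)
  next
    case 0
    then obtain j' where j: "j = Suc j'" using n by (cases j) auto
    let ?f = "\<lambda>e x z y. (\<Prod>e\<leftarrow>e # w. u e y) * (t x y ^ i * t y z ^ j')"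
    have eq: "(\<Prod>e\<leftarrow>w. u e y) * (t x y ^ i * t y z ^ j) = (\<Sum>e<D. u e z * ?f e x z y)" if "z \<in> X" "y \<in> X" for x y z
      unfolding j power_Suc t_inner[OF that(2,1)] by (simp add: sum_distrib_left sum_distrib_right mult_ac)
    have "unif_close (\<lambda>N x z. \<Sum>e<D. u e z * avg v (?f e x z) N) (\<lambda>x z. \<Sum>e<D. u e z * (\<integral>y. ?f e x z y \<partial>\<mu>))"
    proof (rule unif_close_sum[where C = "\<lambda>_. 1"])
      fix e assume "e \<in> {..<D}"
      then show "unif_close (\<lambda>N x z. avg v (?f e x z) N) (\<lambda>x z. \<integral>y. ?f e x z y \<partial>\<mu>)"
        by (intro IH) (use n 0 j w in auto)
    qed (use u_bounded in auto)
    moreover have "avg v (\<lambda>y. (\<Prod>e\<leftarrow>w. u e y) * (t x y ^ i * t y z ^ j)) N = (\<Sum>e<D. u e z * avg v (?f e x z) N)"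
      if "z \<in> X" for x z N
      unfolding avg_sum[symmetric] by (rule avg_cong) (rule eq[OF that vX])
    moreover have "(\<integral>y. (\<Prod>e\<leftarrow>w. u e y) * (t x y ^ i * t y z ^ j) \<partial>\<mu>) = (\<Sum>e<D. u e z * (\<integral>y. ?f e x z y \<partial>\<mu>))"
      if "x \<in> X" "z \<in> X" for x z
    proof -
      have "(\<integral>y. (\<Prod>e\<leftarrow>w. u e y) * (t x y ^ i * t y z ^ j) \<partial>\<mu>) = (\<integral>y. (\<Sum>e<D. u e z * ?f e x z y) \<partial>\<mu>)"
        by (intro Bochner_Integration.integral_cong refl eq that) (simp add: space_\<mu>)
      also have "\<dots> = (\<Sum>e<D. \<integral>y. u e z * ?f e x z y \<partial>\<mu>)"
        using w that by (intro Bochner_Integration.integral_sum integrable_mult_right integrable_word) auto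
      finally show ?thesis by simp
    qed
    ultimately show ?thesis by (simp add: unif_close_def)
  qed
qed

lemma poly_uniform:
  assumes v: "equidistributed v"
  shows "unif_close (\<lambda>N x z. avg v (\<lambda>y. poly p (t x y) * poly q (t y z)) N) (\<lambda>x z. \<integral>y. poly p (t x y) * poly q (t y z) \<partial>\<mu>)"
proof -
  let ?A = "{..degree p} \<times> {..degree q}"
  let ?f = "\<lambda>ij x z y. t x y ^ fst ij * t y z ^ snd ij"
  let ?c = "\<lambda>ij. coeff p (fst ij) * coeff q (snd ij)"
  have eq: "poly p (t x y) * poly q (t y z) = (\<Sum>ij\<in>?A. ?c ij * ?f ij x z y)" for x y z
    by (simp add: poly_altdef sum_product sum.cartesian_product case_prod_unfold mult_ac)
  have "unif_close (\<lambda>N x z. \<Sum>ij\<in>?A. ?c ij * avg v (?f ij x z) N) (\<lambda>x z. \<Sum>ij\<in>?A. ?c ij * (\<integral>y. ?f ij x z y \<partial>\<mu>))"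
    using word_uniform[OF v, of "[]"] by (intro unif_close_sum[where C = "\<lambda>ij. \<bar>?c ij\<bar>"]) auto
  moreover have "(\<integral>y. (\<Sum>ij\<in>?A. ?c ij * ?f ij x z y) \<partial>\<mu>) = (\<Sum>ij\<in>?A. ?c ij * (\<integral>y. ?f ij x z y \<partial>\<mu>))" if "x \<in> X" "z \<in> X" for x z
    using integrable_word[of "[]" x z] that by (subst Bochner_Integration.integral_sum) auto
  ultimately show ?thesis unfolding eq avg_sum by (simp add: unif_close_def)
qed

section \<open>Matrices of sampled kernels and their traces\<close>

definition samp :: "(nat \<Rightarrow> 'p) \<Rightarrow> nat \<Rightarrow> real poly \<Rightarrow> nat \<Rightarrow> nat \<Rightarrow> real" where
  "samp v N p = (\<lambda>i j. poly p (t (v i) (v j)) / real N)"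

lemma double_average:
  assumes v: "equidistributed v"
  shows "(\<lambda>N. (\<Sum>i<N. \<Sum>j<N. poly p (t (v i) (v j))) / (real N)\<^sup>2) \<longlonglongrightarrow> beta_exp a b p"
proof -
  have vX: "v i \<in> X" for i using v by (simp add: equidistributed_def)
  obtain \<rho> where \<rho>: "\<rho> \<longlonglongrightarrow> 0"
    "\<And>N x z. x \<in> X \<Longrightarrow> z \<in> X \<Longrightarrow> \<bar>avg v (\<lambda>y. poly p (t x y) * poly 1 (t y z)) N - (\<integral>y. poly p (t x y) * poly 1 (t y z) \<partial>\<mu>)\<bar> \<le> \<rho> N"
    using poly_uniform[OF v, of p 1] unfolding unif_close_def by blast
  have r: "\<bar>(\<Sum>j<N. poly p (t (v i) (v j))) / real N - beta_exp a b p\<bar> \<le> \<rho> N" for i N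
    using \<rho>(2)[OF vX vX, of i i N] by (simp add: avg_def integral_poly_t vX)
  have "(\<lambda>N. (\<Sum>i<N. \<Sum>j<N. poly p (t (v i) (v j))) / (real N)\<^sup>2 - beta_exp a b p) \<longlonglongrightarrow> 0"
  proof (rule Lim_null_comparison[OF _ \<rho>(1)])
    show "eventually (\<lambda>N. norm ((\<Sum>i<N. \<Sum>j<N. poly p (t (v i) (v j))) / (real N)\<^sup>2 - beta_exp a b p) \<le> \<rho> N) sequentially"
      using eventually_gt_at_top[of 0]
    proof eventually_elim
      case (elim N)
      have eq: "(\<Sum>i<N. \<Sum>j<N. poly p (t (v i) (v j))) / (real N)\<^sup>2 - beta_exp a b p
         = (\<Sum>i<N. (\<Sum>j<N. poly p (t (v i) (v j))) / real N - beta_exp a b p) / real N"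
        using elim by (simp add: sum_subtractf sum_divide_distrib[symmetric] power2_eq_square field_simps)
      have "\<bar>\<Sum>i<N. (\<Sum>j<N. poly p (t (v i) (v j))) / real N - beta_exp a b p\<bar> \<le> (\<Sum>i<N. \<rho> N)"
        by (rule order_trans[OF sum_abs sum_mono[OF r]])
      then show ?case using elim unfolding eq real_norm_def abs_divide by (simp add: divide_le_eq mult.commute)
    qed
  qed
  then show ?thesis by (rule LIM_zero_cancel)
qed

lemma frob_samp_inner:
  assumes v: "equidistributed v"
  shows "(\<lambda>N. \<Sum>i<N. \<Sum>j<N. samp v N p i j * samp v N q i j) \<longlonglongrightarrow> beta_exp a b (p * q)"
  using double_average[OF v, of "p * q"]
  by (simp add: samp_def sum_divide_distrib power2_eq_square)

text \<open>An entry of the product is a sample average of the convolution integrand divided by N,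
  hence within \<open>\<rho> N / real N\<close> of the sampled convolution; over N^2 entries this
  adds up to \<open>\<rho> N\<close>.\<close>

lemma frob_samp_fmult:
  assumes v: "equidistributed v"
    and s: "\<And>x z. x \<in> X \<Longrightarrow> z \<in> X \<Longrightarrow> (\<integral>y. poly p (t x y) * poly q (t y z) \<partial>\<mu>) = poly s (t x z)"
  shows "(\<lambda>N. frob N (\<lambda>i j. fmult N (samp v N p) (samp v N q) i j - samp v N s i j)) \<longlonglongrightarrow> 0"
proof -
  have vX: "v i \<in> X" for i using v by (simp add: equidistributed_def)
  obtain \<rho> where \<rho>: "\<rho> \<longlonglongrightarrow> 0"
    "\<And>N x z. x \<in> X \<Longrightarrow> z \<in> X \<Longrightarrow> \<bar>avg v (\<lambda>y. poly p (t x y) * poly q (t y z)) N - (\<integral>y. poly p (t x y) * poly q (t y z) \<partial>\<mu>)\<bar> \<le> \<rho> N"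
    using poly_uniform[OF v, of p q] unfolding unif_close_def by blast
  have r0: "0 \<le> \<rho> N" for N using order_trans[OF abs_ge_zero \<rho>(2)[OF vX vX]] by blast
  have le: "frob N (\<lambda>i j. fmult N (samp v N p) (samp v N q) i j - samp v N s i j) \<le> \<rho> N" for N
  proof (cases "N = 0")
    case True
    then show ?thesis using r0 by (simp add: frob_le_iff)
  next
    case False
    have e: "(fmult N (samp v N p) (samp v N q) i j - samp v N s i j)\<^sup>2 \<le> (\<rho> N / real N)\<^sup>2" for i j
    proof -
      have "fmult N (samp v N p) (samp v N q) i j - samp v N s i j
        = (avg v (\<lambda>y. poly p (t (v i) y) * poly q (t y (v j))) N - poly s (t (v i) (v j))) / real N"
        by (simp add: fmult_def samp_def avg_def sum_divide_distrib diff_divide_distrib)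
      moreover have "\<bar>\<dots>\<bar> \<le> \<rho> N / real N"
        using \<rho>(2)[OF vX vX, of i j N] by (simp add: abs_divide s[OF vX vX] divide_right_mono)
      ultimately show ?thesis using r0[of N] by (metis abs_ge_zero power2_abs power_mono)
    qed
    have "(\<Sum>i<N. \<Sum>j<N. (fmult N (samp v N p) (samp v N q) i j - samp v N s i j)\<^sup>2) \<le> (\<Sum>i<N. \<Sum>j<N. (\<rho> N / real N)\<^sup>2)"
      by (intro sum_mono e)
    also have "\<dots> = (\<rho> N)\<^sup>2" using False by (simp add: power2_eq_square)
    finally show ?thesis using r0 by (simp add: frob_le_iff)
  qed
  show ?thesis
    by (rule tendsto_sandwich[OF _ _ tendsto_const \<rho>(1)]) (use le in \<open>auto intro: always_eventually\<close>)
qed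

text \<open>The zonal function with eigenvalue \<open>e k ^ r\<close> on the k-th eigenspace for k
  \<le> K; exponent r is the r-fold convolution power of exponent 1.\<close>

definition jac_comb :: "(nat \<Rightarrow> real) \<Rightarrow> nat \<Rightarrow> nat \<Rightarrow> real poly" where
  "jac_comb e K r = (\<Sum>k\<le>K. Polynomial.smult (e k ^ r * jac_dim a b k) (jac a b k))"

lemma jac_comb_convolution:
  assumes "x \<in> X" "z \<in> X"
  shows "(\<integral>y. poly (jac_comb e K r) (t x y) * poly (jac_comb e K 1) (t y z) \<partial>\<mu>) = poly (jac_comb e K (Suc r)) (t x z)"
proof -
  let ?c = "\<lambda>k l. (e k ^ r * jac_dim a b k) * (e l * jac_dim a b l)"
  have "(\<integral>y. poly (jac_comb e K r) (t x y) * poly (jac_comb e K 1) (t y z) \<partial>\<mu>)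
     = (\<integral>y. (\<Sum>k\<le>K. \<Sum>l\<le>K. ?c k l * (poly (jac a b k) (t x y) * poly (jac a b l) (t y z))) \<partial>\<mu>)"
    by (simp only: jac_comb_def poly_sum poly_smult sum_product power_one_right) (simp only: mult_ac)
  also have "\<dots> = (\<Sum>k\<le>K. \<Sum>l\<le>K. ?c k l * (\<integral>y. poly (jac a b k) (t x y) * poly (jac a b l) (t y z) \<partial>\<mu>))"
    by (simp add: integrable_poly_t assms)
  also have "\<dots> = (\<Sum>k\<le>K. \<Sum>l\<le>K. if k = l then e k ^ Suc r * jac_dim a b k * poly (jac a b k) (t x z) else 0)"
    using jac_dim_pos[OF ab] unfolding jac_convolution[OF assms]
    by (intro sum.cong refl) (auto simp: less_imp_neq[symmetric])
  also have "\<dots> = poly (jac_comb e K (Suc r)) (t x z)" by (simp add: jac_comb_def poly_sum)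
  finally show ?thesis .
qed

text \<open>The inner product is a convolution at coincident points, so it is
  \<open>jac_comb\<close> with exponent r + 1 evaluated at t = 1.\<close>

lemma jac_comb_inner: "beta_exp a b (jac_comb e K r * jac_comb e K 1) = (\<Sum>k\<le>K. jac_dim a b k * e k ^ Suc r)"
proof -
  obtain x where x: "x \<in> X" using X_nonempty by blast
  have "beta_exp a b (jac_comb e K r * jac_comb e K 1) = (\<integral>y. poly (jac_comb e K r) (t x y) * poly (jac_comb e K 1) (t y x) \<partial>\<mu>)"
    by (subst integral_poly_t[OF x, symmetric]) (auto simp: t_commute x space_\<mu> intro!: Bochner_Integration.integral_cong)
  also have "\<dots> = poly (jac_comb e K (Suc r)) 1" by (simp only: jac_comb_convolution[OF x x] t_self[OF x])
  also have "\<dots> = (\<Sum>k\<le>K. jac_dim a b k * e k ^ Suc r)" using ab by (simp add: jac_comb_def poly_sum jac_at_1 mult_ac)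
  finally show ?thesis .
qed

lemma frob_samp_bounded: "\<exists>C\<ge>1. \<forall>v. equidistributed v \<longrightarrow> (\<forall>N. frob N (samp v N p) \<le> C)"
proof -
  obtain C where C: "0 \<le> C" "\<And>x y. x \<in> X \<Longrightarrow> y \<in> X \<Longrightarrow> \<bar>poly p (t x y)\<bar> \<le> C" using poly_t_bounded by blast
  have "frob N (samp v N p) \<le> C + 1" if v: "equidistributed v" for v N
  proof -
    have vX: "v i \<in> X" for i using v by (simp add: equidistributed_def)
    have "(\<Sum>i<N. \<Sum>j<N. (samp v N p i j)\<^sup>2) \<le> (\<Sum>i<N. \<Sum>j<N. ((C + 1) / real N)\<^sup>2)"
    proof (intro sum_mono)
      fix i j
      have "\<bar>samp v N p i j\<bar> \<le> \<bar>(C + 1) / real N\<bar>" unfolding samp_def abs_divide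
        using C(1) C(2)[OF vX vX, of i j] by (intro divide_right_mono) auto
      then show "(samp v N p i j)\<^sup>2 \<le> ((C + 1) / real N)\<^sup>2" by (simp only: abs_le_square_iff)
    qed
    also have "\<dots> \<le> (C + 1)\<^sup>2" by (cases "N = 0") (auto simp: power2_eq_square)
    finally show ?thesis using C by (subst frob_le_iff) auto
  qed
  then show ?thesis using C by (intro exI[of _ "C + 1"]) auto
qed

lemma fpow_samp_jac_comb:
  assumes v: "equidistributed v"
  shows "(\<lambda>N. frob N (\<lambda>i j. fpow N (samp v N (jac_comb e K 1)) (Suc r) i j - samp v N (jac_comb e K (Suc r)) i j)) \<longlonglongrightarrow> 0"
proof (induction r)
  case 0
  have "frob N (\<lambda>i j. fpow N (samp v N (jac_comb e K 1)) (Suc 0) i j - samp v N (jac_comb e K (Suc 0)) i j) = 0" for N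
  proof -
    have "frob N (\<lambda>i j. fpow N (samp v N (jac_comb e K 1)) (Suc 0) i j - samp v N (jac_comb e K (Suc 0)) i j) = frob N (\<lambda>_ _. 0)"
      by (rule frob_cong) (simp add: fpow_1 del: fpow.simps)
    also have "\<dots> = 0" by (simp add: frob_def L2_set_def case_prod_unfold)
    finally show ?thesis .
  qed
  then show ?case by simp
next
  case (Suc r)
  let ?B = "\<lambda>N. samp v N (jac_comb e K 1)"
  let ?F = "\<lambda>N. fpow N (?B N) (Suc r)" and ?S = "\<lambda>N. samp v N (jac_comb e K (Suc r))"
  obtain C where C: "1 \<le> C" "\<And>N. frob N (?B N) \<le> C" using frob_samp_bounded[of "jac_comb e K 1"] v by blast
  have "(\<lambda>N. frob N (\<lambda>i j. ?F N i j - ?S N i j) * C + frob N (\<lambda>i j. fmult N (?S N) (?B N) i j - samp v N (jac_comb e K (Suc (Suc r))) i j)) \<longlonglongrightarrow> 0 * C + 0"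
    by (intro tendsto_add tendsto_mult tendsto_const Suc frob_samp_fmult[OF v] jac_comb_convolution)
  then have lim: "(\<lambda>N. frob N (\<lambda>i j. ?F N i j - ?S N i j) * C + frob N (\<lambda>i j. fmult N (?S N) (?B N) i j - samp v N (jac_comb e K (Suc (Suc r))) i j)) \<longlonglongrightarrow> 0"
    by simp
  have le: "frob N (\<lambda>i j. fpow N (?B N) (Suc (Suc r)) i j - samp v N (jac_comb e K (Suc (Suc r))) i j)
    \<le> frob N (\<lambda>i j. ?F N i j - ?S N i j) * C + frob N (\<lambda>i j. fmult N (?S N) (?B N) i j - samp v N (jac_comb e K (Suc (Suc r))) i j)" for N
  proof -
    have "frob N (\<lambda>i j. fpow N (?B N) (Suc (Suc r)) i j - samp v N (jac_comb e K (Suc (Suc r))) i j)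
      = frob N (\<lambda>i j. fmult N (\<lambda>i j. ?F N i j - ?S N i j) (?B N) i j + (fmult N (?S N) (?B N) i j - samp v N (jac_comb e K (Suc (Suc r))) i j))"
      unfolding fpow_Suc_fmult[of N _ "Suc r"]
      by (intro frob_cong) (simp add: fmult_def left_diff_distrib sum_subtractf del: fpow.simps)
    also have "\<dots> \<le> frob N (\<lambda>i j. ?F N i j - ?S N i j) * frob N (?B N) + frob N (\<lambda>i j. fmult N (?S N) (?B N) i j - samp v N (jac_comb e K (Suc (Suc r))) i j)"
      by (intro order_trans[OF frob_triangle] add_mono frob_fmult order_refl)
    also have "\<dots> \<le> frob N (\<lambda>i j. ?F N i j - ?S N i j) * C + frob N (\<lambda>i j. fmult N (?S N) (?B N) i j - samp v N (jac_comb e K (Suc (Suc r))) i j)"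
      using C by (intro add_mono mult_left_mono) auto
    finally show ?thesis .
  qed
  show ?case
    by (rule tendsto_sandwich[OF _ _ tendsto_const lim]) (use le in \<open>auto intro!: always_eventually simp del: fpow.simps\<close>)
qed

text \<open>As the sampled matrix B is symmetric, the trace of its power r + 2 pairs the power r + 1
  with B, and that power may be replaced by a sampled convolution power.\<close>

lemma trace_samp_jac_comb:
  assumes v: "equidistributed v"
  shows "(\<lambda>N. \<Sum>i<N. fpow N (samp v N (jac_comb e K 1)) (r + 2) i i) \<longlonglongrightarrow> (\<Sum>k\<le>K. jac_dim a b k * e k ^ (r + 2))"
proof -
  let ?B = "\<lambda>N. samp v N (jac_comb e K 1)"
  let ?F = "\<lambda>N. fpow N (?B N) (Suc r)" and ?S = "\<lambda>N. samp v N (jac_comb e K (Suc r))"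
  have vX: "v i \<in> X" for i using v by (simp add: equidistributed_def)
  obtain C where C: "1 \<le> C" "\<And>N. frob N (?B N) \<le> C" using frob_samp_bounded[of "jac_comb e K 1"] v by blast
  have tr: "(\<Sum>i<N. fpow N (?B N) (r + 2) i i) = (\<Sum>i<N. \<Sum>k<N. (?F N i k - ?S N i k) * ?B N i k) + (\<Sum>i<N. \<Sum>k<N. ?S N i k * ?B N i k)" for N
  proof -
    have "(\<Sum>i<N. fpow N (?B N) (r + 2) i i) = (\<Sum>i<N. \<Sum>k<N. ?F N i k * ?B N k i)" by (simp add: fpow.simps(2)[of _ _ "Suc r"])
    also have "\<dots> = (\<Sum>i<N. \<Sum>k<N. ?F N i k * ?B N i k)" by (simp only: samp_def t_commute[OF vX vX])
    finally show ?thesis by (simp add: left_diff_distrib sum_subtractf del: fpow.simps)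
  qed
  have "(\<lambda>N. \<Sum>i<N. \<Sum>k<N. (?F N i k - ?S N i k) * ?B N i k) \<longlonglongrightarrow> 0"
  proof (rule Lim_null_comparison)
    have "(\<lambda>N. frob N (\<lambda>i j. ?F N i j - ?S N i j) * C) \<longlonglongrightarrow> 0 * C"
      by (intro tendsto_mult tendsto_const fpow_samp_jac_comb[OF v])
    then show "(\<lambda>N. frob N (\<lambda>i j. ?F N i j - ?S N i j) * C) \<longlonglongrightarrow> 0" by simp
    show "eventually (\<lambda>N. norm (\<Sum>i<N. \<Sum>k<N. (?F N i k - ?S N i k) * ?B N i k) \<le> frob N (\<lambda>i j. ?F N i j - ?S N i j) * C) sequentially"
    proof (intro always_eventually allI)
      fix N
      have "\<bar>\<Sum>i<N. \<Sum>k<N. (?F N i k - ?S N i k) * ?B N i k\<bar> \<le> frob N (\<lambda>i j. ?F N i j - ?S N i j) * frob N (?B N)"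
        by (rule frob_inner)
      also have "\<dots> \<le> frob N (\<lambda>i j. ?F N i j - ?S N i j) * C" using C by (intro mult_left_mono) auto
      finally show "norm (\<Sum>i<N. \<Sum>k<N. (?F N i k - ?S N i k) * ?B N i k) \<le> frob N (\<lambda>i j. ?F N i j - ?S N i j) * C"
        by (simp only: real_norm_def)
    qed
  qed
  moreover have "(\<lambda>N. \<Sum>i<N. \<Sum>k<N. ?S N i k * ?B N i k) \<longlonglongrightarrow> (\<Sum>k\<le>K. jac_dim a b k * e k ^ (r + 2))"
    using frob_samp_inner[OF v, of "jac_comb e K (Suc r)" "jac_comb e K 1"] unfolding jac_comb_inner by simp
  ultimately show ?thesis unfolding tr by (rule tendsto_add[of _ 0, simplified add_0])
qed

end

lemma spec_fpow:
  assumes "\<And>i j. i < N \<Longrightarrow> j < N \<Longrightarrow> f i j = f j i"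
  shows "(\<Sum>x\<in>#spec (mat N N (\<lambda>(i, j). f i j)). x ^ r) = (\<Sum>i<N. fpow N f r i i)"
  by (subst spec_power_sum[of _ N]) (use assms in \<open>auto simp: pow_mat_fpow\<close>)

lemma spec_frob_bound:
  assumes sym: "\<And>i j. i < N \<Longrightarrow> j < N \<Longrightarrow> f i j = f j i"
    and x: "x \<in># spec (mat N N (\<lambda>(i, j). f i j))" and R: "frob N f \<le> R"
  shows "\<bar>x\<bar> \<le> R"
proof (rule spec_bounded[OF _ _ x])
  have "(\<Sum>i<N. fpow N f 2 i i) = (\<Sum>i<N. \<Sum>k<N. f i k * f k i)"
    unfolding numeral_2_eq_2 fpow_Suc_fmult[of N f "Suc 0"] fmult_def
    by (intro sum.cong refl) (simp only: fpow_1 lessThan_iff)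
  also have "\<dots> = (\<Sum>i<N. \<Sum>k<N. (f i k)\<^sup>2)"
    by (intro sum.cong refl) (simp add: power2_eq_square sym)
  also have "\<dots> = (frob N f)\<^sup>2" by (simp add: frob_square)
  also have "\<dots> \<le> R\<^sup>2" using R by (intro power_mono) auto
  finally show "(\<Sum>i<N. (mat N N (\<lambda>(i, j). f i j) ^\<^sub>m 2) $$ (i, i)) \<le> R\<^sup>2" by (simp add: pow_mat_fpow)
  show "0 \<le> R" using R frob_nonneg[of N f] by linarith
qed (use sym in auto)

context zonal_space
begin

text \<open>The matrix sampled from \<open>jac_dim a b k\<close> times \<open>jac a b k\<close>
  behaves asymptotically like a projection: all power sums of order at least 2 tend to
  \<open>jac_dim a b k\<close>, which is then a limit of eigenvalue counts.\<close>

lemma jac_dim_Nats: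
  assumes v: "equidistributed v"
  shows "jac_dim a b k \<in> \<nat>"
proof -
  define e where "e = (\<lambda>l. if l = k then 1 else 0 :: real)"
  define p where "p = jac_comb e k 1"
  obtain R where R: "1 \<le> R" "\<And>N. frob N (samp v N p) \<le> R" using frob_samp_bounded[of p] v by blast
  have vX: "v i \<in> X" for i using v by (simp add: equidistributed_def)
  have sym: "samp v N p i j = samp v N p j i" for N i j by (simp add: samp_def t_commute vX)
  define S where "S N = spec (mat N N (\<lambda>(i, j). samp v N p i j))" for N
  show ?thesis
  proof (rule power_sums_constant_imp_nat)
    show "\<bar>x\<bar> \<le> R" if "x \<in># S N" for N x
      using that R(2)[of N] unfolding S_def by (intro spec_frob_bound[of N "samp v N p"] sym) auto
    show "0 \<le> jac_dim a b k" using jac_dim_pos[OF ab, of k] by simp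
    fix r :: nat assume "2 \<le> r"
    then obtain r' where r: "r = r' + 2" by (metis add.commute le_Suc_ex)
    have "(\<Sum>l\<le>k. jac_dim a b l * e l ^ (r' + 2)) = (\<Sum>l\<le>k. if l = k then jac_dim a b k else 0)"
      by (intro sum.cong) (auto simp: e_def)
    also have "\<dots> = jac_dim a b k" by simp
    finally have lim: "(\<Sum>l\<le>k. jac_dim a b l * e l ^ (r' + 2)) = jac_dim a b k" .
    have "(\<Sum>x\<in>#S N. x ^ r) = (\<Sum>i<N. fpow N (samp v N p) (r' + 2) i i)" for N
      unfolding S_def r by (rule spec_fpow[OF sym])
    then show "(\<lambda>N. \<Sum>x\<in>#S N. x ^ r) \<longlonglongrightarrow> jac_dim a b k"
      using trace_samp_jac_comb[OF v, of e k r'] unfolding lim p_def by (simp only:)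
  qed (rule R)
qed

text \<open>The polynomial p is fixed before N. The traces of its sampled matrix have explicit
  limits, its Frobenius distance to the scaled adjacency matrix is governed by (q - p)^2, and its
  coefficients e are close to c by Bessel's inequality.\<close>

theorem gk_threshold_graph:
  assumes v: "equidistributed v" and thr: "\<And>i j. d (v i) (v j) \<le> L \<longleftrightarrow> s0 \<le> t (v i) (v j)"
  shows "(\<lambda>N. gk_to_limit (spec ((1 / real N) \<cdot>\<^sub>m rgg_adj d L N v)) (threshold_coeff a b s0) (jac_dim a b)) \<longlonglongrightarrow> 0"
proof -
  interpret beta: prob_space "beta_measure a b" by (rule prob_space_beta_measure[OF ab])
  define c where "c = threshold_coeff a b s0"
  have vX: "v i \<in> X" for i using v by (simp add: equidistributed_def)
  have "\<exists>m. jac_dim a b k = real m" for k using jac_dim_Nats[OF v, of k] by (auto elim: Nats_cases)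
  then obtain m where m: "\<And>k. jac_dim a b k = real (m k)" by metis
  have m1: "1 \<le> m k" for k using jac_dim_pos[OF ab, of k] by (simp add: m)
  have bessel0: "(\<Sum>k\<le>K. real (m k) * (c k)\<^sup>2) \<le> 1" for K
  proof -
    have "(\<Sum>k\<le>K. real (m k) * (c k)\<^sup>2) \<le> (\<integral>s. ((if s0 \<le> s then 1 else 0) - poly 0 s)\<^sup>2 \<partial>beta_measure a b)"
      using threshold_bessel[OF ab, of s0 0 K] by (simp add: m c_def beta_exp_0)
    also have "\<dots> \<le> (\<integral>s. 1 \<partial>beta_measure a b)"
      by (rule integral_mono_AE) (auto intro!: integrable_beta_measure[OF ab, where C = 1])
    finally show ?thesis using beta.prob_space by simp
  qed
  have smc: "summable (\<lambda>k. real (m k) * (c k)\<^sup>2)"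
    using bessel0 by (intro bounded_imp_summable[where B = 1]) auto
  have G: "(\<Sum>k. real (m k) * (c k)\<^sup>2) \<le> 1"
  proof (rule suminf_le_const[OF smc])
    show "(\<Sum>k<n. real (m k) * (c k)\<^sup>2) \<le> 1" for n
      by (rule order_trans[OF sum_mono2 bessel0[of n]]) auto
  qed
  have sq_le: "\<bar>y\<bar> \<le> 1" if "real (m k) * y\<^sup>2 \<le> 1" for y :: real and k
  proof -
    have "1 * y\<^sup>2 \<le> real (m k) * y\<^sup>2" using m1[of k] by (intro mult_right_mono) auto
    with that have "y\<^sup>2 \<le> 1\<^sup>2" by simp
    then show ?thesis by (metis abs_le_square_iff abs_one)
  qed
  have c1: "\<bar>c k\<bar> \<le> 1" for k
  proof (rule sq_le)
    have "real (m k) * (c k)\<^sup>2 \<le> (\<Sum>k\<le>k. real (m k) * (c k)\<^sup>2)"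
      by (rule member_le_sum) auto
    then show "real (m k) * (c k)\<^sup>2 \<le> 1" using bessel0[of k] by linarith
  qed
  define A where "A N = (\<lambda>i j. (if i \<noteq> j \<and> d (v i) (v j) \<le> L then 1 else 0) / real N)" for N :: nat
  have Asym: "A N i j = A N j i" for N i j unfolding A_def thr by (auto simp: t_commute[OF vX vX])
  define S where "S N = spec (mat N N (\<lambda>(i, j). A N i j))" for N
  have AS: "spec ((1 / real N) \<cdot>\<^sub>m rgg_adj d L N v) = S N" for N
    unfolding S_def by (rule arg_cong[where f = spec]) (auto simp: rgg_adj_def A_def)
  have A1: "frob N (A N) \<le> 1" for N
  proof -
    have "(\<Sum>i<N. \<Sum>j<N. (A N i j)\<^sup>2) \<le> (\<Sum>i<N. \<Sum>j<N. (1 / real N)\<^sup>2)"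
      by (intro sum_mono power_mono) (auto simp: A_def)
    also have "\<dots> \<le> 1" by (cases "N = 0") (auto simp: power2_eq_square)
    finally show ?thesis by (simp add: frob_le_iff)
  qed
  have mom: "(\<lambda>N. \<Sum>x\<in>#S N. x ^ r) \<longlonglongrightarrow> (\<Sum>k. real (m k) * c k ^ r)" if "2 \<le> r" for r
  proof (rule tendstoI)
    fix \<eta> :: real assume "0 < \<eta>"
    obtain r' where r: "r = r' + 2" using \<open>2 \<le> r\<close> by (metis add.commute le_Suc_ex)
    define C0 where "C0 = real r * 2 ^ r"
    have "1 * 1 \<le> C0" using \<open>2 \<le> r\<close> unfolding C0_def by (intro mult_mono) auto
    then have C0: "1 \<le> C0" by simp
    \<comment> \<open>Error budget: C0 \<sigma> from the matrices, 11 C0 \<sigma> from the series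
      and \<eta>/3 from the sampled trace. The factor 39 makes 12 C0 \<sigma> + \<eta>/3 smaller
      than \<eta>.\<close>
    define \<sigma> where "\<sigma> = min 1 (\<eta> / (39 * C0))"
    have \<sigma>: "0 < \<sigma>" "\<sigma> \<le> 1" "39 * C0 * \<sigma> \<le> \<eta>"
    proof -
      show "0 < \<sigma>" "\<sigma> \<le> 1" using \<open>0 < \<eta>\<close> C0 by (auto simp: \<sigma>_def)
      have "39 * C0 * \<sigma> \<le> 39 * C0 * (\<eta> / (39 * C0))" using C0 by (intro mult_left_mono) (auto simp: \<sigma>_def)
      then show "39 * C0 * \<sigma> \<le> \<eta>" using C0 by simp
    qed
    obtain p q where pq: "\<And>s. s \<in> {0..1} \<Longrightarrow> poly p s \<le> (if s0 \<le> s then 1 else 0) \<and> (if s0 \<le> s then 1 else 0) \<le> poly q s \<and> \<bar>poly p s\<bar> \<le> 2"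
      and E: "beta_exp a b ((q - p) ^ 2) < \<sigma>\<^sup>2"
      using threshold_sandwich[OF ab zero_less_power[OF \<sigma>(1), of 2], of s0] by blast
    have hp: "((if s0 \<le> s then 1 else 0) - poly p s)\<^sup>2 \<le> poly ((q - p)\<^sup>2) s" if "s \<in> {0..1}" for s
      unfolding poly_power poly_diff using pq[OF that] by (intro power_mono) auto
    define e where "e k = beta_exp a b (p * jac a b k)" for k
    define f where "f k = c k - e k" for k
    \<comment> \<open>p has no components above its degree, so it is exactly the finite Jacobi sum
      with eigenvalues e.\<close>
    define K where "K = degree p"
    have p: "p = jac_comb e K 1"
      unfolding jac_comb_def e_def power_one_right using poly_jac_expansion[OF ab, of p K] by (simp add: K_def mult.commute)
    have eK: "e k = 0" if "K < k" for k
      using that beta_exp_jac_mult[OF ab, of p k] unfolding e_def K_def by (simp add: mult.commute coeff_eq_0)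
    have bessel: "(\<Sum>k\<le>M. real (m k) * (f k)\<^sup>2) \<le> \<sigma>\<^sup>2" for M
    proof -
      have "(\<Sum>k\<le>M. real (m k) * (f k)\<^sup>2) \<le> (\<integral>s. ((if s0 \<le> s then 1 else 0) - poly p s)\<^sup>2 \<partial>beta_measure a b)"
        using threshold_bessel[OF ab, of s0 p M] by (simp add: m c_def f_def e_def)
      also have "\<dots> \<le> beta_exp a b ((q - p)\<^sup>2)"
        unfolding beta_exp_def
      proof (rule integral_mono_AE)
        show "integrable (beta_measure a b) (\<lambda>s. ((if s0 \<le> s then 1 else 0) - poly p s)\<^sup>2)"
        proof (rule integrable_beta_measure[OF ab, where C = 9])
          fix s :: real assume "0 < s" "s < 1"
          then have "\<bar>(if s0 \<le> s then 1 else 0) - poly p s\<bar> \<le> 3" using pq[of s] by auto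
          then have "\<bar>(if s0 \<le> s then 1 else 0) - poly p s\<bar>\<^sup>2 \<le> 3\<^sup>2" by (rule power_mono) simp
          then show "\<bar>((if s0 \<le> s then 1 else 0) - poly p s)\<^sup>2\<bar> \<le> 9" by simp
        qed measurable
        show "integrable (beta_measure a b) (poly ((q - p)\<^sup>2))" by (rule integrable_beta_poly[OF ab])
        show "AE s in beta_measure a b. ((if s0 \<le> s then 1 else 0) - poly p s)\<^sup>2 \<le> poly ((q - p)\<^sup>2) s"
          using AE_beta_measure[of a b] by eventually_elim (rule hp, auto)
      qed
      finally show ?thesis using E by linarith
    qed
    have smf: "summable (\<lambda>k. real (m k) * (f k)\<^sup>2)"
      using bessel by (intro bounded_imp_summable[where B = "\<sigma>\<^sup>2"]) auto
    have F: "(\<Sum>k. real (m k) * (f k)\<^sup>2) \<le> \<sigma>\<^sup>2"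
    proof (rule suminf_le_const[OF smf])
      show "(\<Sum>k<n. real (m k) * (f k)\<^sup>2) \<le> \<sigma>\<^sup>2" for n
        by (rule order_trans[OF sum_mono2 bessel[of n]]) auto
    qed
    have f1: "\<bar>f k\<bar> \<le> 1" for k
    proof (rule sq_le)
      have "real (m k) * (f k)\<^sup>2 \<le> (\<Sum>k\<le>k. real (m k) * (f k)\<^sup>2)" by (rule member_le_sum) auto
      also have "\<dots> \<le> \<sigma>\<^sup>2" by (rule bessel)
      also have "\<dots> \<le> 1" using \<sigma> by (simp add: power_le_one)
      finally show "real (m k) * (f k)\<^sup>2 \<le> 1" .
    qed
    have e2: "\<bar>e k\<bar> \<le> 2" for k using c1[of k] f1[of k] by (simp add: f_def)
    \<comment> \<open>From x y \<le> x^2/\<sigma> + \<sigma> y^2 with x = |f k| and y = |c k| + |e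
      k|, where y^2 \<le> 6 (c k)^2 + 4 (f k)^2. The weighted squares of f sum to at most \<sigma>^2
      and those of c to at most 1, so the total is of order \<sigma>.\<close>
    let ?g = "\<lambda>k. (1 / \<sigma> + 4 * \<sigma>) * (real (m k) * (f k)\<^sup>2) + 6 * \<sigma> * (real (m k) * (c k)\<^sup>2)"
    have trm: "\<bar>real (m k) * c k ^ r - real (m k) * e k ^ r\<bar> \<le> C0 * ?g k" for k
    proof -
      have amgm: "x * y \<le> x\<^sup>2 / \<sigma> + \<sigma> * y\<^sup>2" for x y :: real
      proof -
        have "0 \<le> (x - \<sigma> * y)\<^sup>2 + x\<^sup>2 + (\<sigma> * y)\<^sup>2" by simp
        then have "\<sigma> * (x * y) \<le> x\<^sup>2 + \<sigma>\<^sup>2 * y\<^sup>2" by (simp add: power2_eq_square algebra_simps)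
        then have "(\<sigma> * (x * y)) / \<sigma> \<le> (x\<^sup>2 + \<sigma>\<^sup>2 * y\<^sup>2) / \<sigma>" using \<sigma> by (intro divide_right_mono) auto
        then show ?thesis using \<sigma> by (simp add: add_divide_distrib power2_eq_square)
      qed
      have sqb: "(\<bar>c k\<bar> + \<bar>e k\<bar>)\<^sup>2 \<le> 6 * (c k)\<^sup>2 + 4 * (f k)\<^sup>2"
      proof -
        have "(\<bar>c k\<bar> + \<bar>e k\<bar>)\<^sup>2 \<le> (\<bar>c k\<bar> + (\<bar>c k\<bar> + \<bar>f k\<bar>))\<^sup>2" by (intro power_mono) (auto simp: f_def)
        also have "\<dots> \<le> 6 * \<bar>c k\<bar>\<^sup>2 + 4 * \<bar>f k\<bar>\<^sup>2"
        proof -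
          have "(x + (x + y))\<^sup>2 \<le> 6 * x\<^sup>2 + 4 * y\<^sup>2" for x y :: real
          proof -
            have "6 * x\<^sup>2 + 4 * y\<^sup>2 - (x + (x + y))\<^sup>2 = 2 * (x - y)\<^sup>2 + y\<^sup>2" by (simp add: power2_eq_square algebra_simps)
            then show ?thesis using zero_le_power2[of "x - y"] zero_le_power2[of y] by linarith
          qed
          then show ?thesis .
        qed
        finally show ?thesis by simp
      qed
      have st: "\<sigma> * (\<bar>c k\<bar> + \<bar>e k\<bar>)\<^sup>2 \<le> \<sigma> * (6 * (c k)\<^sup>2 + 4 * (f k)\<^sup>2)"
        using sqb \<sigma> by (intro mult_left_mono) auto
      have am: "\<bar>f k\<bar> * (\<bar>c k\<bar> + \<bar>e k\<bar>) \<le> (f k)\<^sup>2 / \<sigma> + \<sigma> * (\<bar>c k\<bar> + \<bar>e k\<bar>)\<^sup>2"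
        using amgm[of "\<bar>f k\<bar>" "\<bar>c k\<bar> + \<bar>e k\<bar>"] by simp
      have "\<bar>c k - e k\<bar> * (\<bar>c k\<bar> + \<bar>e k\<bar>) \<le> (f k)\<^sup>2 / \<sigma> + \<sigma> * (6 * (c k)\<^sup>2 + 4 * (f k)\<^sup>2)"
        using am st unfolding f_def by linarith
      then have 1: "C0 * (\<bar>c k - e k\<bar> * (\<bar>c k\<bar> + \<bar>e k\<bar>)) \<le> C0 * ((f k)\<^sup>2 / \<sigma> + \<sigma> * (6 * (c k)\<^sup>2 + 4 * (f k)\<^sup>2))"
        using C0 by (intro mult_left_mono) auto
      have "\<bar>c k\<bar> \<le> 2" using c1[of k] by linarith
      from power_diff_bound[OF this e2[of k], of r']
      have "\<bar>c k ^ r - e k ^ r\<bar> \<le> C0 * (\<bar>c k - e k\<bar> * (\<bar>c k\<bar> + \<bar>e k\<bar>))" unfolding C0_def r .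
      with 1 have "\<bar>c k ^ r - e k ^ r\<bar> \<le> C0 * ((f k)\<^sup>2 / \<sigma> + \<sigma> * (6 * (c k)\<^sup>2 + 4 * (f k)\<^sup>2))" by linarith
      then have "real (m k) * \<bar>c k ^ r - e k ^ r\<bar> \<le> real (m k) * (C0 * ((f k)\<^sup>2 / \<sigma> + \<sigma> * (6 * (c k)\<^sup>2 + 4 * (f k)\<^sup>2)))"
        by (intro mult_left_mono) auto
      moreover have "\<bar>real (m k) * c k ^ r - real (m k) * e k ^ r\<bar> = real (m k) * \<bar>c k ^ r - e k ^ r\<bar>"
        unfolding right_diff_distrib[symmetric] abs_mult by simp
      moreover have "real (m k) * (C0 * ((f k)\<^sup>2 / \<sigma> + \<sigma> * (6 * (c k)\<^sup>2 + 4 * (f k)\<^sup>2))) = C0 * ?g k"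
        by (simp add: algebra_simps divide_inverse)
      ultimately show ?thesis by linarith
    qed
    have smg: "summable ?g" by (intro summable_add summable_mult smf smc)
    have sumg: "suminf ?g \<le> 11 * \<sigma>"
    proof -
      have "suminf ?g = (1 / \<sigma> + 4 * \<sigma>) * (\<Sum>k. real (m k) * (f k)\<^sup>2) + 6 * \<sigma> * (\<Sum>k. real (m k) * (c k)\<^sup>2)"
        by (subst suminf_add[symmetric, OF summable_mult[OF smf] summable_mult[OF smc]])
           (simp only: suminf_mult[OF smf] suminf_mult[OF smc])
      also have "\<dots> \<le> (1 / \<sigma> + 4 * \<sigma>) * \<sigma>\<^sup>2 + 6 * \<sigma> * 1"
        using F G \<sigma> by (intro add_mono mult_left_mono) auto
      also have "\<dots> = 7 * \<sigma> + 4 * (\<sigma> * \<sigma>\<^sup>2)" 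
      proof -
        have "1 / \<sigma> * \<sigma>\<^sup>2 = \<sigma>" using \<sigma> by (simp add: power2_eq_square)
        then show ?thesis by (simp add: algebra_simps)
      qed
      also have "\<dots> \<le> 7 * \<sigma> + 4 * (\<sigma> * 1)" using \<sigma> by (intro add_mono mult_left_mono order_refl) (auto simp: power_le_one)
      finally show ?thesis by simp
    qed
    have sme: "summable (\<lambda>k. real (m k) * e k ^ r)" using eK \<open>2 \<le> r\<close>
      by (intro summable_finite[of "{..K}"]) auto
    have smd: "summable (\<lambda>k. \<bar>real (m k) * c k ^ r - real (m k) * e k ^ r\<bar>)"
    proof (rule summable_comparison_test'[OF summable_mult[OF smg, of C0]])
      show "norm \<bar>real (m k) * c k ^ r - real (m k) * e k ^ r\<bar> \<le> C0 * ?g k" for k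
        using trm[of k] by (simp only: real_norm_def abs_idempotent)
    qed
    have smcr: "summable (\<lambda>k. real (m k) * c k ^ r)"
      using summable_add[OF summable_rabs_cancel[OF smd] sme] by simp
    have series: "\<bar>(\<Sum>k. real (m k) * c k ^ r) - (\<Sum>k. real (m k) * e k ^ r)\<bar> \<le> C0 * (11 * \<sigma>)"
    proof -
      have "\<bar>(\<Sum>k. real (m k) * c k ^ r) - (\<Sum>k. real (m k) * e k ^ r)\<bar> = \<bar>\<Sum>k. real (m k) * c k ^ r - real (m k) * e k ^ r\<bar>"
        by (simp add: suminf_diff[OF smcr sme])
      also have "\<dots> \<le> (\<Sum>k. \<bar>real (m k) * c k ^ r - real (m k) * e k ^ r\<bar>)" by (rule summable_rabs[OF smd])
      also have "\<dots> \<le> (\<Sum>k. C0 * ?g k)" by (intro suminf_le trm smd summable_mult smg)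
      also have "\<dots> = C0 * suminf ?g" by (rule suminf_mult[OF smg])
      also have "\<dots> \<le> C0 * (11 * \<sigma>)" using sumg C0 by (intro mult_left_mono) auto
      finally show ?thesis .
    qed
    let ?B = "\<lambda>N. samp v N p"
    have trB: "(\<lambda>N. \<Sum>i<N. fpow N (?B N) r i i) \<longlonglongrightarrow> (\<Sum>k. real (m k) * e k ^ r)"
    proof -
      have "(\<Sum>k. real (m k) * e k ^ r) = (\<Sum>k\<le>K. jac_dim a b k * e k ^ (r' + 2))"
        using eK \<open>2 \<le> r\<close> by (subst suminf_finite[of "{..K}"]) (auto simp: m r)
      then show ?thesis using trace_samp_jac_comb[OF v, of e K r', folded p] by (simp only: r)
    qed
    then have ev1: "eventually (\<lambda>N. \<bar>(\<Sum>i<N. fpow N (?B N) r i i) - (\<Sum>k. real (m k) * e k ^ r)\<bar> < \<eta> / 3) sequentially"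
      using \<open>0 < \<eta>\<close> by (auto dest!: tendstoD[of _ _ _ "\<eta> / 3"] simp: dist_real_def)
    have B2: "frob N (?B N) \<le> 2" for N
    proof -
      have "(\<Sum>i<N. \<Sum>j<N. (?B N i j)\<^sup>2) \<le> (\<Sum>i<N. \<Sum>j<N. (2 / real N)\<^sup>2)"
      proof (intro sum_mono)
        fix i j
        have "\<bar>poly p (t (v i) (v j))\<bar> \<le> 2" using pq[of "t (v i) (v j)"] t_range[OF vX vX] by auto
        then have "\<bar>?B N i j\<bar> \<le> \<bar>2 / real N\<bar>" unfolding samp_def abs_divide by (intro divide_right_mono) auto
        then show "(?B N i j)\<^sup>2 \<le> (2 / real N)\<^sup>2" by (simp only: abs_le_square_iff)
      qed
      also have "\<dots> \<le> 2\<^sup>2" by (cases "N = 0") (auto simp: power2_eq_square)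
      finally show ?thesis by (subst frob_le_iff) auto
    qed
    \<comment> \<open>The adjacency matrix has zero diagonal whereas the sampled one has p(1)/N
      there; this adds p(1)^2/N to the squared distance.\<close>
    have "(\<lambda>N. (\<Sum>i<N. \<Sum>j<N. poly ((q - p)\<^sup>2) (t (v i) (v j))) / (real N)\<^sup>2 + (poly p 1)\<^sup>2 * (1 / real N)) \<longlonglongrightarrow> beta_exp a b ((q - p)\<^sup>2) + (poly p 1)\<^sup>2 * 0"
      by (intro tendsto_add double_average[OF v] tendsto_mult tendsto_const lim_1_over_n)
    from order_tendstoD(2)[OF this, of "\<sigma>\<^sup>2"] E
    have ev2: "eventually (\<lambda>N. (\<Sum>i<N. \<Sum>j<N. poly ((q - p)\<^sup>2) (t (v i) (v j))) / (real N)\<^sup>2 + (poly p 1)\<^sup>2 * (1 / real N) < \<sigma>\<^sup>2) sequentially"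
      by simp
    show "eventually (\<lambda>N. dist (\<Sum>x\<in>#S N. x ^ r) (\<Sum>k. real (m k) * c k ^ r) < \<eta>) sequentially"
      using ev1 ev2 eventually_gt_at_top[of 0]
    proof eventually_elim
      case (elim N)
      have ent: "(A N i j - ?B N i j)\<^sup>2 \<le> poly ((q - p)\<^sup>2) (t (v i) (v j)) / (real N)\<^sup>2 + (if i = j then (poly p 1)\<^sup>2 / (real N)\<^sup>2 else 0)" for i j
      proof (cases "i = j")
        case True
        have "0 \<le> poly ((q - p)\<^sup>2) (t (v i) (v j)) / (real N)\<^sup>2" by simp
        then show ?thesis using True by (simp add: A_def samp_def t_self[OF vX] power_divide)
      next
        case False
        have "A N i j - ?B N i j = ((if s0 \<le> t (v i) (v j) then 1 else 0) - poly p (t (v i) (v j))) / real N"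
          using False by (simp add: A_def thr samp_def diff_divide_distrib)
        then show ?thesis using False hp[of "t (v i) (v j)"] t_range[OF vX vX] elim
          by (simp add: power_divide divide_right_mono)
      qed
      have "(\<Sum>i<N. \<Sum>j<N. (A N i j - ?B N i j)\<^sup>2) \<le> (\<Sum>i<N. \<Sum>j<N. poly ((q - p)\<^sup>2) (t (v i) (v j)) / (real N)\<^sup>2 + (if i = j then (poly p 1)\<^sup>2 / (real N)\<^sup>2 else 0))"
        by (intro sum_mono ent)
      also have "\<dots> = (\<Sum>i<N. \<Sum>j<N. poly ((q - p)\<^sup>2) (t (v i) (v j))) / (real N)\<^sup>2 + (poly p 1)\<^sup>2 * (1 / real N)"
        using elim by (simp add: sum.distrib sum_divide_distrib[symmetric] power2_eq_square)
      finally have "(\<Sum>i<N. \<Sum>j<N. (A N i j - ?B N i j)\<^sup>2) \<le> \<sigma>\<^sup>2" using elim by linarith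
      then have AB: "frob N (\<lambda>i j. A N i j - ?B N i j) \<le> \<sigma>" using \<sigma> by (subst frob_le_iff) auto
      have "\<bar>(\<Sum>i<N. fpow N (A N) r i i) - (\<Sum>i<N. fpow N (?B N) r i i)\<bar> \<le> real (Suc (Suc r')) * 2 ^ Suc r' * frob N (\<lambda>i j. A N i j - ?B N i j)"
      proof -
        have "frob N (A N) \<le> 2" using A1[of N] by linarith
        from trace_fpow_diff[OF this B2[of N], of r'] show ?thesis by (simp add: r)
      qed
      also have "\<dots> \<le> C0 * \<sigma>" unfolding C0_def r using AB \<sigma> by (intro mult_mono) auto
      finally have d1: "\<bar>(\<Sum>i<N. fpow N (A N) r i i) - (\<Sum>i<N. fpow N (?B N) r i i)\<bar> \<le> C0 * \<sigma>" .
      have "(\<Sum>x\<in>#S N. x ^ r) = (\<Sum>i<N. fpow N (A N) r i i)" unfolding S_def by (rule spec_fpow[OF Asym])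
      moreover have "C0 * (11 * \<sigma>) = 11 * (C0 * \<sigma>)" "39 * C0 * \<sigma> = 39 * (C0 * \<sigma>)" "0 < C0 * \<sigma>" using C0 \<sigma> by auto
      ultimately show ?case using d1 elim(1) series \<sigma>(3) \<open>0 < \<eta>\<close> unfolding dist_real_def by linarith
    qed
  qed
  have Sb: "\<bar>x\<bar> \<le> 1" if "x \<in># S N" for N x
    using that unfolding S_def by (intro spec_frob_bound[OF Asym _ A1]) auto
  have "(\<lambda>N. gk_to_limit (S N) c (\<lambda>k. real (m k))) \<longlonglongrightarrow> 0"
    by (rule power_sums_imp_gk_to_limit[OF Sb c1 m1 smc mom])
  moreover have "jac_dim a b = (\<lambda>k. real (m k))" by (rule ext) (rule m)
  ultimately show ?thesis unfolding AS c_def by (simp only:)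
qed

end

section \<open>Almost sure equidistribution of independent samples\<close>

text \<open>Hoeffding's inequality on [-1, 1] bounds the probability of a fixed deviation
  geometrically in N; Borel-Cantelli applied to the deviations 1/(j + 1) gives almost sure
  convergence.\<close>

lemma bounded_strong_law:
  fixes Z :: "nat \<Rightarrow> 'w \<Rightarrow> real"
  assumes "prob_space M" and indep: "prob_space.indep_vars M (\<lambda>_. borel) Z UNIV"
    and dist: "\<And>i. distr M borel (Z i) = distr M borel (Z 0)"
    and bd: "\<And>i \<omega>. \<omega> \<in> space M \<Longrightarrow> \<bar>Z i \<omega>\<bar> \<le> 1"
  shows "AE \<omega> in M. (\<lambda>N. (\<Sum>i<N. Z i \<omega>) / real N) \<longlonglongrightarrow> (\<integral>\<omega>. Z 0 \<omega> \<partial>M)"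
proof -
  interpret prob_space M by fact
  have rv [measurable]: "Z i \<in> borel_measurable M" for i using indep by (simp add: indep_vars_def)
  define E where "E = (\<integral>\<omega>. Z 0 \<omega> \<partial>M)"
  have ae: "AE \<omega> in M. eventually (\<lambda>N. \<bar>(\<Sum>i<N. Z i \<omega>) / real N - E\<bar> < 1 / real (Suc j)) sequentially" for j
  proof -
    define \<epsilon> where "\<epsilon> = 1 / real (Suc j)"
    define B where "B N = {\<omega>\<in>space M. \<epsilon> \<le> \<bar>(\<Sum>i<N. Z i \<omega>) / real N - E\<bar>}" for N :: nat
    have \<epsilon>: "0 < \<epsilon>" by (simp add: \<epsilon>_def)
    have H: "measure M (B N) \<le> 2 * exp (- \<epsilon>\<^sup>2 / 2) ^ N" if "0 < N" for N
    proof -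
      interpret H: Hoeffding_ineq_iid M "{..<N}" Z "Z 0" "-1" 1 E
        using dist bd rv unfolding E_def
        by unfold_locales (auto intro!: indep_vars_subset[OF indep] AE_I2 simp: abs_le_iff minus_le_iff)
      have "measure M (B N) \<le> 2 * exp (- 2 * real N * \<epsilon>\<^sup>2 / 2\<^sup>2)"
        using H.Hoeffding_ineq_abs_ge'[of \<epsilon>] that \<epsilon> by (auto simp: B_def)
      also have "exp (- 2 * real N * \<epsilon>\<^sup>2 / 2\<^sup>2) = exp (- \<epsilon>\<^sup>2 / 2) ^ N"
        by (simp add: exp_of_nat_mult[symmetric] power2_eq_square mult_ac)
      finally show ?thesis .
    qed
    have "AE \<omega> in M. eventually (\<lambda>N. \<omega> \<in> space M - B N) sequentially"
    proof (rule borel_cantelli_AE1)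
      show "B N \<in> sets M" for N unfolding B_def by measurable
      show "emeasure M (B N) < \<infinity>" for N by (simp add: less_top[symmetric])
      have "summable (\<lambda>N. 2 * exp (- \<epsilon>\<^sup>2 / 2) ^ N)" using \<epsilon> by (intro summable_mult summable_geometric) simp
      then show "summable (\<lambda>N. measure M (B N))"
        by (rule summable_comparison_test'[where N = 1]) (use H in auto)
    qed
    then show ?thesis
    proof eventually_elim
      case (elim \<omega>)
      then show ?case by eventually_elim (auto simp: B_def \<epsilon>_def not_le)
    qed
  qed
  have "AE \<omega> in M. \<forall>j. eventually (\<lambda>N. \<bar>(\<Sum>i<N. Z i \<omega>) / real N - E\<bar> < 1 / real (Suc j)) sequentially"
    using ae by (simp add: AE_all_countable)
  then show ?thesis
  proof eventually_elim
    case (elim \<omega>)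
    show ?case
    proof (rule tendstoI)
      fix e :: real assume "0 < e"
      then obtain j where j: "1 / real (Suc j) < e" using nat_approx_posE by metis
      from elim have "eventually (\<lambda>N. \<bar>(\<Sum>i<N. Z i \<omega>) / real N - E\<bar> < 1 / real (Suc j)) sequentially" by blast
      then show "eventually (\<lambda>N. dist ((\<Sum>i<N. Z i \<omega>) / real N) (\<integral>\<omega>. Z 0 \<omega> \<partial>M) < e) sequentially"
        by eventually_elim (use j in \<open>auto simp: dist_real_def E_def\<close>)
    qed
  qed
qed

context zonal_space
begin

text \<open>The strong law for each word; words form a countable type, so the exceptional null sets
  can be united.\<close>

lemma AE_equidistributed:
  assumes iid: "iid_sample X d P \<mu> Y" and sets: "sets \<mu> = sets (ball_sigma X d)"
  shows "AE \<omega> in P. equidistributed (\<lambda>i. Y i \<omega>)"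
proof -
  let ?S = "ball_sigma X d"
  interpret P: prob_space P using iid by (simp add: iid_sample_def)
  have spS: "space ?S = X" using sets_eq_imp_space_eq[OF sets] by (simp add: space_\<mu>)
  have Ym [measurable]: "Y i \<in> measurable P ?S" and Yd: "distr P ?S (Y i) = \<mu>" for i
    using iid by (simp_all add: iid_sample_def)
  have YX: "Y i \<omega> \<in> X" if "\<omega> \<in> space P" for i \<omega> using measurable_space[OF Ym that] by (simp add: spS)
  have "AE \<omega> in P. set w \<subseteq> {..<D} \<longrightarrow> (\<lambda>N. (\<Sum>i<N. \<Prod>e\<leftarrow>w. u e (Y i \<omega>)) / real N) \<longlonglongrightarrow> (\<integral>y. (\<Prod>e\<leftarrow>w. u e y) \<partial>\<mu>)" for w
  proof (cases "set w \<subseteq> {..<D}")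
    case True
    define f where "f y = (\<Prod>e\<leftarrow>w. u e y)" for y
    have "f \<in> borel_measurable \<mu>" using word_measurable[OF True] by (simp add: f_def[abs_def])
    then have fm [measurable]: "f \<in> borel_measurable ?S" using measurable_cong_sets[OF sets refl] by blast
    have "AE \<omega> in P. (\<lambda>N. (\<Sum>i<N. f (Y i \<omega>)) / real N) \<longlonglongrightarrow> (\<integral>\<omega>. f (Y 0 \<omega>) \<partial>P)"
    proof (rule bounded_strong_law)
      show "prob_space P" by (rule P.prob_space_axioms)
      have "P.indep_vars (\<lambda>_. ?S) Y UNIV" using iid by (simp add: iid_sample_def)
      then show "P.indep_vars (\<lambda>_. borel) (\<lambda>i \<omega>. f (Y i \<omega>)) UNIV"
        by (rule P.indep_vars_compose2) (rule fm)
      have "distr P borel (\<lambda>\<omega>. f (Y i \<omega>)) = distr \<mu> borel f" for i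
        unfolding Yd[of i, symmetric] by (subst distr_distr) (auto simp: comp_def)
      then show "distr P borel (\<lambda>\<omega>. f (Y i \<omega>)) = distr P borel (\<lambda>\<omega>. f (Y 0 \<omega>))" for i by simp
      show "\<bar>f (Y i \<omega>)\<bar> \<le> 1" if "\<omega> \<in> space P" for i \<omega>
        unfolding f_def by (rule word_bounded[OF True YX[OF that]])
    qed
    moreover have "(\<integral>\<omega>. f (Y 0 \<omega>) \<partial>P) = (\<integral>y. f y \<partial>\<mu>)"
      unfolding Yd[of 0, symmetric] by (subst integral_distr) auto
    ultimately show ?thesis by (simp add: f_def)
  qed simp
  then have "AE \<omega> in P. \<forall>w. set w \<subseteq> {..<D} \<longrightarrow> (\<lambda>N. (\<Sum>i<N. \<Prod>e\<leftarrow>w. u e (Y i \<omega>)) / real N) \<longlonglongrightarrow> (\<integral>y. (\<Prod>e\<leftarrow>w. u e y) \<partial>\<mu>)"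
    by (simp add: AE_all_countable)
  then show ?thesis using AE_space
    by eventually_elim (auto simp: equidistributed_def YX)
qed

theorem rgg_converges_threshold:
  assumes iid: "iid_sample X d P \<mu> Y" and sets: "sets \<mu> = sets (ball_sigma X d)"
    and thr: "\<And>x y. x \<in> X \<Longrightarrow> y \<in> X \<Longrightarrow> d x y \<le> L \<longleftrightarrow> s0 \<le> t x y"
  shows "rgg_converges X d L P Y (threshold_coeff a b s0) (jac_dim a b)"
  unfolding rgg_converges_def using AE_equidistributed[OF iid sets]
  by eventually_elim (rule gk_threshold_graph, auto simp: equidistributed_def thr)

end

section \<open>Two-point homogeneous spaces\<close>

definition isom :: "'p set \<Rightarrow> ('p \<Rightarrow> 'p \<Rightarrow> real) \<Rightarrow> ('p \<Rightarrow> 'p) \<Rightarrow> bool" where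
  "isom X t g \<longleftrightarrow> bij_betw g X X \<and> (\<forall>x\<in>X. \<forall>y\<in>X. t (g x) (g y) = t x y)"

lemma isom_id: "isom X t (\<lambda>x. x)"
  by (simp add: isom_def bij_betw_def)

lemma isom_comp: "isom X t g \<Longrightarrow> isom X t h \<Longrightarrow> isom X t (\<lambda>x. g (h x))"
  unfolding isom_def using bij_betw_trans[of h X X g X] by (auto simp: comp_def dest: bij_betwE)

lemma isom_in: "isom X t g \<Longrightarrow> x \<in> X \<Longrightarrow> g x \<in> X"
  by (auto simp: isom_def dest: bij_betwE)

lemma isom_preserves: "isom X t g \<Longrightarrow> x \<in> X \<Longrightarrow> y \<in> X \<Longrightarrow> t (g x) (g y) = t x y"
  by (simp add: isom_def)

lemma isom_involution:
  assumes "\<And>x. x \<in> X \<Longrightarrow> g x \<in> X" "\<And>x. x \<in> X \<Longrightarrow> g (g x) = x" "\<And>x y. x \<in> X \<Longrightarrow> y \<in> X \<Longrightarrow> t (g x) (g y) = t x y"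
  shows "isom X t g"
  unfolding isom_def using assms by (auto intro!: bij_betw_byWitness[where f' = g])

lemma isom_inverse:
  assumes "\<And>x. x \<in> X \<Longrightarrow> g x \<in> X" "\<And>x. x \<in> X \<Longrightarrow> h x \<in> X" "\<And>x. x \<in> X \<Longrightarrow> g (h x) = x" "\<And>x. x \<in> X \<Longrightarrow> h (g x) = x"
    "\<And>x y. x \<in> X \<Longrightarrow> y \<in> X \<Longrightarrow> t (g x) (g y) = t x y"
  shows "isom X t g"
  unfolding isom_def using assms by (auto intro!: bij_betw_byWitness[where f' = h])

text \<open>Stein's identity for the monomial of degree i is a first-order recursion for the Beta
  moments, so a sequence with the same recursion and initial value coincides with them.\<close>

lemma beta_moment_unique:
  assumes ab: "0 < a" "0 < b" and "M 0 = 1" and rec: "\<And>i. (a + b + real i) * M (Suc i) = (a + real i) * M i"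
  shows "M i = beta_exp a b (monom 1 i)"
proof (induction i)
  case 0
  show ?case using assms by (simp add: monom_0 beta_exp_1 one_pCons[symmetric])
next
  case (Suc i)
  have "[:0, 1, -1:] * pderiv (monom 1 i) + [:a, - (a + b):] * monom 1 i
     = Polynomial.smult (a + real i) (monom 1 i) - Polynomial.smult (a + b + real i) (monom (1::real) (Suc i))"
  proof (cases i)
    case 0
    then show ?thesis by (simp add: monom_0 monom_Suc pderiv_pCons)
  next
    case (Suc k)
    show ?thesis unfolding Suc
      by (rule poly_eq_poly_eq_iff[THEN iffD1]) (auto simp: fun_eq_iff poly_monom pderiv_monom algebra_simps)
  qed
  then have "(a + b + real i) * beta_exp a b (monom 1 (Suc i)) = (a + real i) * beta_exp a b (monom 1 i)"
    using beta_exp_stein[OF ab, of "monom 1 i"] by (simp only: beta_exp_diff[OF ab] beta_exp_smult)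
  then have "(a + b + real i) * beta_exp a b (monom 1 (Suc i)) = (a + b + real i) * M (Suc i)" using Suc rec[of i] by simp
  then show ?case using ab by simp
qed

text \<open>In the expansion in s and T, symmetry under s to -s removes the odd powers of s, and s^2
  = T (1 - T) makes the rest polynomial. A surviving term s^l T^p has degree at most l + p, which is
  at most i.\<close>

lemma even_part_poly:
  assumes "prob_space \<mu>" and m: "U \<in> borel_measurable \<mu>" "V \<in> borel_measurable \<mu>" "W \<in> borel_measurable \<mu>" "w \<in> borel_measurable \<mu>"
    and bd: "\<And>y. y \<in> space \<mu> \<Longrightarrow> \<bar>U y\<bar> \<le> C" "\<And>y. y \<in> space \<mu> \<Longrightarrow> \<bar>V y\<bar> \<le> C" "\<And>y. y \<in> space \<mu> \<Longrightarrow> \<bar>W y\<bar> \<le> C" "\<And>y. y \<in> space \<mu> \<Longrightarrow> \<bar>w y\<bar> \<le> (C::real)"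
  shows "\<exists>q. degree q \<le> i \<and> (\<forall>T s. s\<^sup>2 = T * (1 - T) \<longrightarrow>
     (\<integral>y. (U y + T * V y + s * W y) ^ i * w y \<partial>\<mu>) = (\<integral>y. (U y + T * V y - s * W y) ^ i * w y \<partial>\<mu>) \<longrightarrow>
     (\<integral>y. (U y + T * V y + s * W y) ^ i * w y \<partial>\<mu>) = poly q T)"
proof -
  interpret prob_space \<mu> by fact
  note [measurable] = m
  define E where "E l p = (\<integral>y. W y ^ l * (V y ^ p * U y ^ (i - l - p)) * w y \<partial>\<mu>)" for l p
  have int: "integrable \<mu> (\<lambda>y. W y ^ l * (V y ^ p * U y ^ k) * w y)" for l p k
  proof (rule integrable_const_bound[where B = "C ^ l * (C ^ p * C ^ k) * C"])
    show "AE y in \<mu>. norm (W y ^ l * (V y ^ p * U y ^ k) * w y) \<le> C ^ l * (C ^ p * C ^ k) * C"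
    proof (rule AE_I2)
      fix y assume y: "y \<in> space \<mu>"
      have "0 \<le> C" using bd(1)[OF y] by linarith
      then show "norm (W y ^ l * (V y ^ p * U y ^ k) * w y) \<le> C ^ l * (C ^ p * C ^ k) * C"
        using bd[OF y] by (simp add: abs_mult power_abs) (intro mult_mono power_mono, auto)
    qed
  qed measurable
  define c where "c l p = real (i choose l) * real ((i - l) choose p) * E l p" for l p
  have ex: "(\<integral>y. (U y + T * V y + s * W y) ^ i * w y \<partial>\<mu>) = (\<Sum>l\<le>i. \<Sum>p\<le>i - l. c l p * (s ^ l * T ^ p))" for T s
  proof -
    have "(U y + T * V y + s * W y) ^ i * w y
      = (\<Sum>l\<le>i. \<Sum>p\<le>i - l. (real (i choose l) * real ((i - l) choose p) * (s ^ l * T ^ p)) * (W y ^ l * (V y ^ p * U y ^ (i - l - p)) * w y))" for y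
    proof -
      have "(U y + T * V y + s * W y) ^ i = (s * W y + (T * V y + U y)) ^ i" by (simp add: algebra_simps)
      also have "\<dots> = (\<Sum>l\<le>i. real (i choose l) * (s * W y) ^ l * (\<Sum>p\<le>i - l. real ((i - l) choose p) * (T * V y) ^ p * U y ^ (i - l - p)))"
        unfolding binomial_ring[of "s * W y" "T * V y + U y" i] binomial_ring[of "T * V y" "U y"] by simp
      finally show ?thesis
        by (simp add: sum_distrib_left sum_distrib_right power_mult_distrib mult_ac)
    qed
    then have "(\<integral>y. (U y + T * V y + s * W y) ^ i * w y \<partial>\<mu>) = (\<Sum>l\<le>i. \<Sum>p\<le>i - l. (real (i choose l) * real ((i - l) choose p) * (s ^ l * T ^ p)) * E l p)"
      by (simp only: E_def Bochner_Integration.integral_sum Bochner_Integration.integrable_sum integrable_mult_right int integral_mult_right_zero)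
    then show ?thesis by (simp only: c_def mult_ac)
  qed
  define q where "q = (\<Sum>l\<le>i. \<Sum>p\<le>i - l. if even l then Polynomial.smult (c l p) ([:0, 1, -1:] ^ (l div 2) * monom 1 p) else 0)"
  have "degree q \<le> i"
    unfolding q_def
  proof (intro degree_sum_le finite_atMost)
    fix l p assume lp: "l \<in> {..i}" "p \<in> {..i - l}"
    show "degree (if even l then Polynomial.smult (c l p) ([:0, 1, -1:] ^ (l div 2) * monom 1 p) else 0) \<le> i"
    proof (cases "even l")
      case True
      have "degree ([:0, 1, -1::real:] ^ (l div 2)) \<le> 2 * (l div 2)"
        using degree_power_le[of "[:0, 1, -1::real:]" "l div 2"] by simp
      moreover have "degree (monom (1::real) p) \<le> p" by (rule degree_monom_le)
      ultimately have "degree ([:0, 1, -1:] ^ (l div 2) * monom (1::real) p) \<le> 2 * (l div 2) + p"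
        by (intro order_trans[OF degree_mult_le]) linarith
      also have "\<dots> \<le> i" using lp True by auto
      finally show ?thesis using True by (simp add: order_trans[OF degree_smult_le])
    qed simp
  qed
  moreover have "(\<integral>y. (U y + T * V y + s * W y) ^ i * w y \<partial>\<mu>) = poly q T"
    if s: "s\<^sup>2 = T * (1 - T)" and sym: "(\<integral>y. (U y + T * V y + s * W y) ^ i * w y \<partial>\<mu>) = (\<integral>y. (U y + T * V y - s * W y) ^ i * w y \<partial>\<mu>)" for T s
  proof -
    have "(\<integral>y. (U y + T * V y - s * W y) ^ i * w y \<partial>\<mu>) = (\<Sum>l\<le>i. \<Sum>p\<le>i - l. c l p * ((- s) ^ l * T ^ p))"
      using ex[of T "- s"] by simp
    then have "2 * (\<integral>y. (U y + T * V y + s * W y) ^ i * w y \<partial>\<mu>)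
      = (\<Sum>l\<le>i. \<Sum>p\<le>i - l. c l p * (s ^ l * T ^ p)) + (\<Sum>l\<le>i. \<Sum>p\<le>i - l. c l p * ((- s) ^ l * T ^ p))"
      using sym ex[of T s] by simp
    also have "\<dots> = (\<Sum>l\<le>i. \<Sum>p\<le>i - l. 2 * (if even l then c l p * (s ^ l * T ^ p) else 0))"
      unfolding sum.distrib[symmetric] by (intro sum.cong refl) auto
    also have "\<dots> = 2 * (\<Sum>l\<le>i. \<Sum>p\<le>i - l. if even l then c l p * (s ^ l * T ^ p) else 0)" by (simp add: sum_distrib_left)
    also have "(\<Sum>l\<le>i. \<Sum>p\<le>i - l. if even l then c l p * (s ^ l * T ^ p) else 0) = poly q T"
      unfolding q_def poly_sum
    proof (intro sum.cong refl)
      fix l p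
      have "s ^ l = (T * (1 - T)) ^ (l div 2)" if "even l"
        using that s by (metis dvd_mult_div_cancel power_mult)
      then show "(if even l then c l p * (s ^ l * T ^ p) else 0) = poly (if even l then Polynomial.smult (c l p) ([:0, 1, -1:] ^ (l div 2) * monom 1 p) else 0) T"
        by (simp add: poly_monom right_diff_distrib)
    qed
    finally show ?thesis by simp
  qed
  ultimately show ?thesis by blast
qed

section \<open>Integration against the invariant measure\<close>

text \<open>Invariance is formulated with d and computations use t; \<delta> and \<tau> translate.
  The sigma-algebra is generated by balls, so measurable functions have to be built from
  distances.\<close>

locale invariant_space =
  fixes X :: "'p set" and d :: "'p \<Rightarrow> 'p \<Rightarrow> real" and \<mu> :: "'p measure" and t :: "'p \<Rightarrow> 'p \<Rightarrow> real" and \<delta> \<tau> :: "real \<Rightarrow> real"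
  assumes inv: "invariant_prob X d \<mu>"
    and d_t: "\<And>x y. x \<in> X \<Longrightarrow> y \<in> X \<Longrightarrow> d x y = \<delta> (t x y)"
    and t_d: "\<And>x y. x \<in> X \<Longrightarrow> y \<in> X \<Longrightarrow> t x y = \<tau> (d x y)"
    and \<tau>: "\<tau> \<in> borel_measurable borel"
    and t_01: "\<And>x y. x \<in> X \<Longrightarrow> y \<in> X \<Longrightarrow> 0 \<le> t x y \<and> t x y \<le> 1"
    and t_sym: "\<And>x y. x \<in> X \<Longrightarrow> y \<in> X \<Longrightarrow> t x y = t y x"
begin

lemma prob: "prob_space \<mu>" and sets_\<mu>: "sets \<mu> = sets (ball_sigma X d)"
  using inv by (auto simp: invariant_prob_def)

lemma balls_Pow: "{{y\<in>X. d x y < r} | x r. x \<in> X} \<subseteq> Pow X" by auto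

lemma space_\<mu>: "space \<mu> = X"
  using sets_eq_imp_space_eq[OF sets_\<mu>] space_measure_of[OF balls_Pow] by (simp add: ball_sigma_def)

lemma ball_sets: "x \<in> X \<Longrightarrow> {y\<in>X. d x y < r} \<in> sets \<mu>"
  unfolding sets_\<mu> ball_sigma_def sets_measure_of[OF balls_Pow] by (rule sigma_sets.Basic) blast

lemma measurable_t: "x \<in> X \<Longrightarrow> t x \<in> borel_measurable \<mu>"
proof -
  assume x: "x \<in> X"
  have "d x \<in> borel_measurable \<mu>"
    unfolding borel_measurable_iff_less using ball_sets[OF x] by (simp add: space_\<mu>)
  then have "(\<lambda>y. \<tau> (d x y)) \<in> borel_measurable \<mu>" using \<tau> by (rule measurable_compose)
  then show ?thesis using t_d[OF x] by (subst measurable_cong[where g = "\<lambda>y. \<tau> (d x y)"]) (auto simp: space_\<mu>)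
qed

lemma isom_integral:
  assumes g: "isom X t g" and f: "f \<in> borel_measurable \<mu>"
  shows "(\<integral>y. f (g y) \<partial>\<mu>) = (\<integral>y. f y \<partial>\<mu> :: real)"
proof -
  have bij: "bij_betw g X X" using g by (simp add: isom_def)
  have dg: "d (g x) (g y) = d x y" if "x \<in> X" "y \<in> X" for x y
    using that isom_in[OF g] isom_preserves[OF g] by (simp add: d_t)
  have gm: "g \<in> measurable \<mu> (ball_sigma X d)"
    unfolding ball_sigma_def
  proof (rule measurable_measure_of[OF balls_Pow])
    show "g \<in> space \<mu> \<rightarrow> X" using isom_in[OF g] by (auto simp: space_\<mu>)
    fix B assume "B \<in> {{y\<in>X. d x y < r} | x r. x \<in> X}"
    then obtain x r where B: "B = {y\<in>X. d x y < r}" "x \<in> X" by auto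
    obtain x' where x': "x' \<in> X" "x = g x'" using bij B(2) by (auto simp: bij_betw_def)
    have "g -` B \<inter> space \<mu> = {y\<in>X. d x' y < r}" using isom_in[OF g] x' dg by (auto simp: B space_\<mu>)
    then show "g -` B \<inter> space \<mu> \<in> sets \<mu>" using ball_sets[OF x'(1)] by simp
  qed
  have "distr \<mu> (ball_sigma X d) g = \<mu>" using inv bij dg by (auto simp: invariant_prob_def)
  then have "(\<integral>y. f y \<partial>\<mu>) = (\<integral>y. f y \<partial>distr \<mu> (ball_sigma X d) g)" by simp
  also have "\<dots> = (\<integral>y. f (g y) \<partial>\<mu>)"
    using f measurable_cong_sets[OF sets_\<mu> refl] by (intro integral_distr[OF gm]) blast
  finally show ?thesis by simp
qed

lemma convolution_isom:
  assumes g: "isom X t g" and x: "x \<in> X" and z: "z \<in> X"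
  shows "(\<integral>y. t (g x) y ^ i * t y (g z) ^ j \<partial>\<mu>) = (\<integral>y. t x y ^ i * t y z ^ j \<partial>\<mu>)"
proof -
  have gx: "g x \<in> X" "g z \<in> X" using isom_in[OF g] x z by auto
  have "(\<lambda>y. t (g x) y ^ i * t (g z) y ^ j) \<in> borel_measurable \<mu>"
    using measurable_t[OF gx(1)] measurable_t[OF gx(2)] by measurable
  from isom_integral[OF g this]
  have "(\<integral>y. t (g x) y ^ i * t (g z) y ^ j \<partial>\<mu>) = (\<integral>y. t (g x) (g y) ^ i * t (g z) (g y) ^ j \<partial>\<mu>)" by simp
  also have "\<dots> = (\<integral>y. t x y ^ i * t y z ^ j \<partial>\<mu>)"
    by (intro Bochner_Integration.integral_cong refl) (simp add: space_\<mu> isom_preserves[OF g] x z t_sym)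
  finally show ?thesis
    using gx by (subst (asm) Bochner_Integration.integral_cong[where g = "\<lambda>y. t (g x) y ^ i * t y (g z) ^ j"]) (auto simp: space_\<mu> t_sym)
qed

text \<open>The point z is moved to e0 by two isometries that bring x to positions differing only in
  the sign of s. Both leave the convolution unchanged, which is the symmetry required by
  \<open>even_part_poly\<close>.\<close>

lemma convolution_polynomial:
  assumes e0: "e0 \<in> X" and m: "U \<in> borel_measurable \<mu>" "V \<in> borel_measurable \<mu>" "W \<in> borel_measurable \<mu>"
    and bd: "\<And>y. y \<in> X \<Longrightarrow> \<bar>U y\<bar> \<le> C" "\<And>y. y \<in> X \<Longrightarrow> \<bar>V y\<bar> \<le> C" "\<And>y. y \<in> X \<Longrightarrow> \<bar>W y\<bar> \<le> C"
    and hom: "\<And>x z. x \<in> X \<Longrightarrow> z \<in> X \<Longrightarrow> \<exists>s g h. s\<^sup>2 = t x z * (1 - t x z) \<and> isom X t g \<and> isom X t h \<and> g z = e0 \<and> h z = e0 \<and>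
       (\<forall>y\<in>X. t (g x) y = U y + t x z * V y + s * W y) \<and> (\<forall>y\<in>X. t (h x) y = U y + t x z * V y - s * W y)"
  shows "\<exists>q. degree q \<le> i \<and> (\<forall>x\<in>X. \<forall>z\<in>X. (\<integral>y. t x y ^ i * t y z ^ j \<partial>\<mu>) = poly q (t x z))"
proof -
  define w where "w y = t e0 y ^ j" for y
  have wm: "w \<in> borel_measurable \<mu>" unfolding w_def using measurable_t[OF e0] by measurable
  have w1: "\<bar>w y\<bar> \<le> max C 1" if "y \<in> X" for y using t_01[OF e0 that] by (simp add: w_def power_le_one le_max_iff_disj)
  have "\<exists>q. degree q \<le> i \<and> (\<forall>T s. s\<^sup>2 = T * (1 - T) \<longrightarrow>
     (\<integral>y. (U y + T * V y + s * W y) ^ i * w y \<partial>\<mu>) = (\<integral>y. (U y + T * V y - s * W y) ^ i * w y \<partial>\<mu>) \<longrightarrow>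
     (\<integral>y. (U y + T * V y + s * W y) ^ i * w y \<partial>\<mu>) = poly q T)"
    by (rule even_part_poly[OF prob m wm, where C = "max C 1"]) (use bd w1 in \<open>auto simp: space_\<mu> le_max_iff_disj\<close>)
  then obtain q where q: "degree q \<le> i" "\<And>T s. s\<^sup>2 = T * (1 - T) \<Longrightarrow>
     (\<integral>y. (U y + T * V y + s * W y) ^ i * w y \<partial>\<mu>) = (\<integral>y. (U y + T * V y - s * W y) ^ i * w y \<partial>\<mu>) \<Longrightarrow>
     (\<integral>y. (U y + T * V y + s * W y) ^ i * w y \<partial>\<mu>) = poly q T" by blast
  have "(\<integral>y. t x y ^ i * t y z ^ j \<partial>\<mu>) = poly q (t x z)" if x: "x \<in> X" and z: "z \<in> X" for x z
  proof -
    obtain s g h where s: "s\<^sup>2 = t x z * (1 - t x z)" and g: "isom X t g" "g z = e0" "\<And>y. y \<in> X \<Longrightarrow> t (g x) y = U y + t x z * V y + s * W y"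
      and h: "isom X t h" "h z = e0" "\<And>y. y \<in> X \<Longrightarrow> t (h x) y = U y + t x z * V y - s * W y"
      using hom[OF x z] by blast
    have 1: "(\<integral>y. t x y ^ i * t y z ^ j \<partial>\<mu>) = (\<integral>y. (U y + t x z * V y + s * W y) ^ i * w y \<partial>\<mu>)"
      unfolding convolution_isom[OF g(1) x z, symmetric] g(2)
      by (intro Bochner_Integration.integral_cong refl) (simp add: space_\<mu> g(3) w_def t_sym e0)
    have 2: "(\<integral>y. t x y ^ i * t y z ^ j \<partial>\<mu>) = (\<integral>y. (U y + t x z * V y - s * W y) ^ i * w y \<partial>\<mu>)"
      unfolding convolution_isom[OF h(1) x z, symmetric] h(2)
      by (intro Bochner_Integration.integral_cong refl) (simp add: space_\<mu> h(3) w_def t_sym e0)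
    show ?thesis unfolding 1 by (rule q(2)[OF s]) (use 1 2 in simp)
  qed
  with q(1) show ?thesis by blast
qed

end

section \<open>The sphere\<close>

definition sip :: "nat \<Rightarrow> (nat \<Rightarrow> real) \<Rightarrow> (nat \<Rightarrow> real) \<Rightarrow> real" where
  "sip n x y = (\<Sum>i\<le>n. x i * y i)"

definition sphere_t :: "nat \<Rightarrow> (nat \<Rightarrow> real) \<Rightarrow> (nat \<Rightarrow> real) \<Rightarrow> real" where
  "sphere_t n x y = (1 + sip n x y) / 2"

lemma sip_sphere_t: "2 * sphere_t n x y - 1 = sip n x y"
  unfolding sphere_t_def by (simp add: field_simps)

lemma sip_commute: "sip n x y = sip n y x"
  by (simp add: sip_def mult.commute)

lemma sip_linear: "sip n (\<lambda>i. x i + c * w i) y = sip n x y + c * sip n w y"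
  by (simp add: sip_def distrib_right sum.distrib sum_distrib_left mult.assoc)

lemma sip_linear': "sip n y (\<lambda>i. x i + c * w i) = sip n y x + c * sip n y w"
  using sip_linear[of n x c w y] by (simp add: sip_commute)

lemma sip_self: "x \<in> sphere_pts n \<Longrightarrow> sip n x x = 1"
  by (simp add: sip_def sphere_pts_def power2_eq_square)

lemma sphere_ptsI: "(\<And>i. n < i \<Longrightarrow> x i = 0) \<Longrightarrow> sip n x x = 1 \<Longrightarrow> x \<in> sphere_pts n"
  by (simp add: sip_def sphere_pts_def power2_eq_square)

lemma sip_abs_le_1:
  assumes "x \<in> sphere_pts n" "y \<in> sphere_pts n"
  shows "\<bar>sip n x y\<bar> \<le> 1"
proof -
  have "0 \<le> (\<Sum>i\<le>n. (x i + y i)\<^sup>2)" "0 \<le> (\<Sum>i\<le>n. (x i - y i)\<^sup>2)" by (simp_all add: sum_nonneg)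
  moreover have "(\<Sum>i\<le>n. (x i + y i)\<^sup>2) = sip n x x + sip n y y + 2 * sip n x y"
    "(\<Sum>i\<le>n. (x i - y i)\<^sup>2) = sip n x x + sip n y y - 2 * sip n x y"
    by (simp_all add: sip_def power2_eq_square algebra_simps sum.distrib sum_subtractf sum_distrib_left)
  ultimately show ?thesis using sip_self[OF assms(1)] sip_self[OF assms(2)] by (simp add: abs_le_iff)
qed

lemma sphere_coord_abs_le_1:
  assumes "x \<in> sphere_pts n" shows "\<bar>x i\<bar> \<le> 1"
proof (cases "i \<le> n")
  case True
  have "(x i)\<^sup>2 \<le> (\<Sum>i\<le>n. (x i)\<^sup>2)" using True by (intro member_le_sum) auto
  then have "(x i)\<^sup>2 \<le> 1\<^sup>2" using assms by (simp add: sphere_pts_def)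
  then show ?thesis by (metis abs_le_square_iff abs_one)
qed (use assms in \<open>auto simp: sphere_pts_def\<close>)

text \<open>Division by zero makes this the identity when \<open>sip n w w = 0\<close>, that is,
  when w vanishes on the coordinates up to n.\<close>

definition refl_along :: "nat \<Rightarrow> (nat \<Rightarrow> real) \<Rightarrow> (nat \<Rightarrow> real) \<Rightarrow> nat \<Rightarrow> real" where
  "refl_along n w y = (\<lambda>i. y i + (- 2 * sip n y w / sip n w w) * w i)"

lemma sip_refl_along: "sip n (refl_along n w x) (refl_along n w y) = sip n x y"
proof (cases "sip n w w = 0")
  case False
  then show ?thesis unfolding refl_along_def sip_linear sip_linear'
    by (simp add: sip_commute[of n w y] field_simps)
qed (simp add: refl_along_def)

lemma refl_along_involution: "refl_along n w (refl_along n w y) = y"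
proof (cases "sip n w w = 0")
  case False
  then have "sip n (refl_along n w y) w = - sip n y w"
    unfolding refl_along_def sip_linear by simp
  then show ?thesis by (simp add: refl_along_def fun_eq_iff)
qed (simp add: refl_along_def)

lemma isom_refl_along:
  assumes "\<And>i. n < i \<Longrightarrow> w i = 0"
  shows "isom (sphere_pts n) (sphere_t n) (refl_along n w)"
proof (rule isom_involution)
  fix x assume x: "x \<in> sphere_pts n"
  show "refl_along n w x \<in> sphere_pts n"
  proof (rule sphere_ptsI)
    show "refl_along n w x i = 0" if "n < i" for i using x assms that by (simp add: refl_along_def sphere_pts_def)
    show "sip n (refl_along n w x) (refl_along n w x) = 1" by (simp add: sip_refl_along sip_self[OF x])
  qed
qed (simp_all add: refl_along_involution sphere_t_def sip_refl_along)

text \<open>Reflection in the hyperplane that bisects p and q. It fixes the points with equal inner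
  products with p and q, so it serves both to move one point and to move a second one while the
  first is held.\<close>

lemma sphere_move:
  assumes p: "p \<in> sphere_pts n" and q: "q \<in> sphere_pts n"
  shows "\<exists>g. isom (sphere_pts n) (sphere_t n) g \<and> g p = q \<and>
    (\<forall>z\<in>sphere_pts n. sip n z p = sip n z q \<longrightarrow> g z = z)"
proof -
  define w where "w = (\<lambda>i. p i + (- 1) * q i)"
  have w0: "w i = 0" if "n < i" for i using p q that by (simp add: w_def sphere_pts_def)
  have ww: "sip n w w = 2 - 2 * sip n p q"
    unfolding w_def sip_linear sip_linear' using sip_self[OF p] sip_self[OF q] by (simp add: sip_commute)
  have pw: "sip n p w = 1 - sip n p q"
    unfolding w_def sip_linear' using sip_self[OF p] by simp
  have "refl_along n w p = q"
  proof (cases "sip n w w = 0")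
    case True
    then have "\<forall>i\<le>n. w i * w i = 0" unfolding sip_def by (subst (asm) sum_nonneg_eq_0_iff) auto
    then have "p i = q i" for i using w0[of i] by (cases "i \<le> n") (auto simp: w_def)
    then have "p = q" by (simp add: fun_eq_iff)
    then show ?thesis using True by (simp add: refl_along_def)
  next
    case False
    then have "- 2 * sip n p w / sip n w w = - 1" using ww pw by (simp add: field_simps)
    then show ?thesis by (simp add: refl_along_def w_def fun_eq_iff)
  qed
  moreover have "refl_along n w z = z" if "sip n z p = sip n z q" for z
  proof -
    have "sip n z w = 0" unfolding w_def sip_linear' using that by simp
    then show ?thesis by (simp add: refl_along_def)
  qed
  moreover have "isom (sphere_pts n) (sphere_t n) (refl_along n w)" by (rule isom_refl_along) (rule w0)
  ultimately show ?thesis by blast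
qed

definition unit_pt :: "nat \<Rightarrow> nat \<Rightarrow> real" where
  "unit_pt j = (\<lambda>i. if i = j then 1 else 0)"

lemma sip_unit_pt: "j \<le> n \<Longrightarrow> sip n (unit_pt j) y = y j"
  by (simp add: sip_def unit_pt_def if_distrib if_distribR cong: if_cong)

lemma unit_pt_sphere: "j \<le> n \<Longrightarrow> unit_pt j \<in> sphere_pts n"
  by (intro sphere_ptsI) (auto simp: sip_unit_pt, auto simp: unit_pt_def)

definition plane_pt :: "nat \<Rightarrow> real \<Rightarrow> real \<Rightarrow> nat \<Rightarrow> real" where
  "plane_pt j c s = (\<lambda>i. (c * unit_pt 0 i) + s * unit_pt j i)"

lemma sip_plane_pt: "j \<le> n \<Longrightarrow> sip n (plane_pt j c s) y = c * y 0 + s * y j"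
proof -
  assume j: "j \<le> n"
  have "sip n (plane_pt j c s) y = c * sip n (unit_pt 0) y + s * sip n (unit_pt j) y"
    by (simp add: sip_def plane_pt_def distrib_right sum.distrib mult.assoc sum_distrib_left)
  then show ?thesis using j by (simp add: sip_unit_pt)
qed

lemma plane_pt_sphere: "1 \<le> j \<Longrightarrow> j \<le> n \<Longrightarrow> c\<^sup>2 + s\<^sup>2 = 1 \<Longrightarrow> plane_pt j c s \<in> sphere_pts n"
  by (intro sphere_ptsI) (auto simp: sip_plane_pt, auto simp: plane_pt_def unit_pt_def power2_eq_square)

section \<open>Moments of a coordinate and the zonal structure of the sphere\<close>

context
  fixes n :: nat and \<mu> :: "(nat \<Rightarrow> real) measure"
  assumes n1: "1 \<le> n" and inv: "invariant_prob (sphere_pts n) (sphere_dist n) \<mu>"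
begin

interpretation invariant_space "sphere_pts n" "sphere_dist n" \<mu> "sphere_t n" "\<lambda>t. arccos (2 * t - 1)" "\<lambda>r. (1 + cos r) / 2"
proof
  fix x y assume xy: "x \<in> sphere_pts n" "y \<in> sphere_pts n"
  have b: "-1 \<le> sip n x y" "sip n x y \<le> 1" using sip_abs_le_1[OF xy] by auto
  show "sphere_dist n x y = arccos (2 * sphere_t n x y - 1)" unfolding sip_sphere_t by (simp add: sphere_dist_def sip_def)
  show "sphere_t n x y = (1 + cos (sphere_dist n x y)) / 2" using b by (simp add: sphere_dist_def sphere_t_def flip: sip_def)
  show "0 \<le> sphere_t n x y \<and> sphere_t n x y \<le> 1" using b by (simp add: sphere_t_def)
  show "sphere_t n x y = sphere_t n y x" by (simp add: sphere_t_def sip_commute)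
qed (use inv in auto)

interpretation prob_space \<mu> by (rule prob)

lemma sphere_coord_measurable: "j \<le> n \<Longrightarrow> (\<lambda>y. y j) \<in> borel_measurable \<mu>"
proof -
  assume j: "j \<le> n"
  have "(\<lambda>y. 2 * sphere_t n (unit_pt j) y - 1) \<in> borel_measurable \<mu>"
    using measurable_t[OF unit_pt_sphere[OF j]] by measurable
  then show ?thesis unfolding sip_sphere_t by (simp add: sip_unit_pt j)
qed

lemma sphere_integrable: "f \<in> borel_measurable \<mu> \<Longrightarrow> (\<And>y. y \<in> sphere_pts n \<Longrightarrow> \<bar>f y\<bar> \<le> C) \<Longrightarrow> integrable \<mu> (f :: _ \<Rightarrow> real)"
  by (rule integrable_const_bound[where B = C]) (auto simp: space_\<mu>)

lemma sphere_int_mono: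
  assumes "j \<le> n" "l \<le> n"
  shows "integrable \<mu> (\<lambda>y. y j ^ p * y l ^ q)"
proof (rule sphere_integrable[where C = 1])
  show "(\<lambda>y. y j ^ p * y l ^ q) \<in> borel_measurable \<mu>"
    using sphere_coord_measurable[OF assms(1)] sphere_coord_measurable[OF assms(2)] by measurable
  show "\<bar>y j ^ p * y l ^ q\<bar> \<le> 1" if "y \<in> sphere_pts n" for y
    using sphere_coord_abs_le_1[OF that] by (simp add: abs_mult power_abs mult_le_one power_le_one)
qed

lemma sphere_moment_const:
  assumes x: "x \<in> sphere_pts n"
  shows "(\<integral>y. (sip n x y) ^ i \<partial>\<mu>) = (\<integral>y. (y 0) ^ i \<partial>\<mu>)"
proof -
  have e0: "unit_pt 0 \<in> sphere_pts n" by (rule unit_pt_sphere) simp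
  obtain g where g: "isom (sphere_pts n) (sphere_t n) g" "g (unit_pt 0) = x"
    using sphere_move[OF e0 x] by blast
  have m: "(\<lambda>y. (2 * sphere_t n x y - 1) ^ i) \<in> borel_measurable \<mu>" using measurable_t[OF x] by measurable
  have "(\<integral>y. (2 * sphere_t n x y - 1) ^ i \<partial>\<mu>) = (\<integral>y. (2 * sphere_t n (g (unit_pt 0)) (g y) - 1) ^ i \<partial>\<mu>)"
    unfolding g(2) by (rule isom_integral[OF g(1) m, symmetric])
  also have "\<dots> = (\<integral>y. (2 * sphere_t n (unit_pt 0) y - 1) ^ i \<partial>\<mu>)"
    by (intro Bochner_Integration.integral_cong refl) (simp add: space_\<mu> isom_preserves[OF g(1) e0])
  finally show ?thesis unfolding sip_sphere_t by (simp add: sip_unit_pt)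
qed

lemma sphere_odd_moment: "odd i \<Longrightarrow> (\<integral>y. (y 0) ^ i \<partial>\<mu>) = 0"
proof -
  assume i: "odd i"
  \<comment> \<open>The antipode of \<open>unit_pt 0\<close>; its moments agree with those of
    \<open>unit_pt 0\<close>, while an odd power changes sign.\<close>
  have "plane_pt 1 (-1) 0 \<in> sphere_pts n" using n1 by (intro plane_pt_sphere) auto
  from sphere_moment_const[OF this, of i] show ?thesis using n1 i by (simp add: sip_plane_pt)
qed

text \<open>By invariance the expectation of (y 0 + \<beta> y j)^(2k+2) is M (1 + \<beta>^2)^(k+1)
  for every \<beta>, M being the moment on the right; the coefficients of \<beta>^2 are
  compared.\<close>

lemma sphere_even_moment:
  assumes j: "1 \<le> j" "j \<le> n"
  shows "(2 * real k + 1) * (\<integral>y. (y 0) ^ (2 * k) * (y j)\<^sup>2 \<partial>\<mu>) = (\<integral>y. (y 0) ^ (2 * k + 2) \<partial>\<mu>)"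
proof -
  define M where "M = (\<integral>y. (y 0) ^ (2 * k + 2) \<partial>\<mu>)"
  define E where "E l = (\<integral>y. (y 0) ^ (2 * k + 2 - l) * (y j) ^ l \<partial>\<mu>)" for l
  define p where "p = (\<Sum>l\<le>2 * k + 2. monom (real ((2 * k + 2) choose l) * E l) l)"
  have "poly p \<beta> = poly (Polynomial.smult M ([:1, 0, 1:] ^ (k + 1))) \<beta>" for \<beta>
  proof -
    define r where "r = sqrt (1 + \<beta>\<^sup>2)"
    have r: "0 < r" "r\<^sup>2 = 1 + \<beta>\<^sup>2" by (auto simp: r_def add_pos_nonneg)
    have "plane_pt j (1 / r) (\<beta> / r) \<in> sphere_pts n"
      using j r by (intro plane_pt_sphere) (auto simp: power_divide add_divide_distrib[symmetric])
    from sphere_moment_const[OF this, of "2 * k + 2"]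
    have "M = (\<integral>y. (1 / r * y 0 + \<beta> / r * y j) ^ (2 * k + 2) \<partial>\<mu>)" using j by (simp add: sip_plane_pt M_def)
    also have "\<dots> = (\<integral>y. (\<beta> * y j + y 0) ^ (2 * k + 2) / r ^ (2 * k + 2) \<partial>\<mu>)"
    proof (intro Bochner_Integration.integral_cong refl)
      fix y :: "nat \<Rightarrow> real"
      have "1 / r * y 0 + \<beta> / r * y j = (\<beta> * y j + y 0) / r" by (simp add: add_divide_distrib)
      then show "(1 / r * y 0 + \<beta> / r * y j) ^ (2 * k + 2) = (\<beta> * y j + y 0) ^ (2 * k + 2) / r ^ (2 * k + 2)"
        by (simp only: power_divide)
    qed
    also have "\<dots> = (\<integral>y. (\<beta> * y j + y 0) ^ (2 * k + 2) \<partial>\<mu>) / r ^ (2 * k + 2)" by simp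
    also have "(\<integral>y. (\<beta> * y j + y 0) ^ (2 * k + 2) \<partial>\<mu>) = (\<integral>y. (\<Sum>l\<le>2 * k + 2. (real ((2 * k + 2) choose l) * \<beta> ^ l) * ((y 0) ^ (2 * k + 2 - l) * (y j) ^ l)) \<partial>\<mu>)"
      by (intro Bochner_Integration.integral_cong refl, subst binomial_ring) (simp add: power_mult_distrib mult_ac del: power_Suc)
    also have "\<dots> = (\<Sum>l\<le>2 * k + 2. (real ((2 * k + 2) choose l) * \<beta> ^ l) * E l)"
      unfolding E_def using j
      by (simp only: Bochner_Integration.integral_sum integrable_mult_right sphere_int_mono[of 0 j] integral_mult_right_zero zero_le)
    also have "\<dots> = poly p \<beta>" by (simp add: p_def poly_sum poly_monom mult_ac)
    finally have "poly p \<beta> = M * r ^ (2 * k + 2)" using r by (simp add: field_simps)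
    also have "r ^ (2 * k + 2) = (1 + \<beta>\<^sup>2) ^ (k + 1)" using r(2) by (metis distrib_left mult.right_neutral power_mult)
    finally have "poly p \<beta> = M * (1 + \<beta>\<^sup>2) ^ (k + 1)" .
    moreover have "poly [:1, 0, 1:] \<beta> = 1 + \<beta>\<^sup>2" by (simp add: power2_eq_square)
    ultimately show ?thesis by (simp only: poly_smult poly_power)
  qed
  then have eq: "p = Polynomial.smult M ([:1, 0, 1:] ^ (k + 1))" by (intro poly_eq_poly_eq_iff[THEN iffD1] ext)
  have cp: "coeff p 2 = real ((2 * k + 2) choose 2) * E 2"
    unfolding p_def coeff_sum coeff_monom by (simp only: sum.delta' sum.delta finite_atMost) simp
  have c2: "coeff ([:1, 0, 1::real:] ^ m) 0 = 1 \<and> coeff ([:1, 0, 1::real:] ^ m) 1 = 0 \<and> coeff ([:1, 0, 1::real:] ^ m) 2 = real m" for m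
    by (induction m) (auto simp: coeff_pCons numeral_2_eq_2 split: nat.splits)
  have "coeff p 2 = M * real (k + 1)" unfolding eq coeff_smult using c2[of "k + 1"] by (simp only:)
  with cp have "real ((2 * k + 2) choose 2) * E 2 = M * real (k + 1)" by (simp only:)
  moreover have "real ((2 * k + 2) choose 2) = real (k + 1) * (2 * real k + 1)"
    by (simp add: choose_two) (simp add: algebra_simps)
  ultimately have "real (k + 1) * ((2 * real k + 1) * E 2) = real (k + 1) * M" by (simp add: mult_ac)
  then have "(2 * real k + 1) * E 2 = M" by (simp del: of_nat_Suc of_nat_add)
  then show ?thesis by (simp add: E_def M_def)
qed

text \<open>For odd i the preceding identities are summed over j, where the squares of y 1 to y n
  add up to 1 - (y 0)^2. For even i the moments are of odd order and vanish, except the one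
  multiplied by i = 0.\<close>

lemma sphere_stein_power: "real i * ((\<integral>y. (y 0) ^ (i - 1) \<partial>\<mu>) - (\<integral>y. (y 0) ^ (i + 1) \<partial>\<mu>)) = real n * (\<integral>y. (y 0) ^ (i + 1) \<partial>\<mu>)"
proof (cases "even i")
  case True
  then have "(\<integral>y. (y 0) ^ (i + 1) \<partial>\<mu>) = 0" by (intro sphere_odd_moment) auto
  moreover have "i = 0 \<or> (\<integral>y. (y 0) ^ (i - 1) \<partial>\<mu>) = 0" using True by (cases "i = 0") (auto intro!: sphere_odd_moment)
  ultimately show ?thesis by auto
next
  case False
  then obtain k where i: "i = 2 * k + 1" by (auto elim: oddE)
  have int: "integrable \<mu> (\<lambda>y. (y 0) ^ p)" "integrable \<mu> (\<lambda>y. (y 0) ^ p * (y j)\<^sup>2)" if "j \<le> n" for p j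
    using sphere_int_mono[of 0 0 p 0] sphere_int_mono[of 0 j p 2] that by auto
  have "(\<Sum>j=1..n. (2 * real k + 1) * (\<integral>y. (y 0) ^ (2 * k) * (y j)\<^sup>2 \<partial>\<mu>)) = (\<Sum>j=1..n. (\<integral>y. (y 0) ^ (2 * k + 2) \<partial>\<mu>))"
    by (intro sum.cong refl sphere_even_moment) auto
  also have "\<dots> = real n * (\<integral>y. (y 0) ^ (2 * k + 2) \<partial>\<mu>)" by simp
  also have "(\<Sum>j=1..n. (2 * real k + 1) * (\<integral>y. (y 0) ^ (2 * k) * (y j)\<^sup>2 \<partial>\<mu>)) = (2 * real k + 1) * (\<integral>y. (\<Sum>j=1..n. (y 0) ^ (2 * k) * (y j)\<^sup>2) \<partial>\<mu>)"
    by (subst Bochner_Integration.integral_sum) (auto simp: int sum_distrib_left)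
  also have "(\<integral>y. (\<Sum>j=1..n. (y 0) ^ (2 * k) * (y j)\<^sup>2) \<partial>\<mu>) = (\<integral>y. (y 0) ^ (2 * k) - (y 0) ^ (2 * k + 2) \<partial>\<mu>)"
  proof (intro Bochner_Integration.integral_cong refl)
    fix y assume "y \<in> space \<mu>"
    then have "(\<Sum>i\<le>n. (y i)\<^sup>2) = 1" by (simp add: space_\<mu> sphere_pts_def)
    then have "(\<Sum>j=1..n. (y j)\<^sup>2) = 1 - (y 0)\<^sup>2" by (simp add: atMost_atLeast0 sum.atLeast_Suc_atMost)
    then show "(\<Sum>j=1..n. (y 0) ^ (2 * k) * (y j)\<^sup>2) = (y 0) ^ (2 * k) - (y 0) ^ (2 * k + 2)"
      by (simp add: sum_distrib_left[symmetric] right_diff_distrib power2_eq_square)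
  qed
  also have "\<dots> = (\<integral>y. (y 0) ^ (2 * k) \<partial>\<mu>) - (\<integral>y. (y 0) ^ (2 * k + 2) \<partial>\<mu>)"
    by (intro Bochner_Integration.integral_diff int(1)[of 0]) auto
  finally show ?thesis by (simp add: i add.commute)
qed

text \<open>Linear extension of the monomial case: Stein's identity for a density proportional to (1
  - x^2)^(n/2 - 1).\<close>

lemma sphere_stein: "(\<integral>y. (1 - (y 0)\<^sup>2) * poly (pderiv g) (y 0) - real n * y 0 * poly g (y 0) \<partial>\<mu>) = 0"
proof -
  have int: "integrable \<mu> (\<lambda>y. (y 0) ^ p)" for p using sphere_int_mono[of 0 0 p 0] by auto
  have eq: "(1 - x\<^sup>2) * poly (pderiv g) x - real n * x * poly g x
     = (\<Sum>i\<le>degree g. coeff g i * (real i * (x ^ (i - 1) - x ^ (i + 1)) - real n * x ^ (i + 1)))" for x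
  proof -
    have "pderiv g = (\<Sum>i\<le>degree g. pderiv (monom (coeff g i) i))"
      by (subst (1) poly_as_sum_of_monoms[symmetric]) (simp add: pderiv_sum)
    then have "poly (pderiv g) x = (\<Sum>i\<le>degree g. coeff g i * (real i * x ^ (i - 1)))"
      by (simp add: poly_sum pderiv_monom poly_monom mult_ac)
    then have "(1 - x\<^sup>2) * poly (pderiv g) x - real n * x * poly g x
      = (\<Sum>i\<le>degree g. (1 - x\<^sup>2) * (coeff g i * (real i * x ^ (i - 1))) - real n * x * (coeff g i * x ^ i))"
      by (simp add: poly_altdef[of g] sum_distrib_left sum_subtractf)
    also have "\<dots> = (\<Sum>i\<le>degree g. coeff g i * (real i * (x ^ (i - 1) - x ^ (i + 1)) - real n * x ^ (i + 1)))"
    proof (intro sum.cong refl)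
      fix i
      show "(1 - x\<^sup>2) * (coeff g i * (real i * x ^ (i - 1))) - real n * x * (coeff g i * x ^ i) = coeff g i * (real i * (x ^ (i - 1) - x ^ (i + 1)) - real n * x ^ (i + 1))"
        by (cases i) (simp_all add: algebra_simps power2_eq_square)
    qed
    finally show ?thesis .
  qed
  have "(\<integral>y. (\<Sum>i\<le>degree g. coeff g i * (real i * (y 0 ^ (i - 1) - y 0 ^ (i + 1)) - real n * y 0 ^ (i + 1))) \<partial>\<mu>)
      = (\<Sum>i\<le>degree g. coeff g i * (real i * ((\<integral>y. y 0 ^ (i - 1) \<partial>\<mu>) - (\<integral>y. y 0 ^ (i + 1) \<partial>\<mu>)) - real n * (\<integral>y. y 0 ^ (i + 1) \<partial>\<mu>)))"
    by (simp only: Bochner_Integration.integral_sum Bochner_Integration.integral_diff Bochner_Integration.integrable_diff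
          integrable_mult_right int integral_mult_right_zero)
  also have "\<dots> = 0" unfolding sphere_stein_power by simp
  finally show ?thesis unfolding eq .
qed

text \<open>Coordinate 0 of the embedding is the constant 1 / sqrt 2 and produces the summand 1/2 of
  t, hence n + 2 coordinates.\<close>

lemma sphere_zonal:
  "zonal_space (sphere_pts n) \<mu> (sphere_t n) (real n / 2) (real n / 2) (n + 2)
     (\<lambda>e y. if e = 0 then 1 / sqrt 2 else y (e - 1) / sqrt 2)"
proof
  have rt: "1 \<le> sqrt (2::real)" by simp
  show "0 < real n / 2" using n1 by auto
  show "space \<mu> = sphere_pts n" by (rule space_\<mu>)
  fix x y assume xy: "x \<in> sphere_pts n" "y \<in> sphere_pts n"
  have "(\<Sum>e<n + 2. (if e = 0 then 1 / sqrt 2 else x (e - 1) / sqrt 2) * (if e = 0 then 1 / sqrt 2 else y (e - 1) / sqrt 2))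
     = 1 / 2 + (\<Sum>e<Suc n. x e * y e / 2)"
    unfolding add_2_eq_Suc' sum.lessThan_Suc_shift[of _ "Suc n"] by (simp del: sum.lessThan_Suc)
  also have "\<dots> = sphere_t n x y"
    by (simp add: sphere_t_def sip_def lessThan_Suc_atMost add_divide_distrib sum_divide_distrib)
  finally show "sphere_t n x y = (\<Sum>e<n + 2. (if e = 0 then 1 / sqrt 2 else x (e - 1) / sqrt 2) * (if e = 0 then 1 / sqrt 2 else y (e - 1) / sqrt 2))" by simp
  show "0 \<le> sphere_t n x y \<and> sphere_t n x y \<le> 1" by (rule t_01[OF xy])
next
  fix e assume e: "e < n + 2"
  show "(\<lambda>y. if e = 0 then 1 / sqrt 2 else y (e - 1) / sqrt 2) \<in> borel_measurable \<mu>"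
    using sphere_coord_measurable[of "e - 1"] e by (cases "e = 0") auto
  fix x assume x: "x \<in> sphere_pts n"
  have "\<bar>z / sqrt 2\<bar> \<le> 1" if "\<bar>z\<bar> \<le> 1" for z :: real
  proof -
    have rt: "1 \<le> sqrt (2::real)" by simp
    have "\<bar>z / sqrt 2\<bar> = \<bar>z\<bar> / sqrt 2" by (simp add: abs_divide)
    also have "\<dots> \<le> 1" by (subst divide_le_eq_1_pos) (simp, rule order_trans[OF that rt])
    finally show ?thesis .
  qed
  from this[of 1] this[OF sphere_coord_abs_le_1[OF x]]
  show "\<bar>if e = 0 then 1 / sqrt 2 else x (e - 1) / sqrt 2\<bar> \<le> 1" by auto
next
  fix x assume x: "x \<in> sphere_pts n"
  show "sphere_t n x x = 1" by (simp add: sphere_t_def sip_self[OF x])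
  fix i
  have mom: "(\<integral>y. sphere_t n x y ^ k \<partial>\<mu>) = (\<integral>y. ((1 + y 0) / 2) ^ k \<partial>\<mu>)" for k
  proof -
    have e0: "unit_pt 0 \<in> sphere_pts n" by (rule unit_pt_sphere) simp
    obtain g where g: "isom (sphere_pts n) (sphere_t n) g" "g x = unit_pt 0" using sphere_move[OF x e0] by blast
    have "(\<integral>y. sphere_t n x y ^ k * sphere_t n y x ^ 0 \<partial>\<mu>) = (\<integral>y. sphere_t n (unit_pt 0) y ^ k * sphere_t n y (unit_pt 0) ^ 0 \<partial>\<mu>)"
      using convolution_isom[OF g(1) x x, of k 0] by (simp add: g(2))
    then show ?thesis by (simp add: sphere_t_def sip_unit_pt)
  qed
  have int: "integrable \<mu> (\<lambda>y. ((1 + y 0) / 2) ^ k)" for k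
  proof (rule sphere_integrable[where C = 1])
    show "(\<lambda>y. ((1 + y 0) / 2) ^ k) \<in> borel_measurable \<mu>" using sphere_coord_measurable[of 0] by measurable
    show "\<bar>((1 + y 0) / 2) ^ k\<bar> \<le> 1" if "y \<in> sphere_pts n" for y
      using sphere_coord_abs_le_1[OF that, of 0] by (simp add: power_abs abs_le_iff power_le_one)
  qed
  show "(\<integral>y. sphere_t n x y ^ i \<partial>\<mu>) = beta_exp (real n / 2) (real n / 2) (monom 1 i)"
    unfolding mom
  proof (rule beta_moment_unique)
    show "0 < real n / 2" "0 < real n / 2" using n1 by auto
    show "(\<integral>y. ((1 + y 0) / 2) ^ 0 \<partial>\<mu>) = 1" using prob_space by simp
    fix k
    \<comment> \<open>Stein's identity for the k-th power of (1 + x)/2 is the moment recursion of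
      Beta(n/2, n/2).\<close>
    let ?g = "[:1 / 2, 1 / 2:] ^ k :: real poly"
    have "(1 - x\<^sup>2) * poly (pderiv ?g) x - real n * x * poly ?g x
       = 2 * ((real k + real n / 2) * ((1 + x) / 2) ^ k - (real k + real n) * ((1 + x) / 2) ^ Suc k)" for x
    proof -
      have gz: "poly ?g x = ((1 + x) / 2) ^ k" by (simp add: add_divide_distrib)
      have h: "(1 - x\<^sup>2) * poly (pderiv ?g) x = 2 * real k * ((1 + x) / 2) ^ k * (1 - (1 + x) / 2)"
      proof (cases k)
        case (Suc j)
        have e1: "poly (pderiv ?g) x = real k * (1 / 2) * ((1 + x) / 2) ^ j"
          unfolding Suc pderiv_power_Suc poly_mult poly_smult poly_power by (simp add: pderiv_pCons add_divide_distrib)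
        have e2: "(1 - x\<^sup>2) = 4 * ((1 + x) / 2) * (1 - (1 + x) / 2)" by (simp add: power2_eq_square field_simps)
        have e3: "4 * z * (1 - z) * (r * (1 / 2) * w) = 2 * r * (z * w) * (1 - z)" for z r w :: real by (simp add: algebra_simps)
        show ?thesis unfolding e1 e2 unfolding Suc power_Suc by (rule e3)
      qed simp
      have e4: "2 * real k * w * (1 - (1 + x) / 2) - real n * x * w = 2 * ((real k + real n / 2) * w - (real k + real n) * ((1 + x) / 2 * w))" for w
        by (simp add: field_simps)
      show ?thesis unfolding h gz power_Suc by (rule e4)
    qed
    then have "(\<integral>y. 2 * ((real k + real n / 2) * ((1 + y 0) / 2) ^ k - (real k + real n) * ((1 + y 0) / 2) ^ Suc k) \<partial>\<mu>) = 0"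
      using sphere_stein[of ?g] by simp
    moreover define F where "F j y = ((1 + y 0) / 2) ^ j" for j :: nat and y :: "nat \<Rightarrow> real"
    moreover have "integrable \<mu> (F j)" for j unfolding F_def by (rule int)
    then have "(\<integral>y. 2 * (c1 * F k y - c2 * F (Suc k) y) \<partial>\<mu>) = 2 * (c1 * (\<integral>y. F k y \<partial>\<mu>) - c2 * (\<integral>y. F (Suc k) y \<partial>\<mu>))" for c1 c2
      by simp
    ultimately have "(real k + real n / 2) * (\<integral>y. ((1 + y 0) / 2) ^ k \<partial>\<mu>) - (real k + real n) * (\<integral>y. ((1 + y 0) / 2) ^ Suc k \<partial>\<mu>) = 0"
      by (simp del: power_Suc)
    then show "(real n / 2 + real n / 2 + real k) * (\<integral>y. ((1 + y 0) / 2) ^ Suc k \<partial>\<mu>) = (real n / 2 + real k) * (\<integral>y. ((1 + y 0) / 2) ^ k \<partial>\<mu>)"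
      by (simp add: algebra_simps del: power_Suc)
  qed
next
  fix i j
  have e0: "unit_pt 0 \<in> sphere_pts n" by (rule unit_pt_sphere) simp
  show "\<exists>q. degree q \<le> i \<and> (\<forall>x\<in>sphere_pts n. \<forall>z\<in>sphere_pts n. (\<integral>y. sphere_t n x y ^ i * sphere_t n y z ^ j \<partial>\<mu>) = poly q (sphere_t n x z))"
  \<comment> \<open>With z at \<open>unit_pt 0\<close>, x can be brought to (2 T - 1, 2 s, 0, ...);
    writing t from that point as an affine function of T and s gives these U, V and W.\<close>
  proof (rule convolution_polynomial[OF e0, where U = "\<lambda>y. (1 - y 0) / 2" and V = "\<lambda>y. y 0" and W = "\<lambda>y. y 1" and C = 1])
    show "(\<lambda>y. (1 - y 0) / 2) \<in> borel_measurable \<mu>" "(\<lambda>y. y 0) \<in> borel_measurable \<mu>" "(\<lambda>y. y 1) \<in> borel_measurable \<mu>"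
      using sphere_coord_measurable[of 0] sphere_coord_measurable[of 1] n1 by auto
    fix y assume y: "y \<in> sphere_pts n"
    show "\<bar>y 0\<bar> \<le> 1" "\<bar>y 1\<bar> \<le> 1" "\<bar>(1 - y 0) / 2\<bar> \<le> 1"
      using sphere_coord_abs_le_1[OF y, of 0] sphere_coord_abs_le_1[OF y, of 1] by auto
  next
    fix x z assume x: "x \<in> sphere_pts n" and z: "z \<in> sphere_pts n"
    define T where "T = sphere_t n x z"
    define s where "s = sqrt (T * (1 - T))"
    have s: "s\<^sup>2 = T * (1 - T)" using t_01[OF x z] by (simp add: s_def T_def)
    \<comment> \<open>One reflection takes z to \<open>unit_pt 0\<close>; a second one takes the
      image of x to q and fixes \<open>unit_pt 0\<close>, since both have the same inner product
      with it.\<close>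
    have move: "\<exists>g. isom (sphere_pts n) (sphere_t n) g \<and> g z = unit_pt 0 \<and> (\<forall>y\<in>sphere_pts n. sphere_t n (g x) y = (1 - y 0) / 2 + T * y 0 + s' * y 1)"
      if s': "s'\<^sup>2 = T * (1 - T)" for s'
    proof -
      define q where "q = plane_pt 1 (2 * T - 1) (2 * s')"
      have q: "q \<in> sphere_pts n" unfolding q_def using n1 s'
        by (intro plane_pt_sphere) (auto simp: power2_eq_square algebra_simps)
      obtain g1 where g1: "isom (sphere_pts n) (sphere_t n) g1" "g1 z = unit_pt 0" using sphere_move[OF z e0] by blast
      have g1x: "g1 x \<in> sphere_pts n" by (rule isom_in[OF g1(1) x])
      have "sphere_t n (g1 x) (unit_pt 0) = T" using isom_preserves[OF g1(1) x z] by (simp add: g1(2) T_def)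
      then have "sip n (unit_pt 0) (g1 x) = 2 * T - 1" by (simp add: sphere_t_def sip_commute field_simps)
      moreover have "sip n (unit_pt 0) q = 2 * T - 1" unfolding sip_unit_pt[OF le0] q_def by (simp add: plane_pt_def unit_pt_def)
      ultimately obtain g2 where g2: "isom (sphere_pts n) (sphere_t n) g2" "g2 (g1 x) = q" "g2 (unit_pt 0) = unit_pt 0"
        using sphere_move[OF g1x q] e0 by metis
      have "sphere_t n q y = (1 - y 0) / 2 + T * y 0 + s' * y 1" for y
        using n1 by (simp add: sphere_t_def q_def sip_plane_pt field_simps)
      then show ?thesis using isom_comp[OF g2(1) g1(1)] g1 g2 by (intro exI[of _ "\<lambda>x. g2 (g1 x)"]) auto
    qed
    obtain g h where "isom (sphere_pts n) (sphere_t n) g" "g z = unit_pt 0" "\<forall>y\<in>sphere_pts n. sphere_t n (g x) y = (1 - y 0) / 2 + T * y 0 + s * y 1"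
      "isom (sphere_pts n) (sphere_t n) h" "h z = unit_pt 0" "\<forall>y\<in>sphere_pts n. sphere_t n (h x) y = (1 - y 0) / 2 + T * y 0 + (- s) * y 1"
      using move[OF s] move[of "- s"] s by auto
    then show "\<exists>s g h. s\<^sup>2 = sphere_t n x z * (1 - sphere_t n x z) \<and> isom (sphere_pts n) (sphere_t n) g \<and> isom (sphere_pts n) (sphere_t n) h \<and> g z = unit_pt 0 \<and> h z = unit_pt 0 \<and>
       (\<forall>y\<in>sphere_pts n. sphere_t n (g x) y = (1 - y 0) / 2 + sphere_t n x z * y 0 + s * y 1) \<and> (\<forall>y\<in>sphere_pts n. sphere_t n (h x) y = (1 - y 0) / 2 + sphere_t n x z * y 0 - s * y 1)"
      unfolding T_def[symmetric] using s by (intro exI[of _ s] exI[of _ g] exI[of _ h]) auto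
  qed
qed

lemma sphere_rgg:
  assumes "iid_sample (sphere_pts n) (sphere_dist n) P \<mu> Y" "0 < L" "L < pi / 2"
  shows "rgg_converges (sphere_pts n) (sphere_dist n) L P Y
     (threshold_coeff (real n / 2) (real n / 2) ((1 + cos L) / 2)) (jac_dim (real n / 2) (real n / 2))"
proof -
  interpret zonal_space "sphere_pts n" \<mu> "sphere_t n" "real n / 2" "real n / 2" "n + 2"
    "\<lambda>e y. if e = 0 then 1 / sqrt 2 else y (e - 1) / sqrt 2" by (rule sphere_zonal)
  show ?thesis
  proof (rule rgg_converges_threshold[OF assms(1) sets_\<mu>])
    fix x y assume xy: "x \<in> sphere_pts n" "y \<in> sphere_pts n"
    have b: "\<bar>sip n x y\<bar> \<le> 1" by (rule sip_abs_le_1[OF xy])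
    have "sphere_dist n x y \<le> L \<longleftrightarrow> cos L \<le> cos (sphere_dist n x y)"
      using assms b arccos_bounded[of "sip n x y"] by (subst cos_mono_le_eq) (auto simp: sphere_dist_def sip_def abs_le_iff)
    also have "cos (sphere_dist n x y) = sip n x y" using b by (simp add: sphere_dist_def abs_le_iff flip: sip_def)
    finally show "sphere_dist n x y \<le> L \<longleftrightarrow> (1 + cos L) / 2 \<le> sphere_t n x y" by (simp add: sphere_t_def)
  qed
qed

end

section \<open>Composition algebras\<close>

lemma cd_mult_supp: "2 ^ m \<le> i \<Longrightarrow> cd_mult m a b i = 0"
  by (cases m) (auto simp: cd_join_def)

lemma cd_conj_eq: "cd_conj m a = (\<lambda>i. if i = 0 then a 0 else if i < 2 ^ m then - a i else 0)"
proof (induction m arbitrary: a)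
  case (Suc m)
  show ?case by (auto simp: fun_eq_iff Suc cd_join_def cd_lo_def cd_hi_def)
qed (auto simp: fun_eq_iff)

lemma cd_mult_add_left: "cd_mult m (\<lambda>i. a i + a' i) b = (\<lambda>i. cd_mult m a b i + cd_mult m a' b i)"
  and cd_mult_add_right: "cd_mult m b (\<lambda>i. a i + a' i) = (\<lambda>i. cd_mult m b a i + cd_mult m b a' i)"
proof (induction m arbitrary: a a' b)
  case (Suc m)
  have lo: "cd_lo m (\<lambda>i. a i + a' i) = (\<lambda>i. cd_lo m a i + cd_lo m a' i)" for a a' by (auto simp: cd_lo_def)
  have hi: "cd_hi m (\<lambda>i. a i + a' i) = (\<lambda>i. cd_hi m a i + cd_hi m a' i)" for a a' by (auto simp: cd_hi_def)
  have cj: "cd_conj m (\<lambda>i. a i + a' i) = (\<lambda>i. cd_conj m a i + cd_conj m a' i)" for a a' by (auto simp: cd_conj_eq)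
  { case 1 show ?case by (simp only: cd_mult.simps lo hi cj Suc) (auto simp: cd_join_def fun_eq_iff) }
  { case 2 show ?case by (simp only: cd_mult.simps lo hi cj Suc) (auto simp: cd_join_def fun_eq_iff) }
qed (auto simp: fun_eq_iff algebra_simps)

lemma cd_mult_scale_left: "cd_mult m (\<lambda>i. c * a i) b = (\<lambda>i. c * cd_mult m a b i)"
  and cd_mult_scale_right: "cd_mult m b (\<lambda>i. c * a i) = (\<lambda>i. c * cd_mult m b a i)"
proof (induction m arbitrary: a b)
  case (Suc m)
  have lo: "cd_lo m (\<lambda>i. c * a i) = (\<lambda>i. c * cd_lo m a i)" for a by (auto simp: cd_lo_def)
  have hi: "cd_hi m (\<lambda>i. c * a i) = (\<lambda>i. c * cd_hi m a i)" for a by (auto simp: cd_hi_def)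
  have cj: "cd_conj m (\<lambda>i. c * a i) = (\<lambda>i. c * cd_conj m a i)" for a by (auto simp: cd_conj_eq)
  { case 1 show ?case by (simp only: cd_mult.simps lo hi cj Suc) (auto simp: cd_join_def fun_eq_iff algebra_simps) }
  { case 2 show ?case by (simp only: cd_mult.simps lo hi cj Suc) (auto simp: cd_join_def fun_eq_iff algebra_simps) }
qed (auto simp: fun_eq_iff algebra_simps)

lemma cd_mult_0_left: "cd_mult m (\<lambda>_. 0) b = (\<lambda>_. 0)" and cd_mult_0_right: "cd_mult m b (\<lambda>_. 0) = (\<lambda>_. 0)"
  using cd_mult_scale_left[of m 0 "\<lambda>_. 0" b] cd_mult_scale_right[of m b 0 "\<lambda>_. 0"] by simp_all

lemma cd_mult_sum_left: "cd_mult m (\<lambda>i. \<Sum>k\<in>A. f k i) b = (\<lambda>i. \<Sum>k\<in>A. cd_mult m (f k) b i)"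
  by (induction A rule: infinite_finite_induct) (simp_all add: cd_mult_0_left cd_mult_add_left)

lemma cd_mult_sum_right: "cd_mult m b (\<lambda>i. \<Sum>k\<in>A. f k i) = (\<lambda>i. \<Sum>k\<in>A. cd_mult m b (f k) i)"
  by (induction A rule: infinite_finite_induct) (simp_all add: cd_mult_0_right cd_mult_add_right)

text \<open>The level-m algebra inside the octonions: elements supported on the first 2^m
  coordinates.\<close>

definition cd_supp :: "nat \<Rightarrow> (nat \<Rightarrow> real) \<Rightarrow> bool" where
  "cd_supp m a \<longleftrightarrow> (\<forall>i\<ge>2 ^ m. a i = 0)"

lemma cd_mult_embed_Suc:
  assumes "cd_supp m a" "cd_supp m b"
  shows "cd_mult (Suc m) a b = cd_mult m a b"
proof -
  have e: "cd_lo m a = a" "cd_lo m b = b" "cd_hi m a = (\<lambda>_. 0)" "cd_hi m b = (\<lambda>_. 0)" "cd_conj m (\<lambda>_. 0) = (\<lambda>_. 0)"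
    using assms by (auto simp: cd_supp_def cd_lo_def cd_hi_def cd_conj_eq fun_eq_iff)
  show ?thesis unfolding cd_mult.simps e cd_mult_0_left cd_mult_0_right
    by (auto simp: cd_join_def fun_eq_iff cd_mult_supp)
qed

lemma cd_supp_mono: "cd_supp m a \<Longrightarrow> m \<le> m' \<Longrightarrow> cd_supp m' a"
  unfolding cd_supp_def by (meson order_trans power_increasing one_le_numeral)

text \<open>Each doubling contains the smaller algebra as the pairs (a, 0); from here on all four
  algebras share the octonion product \<open>om\<close>.\<close>

lemma cd_mult_embed:
  assumes "m \<le> 3" "cd_supp m a" "cd_supp m b"
  shows "cd_mult m a b = cd_mult 3 a b"
  using assms(1)
proof (induction rule: inc_induct)
  case (step k)
  show ?case
    using step cd_mult_embed_Suc[of k a b] assms(2,3)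
    by (metis cd_supp_mono)
qed simp

lemma cd_conj_embed: "m \<le> 3 \<Longrightarrow> cd_supp m a \<Longrightarrow> cd_conj m a = cd_conj 3 a"
  using cd_supp_mono[of m a 3] power_increasing[of m 3 "2::nat"] by (auto simp: cd_conj_eq cd_supp_def fun_eq_iff)

section \<open>Octonion identities from the multiplication table\<close>

lemma oct_mult:
  "cd_mult 3 a b 0 = a 0 * b 0 - a 1 * b 1 - a 2 * b 2 - a 3 * b 3 - a 4 * b 4 - a 5 * b 5 - a 6 * b 6 - a 7 * b 7"
  "cd_mult 3 a b 1 = a 0 * b 1 + a 1 * b 0 + a 2 * b 3 - a 3 * b 2 + a 4 * b 5 - a 5 * b 4 - a 6 * b 7 + a 7 * b 6"
  "cd_mult 3 a b 2 = a 0 * b 2 - a 1 * b 3 + a 2 * b 0 + a 3 * b 1 + a 4 * b 6 + a 5 * b 7 - a 6 * b 4 - a 7 * b 5"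
  "cd_mult 3 a b 3 = a 0 * b 3 + a 1 * b 2 - a 2 * b 1 + a 3 * b 0 + a 4 * b 7 - a 5 * b 6 + a 6 * b 5 - a 7 * b 4"
  "cd_mult 3 a b 4 = a 0 * b 4 - a 1 * b 5 - a 2 * b 6 - a 3 * b 7 + a 4 * b 0 + a 5 * b 1 + a 6 * b 2 + a 7 * b 3"
  "cd_mult 3 a b 5 = a 0 * b 5 + a 1 * b 4 - a 2 * b 7 + a 3 * b 6 - a 4 * b 1 + a 5 * b 0 - a 6 * b 3 + a 7 * b 2"
  "cd_mult 3 a b 6 = a 0 * b 6 + a 1 * b 7 + a 2 * b 4 - a 3 * b 5 - a 4 * b 2 + a 5 * b 3 + a 6 * b 0 - a 7 * b 1"
  "cd_mult 3 a b 7 = a 0 * b 7 - a 1 * b 6 + a 2 * b 5 + a 3 * b 4 - a 4 * b 3 - a 5 * b 2 + a 6 * b 1 + a 7 * b 0"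
  by (simp_all add: numeral_eq_Suc cd_join_def cd_lo_def cd_hi_def cd_conj_eq algebra_simps)

abbreviation om :: "(nat \<Rightarrow> real) \<Rightarrow> (nat \<Rightarrow> real) \<Rightarrow> nat \<Rightarrow> real" where "om \<equiv> cd_mult 3"

abbreviation oc :: "(nat \<Rightarrow> real) \<Rightarrow> nat \<Rightarrow> real" where "oc \<equiv> cd_conj 3"

definition dot :: "(nat \<Rightarrow> real) \<Rightarrow> (nat \<Rightarrow> real) \<Rightarrow> real" where
  "dot a b = (\<Sum>i<8. a i * b i)"

definition cd_unit :: "nat \<Rightarrow> nat \<Rightarrow> real" where
  "cd_unit k = (\<lambda>i. if i = k then 1 else 0)"

lemma dot_expand: "dot a b = a 0 * b 0 + a 1 * b 1 + a 2 * b 2 + a 3 * b 3 + a 4 * b 4 + a 5 * b 5 + a 6 * b 6 + a 7 * b 7"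
  by (simp add: dot_def numeral_eq_Suc)

lemma oct_conj: "oc a 0 = a 0" "oc a 1 = - a 1" "oc a 2 = - a 2" "oc a 3 = - a 3" "oc a 4 = - a 4"
  "oc a 5 = - a 5" "oc a 6 = - a 6" "oc a 7 = - a 7"
  by (simp_all add: cd_conj_eq)

lemma oct_supp: "8 \<le> i \<Longrightarrow> om a b i = 0" "8 \<le> i \<Longrightarrow> oc a i = 0"
  using cd_mult_supp[of 3 i a b] by (auto simp: cd_conj_eq)

lemma oct_eqI:
  fixes f g :: "nat \<Rightarrow> real"
  assumes "\<And>i. 8 \<le> i \<Longrightarrow> f i = g i" "f 0 = g 0" "f 1 = g 1" "f 2 = g 2" "f 3 = g 3" "f 4 = g 4" "f 5 = g 5" "f 6 = g 6" "f 7 = g 7"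
  shows "f = g"
proof
  fix i :: nat
  consider "i = 0" | "i = 1" | "i = 2" | "i = 3" | "i = 4" | "i = 5" | "i = 6" | "i = 7" | "8 \<le> i" by linarith
  then show "f i = g i" by cases (simp_all only: assms)
qed

lemmas oct_mult_Suc = oct_mult oct_mult(2)[unfolded One_nat_def] and oct_conj_Suc = oct_conj oct_conj(2)[unfolded One_nat_def]

lemma om_re: "om a b 0 = dot a (oc b)"
  by (simp add: oct_mult_Suc dot_expand oct_conj_Suc)

lemma oc_om: "oc (om a b) = om (oc b) (oc a)"
  by (rule oct_eqI) (simp_all only: oct_supp oct_mult oct_conj, simp_all add: algebra_simps)

lemma oc_oc: "cd_supp 3 a \<Longrightarrow> oc (oc a) = a"
  by (rule oct_eqI) (auto simp only: oct_supp oct_conj cd_supp_def, simp_all)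

lemma om_oc_self: "om a (oc a) = (\<lambda>i. if i = 0 then dot a a else 0)"
  by (rule oct_eqI) (simp_all add: oct_supp oct_mult_Suc oct_conj_Suc dot_expand algebra_simps)

lemma om_alt_right: "cd_supp 3 a \<Longrightarrow> om (om a b) (oc b) = (\<lambda>i. dot b b * a i)"
  by (rule oct_eqI) (simp_all only: oct_supp oct_mult oct_conj dot_expand, simp_all add: cd_supp_def algebra_simps)

lemma om_alt_left: "cd_supp 3 a \<Longrightarrow> om (oc b) (om b a) = (\<lambda>i. dot b b * a i)"
  by (rule oct_eqI) (simp_all only: oct_supp oct_mult oct_conj dot_expand, simp_all add: cd_supp_def algebra_simps)

lemma dot_om_adjoint: "dot (om a b) c = dot a (om c (oc b))"
  by (simp only: dot_expand oct_mult oct_conj) (simp add: algebra_simps)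

text \<open>Right multiplication by b has adjoint right multiplication by \<open>oc b\<close>, and
  by alternativity the two compose to the scalar \<open>dot b b\<close>; so norms multiply.\<close>

lemma dot_om_om: "dot (om a b) (om a b) = dot a a * dot b b"
proof -
  \<comment> \<open>\<open>dot\<close> and \<open>om\<close> only read the first eight coordinates,
    while \<open>om_alt_right\<close> asks for support there; hence the truncation.\<close>
  define a' where "a' = (\<lambda>i. if i < 8 then a i else 0)"
  have a: "om a b = om a' b" by (rule oct_eqI) (simp_all only: oct_supp oct_mult, simp_all add: a'_def)
  have "cd_supp 3 a'" by (simp add: a'_def cd_supp_def)
  then have "dot (om a' b) (om a' b) = dot a' (\<lambda>i. dot b b * a' i)" by (simp only: dot_om_adjoint om_alt_right)
  also have "\<dots> = dot a a * dot b b" by (simp add: dot_def a'_def sum_distrib_right mult_ac)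
  finally show ?thesis by (simp only: a)
qed

lemma om_assoc:
  assumes "cd_supp 2 a" "cd_supp 2 b" "cd_supp 2 c"
  shows "om (om a b) c = om a (om b c)"
proof -
  have "x 4 = 0" "x 5 = 0" "x 6 = 0" "x 7 = 0" if "cd_supp 2 x" for x using that by (auto simp: cd_supp_def)
  note z = this[OF assms(1)] this[OF assms(2)] this[OF assms(3)]
  show ?thesis
    by (rule oct_eqI) (simp_all only: oct_supp oct_mult z, simp_all add: algebra_simps)
qed

text \<open>Moufang identities, which take the place of associativity. They are not linear in the
  unit, but basis units suffice later, where each of them brings one coordinate of an entry to the
  real part.\<close>

lemma om_moufang_unit:
  assumes "k < 8"
  shows "om (om (cd_unit k) x) (om y (cd_unit k)) = om (om (cd_unit k) (om x y)) (cd_unit k)"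
    and "om (om (om (cd_unit k) x) (cd_unit k)) (om (oc (cd_unit k)) y) = om (cd_unit k) (om x y)"
proof -
  have k: "k = 0 \<or> k = 1 \<or> k = 2 \<or> k = 3 \<or> k = 4 \<or> k = 5 \<or> k = 6 \<or> k = 7" using assms by auto
  show "om (om (cd_unit k) x) (om y (cd_unit k)) = om (om (cd_unit k) (om x y)) (cd_unit k)"
    using k by (elim disjE; hypsubst; intro oct_eqI) (simp_all add: oct_supp oct_mult_Suc cd_unit_def algebra_simps)
  show "om (om (om (cd_unit k) x) (cd_unit k)) (om (oc (cd_unit k)) y) = om (cd_unit k) (om x y)"
    using k by (elim disjE; hypsubst; intro oct_eqI) (simp_all add: oct_supp oct_mult_Suc oct_conj_Suc cd_unit_def algebra_simps)
qed

lemma om_unit_0: "cd_supp 3 a \<Longrightarrow> om (cd_unit 0) a = a" "cd_supp 3 a \<Longrightarrow> om a (cd_unit 0) = a"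
  by (intro oct_eqI; simp add: oct_supp oct_mult_Suc cd_unit_def cd_supp_def)+

lemma om_supp: "m \<le> 3 \<Longrightarrow> cd_supp m a \<Longrightarrow> cd_supp m b \<Longrightarrow> cd_supp m (om a b)"
  using cd_mult_embed[of m a b] cd_mult_supp[of m _ a b] by (simp add: cd_supp_def)

lemma oc_supp: "cd_supp m a \<Longrightarrow> cd_supp m (oc a)"
  by (auto simp: cd_supp_def cd_conj_eq)

lemma unit_supp: "k < 2 ^ m \<Longrightarrow> cd_supp m (cd_unit k)"
  by (auto simp: cd_supp_def cd_unit_def)

section \<open>Projective spaces as sets of idempotents\<close>

text \<open>\<open>herm_ok\<close> expressed through octonion conjugation and a support condition,
  so that all levels use the same operations.\<close>

definition hform :: "nat \<Rightarrow> nat \<Rightarrow> hmat \<Rightarrow> bool" where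
  "hform m n M \<longleftrightarrow> (\<forall>i j. n < i \<or> n < j \<longrightarrow> M i j = (\<lambda>_. 0)) \<and> (\<forall>i j. cd_supp m (M i j)) \<and> (\<forall>i j. M j i = oc (M i j))"

definition pprod :: "nat \<Rightarrow> hmat \<Rightarrow> hmat \<Rightarrow> hmat" where
  "pprod n M N = (\<lambda>i j a. \<Sum>k\<le>n. om (M i k) (N k j) a)"

text \<open>The trace form of the Jordan product as the Euclidean inner product of all
  entries.\<close>

definition tt :: "nat \<Rightarrow> hmat \<Rightarrow> hmat \<Rightarrow> real" where
  "tt n P Q = (\<Sum>i\<le>n. \<Sum>k\<le>n. dot (P i k) (Q i k))"

lemma hform_out: "hform m n M \<Longrightarrow> n < i \<or> n < j \<Longrightarrow> M i j = (\<lambda>_. 0)"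
  and hform_supp: "hform m n M \<Longrightarrow> cd_supp m (M i j)"
  and hform_conj: "hform m n M \<Longrightarrow> M j i = oc (M i j)"
  unfolding hform_def by blast+

lemma hform_supp3: "m \<le> 3 \<Longrightarrow> hform m n M \<Longrightarrow> cd_supp 3 (M i j)"
  unfolding hform_def by (blast intro: cd_supp_mono)

lemma herm_ok_iff: "m \<le> 3 \<Longrightarrow> herm_ok m n M \<longleftrightarrow> hform m n M"
proof -
  assume m: "m \<le> 3"
  have 1: "(\<forall>i j a. 2 ^ m \<le> a \<longrightarrow> M i j a = 0) \<longleftrightarrow> (\<forall>i j. cd_supp m (M i j))" by (auto simp: cd_supp_def)
  have 2: "cd_conj m (M i j) = oc (M i j)" if "\<forall>i j. cd_supp m (M i j)" for i j
    using that m by (simp add: cd_conj_embed)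
  have 3: "(\<forall>i j. M j i = cd_conj m (M i j)) \<longleftrightarrow> (\<forall>i j. M j i = oc (M i j))" if "\<forall>i j. cd_supp m (M i j)"
    by (simp only: 2[OF that])
  show ?thesis unfolding herm_ok_def hform_def 1 using 3 by blast
qed

lemma jordan_prod_eq:
  assumes m: "m \<le> 3" and M: "hform m n M" and N: "hform m n N"
  shows "jordan_prod m n M N i j a = (pprod n M N i j a + pprod n N M i j a) / 2"
proof -
  have "cd_mult m (M i k) (N k j) = om (M i k) (N k j)" "cd_mult m (N i k) (M k j) = om (N i k) (M k j)" for k
    by (rule cd_mult_embed[OF m hform_supp[OF M] hform_supp[OF N]]) (rule cd_mult_embed[OF m hform_supp[OF N] hform_supp[OF M]])
  then show ?thesis by (simp add: jordan_prod_def pprod_def sum.distrib)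
qed

text \<open>The Jordan square of a Hermitian matrix is its matrix square, and outside the block of
  indices up to n both sides of the idempotent equation vanish.\<close>

lemma proj_space_iff:
  assumes m: "m \<le> 3"
  shows "M \<in> proj_space m n \<longleftrightarrow> hform m n M \<and> (\<forall>i\<le>n. \<forall>j\<le>n. pprod n M M i j = M i j) \<and> (\<Sum>i\<le>n. M i i 0) = 1"
proof -
  have "jordan_prod m n M M = M \<longleftrightarrow> (\<forall>i\<le>n. \<forall>j\<le>n. pprod n M M i j = M i j)" if M: "hform m n M"
  proof -
    have z: "pprod n M M i j = M i j" if "\<not> (i \<le> n \<and> j \<le> n)" for i j
    proof -
      have "om (M i k) (M k j) = (\<lambda>_. 0)" for k
        using that hform_out[OF M, of i k] hform_out[OF M, of k j] by (cases "i \<le> n") (simp_all add: cd_mult_0_left cd_mult_0_right)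
      moreover have "M i j = (\<lambda>_. 0)" using that by (intro hform_out[OF M]) auto
      ultimately show ?thesis by (simp add: pprod_def fun_eq_iff)
    qed
    have "jordan_prod m n M M = pprod n M M" by (intro ext) (simp add: jordan_prod_eq[OF m M M])
    then have "jordan_prod m n M M = M \<longleftrightarrow> (\<forall>i j. pprod n M M i j = M i j)" by (simp only: fun_eq_iff)
    then show ?thesis using z by blast
  qed
  then show ?thesis unfolding proj_space_def mem_Collect_eq herm_ok_iff[OF m] jtrace_def by blast
qed

lemma jtrace_jordan_prod:
  assumes m: "m \<le> 3" and P: "hform m n P" and Q: "hform m n Q"
  shows "jtrace n (jordan_prod m n P Q) = tt n P Q"
proof -
  have 1: "om (P i k) (Q k i) 0 = dot (P i k) (Q i k)" for i k
  proof -
    show ?thesis unfolding om_re hform_conj[OF Q, of i k, symmetric] ..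
  qed
  have 2: "om (Q i k) (P k i) 0 = dot (P i k) (Q i k)" for i k
  proof -
    show ?thesis unfolding om_re hform_conj[OF P, of i k, symmetric] by (simp add: dot_def mult.commute)
  qed
  show ?thesis by (simp add: jtrace_def jordan_prod_eq[OF m P Q] pprod_def 1 2 tt_def)
qed

lemma dot_nonneg: "0 \<le> dot a a"
  by (simp add: dot_def sum_nonneg)

lemma dot_eq_0: "dot a a = 0 \<Longrightarrow> cd_supp 3 a \<Longrightarrow> a = (\<lambda>_. 0)"
proof -
  assume "dot a a = 0" and s: "cd_supp 3 a"
  then have "\<forall>i<8. a i = 0" unfolding dot_def by (subst (asm) sum_nonneg_eq_0_iff) auto
  moreover have "\<forall>i\<ge>8. a i = 0" using s by (simp add: cd_supp_def)
  ultimately show ?thesis by (intro ext) (metis not_less)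
qed

lemma dot_oc: "dot (oc a) (oc b) = dot a b"
  by (simp only: dot_expand oct_conj minus_mult_minus)

lemma om_real_left: "cd_supp 3 a \<Longrightarrow> om (\<lambda>i. c * cd_unit 0 i) a = (\<lambda>i. c * a i)"
  and om_real_right: "cd_supp 3 a \<Longrightarrow> om a (\<lambda>i. c * cd_unit 0 i) = (\<lambda>i. c * a i)"
  by (simp_all add: cd_mult_scale_left cd_mult_scale_right om_unit_0)

section \<open>Entries of an idempotent of trace one\<close>

context
  fixes m n :: nat and y :: hmat
  assumes m: "m \<le> 3" and y: "y \<in> proj_space m n"
begin

lemma proj_herm: "hform m n y"
  and proj_idem: "i \<le> n \<Longrightarrow> j \<le> n \<Longrightarrow> pprod n y y i j = y i j"
  and proj_trace: "(\<Sum>i\<le>n. y i i 0) = 1"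
  using y by (auto simp: proj_space_iff[OF m])

lemma proj_supp: "cd_supp 3 (y i j)"
  using hform_supp3[OF m proj_herm] .

lemma proj_conj: "y j i = oc (y i j)"
  by (rule hform_conj[OF proj_herm])

lemma proj_outside: "n < i \<or> n < j \<Longrightarrow> y i j = (\<lambda>_. 0)"
  by (rule hform_out[OF proj_herm])

lemma proj_diag: "y i i = (\<lambda>a. y i i 0 * cd_unit 0 a)"
proof
  fix a
  have "y i i a = oc (y i i) a" by (rule fun_cong[OF proj_conj])
  then show "y i i a = y i i 0 * cd_unit 0 a"
    using proj_supp[of i i] by (cases "a < 8") (auto simp: cd_conj_eq cd_unit_def cd_supp_def split: if_splits)
qed

lemma proj_diag_sum: "i \<le> n \<Longrightarrow> y i i 0 = (\<Sum>k\<le>n. dot (y i k) (y i k))"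
proof -
  assume i: "i \<le> n"
  have "y i i 0 = pprod n y y i i 0" by (simp add: proj_idem i)
  also have "\<dots> = (\<Sum>k\<le>n. dot (y i k) (y i k))"
    unfolding pprod_def
  proof (intro sum.cong refl)
    fix k
    have "om (y i k) (y k i) 0 = dot (y i k) (oc (y k i))" by (rule om_re)
    also have "oc (y k i) = y i k" by (rule proj_conj[symmetric])
    finally show "om (y i k) (y k i) 0 = dot (y i k) (y i k)" .
  qed
  finally show ?thesis .
qed

lemma proj_diag_nonneg: "0 \<le> y i i 0"
proof (cases "i \<le> n")
  case True
  then show ?thesis by (simp add: proj_diag_sum sum_nonneg dot_nonneg)
next
  case False
  then show ?thesis by (simp add: proj_outside)
qed

lemma proj_diag_le_1: "y i i 0 \<le> 1"
proof (cases "i \<le> n")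
  case True
  then have "y i i 0 \<le> (\<Sum>i\<le>n. y i i 0)" by (intro member_le_sum) (auto simp: proj_diag_nonneg)
  then show ?thesis by (simp add: proj_trace)
next
  case False
  then show ?thesis by (simp add: proj_outside)
qed

text \<open>The triangle inequality and the Cauchy--Schwarz inequality bound each entry by the diagonal;
  since both sides sum to 1, equality holds throughout.\<close>
lemma proj_norm:
  assumes ij: "i \<le> n" "j \<le> n"
  shows "dot (y i j) (y i j) = y i i 0 * y j j 0"
proof -
  define nr where "nr x = sqrt (dot x x)" for x :: "nat \<Rightarrow> real"
  have nr_L2: "nr x = L2_set x {..<8}" for x by (simp add: nr_def dot_def L2_set_def power2_eq_square)
  have nr_sum: "nr (\<lambda>a. \<Sum>k\<in>A. f k a) \<le> (\<Sum>k\<in>A. nr (f k))" for A :: "nat set" and f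
    unfolding nr_L2
  proof (induction A rule: infinite_finite_induct)
    case (insert k A)
    then show ?case using L2_set_triangle_ineq[of "f k" "\<lambda>a. \<Sum>k\<in>A. f k a" "{..<8}"] by simp
  qed (auto simp: L2_set_def)
  have le: "dot (y i j) (y i j) \<le> y i i 0 * y j j 0" if "i \<le> n" "j \<le> n" for i j
  proof -
    have "nr (y i j) = nr (\<lambda>a. \<Sum>k\<le>n. om (y i k) (y k j) a)"
      using proj_idem[OF that] by (simp add: pprod_def)
    also have "\<dots> \<le> (\<Sum>k\<le>n. nr (om (y i k) (y k j)))" by (rule nr_sum)
    also have "\<dots> = (\<Sum>k\<le>n. \<bar>nr (y i k)\<bar> * \<bar>nr (y k j)\<bar>)"
      by (simp add: nr_def dot_om_om real_sqrt_mult dot_nonneg)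
    also have "\<dots> \<le> L2_set (\<lambda>k. nr (y i k)) {..n} * L2_set (\<lambda>k. nr (y k j)) {..n}" by (rule L2_set_mult_ineq)
    also have "L2_set (\<lambda>k. nr (y i k)) {..n} = sqrt (y i i 0)"
      using that by (simp add: L2_set_def nr_def dot_nonneg proj_diag_sum)
    also have "L2_set (\<lambda>k. nr (y k j)) {..n} = sqrt (y j j 0)"
    proof -
      have "dot (y k j) (y k j) = dot (y j k) (y j k)" for k
        using dot_oc[of "y k j" "y k j"] unfolding proj_conj[of j k, symmetric] by (rule sym)
      then show ?thesis using that by (simp add: L2_set_def nr_def dot_nonneg proj_diag_sum)
    qed
    finally have "sqrt (dot (y i j) (y i j)) \<le> sqrt (y i i 0 * y j j 0)" by (simp add: nr_def real_sqrt_mult)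
    then show ?thesis by simp
  qed
  have "(\<Sum>p\<in>{..n} \<times> {..n}. y (fst p) (fst p) 0 * y (snd p) (snd p) 0 - dot (y (fst p) (snd p)) (y (fst p) (snd p))) = 0"
  proof -
    have "(\<Sum>p\<in>{..n} \<times> {..n}. y (fst p) (fst p) 0 * y (snd p) (snd p) 0) = (\<Sum>i\<le>n. y i i 0) * (\<Sum>j\<le>n. y j j 0)"
      by (simp add: sum_product sum.cartesian_product case_prod_unfold)
    moreover have "(\<Sum>p\<in>{..n} \<times> {..n}. dot (y (fst p) (snd p)) (y (fst p) (snd p))) = (\<Sum>i\<le>n. \<Sum>j\<le>n. dot (y i j) (y i j))"
      by (simp add: sum.cartesian_product case_prod_unfold)
    moreover have "(\<Sum>i\<le>n. \<Sum>j\<le>n. dot (y i j) (y i j)) = (\<Sum>i\<le>n. y i i 0)"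
      by (intro sum.cong refl proj_diag_sum[symmetric]) auto
    ultimately show ?thesis by (simp add: sum_subtractf proj_trace)
  qed
  then have "\<forall>p\<in>{..n} \<times> {..n}. y (fst p) (fst p) 0 * y (snd p) (snd p) 0 - dot (y (fst p) (snd p)) (y (fst p) (snd p)) = 0"
    by (subst (asm) sum_nonneg_eq_0_iff) (auto simp: le)
  then show ?thesis using ij by auto
qed

lemma proj_entry_zero: "y i i 0 = 0 \<or> y j j 0 = 0 \<Longrightarrow> y i j = (\<lambda>_. 0)"
proof (cases "i \<le> n \<and> j \<le> n")
  case True
  assume "y i i 0 = 0 \<or> y j j 0 = 0"
  then have "dot (y i j) (y i j) = 0" using proj_norm[of i j] True by auto
  then show ?thesis using proj_supp by (rule dot_eq_0)
next
  case False
  then show ?thesis using proj_outside[of i j] by (auto simp: not_le)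
qed

lemma proj_coord_bound: "\<bar>y i j a\<bar> \<le> 1"
proof (cases "i \<le> n \<and> j \<le> n \<and> a < 8")
  case True
  have "(y i j a)\<^sup>2 \<le> dot (y i j) (y i j)"
    unfolding dot_def power2_eq_square using True by (intro member_le_sum) auto
  also have "\<dots> = y i i 0 * y j j 0" using True by (intro proj_norm) auto
  also have "\<dots> \<le> 1 * 1" by (intro mult_mono) (auto simp: proj_diag_le_1 proj_diag_nonneg)
  finally have "(y i j a)\<^sup>2 \<le> 1\<^sup>2" by simp
  then show ?thesis by (metis abs_le_square_iff abs_one)
next
  case False
  then have "y i j a = 0" using proj_outside[of i j] proj_supp[of i j] by (auto simp: cd_supp_def not_le not_less)
  then show ?thesis by simp
qed

end

definition base_pt :: "nat \<Rightarrow> hmat" where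
  "base_pt j = (\<lambda>i k a. if i = j \<and> k = j then cd_unit 0 a else 0)"

lemma cd_supp_0: "cd_supp m (\<lambda>_. 0)" by (simp add: cd_supp_def)

lemma oc_0: "oc (\<lambda>_. 0) = (\<lambda>_. 0)" by (auto simp: cd_conj_eq)

lemma base_pt_in: "m \<le> 3 \<Longrightarrow> j \<le> n \<Longrightarrow> base_pt j \<in> proj_space m n"
proof -
  assume m: "m \<le> 3" and j: "j \<le> n"
  have e: "base_pt j i k = (if i = j \<and> k = j then cd_unit 0 else (\<lambda>_. 0))" for i k by (auto simp: base_pt_def)
  have u0: "oc (cd_unit 0) = cd_unit 0" by (auto simp: cd_conj_eq cd_unit_def fun_eq_iff)
  have "hform m n (base_pt j)"
    using j unit_supp[of 0 m] by (auto simp: hform_def e cd_supp_0 oc_0 u0)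
  moreover have "pprod n (base_pt j) (base_pt j) i k = base_pt j i k" for i k
  proof -
    have "om (base_pt j i l) (base_pt j l k) = (if l = j then base_pt j i k else (\<lambda>_. 0))" for l
      using om_unit_0(1)[of "cd_unit 0"] unit_supp[of 0 3] by (auto simp: e cd_mult_0_left cd_mult_0_right)
    then have "pprod n (base_pt j) (base_pt j) i k a = (\<Sum>l\<le>n. if l = j then base_pt j i k a else 0)" for a
      unfolding pprod_def by (intro sum.cong refl) auto
    then show ?thesis using j by (simp add: fun_eq_iff)
  qed
  moreover have "(\<Sum>i\<le>n. base_pt j i i 0) = 1"
    using j by (simp add: base_pt_def cd_unit_def)
  ultimately show ?thesis by (simp add: proj_space_iff[OF m])
qed

text \<open>Diagonal entries are nonnegative with sum 1, so all others vanish, and with them, by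
  \<open>proj_entry_zero\<close>, every entry outside position (j, j).\<close>

lemma proj_eq_base_pt:
  assumes m: "m \<le> 3" and y: "y \<in> proj_space m n" and j: "j \<le> n" and 1: "y j j 0 = 1"
  shows "y = base_pt j"
proof -
  have z: "y k k 0 = 0" if "k \<noteq> j" for k
  proof (cases "k \<le> n")
    case True
    have "y j j 0 + y k k 0 \<le> (\<Sum>i\<le>n. y i i 0)"
      using sum_mono2[of "{..n}" "{j, k}" "\<lambda>i. y i i 0"] j True that proj_diag_nonneg[OF m y] by auto
    then show ?thesis using 1 proj_trace[OF m y] proj_diag_nonneg[OF m y, of k] by linarith
  next
    case False
    then show ?thesis using proj_outside[OF m y, of k k] by simp
  qed
  have "y i k = base_pt j i k" for i k
  proof (cases "i = j \<and> k = j")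
    case True
    then show ?thesis using proj_diag[OF m y, of j] 1 by (simp add: base_pt_def fun_eq_iff)
  next
    case False
    then show ?thesis using proj_entry_zero[OF m y, of i k] z[of i] z[of k] by (auto simp: base_pt_def)
  qed
  then show ?thesis by (simp add: fun_eq_iff)
qed

lemma tt_base_pt: "j \<le> n \<Longrightarrow> tt n (base_pt j) y = y j j 0"
proof -
  assume j: "j \<le> n"
  have "dot (base_pt j i k) (y i k) = (if i = j \<and> k = j then y j j 0 else 0)" for i k
    by (auto simp: base_pt_def dot_expand cd_unit_def)
  then have "tt n (base_pt j) y = (\<Sum>i\<le>n. if i = j then (\<Sum>k\<le>n. if k = j then y j j 0 else 0) else 0)"
    unfolding tt_def by (intro sum.cong refl) (auto intro!: sum.cong)
  then show ?thesis using j by simp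
qed

lemma tt_commute: "tt n x y = tt n y x"
  by (simp add: tt_def dot_def mult.commute)

subsection \<open>Conjugation by orthogonal matrices\<close>

definition orth :: "nat \<Rightarrow> (nat \<Rightarrow> nat \<Rightarrow> real) \<Rightarrow> bool" where
  "orth n O1 \<longleftrightarrow> (\<forall>k\<le>n. \<forall>l\<le>n. (\<Sum>i\<le>n. O1 i k * O1 i l) = (if k = l then 1 else 0))
     \<and> (\<forall>k\<le>n. \<forall>l\<le>n. (\<Sum>i\<le>n. O1 k i * O1 l i) = (if k = l then 1 else 0))"

text \<open>Real scalars commute and associate with everything, so conjugation by a real orthogonal
  matrix respects the idempotent equation over the octonions too.\<close>

definition conjO :: "nat \<Rightarrow> (nat \<Rightarrow> nat \<Rightarrow> real) \<Rightarrow> hmat \<Rightarrow> hmat" where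
  "conjO n O1 M = (\<lambda>i j a. if i \<le> n \<and> j \<le> n then \<Sum>k\<le>n. \<Sum>l\<le>n. O1 i k * O1 j l * M k l a else 0)"

lemma orth_transpose: "orth n O1 \<Longrightarrow> orth n (\<lambda>i j. O1 j i)"
  by (simp add: orth_def)

lemma orth_collapse:
  assumes "orth n O1" "l \<le> n"
  shows "(\<Sum>i\<le>n. O1 i l * (\<Sum>k\<le>n. O1 i k * x k)) = x l"
proof -
  have "(\<Sum>i\<le>n. O1 i l * (\<Sum>k\<le>n. O1 i k * x k)) = (\<Sum>k\<le>n. (\<Sum>i\<le>n. O1 i l * O1 i k) * x k)"
    unfolding sum_distrib_left sum_distrib_right by (subst sum.swap) (simp add: mult_ac)
  also have "\<dots> = (\<Sum>k\<le>n. if k = l then x l else 0)"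
    using assms by (intro sum.cong refl) (auto simp: orth_def)
  finally show ?thesis using assms by simp
qed

lemma orth_inner:
  assumes "orth n O1"
  shows "(\<Sum>i\<le>n. (\<Sum>k\<le>n. O1 i k * x k) * (\<Sum>l\<le>n. O1 i l * z l)) = (\<Sum>k\<le>n. x k * z k)"
proof -
  have "(\<Sum>i\<le>n. (\<Sum>k\<le>n. O1 i k * x k) * (\<Sum>l\<le>n. O1 i l * z l)) = (\<Sum>k\<le>n. x k * (\<Sum>i\<le>n. O1 i k * (\<Sum>l\<le>n. O1 i l * z l)))"
    unfolding sum_distrib_right[of _ "{..n}" "\<Sum>l\<le>n. O1 i l * z l" for i] sum_distrib_left[of "x k" for k]
    by (subst sum.swap) (simp add: mult_ac)
  also have "\<dots> = (\<Sum>k\<le>n. x k * z k)" using assms by (intro sum.cong refl) (simp add: orth_collapse)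
  finally show ?thesis .
qed

lemma conjO_nested:
  "i \<le> n \<Longrightarrow> j \<le> n \<Longrightarrow> conjO n O1 M i j a = (\<Sum>k\<le>n. O1 i k * (\<Sum>l\<le>n. O1 j l * M k l a))"
  by (simp add: conjO_def sum_distrib_left mult.assoc)

lemma conjO_inverse:
  assumes O1: "orth n O1" and M: "\<And>i j. n < i \<or> n < j \<Longrightarrow> M i j = (\<lambda>_. 0)"
  shows "conjO n (\<lambda>i j. O1 j i) (conjO n O1 M) = M"
proof (intro ext)
  fix p q a
  show "conjO n (\<lambda>i j. O1 j i) (conjO n O1 M) p q a = M p q a"
  proof (cases "p \<le> n \<and> q \<le> n")
    case True
    have "conjO n (\<lambda>i j. O1 j i) (conjO n O1 M) p q a = (\<Sum>i\<le>n. O1 i p * (\<Sum>j\<le>n. O1 j q * conjO n O1 M i j a))"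
      using True by (simp add: conjO_nested)
    also have "\<dots> = (\<Sum>i\<le>n. O1 i p * (\<Sum>j\<le>n. O1 j q * (\<Sum>l\<le>n. O1 j l * (\<Sum>k\<le>n. O1 i k * M k l a))))"
    proof (intro sum.cong refl arg_cong2[where f = times])
      fix i j assume "i \<in> {..n}" "j \<in> {..n}"
      then show "conjO n O1 M i j a = (\<Sum>l\<le>n. O1 j l * (\<Sum>k\<le>n. O1 i k * M k l a))"
        unfolding sum_distrib_left conjO_def by (subst sum.swap) (simp add: mult_ac)
    qed
    also have "\<dots> = M p q a" using True by (simp add: orth_collapse[OF O1])
    finally show ?thesis .
  next
    case False
    then show ?thesis using M[of p q] by (auto simp: conjO_def not_le)
  qed
qed

lemma tt_conjO:
  assumes O1: "orth n O1"
  shows "tt n (conjO n O1 P) (conjO n O1 Q) = tt n P Q"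
proof -
  have "(\<Sum>i\<le>n. \<Sum>j\<le>n. conjO n O1 P i j a * conjO n O1 Q i j a) = (\<Sum>i\<le>n. \<Sum>j\<le>n. P i j a * Q i j a)" for a
  proof -
    have "(\<Sum>i\<le>n. \<Sum>j\<le>n. conjO n O1 P i j a * conjO n O1 Q i j a)
      = (\<Sum>j\<le>n. \<Sum>i\<le>n. (\<Sum>k\<le>n. O1 i k * (\<Sum>l\<le>n. O1 j l * P k l a)) * (\<Sum>k\<le>n. O1 i k * (\<Sum>l\<le>n. O1 j l * Q k l a)))"
      by (subst sum.swap) (simp add: conjO_nested)
    also have "\<dots> = (\<Sum>j\<le>n. \<Sum>k\<le>n. (\<Sum>l\<le>n. O1 j l * P k l a) * (\<Sum>l\<le>n. O1 j l * Q k l a))" by (simp only: orth_inner[OF O1])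
    also have "\<dots> = (\<Sum>k\<le>n. \<Sum>j\<le>n. (\<Sum>l\<le>n. O1 j l * P k l a) * (\<Sum>l\<le>n. O1 j l * Q k l a))" by (rule sum.swap)
    also have "\<dots> = (\<Sum>k\<le>n. \<Sum>l\<le>n. P k l a * Q k l a)" by (simp only: orth_inner[OF O1])
    finally show ?thesis .
  qed
  moreover have "tt n A B = (\<Sum>a<8. \<Sum>i\<le>n. \<Sum>j\<le>n. A i j a * B i j a)" for A B
  proof -
    have "tt n A B = (\<Sum>i\<le>n. \<Sum>a<8. \<Sum>j\<le>n. A i j a * B i j a)"
      unfolding tt_def dot_def by (intro sum.cong refl sum.swap)
    also have "\<dots> = (\<Sum>a<8. \<Sum>i\<le>n. \<Sum>j\<le>n. A i j a * B i j a)" by (rule sum.swap)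
    finally show ?thesis .
  qed
  ultimately show ?thesis by simp
qed

lemma hform_conjO:
  assumes M: "hform m n M"
  shows "hform m n (conjO n O1 M)"
proof -
  have conj: "M j i = oc (M i j)" for i j by (rule hform_conj[OF M])
  have "conjO n O1 M j i = oc (conjO n O1 M i j)" for i j
  proof
    fix a
    have oc_sum: "oc (\<lambda>a. \<Sum>k\<le>n. \<Sum>l\<le>n. c k l * f k l a) a = (\<Sum>k\<le>n. \<Sum>l\<le>n. c k l * oc (f k l) a)" for c f
      by (auto simp: cd_conj_eq sum_negf)
    show "conjO n O1 M j i a = oc (conjO n O1 M i j) a"
    proof (cases "i \<le> n \<and> j \<le> n")
      case True
      have "conjO n O1 M i j = (\<lambda>a. \<Sum>k\<le>n. \<Sum>l\<le>n. (O1 i k * O1 j l) * M k l a)" using True by (simp add: conjO_def fun_eq_iff)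
      then have "oc (conjO n O1 M i j) a = (\<Sum>k\<le>n. \<Sum>l\<le>n. (O1 i k * O1 j l) * M l k a)" by (simp only: oc_sum conj[symmetric])
      also have "\<dots> = conjO n O1 M j i a" using True unfolding conjO_def by (subst sum.swap) (simp add: mult_ac)
      finally show ?thesis by simp
    next
      case False
      then show ?thesis by (auto simp: conjO_def cd_conj_eq)
    qed
  qed
  moreover have "cd_supp m (conjO n O1 M i j)" for i j using hform_supp[OF M] by (simp add: cd_supp_def conjO_def)
  moreover have "n < i \<or> n < j \<Longrightarrow> conjO n O1 M i j = (\<lambda>_. 0)" for i j by (auto simp: conjO_def fun_eq_iff)
  ultimately show ?thesis unfolding hform_def by blast
qed

lemma conjO_in:
  assumes m: "m \<le> 3" and O1: "orth n O1" and y: "y \<in> proj_space m n"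
  shows "conjO n O1 y \<in> proj_space m n"
proof -
  have "pprod n (conjO n O1 y) (conjO n O1 y) i j = conjO n O1 y i j" if ij: "i \<le> n" "j \<le> n" for i j
  proof -
    \<comment> \<open>A is row i of the matrix times y and B is column j of y times the transpose;
      the sum over the middle index p then contracts by orthogonality.\<close>
    define A where "A l = (\<lambda>a. \<Sum>k\<le>n. O1 i k * y k l a)" for l
    define B where "B k = (\<lambda>a. \<Sum>l\<le>n. O1 j l * y k l a)" for k
    have a: "conjO n O1 y i p = (\<lambda>a. \<Sum>l\<le>n. O1 p l * A l a)" if "p \<le> n" for p
      using that ij unfolding A_def fun_eq_iff by (simp add: conjO_def sum_distrib_left) (subst sum.swap, simp add: mult_ac)
    have b: "conjO n O1 y p j = (\<lambda>a. \<Sum>k\<le>n. O1 p k * B k a)" if "p \<le> n" for p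
      using that ij unfolding B_def fun_eq_iff by (simp add: conjO_nested)
    have om2: "om (\<lambda>a. \<Sum>l\<le>n. c l * f l a) (\<lambda>a. \<Sum>k\<le>n. d k * g k a) q = (\<Sum>l\<le>n. c l * (\<Sum>k\<le>n. d k * om (f l) (g k) q))" for c f d g q
      by (simp add: cd_mult_sum_left cd_mult_sum_right cd_mult_scale_left cd_mult_scale_right sum_distrib_left mult_ac)
    have "pprod n (conjO n O1 y) (conjO n O1 y) i j q = conjO n O1 y i j q" for q
    proof -
      have "pprod n (conjO n O1 y) (conjO n O1 y) i j q = (\<Sum>p\<le>n. \<Sum>l\<le>n. O1 p l * (\<Sum>k\<le>n. O1 p k * om (A l) (B k) q))"
        unfolding pprod_def by (intro sum.cong refl) (simp add: a b om2)
      also have "\<dots> = (\<Sum>l\<le>n. \<Sum>p\<le>n. O1 p l * (\<Sum>k\<le>n. O1 p k * om (A l) (B k) q))" by (rule sum.swap)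
      also have "\<dots> = (\<Sum>l\<le>n. om (A l) (B l) q)" by (intro sum.cong refl) (simp add: orth_collapse[OF O1])
      also have "\<dots> = (\<Sum>l\<le>n. \<Sum>k\<le>n. O1 i k * (\<Sum>l'\<le>n. O1 j l' * om (y k l) (y l l') q))"
        unfolding A_def B_def by (simp only: om2)
      also have "\<dots> = (\<Sum>k\<le>n. O1 i k * (\<Sum>l'\<le>n. O1 j l' * pprod n y y k l' q))"
      proof -
        have "(\<Sum>l\<le>n. \<Sum>k\<le>n. O1 i k * (\<Sum>l'\<le>n. O1 j l' * om (y k l) (y l l') q))
          = (\<Sum>k\<le>n. \<Sum>l\<le>n. \<Sum>l'\<le>n. O1 i k * (O1 j l' * om (y k l) (y l l') q))"
          unfolding sum_distrib_left by (rule sum.swap)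
        also have "\<dots> = (\<Sum>k\<le>n. \<Sum>l'\<le>n. \<Sum>l\<le>n. O1 i k * (O1 j l' * om (y k l) (y l l') q))"
          by (intro sum.cong refl sum.swap)
        finally show ?thesis unfolding pprod_def sum_distrib_left .
      qed
      also have "\<dots> = conjO n O1 y i j q" using ij by (simp add: conjO_nested proj_idem[OF m y])
      finally show ?thesis .
    qed
    then show ?thesis by (rule ext)
  qed
  moreover have "(\<Sum>i\<le>n. conjO n O1 y i i 0) = 1"
  proof -
    have "(\<Sum>i\<le>n. conjO n O1 y i i 0) = (\<Sum>i\<le>n. \<Sum>k\<le>n. O1 i k * (\<Sum>l\<le>n. O1 i l * y k l 0))" by (simp add: conjO_nested)
    also have "\<dots> = (\<Sum>k\<le>n. \<Sum>i\<le>n. O1 i k * (\<Sum>l\<le>n. O1 i l * y k l 0))" by (rule sum.swap)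
    also have "\<dots> = (\<Sum>k\<le>n. y k k 0)" by (intro sum.cong refl) (simp add: orth_collapse[OF O1])
    finally show ?thesis by (simp add: proj_trace[OF m y])
  qed
  ultimately show ?thesis using hform_conjO[OF proj_herm[OF m y]] by (simp add: proj_space_iff[OF m])
qed

lemma isom_conjO:
  assumes m: "m \<le> 3" and O1: "orth n O1"
  shows "isom (proj_space m n) (tt n) (conjO n O1)"
proof (rule isom_inverse[where h = "conjO n (\<lambda>i j. O1 j i)"])
  show "conjO n O1 (conjO n (\<lambda>i j. O1 j i) x) = x" if "x \<in> proj_space m n" for x
    using conjO_inverse[OF orth_transpose[OF O1], of x] proj_outside[OF m that] by simp
  show "conjO n (\<lambda>i j. O1 j i) (conjO n O1 x) = x" if "x \<in> proj_space m n" for x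
    using conjO_inverse[OF O1, of x] proj_outside[OF m that] by simp
qed (simp_all add: conjO_in m O1 orth_transpose tt_conjO)


subsection \<open>Multiplication of the off-diagonal entries by units\<close>

lemma dot_scale_right: "dot a (\<lambda>i. k * c i) = k * dot a c"
  by (simp add: dot_def sum_distrib_left mult_ac)

lemma dot_om_right: "cd_supp 3 c \<Longrightarrow> dot (om a b) (om c b) = dot b b * dot a c"
  by (simp only: dot_om_adjoint om_alt_right dot_scale_right)

lemma dot_om_left:
  assumes "cd_supp 3 c"
  shows "dot (om b a) (om b c) = dot b b * dot a c"
proof -
  have "dot (om b a) (om b c) = dot (om (oc a) (oc b)) (om (oc c) (oc b))" by (simp only: oc_om[symmetric] dot_oc)
  also have "\<dots> = dot b b * dot a c" using oc_supp[OF assms] by (simp only: dot_om_right dot_oc)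
  finally show ?thesis .
qed

text \<open>Conjugation by a diagonal matrix of units, meant for the associative levels, where the
  inner units of a product cancel.\<close>

definition TA :: "(nat \<Rightarrow> nat \<Rightarrow> real) \<Rightarrow> hmat \<Rightarrow> hmat" where
  "TA v M = (\<lambda>i j. om (om (v i) (M i j)) (oc (v j)))"

lemma TA_in:
  assumes m: "m \<le> 2" and v: "\<And>i. cd_supp m (v i)" "\<And>i. dot (v i) (v i) = 1" and y: "y \<in> proj_space m n"
  shows "TA v y \<in> proj_space m n" and "TA v y i i 0 = y i i 0"
proof -
  have m3: "m \<le> 3" using m by simp
  note h = proj_herm[OF m3 y]
  have s: "cd_supp m (y i j)" for i j by (rule hform_supp[OF h])
  have sv: "cd_supp 2 (v i)" "cd_supp 3 (v i)" for i using cd_supp_mono[OF v(1) m] cd_supp_mono[OF v(1) m3] by auto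
  have sy: "cd_supp 2 (y i j)" "cd_supp 3 (y i j)" for i j using cd_supp_mono[OF s m] cd_supp_mono[OF s m3] by auto
  have so: "cd_supp 2 (om a b)" if "cd_supp 2 a" "cd_supp 2 b" for a b using that by (intro om_supp) auto
  note S = sv sy so oc_supp
  have hf: "hform m n (TA v y)"
    unfolding hform_def
  proof (intro conjI allI impI)
    fix i j
    show "TA v y i j = (\<lambda>_. 0)" if "n < i \<or> n < j"
      using hform_out[OF h that] by (simp add: TA_def cd_mult_0_left cd_mult_0_right)
    show "cd_supp m (TA v y i j)" unfolding TA_def by (intro om_supp m3 v s oc_supp)
    have "oc (TA v y i j) = om (v j) (om (oc (y i j)) (oc (v i)))"
      unfolding TA_def oc_om oc_oc[OF sv(2)] ..
    also have "oc (y i j) = y j i" by (rule hform_conj[OF h, symmetric])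
    also have "om (v j) (om (y j i) (oc (v i))) = TA v y j i" unfolding TA_def by (rule om_assoc[symmetric]) (intro S)+
    finally show "TA v y j i = oc (TA v y i j)" ..
  qed
  have prod: "om (TA v y i p) (TA v y p j) = om (om (v i) (om (y i p) (y p j))) (oc (v j))" for i p j
  proof -
    have "om (TA v y i p) (TA v y p j) = om (v i) (om (y i p) (om (oc (v p)) (om (v p) (om (y p j) (oc (v j))))))"
      unfolding TA_def by (simp add: om_assoc S)
    also have "om (oc (v p)) (om (v p) (om (y p j) (oc (v j)))) = om (y p j) (oc (v j))"
      by (subst om_alt_left) (simp_all add: v cd_supp_def oct_supp)
    also have "om (v i) (om (y i p) (om (y p j) (oc (v j)))) = om (om (v i) (om (y i p) (y p j))) (oc (v j))"
      by (simp add: om_assoc S)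
    finally show ?thesis .
  qed
  have "pprod n (TA v y) (TA v y) i j = TA v y i j" if ij: "i \<le> n" "j \<le> n" for i j
  proof -
    have "pprod n (TA v y) (TA v y) i j = om (om (v i) (pprod n y y i j)) (oc (v j))"
      unfolding pprod_def prod cd_mult_sum_left cd_mult_sum_right ..
    then show ?thesis unfolding proj_idem[OF m3 y ij] TA_def .
  qed
  moreover have d: "TA v y i i 0 = y i i 0" for i
  proof -
    have "om (v i) (y i i) = om (v i) (\<lambda>a. y i i 0 * cd_unit 0 a)" by (rule arg_cong[OF proj_diag[OF m3 y]])
    also have "\<dots> = (\<lambda>a. y i i 0 * v i a)" by (rule om_real_right[OF sv(2)])
    finally have "TA v y i i = (\<lambda>a. y i i 0 * om (v i) (oc (v i)) a)" unfolding TA_def by (simp only: cd_mult_scale_left)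
    then show ?thesis by (simp add: om_oc_self v)
  qed
  ultimately show "TA v y \<in> proj_space m n" using hf proj_trace[OF m3 y] by (simp add: proj_space_iff[OF m3])
  show "TA v y i i 0 = y i i 0" by (rule d)
qed

lemma isom_TA:
  assumes m: "m \<le> 2" and v: "\<And>i. cd_supp m (v i)" "\<And>i. dot (v i) (v i) = 1"
  shows "isom (proj_space m n) (tt n) (TA v)"
proof -
  have m3: "m \<le> 3" using m by simp
  have sv: "cd_supp 3 (v i)" for i using v(1) m3 by (auto intro: cd_supp_mono)
  have inv: "TA (\<lambda>i. oc (w i)) (TA w y) = y" if y: "y \<in> proj_space m n" and w: "\<And>i. cd_supp m (w i)" "\<And>i. dot (w i) (w i) = 1" for w y
  proof (intro ext)
    fix i j a
    have sy: "cd_supp 2 (y i j)" "cd_supp 3 (y i j)" using cd_supp_mono[OF hform_supp[OF proj_herm[OF m3 y]] m] cd_supp_mono[OF hform_supp[OF proj_herm[OF m3 y]] m3] by auto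
    have sw: "cd_supp 2 (w i)" "cd_supp 3 (w i)" for i using cd_supp_mono[OF w(1) m] cd_supp_mono[OF w(1) m3] by auto
    have "om (oc (w i)) (om (om (w i) (y i j)) (oc (w j))) = om (oc (w i)) (om (w i) (om (y i j) (oc (w j))))"
      using sy sw by (simp add: om_assoc oc_supp)
    also have "\<dots> = om (y i j) (oc (w j))" by (subst om_alt_left) (simp_all add: w cd_supp_def oct_supp)
    finally have "TA (\<lambda>i. oc (w i)) (TA w y) i j = om (om (y i j) (oc (w j))) (oc (oc (w j)))" unfolding TA_def by simp
    also have "\<dots> = y i j" using om_alt_right[OF sy(2), of "oc (w j)"] by (simp add: dot_oc w)
    finally show "TA (\<lambda>i. oc (w i)) (TA w y) i j a = y i j a" by simp
  qed
  let ?v' = "\<lambda>i. oc (v i)"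
  have v': "cd_supp m (?v' i)" "dot (?v' i) (?v' i) = 1" for i using v by (simp_all only: oc_supp dot_oc)
  have vv: "(\<lambda>i. oc (?v' i)) = v" by (simp only: oc_oc[OF sv])
  show ?thesis
  proof (rule isom_inverse[where h = "TA ?v'"])
    show "TA v (TA ?v' x) = x" if "x \<in> proj_space m n" for x using inv[OF that, of ?v'] v' unfolding vv by blast
    show "TA ?v' (TA v x) = x" if "x \<in> proj_space m n" for x using inv[OF that, of v] v by blast
    show "tt n (TA v x) (TA v z) = tt n x z" if "x \<in> proj_space m n" "z \<in> proj_space m n" for x z
    proof -
      have "dot (TA v x i j) (TA v z i j) = dot (x i j) (z i j)" for i j
        unfolding TA_def using proj_supp[OF m3 that(2)]
        by (simp add: dot_om_right dot_om_left dot_oc v om_supp sv)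
      then show ?thesis by (simp add: tt_def)
    qed
  qed (use TA_in[OF m v] TA_in[OF m v'] in auto)
qed

text \<open>The octonionic substitute for diagonal conjugation, with three rows. The maps (u x) u, u
  x and \<open>oc u\<close> x on the entries (0,1), (0,2) and (1,2) are compatible with products of
  entries by the Moufang identities; they form a triality triple.\<close>

definition TO :: "(nat \<Rightarrow> real) \<Rightarrow> hmat \<Rightarrow> hmat" where
  "TO u M = (\<lambda>i j. if i = 0 \<and> j = 1 then om (om u (M 0 1)) u
     else if i = 1 \<and> j = 0 then oc (om (om u (M 0 1)) u)
     else if i = 0 \<and> j = 2 then om u (M 0 2)
     else if i = 2 \<and> j = 0 then oc (om u (M 0 2))
     else if i = 1 \<and> j = 2 then om (oc u) (M 1 2)
     else if i = 2 \<and> j = 1 then oc (om (oc u) (M 1 2))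
     else M i j)"

text \<open>Basis units up to sign: a class closed under \<open>oc\<close>, so that the inverse of
  \<open>TO u\<close> is again of this form.\<close>

definition signed_unit :: "(nat \<Rightarrow> real) \<Rightarrow> bool" where
  "signed_unit u \<longleftrightarrow> (\<exists>c k. k < 8 \<and> c * c = 1 \<and> u = (\<lambda>i. c * cd_unit k i))"

lemma signed_unit_supp: "signed_unit u \<Longrightarrow> cd_supp 3 u"
  by (auto simp: signed_unit_def cd_supp_def cd_unit_def)

lemma signed_unit_oc: "signed_unit u \<Longrightarrow> signed_unit (oc u)"
proof -
  assume "signed_unit u"
  then obtain c k where k: "k < 8" "c * c = 1" "u = (\<lambda>i. c * cd_unit k i)" by (auto simp: signed_unit_def)
  then have "oc u = (\<lambda>i. (if k = 0 then c else - c) * cd_unit k i)" by (auto simp: cd_conj_eq cd_unit_def fun_eq_iff)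
  then show ?thesis unfolding signed_unit_def using k by (intro exI[of _ "if k = 0 then c else - c"] exI[of _ k]) auto
qed

lemma signed_unit_dot: "signed_unit u \<Longrightarrow> dot u u = 1"
proof -
  assume "signed_unit u"
  then obtain c k where k: "k < 8" "c * c = 1" "u = (\<lambda>i. c * cd_unit k i)" by (auto simp: signed_unit_def)
  have "dot u u = (\<Sum>i<8. if i = k then c * c else 0)" unfolding dot_def k(3) by (intro sum.cong refl) (simp add: cd_unit_def)
  then show ?thesis using k by simp
qed

lemma signed_unit_moufang:
  assumes "signed_unit u"
  shows "om (om u x) (om y u) = om (om u (om x y)) u"
    and "om (om (om u x) u) (om (oc u) y) = om u (om x y)"
    and "cd_supp 3 x \<Longrightarrow> om u (om x u) = om (om u x) u"
proof -
  obtain c k where k: "k < 8" "c * c = 1" "u = (\<lambda>i. c * cd_unit k i)" using assms by (auto simp: signed_unit_def)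
  show 1: "om (om u x) (om y u) = om (om u (om x y)) u" for x y
    unfolding k(3) cd_mult_scale_left cd_mult_scale_right om_moufang_unit[OF k(1)] ..
  have ocu: "oc u = (\<lambda>i. c * oc (cd_unit k) i)" by (auto simp: k(3) cd_conj_eq fun_eq_iff)
  have "om (om (om u x) u) (om (oc u) y) = (\<lambda>i. c * (c * (c * om (cd_unit k) (om x y) i)))"
    unfolding ocu unfolding k(3) cd_mult_scale_left cd_mult_scale_right om_moufang_unit[OF k(1)] ..
  also have "\<dots> = om u (om x y)" unfolding k(3) cd_mult_scale_left mult.assoc[symmetric] k(2) by simp
  finally show "om (om (om u x) u) (om (oc u) y) = om u (om x y)" .
  show "om u (om x u) = om (om u x) u" if "cd_supp 3 x"
    using 1[of "cd_unit 0" x] unfolding om_unit_0(1)[OF that] om_unit_0(2)[OF signed_unit_supp[OF assms]] .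
qed

lemma sum_upto_2: "(\<Sum>k\<le>(2::nat). f k) = f 0 + f 1 + f 2"
  by (simp add: numeral_2_eq_2)

lemma upto_2_cases: "i \<le> (2::nat) \<Longrightarrow> i = 0 \<or> i = 1 \<or> i = 2"
  by auto

lemma TO_entries:
  "TO u M 0 1 = om (om u (M 0 1)) u" "TO u M 1 0 = oc (om (om u (M 0 1)) u)"
  "TO u M 0 2 = om u (M 0 2)" "TO u M 2 0 = oc (om u (M 0 2))"
  "TO u M 1 2 = om (oc u) (M 1 2)" "TO u M 2 1 = oc (om (oc u) (M 1 2))" "TO u M i i = M i i"
  by (auto simp: TO_def)

lemma hform_TO:
  assumes u: "signed_unit u" and M: "hform 3 2 M"
  shows "hform 3 2 (TO u M)"
  unfolding hform_def
proof (intro conjI allI impI)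
  fix i j :: nat
  show out: "TO u M i j = (\<lambda>_. 0)" if "2 < i \<or> 2 < j" using that hform_out[OF M that] by (auto simp: TO_def)
  show "cd_supp 3 (TO u M i j)" using hform_supp[OF M] by (simp add: TO_def cd_supp_def oct_supp)
  have s: "oc (oc (om a b)) = om a b" for a b by (rule oc_oc) (simp add: cd_supp_def oct_supp)
  show "TO u M j i = oc (TO u M i j)"
  proof (cases "i = j \<or> 2 < i \<or> 2 < j")
    case True
    then show ?thesis
    proof (elim disjE)
      assume e: "i = j" show ?thesis unfolding e TO_entries by (rule hform_conj[OF M])
    next
      assume a: "2 < i" then have b: "M i j = (\<lambda>_. 0)" "M j i = (\<lambda>_. 0)" using hform_out[OF M] by auto
      have "TO u M j i = M j i" "TO u M i j = M i j" using a by (auto simp: TO_def)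
      then show ?thesis by (simp only: b oc_0)
    next
      assume a: "2 < j" then have b: "M i j = (\<lambda>_. 0)" "M j i = (\<lambda>_. 0)" using hform_out[OF M] by auto
      have "TO u M j i = M j i" "TO u M i j = M i j" using a by (auto simp: TO_def)
      then show ?thesis by (simp only: b oc_0)
    qed
  next
    case False
    then have "i = 0 \<or> i = 1 \<or> i = 2" "j = 0 \<or> j = 1 \<or> j = 2" "i \<noteq> j" by auto
    moreover have "TO u M 1 0 = oc (TO u M 0 1)" "TO u M 0 1 = oc (TO u M 1 0)" "TO u M 2 0 = oc (TO u M 0 2)"
      "TO u M 0 2 = oc (TO u M 2 0)" "TO u M 2 1 = oc (TO u M 1 2)" "TO u M 1 2 = oc (TO u M 2 1)"
      by (simp_all only: TO_entries s)
    ultimately show ?thesis by metis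
  qed
qed

lemma pprod_conj:
  assumes "hform m n M"
  shows "pprod n M M j i = oc (pprod n M M i j)"
proof
  fix a
  have oc_sum: "oc (\<lambda>a. \<Sum>k\<le>n. f k a) a = (\<Sum>k\<le>n. oc (f k) a)" for f by (auto simp: cd_conj_eq sum_negf)
  show "pprod n M M j i a = oc (pprod n M M i j) a"
    unfolding pprod_def oc_sum oc_om hform_conj[OF assms, symmetric] ..
qed

lemma pprod_diag:
  assumes "hform m n M"
  shows "pprod n M M i i = (\<lambda>a. (\<Sum>k\<le>n. dot (M i k) (M i k)) * cd_unit 0 a)"
proof
  fix a
  have "om (M i k) (M k i) a = dot (M i k) (M i k) * cd_unit 0 a" for k
  proof -
    have "om (M i k) (M k i) = om (M i k) (oc (M i k))" by (rule arg_cong[OF hform_conj[OF assms]])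
    then show ?thesis by (simp add: om_oc_self cd_unit_def)
  qed
  then show "pprod n M M i i a = (\<Sum>k\<le>n. dot (M i k) (M i k)) * cd_unit 0 a" by (simp add: pprod_def sum_distrib_right)
qed

lemma TO_dot:
  assumes u: "signed_unit u" and M: "hform 3 2 M" and N: "hform 3 2 N"
  shows "dot (TO u M i j) (TO u N i j) = dot (M i j) (N i j)"
proof -
  note su = signed_unit_supp[OF u] signed_unit_dot[OF u]
  have s: "cd_supp 3 (N i j)" for i j by (rule hform_supp[OF N])
  have so: "cd_supp 3 (om a b)" for a b by (simp add: cd_supp_def oct_supp)
  have o: "dot (M j i) (N j i) = dot (M i j) (N i j)" for i j
    unfolding hform_conj[OF M, of j i] hform_conj[OF N, of j i] by (rule dot_oc)
  have e: "dot (TO u M 0 1) (TO u N 0 1) = dot (M 0 1) (N 0 1)" "dot (TO u M 0 2) (TO u N 0 2) = dot (M 0 2) (N 0 2)"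
    "dot (TO u M 1 2) (TO u N 1 2) = dot (M 1 2) (N 1 2)" "dot (TO u M 1 0) (TO u N 1 0) = dot (M 1 0) (N 1 0)"
    "dot (TO u M 2 0) (TO u N 2 0) = dot (M 2 0) (N 2 0)" "dot (TO u M 2 1) (TO u N 2 1) = dot (M 2 1) (N 2 1)"
    unfolding TO_entries dot_oc dot_om_right[OF so] dot_om_left[OF s] su(2) o[of 1 0] o[of 2 0] o[of 2 1] by simp_all
  show ?thesis
  proof (cases "i \<noteq> j \<and> i \<le> 2 \<and> j \<le> 2")
    case True
    then have "i = 0 \<or> i = 1 \<or> i = 2" "j = 0 \<or> j = 1 \<or> j = 2" "i \<noteq> j" by auto
    then show ?thesis using e by metis
  next
    case False
    then have "TO u M i j = M i j" "TO u N i j = N i j" by (auto simp: TO_def)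
    then show ?thesis by simp
  qed
qed

text \<open>The three entries above the diagonal are Moufang identities, the second one serving for
  u and for \<open>oc u\<close>. Conjugation gives the entries below, and the diagonal follows
  because \<open>TO\<close> preserves the norms of entries.\<close>

lemma TO_in:
  assumes u: "signed_unit u" and y: "y \<in> proj_space 3 2"
  shows "TO u y \<in> proj_space 3 2"
proof -
  have m: "(3::nat) \<le> 3" by simp
  note h = proj_herm[OF m y]
  note hT = hform_TO[OF u h]
  note su = signed_unit_supp[OF u] signed_unit_oc[OF u]
  have ocu: "oc (oc u) = u" by (rule oc_oc[OF su(1)])
  have D: "om (y i i) x = (\<lambda>a. y i i 0 * x a)" "om x (y i i) = (\<lambda>a. y i i 0 * x a)" if "cd_supp 3 x" for x i
  proof -
    have "om (y i i) x = om (\<lambda>a. y i i 0 * cd_unit 0 a) x" by (rule arg_cong[OF proj_diag[OF m y]])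
    then show "om (y i i) x = (\<lambda>a. y i i 0 * x a)" by (simp only: om_real_left[OF that])
    have "om x (y i i) = om x (\<lambda>a. y i i 0 * cd_unit 0 a)" by (rule arg_cong[OF proj_diag[OF m y]])
    then show "om x (y i i) = (\<lambda>a. y i i 0 * x a)" by (simp only: om_real_right[OF that])
  qed
  have s: "cd_supp 3 (y i j)" for i j by (rule hform_supp[OF h])
  have so: "cd_supp 3 (om a b)" for a b by (simp add: cd_supp_def oct_supp)
  have idem: "pprod 2 y y i j = y i j" if "i \<le> 2" "j \<le> 2" for i j using proj_idem[OF m y that] .
  note lin = cd_mult_add_left cd_mult_add_right cd_mult_scale_left cd_mult_scale_right
  have 01: "pprod 2 (TO u y) (TO u y) 0 1 = TO u y 0 1"
  proof -
    have "om (om u (y 0 2)) (oc (om (oc u) (y 1 2))) = om (om u (y 0 2)) (om (y 2 1) u)"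
      unfolding oc_om ocu by (simp only: hform_conj[OF h, of 2 1, symmetric])
    also have "\<dots> = om (om u (om (y 0 2) (y 2 1))) u" by (rule signed_unit_moufang(1)[OF u])
    finally have e: "om (om u (y 0 2)) (oc (om (oc u) (y 1 2))) = om (om u (om (y 0 2) (y 2 1))) u" .
    have "pprod 2 (TO u y) (TO u y) 0 1 = om (om u (pprod 2 y y 0 1)) u"
      unfolding pprod_def sum_upto_2 TO_entries e D[OF so] D[OF s] lin ..
    then show ?thesis by (simp only: idem[of 0 1] TO_entries le0 one_le_numeral)
  qed
  have 02: "pprod 2 (TO u y) (TO u y) 0 2 = TO u y 0 2"
  proof -
    have e: "om (om (om u (y 0 1)) u) (om (oc u) (y 1 2)) = om u (om (y 0 1) (y 1 2))" by (rule signed_unit_moufang(2)[OF u])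
    have "pprod 2 (TO u y) (TO u y) 0 2 = om u (pprod 2 y y 0 2)"
      unfolding pprod_def sum_upto_2 TO_entries e D[OF so] D[OF s] lin ..
    then show ?thesis by (simp only: idem[of 0 2] TO_entries le0 order_refl)
  qed
  have 12: "pprod 2 (TO u y) (TO u y) 1 2 = TO u y 1 2"
  proof -
    have "oc (om (om u (y 0 1)) u) = om (om (oc u) (y 1 0)) (oc u)"
      unfolding oc_om by (simp only: hform_conj[OF h, of 1 0, symmetric] signed_unit_moufang(3)[OF su(2) s])
    then have e: "om (oc (om (om u (y 0 1)) u)) (om u (y 0 2)) = om (oc u) (om (y 1 0) (y 0 2))"
      using signed_unit_moufang(2)[OF su(2), of "y 1 0" "y 0 2"] unfolding ocu by simp
    have "pprod 2 (TO u y) (TO u y) 1 2 = om (oc u) (pprod 2 y y 1 2)"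
      unfolding pprod_def sum_upto_2 TO_entries e D[OF so] D[OF s] lin ..
    then show ?thesis by (simp only: idem[of 1 2] TO_entries one_le_numeral order_refl)
  qed
  have dg: "pprod 2 (TO u y) (TO u y) i i = TO u y i i" if "i \<le> 2" for i
    unfolding pprod_diag[OF hT] TO_dot[OF u h h] TO_entries pprod_diag[OF h, symmetric] using idem[OF that that] .
  have flip: "pprod 2 (TO u y) (TO u y) j i = TO u y j i" if "pprod 2 (TO u y) (TO u y) i j = TO u y i j" for i j
    unfolding pprod_conj[OF hT, of j i] that by (rule hform_conj[OF hT, symmetric])
  have "pprod 2 (TO u y) (TO u y) i j = TO u y i j" if "i \<le> 2" "j \<le> 2" for i j
    using upto_2_cases[OF that(1)] upto_2_cases[OF that(2)]
    by (elim disjE) (simp_all only: 01 02 12 flip[OF 01] flip[OF 02] flip[OF 12] dg le0 order_refl one_le_numeral)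
  moreover have "(\<Sum>i\<le>2. TO u y i i 0) = 1" using proj_trace[OF m y] by (simp only: TO_entries)
  ultimately show ?thesis using hT by (simp only: proj_space_iff[OF m]) blast
qed

lemma isom_TO:
  assumes u: "signed_unit u"
  shows "isom (proj_space 3 2) (tt 2) (TO u)"
proof -
  have m: "(3::nat) \<le> 3" by simp
  have inv: "TO (oc w) (TO w y) = y" if y: "y \<in> proj_space 3 2" and w: "signed_unit w" for w y
  proof (intro ext)
    fix i j a
    note h = proj_herm[OF m y]
    have s: "cd_supp 3 (y i j)" for i j by (rule hform_supp[OF h])
    have so: "cd_supp 3 (om a b)" for a b by (simp add: cd_supp_def oct_supp)
    have ow: "oc (oc w) = w" by (rule oc_oc[OF signed_unit_supp[OF w]])
    have dw: "dot w w = 1" "dot (oc w) (oc w) = 1" using signed_unit_dot[OF w] by (simp_all only: dot_oc)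
    have al: "om (oc w) (om w x) = x" "om w (om (oc w) x) = x" "om (om x w) (oc w) = x" if "cd_supp 3 x" for x
      using om_alt_left[OF that, of w] om_alt_left[OF that, of "oc w"] om_alt_right[OF that, of w] unfolding ow dw by simp_all
    have 1: "om (om (oc w) (om (om w (y 0 1)) w)) (oc w) = y 0 1"
      unfolding signed_unit_moufang(3)[OF w s, symmetric] al(1)[OF so] al(3)[OF s] ..
    have "TO (oc w) (TO w y) i j = y i j"
    proof (cases "i \<noteq> j \<and> i \<le> 2 \<and> j \<le> 2")
      case True
      then have "i = 0 \<or> i = 1 \<or> i = 2" "j = 0 \<or> j = 1 \<or> j = 2" "i \<noteq> j" by auto
      moreover have "TO (oc w) (TO w y) 0 1 = y 0 1" "TO (oc w) (TO w y) 1 0 = y 1 0" "TO (oc w) (TO w y) 0 2 = y 0 2"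
        "TO (oc w) (TO w y) 2 0 = y 2 0" "TO (oc w) (TO w y) 1 2 = y 1 2" "TO (oc w) (TO w y) 2 1 = y 2 1"
        by (simp_all only: TO_entries ow 1 al[OF s] hform_conj[OF h, symmetric])
      ultimately show ?thesis by metis
    next
      case False
      then show ?thesis by (auto simp: TO_def)
    qed
    then show "TO (oc w) (TO w y) i j a = y i j a" by simp
  qed
  show ?thesis
  proof (rule isom_inverse[where h = "TO (oc u)"])
    show "TO u (TO (oc u) x) = x" if "x \<in> proj_space 3 2" for x
      using inv[OF that signed_unit_oc[OF u]] unfolding oc_oc[OF signed_unit_supp[OF u]] .
    show "TO (oc u) (TO u x) = x" if "x \<in> proj_space 3 2" for x using inv[OF that u] .
    show "tt 2 (TO u x) (TO u z) = tt 2 x z" if "x \<in> proj_space 3 2" "z \<in> proj_space 3 2" for x z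
      using TO_dot[OF u proj_herm[OF m that(1)] proj_herm[OF m that(2)]] by (simp only: tt_def)
  qed (use TO_in[OF u] TO_in[OF signed_unit_oc[OF u]] in auto)
qed

subsection \<open>One-parameter groups of isometries\<close>

definition rot :: "nat \<Rightarrow> nat \<Rightarrow> real \<Rightarrow> real \<Rightarrow> nat \<Rightarrow> nat \<Rightarrow> real" where
  "rot j k c s = (\<lambda>p q. if p = j then (if q = j then c else if q = k then s else 0)
     else if p = k then (if q = j then - s else if q = k then c else 0) else if p = q then 1 else 0)"

lemma rot_row:
  assumes "j \<le> n" "k \<le> n" "j \<noteq> k" "p \<le> n"
  shows "(\<Sum>q\<le>n. rot j k c s p q * x q) = (if p = j then c * x j + s * x k else if p = k then c * x k - s * x j else x p)"
proof -
  have "(\<Sum>q\<le>n. (if q = j then A else 0) + (if q = k then B else 0)) = A + B" for A B :: real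
    using assms by (simp add: sum.distrib)
  moreover have "rot j k c s p q * x q = (if q = j then (if p = j then c * x j else if p = k then - s * x j else 0) else 0)
     + (if q = k then (if p = j then s * x k else if p = k then c * x k else 0) else 0)" if "p = j \<or> p = k" for q
    using that assms by (auto simp: rot_def)
  moreover have "(\<Sum>q\<le>n. rot j k c s p q * x q) = (\<Sum>q\<le>n. if q = p then x p else 0)" if "p \<noteq> j" "p \<noteq> k"
    using that by (intro sum.cong refl) (auto simp: rot_def)
  ultimately show ?thesis using assms by (cases "p = j \<or> p = k") auto
qed

lemma rot_transpose: "j \<noteq> k \<Longrightarrow> rot j k c s p q = rot j k c (- s) q p"
  by (auto simp: rot_def)

lemma orth_rot:
  assumes "j \<le> n" "k \<le> n" "j \<noteq> k" and cs: "c\<^sup>2 + s\<^sup>2 = 1"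
  shows "orth n (rot j k c s)"
proof -
  have *: "(\<Sum>i\<le>n. rot j k c s p i * rot j k c s l i) = (if p = l then 1 else 0)"
    if "p \<le> n" "l \<le> n" "c\<^sup>2 + s\<^sup>2 = 1" for p l c s
    using that(3) assms(3) unfolding rot_row[OF assms(1-3) that(1)]
    by (auto simp: rot_def power2_eq_square)
  have "(\<Sum>i\<le>n. rot j k c s i p * rot j k c s i l) = (if p = l then 1 else 0)" if "p \<le> n" "l \<le> n" for p l
    using *[OF that, of c "- s"] cs unfolding rot_transpose[OF assms(3), of c s] by simp
  then show ?thesis unfolding orth_def using *[OF _ _ cs] by simp
qed

text \<open>The map \<open>g\<close> rotates the plane with coordinates \<open>(y\<^sub>j\<^sub>j - y\<^sub>k\<^sub>k)/2\<close> and the component \<open>i\<close> of \<open>y\<^sub>j\<^sub>k\<close>.\<close>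
definition rotates :: "nat \<Rightarrow> nat \<Rightarrow> nat \<Rightarrow> nat \<Rightarrow> nat \<Rightarrow> real \<Rightarrow> real \<Rightarrow> (hmat \<Rightarrow> hmat) \<Rightarrow> bool" where
  "rotates m n j k i C S g \<longleftrightarrow> isom (proj_space m n) (tt n) g \<and> (\<forall>y\<in>proj_space m n.
     (\<forall>l. l \<noteq> j \<longrightarrow> l \<noteq> k \<longrightarrow> g y l l 0 = y l l 0) \<and>
     g y j j 0 = (y j j 0 + y k k 0) / 2 + (C * ((y j j 0 - y k k 0) / 2) + S * y j k i) \<and>
     g y k k 0 = (y j j 0 + y k k 0) / 2 - (C * ((y j j 0 - y k k 0) / 2) + S * y j k i) \<and>
     g y j k = (\<lambda>a. y j k a + (C * y j k i - S * ((y j j 0 - y k k 0) / 2) - y j k i) * cd_unit i a))"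

definition Emove :: "nat \<Rightarrow> nat \<Rightarrow> nat \<Rightarrow> nat \<Rightarrow> nat \<Rightarrow> bool" where
  "Emove m n j k i \<longleftrightarrow> (\<forall>C S. C\<^sup>2 + S\<^sup>2 = 1 \<longrightarrow> (\<exists>g. rotates m n j k i C S g))"

lemma rotatesD:
  assumes "rotates m n j k i C S g"
  shows "isom (proj_space m n) (tt n) g"
    "\<And>y l. y \<in> proj_space m n \<Longrightarrow> l \<noteq> j \<Longrightarrow> l \<noteq> k \<Longrightarrow> g y l l 0 = y l l 0"
    "\<And>y. y \<in> proj_space m n \<Longrightarrow> g y j j 0 = (y j j 0 + y k k 0) / 2 + (C * ((y j j 0 - y k k 0) / 2) + S * y j k i)"
    "\<And>y. y \<in> proj_space m n \<Longrightarrow> g y k k 0 = (y j j 0 + y k k 0) / 2 - (C * ((y j j 0 - y k k 0) / 2) + S * y j k i)"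
    "\<And>y. y \<in> proj_space m n \<Longrightarrow> g y j k = (\<lambda>a. y j k a + (C * y j k i - S * ((y j j 0 - y k k 0) / 2) - y j k i) * cd_unit i a)"
  using assms unfolding rotates_def by simp_all

lemma EmoveD:
  assumes "Emove m n j k i" "C\<^sup>2 + S\<^sup>2 = 1"
  obtains g where "rotates m n j k i C S g"
  using assms unfolding Emove_def by blast

text \<open>Conjugation by a plane rotation turns the pair formed by (y_jj - y_kk)/2 and Re y_jk
  through twice its angle, hence the half angle below. The imaginary coordinates of y_jk stay fixed
  since y_kj carries them with opposite sign and the diagonal is real.\<close>

lemma Emove_0:
  assumes m: "m \<le> 3" and jk: "j \<le> n" "k \<le> n" "j \<noteq> k"
  shows "Emove m n j k 0"
  unfolding Emove_def
proof (intro allI impI)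
  fix C S :: real assume "C\<^sup>2 + S\<^sup>2 = 1"
  then obtain \<phi> where \<phi>: "C = cos \<phi>" "S = sin \<phi>" using sincos_total_2pi by metis
  define c s where "c = cos (\<phi> / 2)" and "s = sin (\<phi> / 2)"
  have cs: "c\<^sup>2 + s\<^sup>2 = 1" by (simp add: c_def s_def)
  have CS: "C = c * c - s * s" "S = 2 * (c * s)"
    unfolding \<phi> c_def s_def using cos_double[of "\<phi> / 2"] sin_double[of "\<phi> / 2"] by (simp_all add: power2_eq_square)
  have cc: "c * c = 1 - s * s" using cs by (simp add: power2_eq_square)
  show "\<exists>g. rotates m n j k 0 C S g"
    unfolding rotates_def
  proof (intro exI[of _ "conjO n (rot j k c s)"] conjI ballI)
    show "isom (proj_space m n) (tt n) (conjO n (rot j k c s))" by (rule isom_conjO[OF m orth_rot[OF jk cs]])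
    fix y assume y: "y \<in> proj_space m n"
    note r = rot_row[OF jk]
    have kj: "y k j a = (if a = 0 then y j k 0 else - y j k a)" for a
      using fun_cong[OF proj_conj[OF m y, of k j], of a] proj_supp[OF m y, of j k] by (auto simp: cd_conj_eq cd_supp_def not_less)
    have dg: "y l l a = y l l 0 * cd_unit 0 a" for l a using fun_cong[OF proj_diag[OF m y, of l], of a] .
    show "\<forall>l. l \<noteq> j \<longrightarrow> l \<noteq> k \<longrightarrow> conjO n (rot j k c s) y l l 0 = y l l 0"
    proof (intro allI impI)
      fix l assume l: "l \<noteq> j" "l \<noteq> k"
      show "conjO n (rot j k c s) y l l 0 = y l l 0"
      proof (cases "l \<le> n")
        case True
        then show ?thesis using l by (simp add: conjO_nested r)
      next
        case False
        then show ?thesis using proj_outside[OF m y, of l l] by (simp add: conjO_def)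
      qed
    qed
    have e: "conjO n (rot j k c s) y j j 0 = c * (c * y j j 0 + s * y j k 0) + s * (c * y j k 0 + s * y k k 0)"
      using jk by (simp add: conjO_nested r kj)
    also have "\<dots> = (c * c) * y j j 0 + 2 * (c * s) * y j k 0 + s * s * y k k 0" by (simp add: algebra_simps)
    finally show "conjO n (rot j k c s) y j j 0 = (y j j 0 + y k k 0) / 2 + (C * ((y j j 0 - y k k 0) / 2) + S * y j k 0)"
      unfolding CS cc by (simp add: field_simps)
    have "conjO n (rot j k c s) y k k 0 = c * (c * y k k 0 - s * y j k 0) - s * (c * y j k 0 - s * y j j 0)"
      using jk by (simp add: conjO_nested r kj)
    also have "\<dots> = (c * c) * y k k 0 - 2 * (c * s) * y j k 0 + s * s * y j j 0" by (simp add: algebra_simps)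
    finally show "conjO n (rot j k c s) y k k 0 = (y j j 0 + y k k 0) / 2 - (C * ((y j j 0 - y k k 0) / 2) + S * y j k 0)"
      unfolding CS cc by (simp add: field_simps)
    show "conjO n (rot j k c s) y j k = (\<lambda>a. y j k a + (C * y j k 0 - S * ((y j j 0 - y k k 0) / 2) - y j k 0) * cd_unit 0 a)"
    proof
      fix a
      have "conjO n (rot j k c s) y j k a = c * (c * y j k a - s * y j j a) + s * (c * y k k a - s * y k j a)"
        using jk by (simp add: conjO_nested r)
      also have "\<dots> = c * c * y j k a - s * s * y k j a + c * s * (y k k a - y j j a)" by (simp add: algebra_simps)
      finally have e: "conjO n (rot j k c s) y j k a = c * c * y j k a - s * s * y k j a + c * s * (y k k a - y j j a)" .
      show "conjO n (rot j k c s) y j k a = y j k a + (C * y j k 0 - S * ((y j j 0 - y k k 0) / 2) - y j k 0) * cd_unit 0 a"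
      proof (cases "a = 0")
        case True
        then show ?thesis unfolding e CS kj by (simp add: cd_unit_def field_simps)
      next
        case False
        then show ?thesis unfolding e CS kj cc dg[of k a] dg[of j a] by (simp add: cd_unit_def algebra_simps)
      qed
    qed
  qed
qed

text \<open>Multiplication by the conjugate unit makes coordinate i of y_jk its real part; rotate
  there and undo the multiplication.\<close>

lemma Emove_lift:
  assumes m: "m \<le> 3" and i: "i < 8" and E: "Emove m n j k 0"
    and T: "isom (proj_space m n) (tt n) T" "\<And>y l. y \<in> proj_space m n \<Longrightarrow> T y l l 0 = y l l 0"
      "\<And>y. y \<in> proj_space m n \<Longrightarrow> T y j k = om (oc (cd_unit i)) (y j k)"
    and T': "isom (proj_space m n) (tt n) T'" "\<And>y l. y \<in> proj_space m n \<Longrightarrow> T' y l l 0 = y l l 0"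
      "\<And>y. y \<in> proj_space m n \<Longrightarrow> T' y j k = om (cd_unit i) (y j k)"
  shows "Emove m n j k i"
  unfolding Emove_def
proof (intro allI impI)
  fix C S :: real assume "C\<^sup>2 + S\<^sup>2 = 1"
  from EmoveD[OF E this] obtain g where "rotates m n j k 0 C S g" .
  note g = rotatesD[OF this]
  have us: "cd_supp 3 (cd_unit i)" using i unit_supp[of i 3] by simp
  have ou: "oc (oc (cd_unit i)) = cd_unit i" by (rule oc_oc[OF us])
  have du: "dot (cd_unit i) x = x i" for x
  proof -
    have "dot (cd_unit i) x = (\<Sum>a<8. if a = i then x i else 0)" unfolding dot_def by (intro sum.cong refl) (simp add: cd_unit_def)
    then show ?thesis using i by simp
  qed
  have re: "om (oc (cd_unit i)) x 0 = x i" for x unfolding om_re dot_oc du ..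
  have undo_om: "om (cd_unit i) (om (oc (cd_unit i)) x) = x" if "cd_supp 3 x" for x
    using om_alt_left[OF that, of "oc (cd_unit i)"] unfolding ou dot_oc du by (simp add: cd_unit_def)
  show "\<exists>g. rotates m n j k i C S g"
    unfolding rotates_def
  proof (intro exI[of _ "\<lambda>y. T' (g (T y))"] conjI ballI)
    show "isom (proj_space m n) (tt n) (\<lambda>y. T' (g (T y)))"
      by (rule isom_comp[OF T'(1) isom_comp[OF g(1) T(1)]])
    fix y assume y: "y \<in> proj_space m n"
    have Ty: "T y \<in> proj_space m n" by (rule isom_in[OF T(1) y])
    have gTy: "g (T y) \<in> proj_space m n" by (rule isom_in[OF g(1) Ty])
    have r0: "T y j k 0 = y j k i" unfolding T(3)[OF y] by (rule re)
    show "\<forall>l. l \<noteq> j \<longrightarrow> l \<noteq> k \<longrightarrow> T' (g (T y)) l l 0 = y l l 0" by (simp add: T'(2)[OF gTy] g(2)[OF Ty] T(2)[OF y])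
    show "T' (g (T y)) j j 0 = (y j j 0 + y k k 0) / 2 + (C * ((y j j 0 - y k k 0) / 2) + S * y j k i)"
      unfolding T'(2)[OF gTy] g(3)[OF Ty] T(2)[OF y] r0 ..
    show "T' (g (T y)) k k 0 = (y j j 0 + y k k 0) / 2 - (C * ((y j j 0 - y k k 0) / 2) + S * y j k i)"
      unfolding T'(2)[OF gTy] g(4)[OF Ty] T(2)[OF y] r0 ..
    show "T' (g (T y)) j k = (\<lambda>a. y j k a + (C * y j k i - S * ((y j j 0 - y k k 0) / 2) - y j k i) * cd_unit i a)"
      unfolding T'(3)[OF gTy] g(5)[OF Ty] T(2)[OF y] r0 cd_mult_add_right cd_mult_scale_right om_unit_0(2)[OF us]
      unfolding T(3)[OF y] undo_om[OF proj_supp[OF m y]] ..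
  qed
qed

lemma isom_perm:
  assumes m: "m \<le> 3" and p: "\<And>i. \<pi> (\<pi> i) = i" "\<And>i. \<pi> i \<le> n \<longleftrightarrow> i \<le> n"
  shows "isom (proj_space m n) (tt n) (\<lambda>y i j. y (\<pi> i) (\<pi> j))"
proof (rule isom_involution)
  have sm: "(\<Sum>k\<le>n. f (\<pi> k)) = (\<Sum>k\<le>n. f k)" for f :: "nat \<Rightarrow> real"
    by (rule sum.reindex_bij_witness[of _ \<pi> \<pi>]) (auto simp: p)
  show "(\<lambda>i j. y (\<pi> i) (\<pi> j)) \<in> proj_space m n" if y: "y \<in> proj_space m n" for y
  proof -
    have "hform m n (\<lambda>i j. y (\<pi> i) (\<pi> j))"
      unfolding hform_def
    proof (intro conjI allI impI)
      fix i j
      show "y (\<pi> i) (\<pi> j) = (\<lambda>_. 0)" if "n < i \<or> n < j"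
        by (rule proj_outside[OF m y]) (metis that p(2) not_le)
      show "cd_supp m (y (\<pi> i) (\<pi> j))" by (rule hform_supp[OF proj_herm[OF m y]])
      show "y (\<pi> j) (\<pi> i) = oc (y (\<pi> i) (\<pi> j))" by (rule proj_conj[OF m y])
    qed
    moreover have "pprod n (\<lambda>i j. y (\<pi> i) (\<pi> j)) (\<lambda>i j. y (\<pi> i) (\<pi> j)) i j = y (\<pi> i) (\<pi> j)" if "i \<le> n" "j \<le> n" for i j
    proof -
      have "pprod n (\<lambda>i j. y (\<pi> i) (\<pi> j)) (\<lambda>i j. y (\<pi> i) (\<pi> j)) i j = pprod n y y (\<pi> i) (\<pi> j)"
        unfolding pprod_def by (rule ext) (rule sm)
      then show ?thesis using proj_idem[OF m y, of "\<pi> i" "\<pi> j"] that by (simp add: p)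
    qed
    moreover have "(\<Sum>i\<le>n. y (\<pi> i) (\<pi> i) 0) = 1" using sm[of "\<lambda>i. y i i 0"] proj_trace[OF m y] by simp
    ultimately show ?thesis by (simp add: proj_space_iff[OF m])
  qed
  show "tt n (\<lambda>i j. x (\<pi> i) (\<pi> j)) (\<lambda>i j. y (\<pi> i) (\<pi> j)) = tt n x y" for x y
    unfolding tt_def sm[of "\<lambda>k. dot (x (\<pi> i) k) (y (\<pi> i) k)" for i] by (rule sm)
qed (simp add: p)

lemma Emove_perm:
  assumes m: "m \<le> 3" and p: "\<And>i. \<pi> (\<pi> i) = i" "\<And>i. \<pi> i \<le> n \<longleftrightarrow> i \<le> n" and E: "Emove m n (\<pi> j) (\<pi> k) i"
  shows "Emove m n j k i"
  unfolding Emove_def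
proof (intro allI impI)
  fix C S :: real assume "C\<^sup>2 + S\<^sup>2 = 1"
  let ?P = "\<lambda>y i j. y (\<pi> i) (\<pi> j)"
  from EmoveD[OF E \<open>C\<^sup>2 + S\<^sup>2 = 1\<close>] obtain g where "rotates m n (\<pi> j) (\<pi> k) i C S g" .
  note g = rotatesD[OF this]
  have P: "isom (proj_space m n) (tt n) ?P" by (rule isom_perm[OF m p])
  have ne: "\<pi> l \<noteq> \<pi> j" if "l \<noteq> j" for l j using that p(1) by metis
  show "\<exists>g. rotates m n j k i C S g"
    unfolding rotates_def
    by (rule exI[of _ "\<lambda>y. ?P (g (?P y))"])
      (intro conjI ballI allI impI; (rule isom_comp[OF P isom_comp[OF g(1) P]])?;
        simp add: g(2-)[OF isom_in[OF P]] p ne)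
qed

lemma signed_unit_cd_unit: "a < 8 \<Longrightarrow> signed_unit (cd_unit a)"
  unfolding signed_unit_def by (rule exI[of _ 1], rule exI[of _ a]) simp

lemma Emove_assoc:
  assumes m: "m \<le> 2" and jk: "j \<le> n" "k \<le> n" "j \<noteq> k" and i: "i < 2 ^ m"
  shows "Emove m n j k i"
proof -
  have m3: "m \<le> 3" using m by simp
  have "(2::nat) ^ m \<le> 2 ^ 2" using m by (intro power_increasing) auto
  then have i8: "i < 8" "0 < (2::nat) ^ m" using i by auto
  have ds: "dot (cd_unit a) (cd_unit a) = 1" if "a < 8" for a
    by (rule signed_unit_dot[OF signed_unit_cd_unit[OF that]])
  have o0: "oc (cd_unit 0) = cd_unit 0" by (auto simp: cd_conj_eq cd_unit_def fun_eq_iff)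
  define v where "v u = (\<lambda>l. if l = j then u else cd_unit 0)" for u :: "nat \<Rightarrow> real"
  have v: "cd_supp m (v u l)" "dot (v u l) (v u l) = 1" if "cd_supp m u" "dot u u = 1" for u l
    using that unit_supp[of 0 m] ds[of 0] by (auto simp: v_def)
  have e: "TA (v u) y j k = om u (y j k)" for u y
  proof -
    have "cd_supp 3 (om u (y j k))" by (simp add: cd_supp_def oct_supp)
    then show ?thesis using jk by (simp add: TA_def v_def o0 om_unit_0)
  qed
  have u: "cd_supp m (cd_unit i)" "dot (cd_unit i) (cd_unit i) = 1" using unit_supp[OF i] ds[OF i8(1)] .
  have u': "cd_supp m (oc (cd_unit i))" "dot (oc (cd_unit i)) (oc (cd_unit i)) = 1" using oc_supp[OF u(1)] u(2) by (simp_all only: dot_oc)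
  show ?thesis
    by (rule Emove_lift[OF m3 i8(1) Emove_0[OF m3 jk], where T = "TA (v (oc (cd_unit i)))" and T' = "TA (v (cd_unit i))"])
      (auto intro!: isom_TA[OF m] v u u' TA_in(2)[OF m] simp only: e)
qed

text \<open>\<open>TO\<close> acts on the entry (0, 2) by plain left multiplication, so the lift is
  made there; transpositions of indices carry it to the other two pairs.\<close>

lemma Emove_oct:
  assumes jk: "j < k" "k \<le> 2" and i: "i < 8"
  shows "Emove 3 2 j k i"
proof -
  have u: "signed_unit (cd_unit i)" by (rule signed_unit_cd_unit[OF i])
  have u': "signed_unit (oc (cd_unit i))" by (rule signed_unit_oc[OF u])
  have 02: "Emove 3 2 0 2 i"
    by (rule Emove_lift[OF _ i Emove_0, where T = "TO (oc (cd_unit i))" and T' = "TO (cd_unit i)"])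
      (simp_all add: isom_TO u u' TO_entries)
  have p: "Transposition.transpose a b (Transposition.transpose a b l) = l" for a b l :: nat by simp
  have q: "Transposition.transpose a b l \<le> 2 \<longleftrightarrow> l \<le> 2" if "a \<le> 2" "b \<le> 2" for a b l :: nat
    using that by (auto simp: Transposition.transpose_def)
  have 01: "Emove 3 2 0 1 i"
    using Emove_perm[OF _ p[of 1 2] q[of 1 2], of 3 0 1 i] 02 by (simp add: Transposition.transpose_def)
  have 12: "Emove 3 2 1 2 i"
    using Emove_perm[OF _ p[of 1 0] q[of 1 0], of 3 1 2 i] 02 by (simp add: Transposition.transpose_def)
  have "(j = 0 \<and> k = 1) \<or> (j = 0 \<and> k = 2) \<or> (j = 1 \<and> k = 2)" using jk by auto
  then show ?thesis using 01 02 12 by blast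
qed


section \<open>Normal forms of pairs of points on a projective space\<close>

text \<open>The supply of rotations is where the algebra enters; what follows is uniform in
  m.\<close>

locale proj_geometry =
  fixes m n :: nat
  assumes m: "m \<le> 3" and n1: "1 \<le> n" and Emoves: "\<And>j k i. j < k \<Longrightarrow> k \<le> n \<Longrightarrow> i < 2 ^ m \<Longrightarrow> Emove m n j k i"
begin

abbreviation X where "X \<equiv> proj_space m n"

lemma unit_rotation:
  fixes w D :: real
  obtains C S where "C\<^sup>2 + S\<^sup>2 = 1" "C * w - S * D = 0"
proof (cases "w = 0 \<and> D = 0")
  case True
  then show ?thesis using that[of 1 0] by simp
next
  case False
  then have p: "0 < w\<^sup>2 + D\<^sup>2" by (auto simp: sum_power2_gt_zero_iff)
  have "(D / sqrt (w\<^sup>2 + D\<^sup>2))\<^sup>2 + (w / sqrt (w\<^sup>2 + D\<^sup>2))\<^sup>2 = (w\<^sup>2 + D\<^sup>2) / (w\<^sup>2 + D\<^sup>2)"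
    unfolding power_divide using p by (simp add: add_divide_distrib[symmetric] add.commute)
  then show ?thesis using p by (intro that[of "D / sqrt (w\<^sup>2 + D\<^sup>2)" "w / sqrt (w\<^sup>2 + D\<^sup>2)"]) auto
qed

lemma proj_entry_zeroI:
  assumes "y \<in> X" "\<And>a. a < 2 ^ m \<Longrightarrow> y j k a = 0"
  shows "y j k = (\<lambda>_. 0)"
  using assms(2) hform_supp[OF proj_herm[OF m assms(1)], of j k] by (auto simp: cd_supp_def fun_eq_iff) (metis not_less)

text \<open>Rotations annihilate the coordinates of y_jk one after another, each leaving those
  already treated. Once y_jk = 0, the norm identity says that y_jj or y_kk is 0, and in the first
  case a half turn exchanges the two.\<close>

lemma merge:
  assumes jk: "j < k" "k \<le> n" and y: "y \<in> X"
  obtains g where "isom X (tt n) g" "\<forall>x\<in>X. \<forall>l. l \<noteq> j \<longrightarrow> l \<noteq> k \<longrightarrow> g x l l 0 = x l l 0" "g y k k 0 = 0"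
proof -
  have "\<exists>g. isom X (tt n) g \<and> (\<forall>x\<in>X. \<forall>l. l \<noteq> j \<longrightarrow> l \<noteq> k \<longrightarrow> g x l l 0 = x l l 0) \<and> (\<forall>a<N. g y j k a = 0)" if "N \<le> 2 ^ m" for N
    using that
  proof (induction N)
    case 0
    show ?case by (rule exI[of _ "\<lambda>x. x"]) (simp add: isom_id)
  next
    case (Suc N)
    then obtain g where g: "isom X (tt n) g" "\<And>x l. x \<in> X \<Longrightarrow> l \<noteq> j \<Longrightarrow> l \<noteq> k \<Longrightarrow> g x l l 0 = x l l 0" "\<And>a. a < N \<Longrightarrow> g y j k a = 0" by auto
    obtain C S where CS: "C\<^sup>2 + S\<^sup>2 = 1" "C * g y j k N - S * ((g y j j 0 - g y k k 0) / 2) = 0" by (rule unit_rotation)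
    obtain h where "rotates m n j k N C S h" using EmoveD[OF Emoves[OF jk Suc_le_lessD[OF Suc.prems]] CS(1)] .
    note h = rotatesD[OF this]
    have "h (g y) j k a = 0" if "a < Suc N" for a
      using that g(3)[of a] unfolding h(5)[OF isom_in[OF g(1) y]] CS(2) by (auto simp: cd_unit_def less_Suc_eq)
    then show ?case
      using isom_comp[OF h(1) g(1)] h(2)[OF isom_in[OF g(1)]] g(2) by (intro exI[of _ "\<lambda>x. h (g x)"]) simp
  qed
  then obtain g where g: "isom X (tt n) g" "\<And>x l. x \<in> X \<Longrightarrow> l \<noteq> j \<Longrightarrow> l \<noteq> k \<Longrightarrow> g x l l 0 = x l l 0" "\<And>a. a < 2 ^ m \<Longrightarrow> g y j k a = 0"
    by blast
  have gy: "g y \<in> X" by (rule isom_in[OF g(1) y])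
  have z: "g y j k = (\<lambda>_. 0)" by (rule proj_entry_zeroI[OF gy g(3)])
  show ?thesis
  proof (cases "g y k k 0 = 0")
    case True
    then show ?thesis using g by (intro that[of g]) auto
  next
    case False
    have "g y j j 0 * g y k k 0 = 0" using proj_norm[OF m gy, of j k] jk unfolding z by (simp add: dot_def)
    then have j0: "g y j j 0 = 0" using False by simp
    obtain h where "rotates m n j k 0 (- 1) 0 h" by (rule EmoveD[OF Emoves[OF jk, of 0], of "- 1" 0]) auto
    note h = rotatesD[OF this]
    have "h (g y) k k 0 = 0" unfolding h(4)[OF gy] j0 by simp
    then show ?thesis using that[of "\<lambda>x. h (g x)"] isom_comp[OF h(1) g(1)] h(2)[OF isom_in[OF g(1)]] g(2) by simp
  qed
qed

text \<open>With j = 0 this moves y to the base point; with j = 1 it concentrates y on the first two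
  indices without changing entry (0, 0) of any point.\<close>

lemma merge_all:
  assumes y: "y \<in> X" and N: "N \<le> n"
  obtains g where "isom X (tt n) g" "\<forall>x\<in>X. \<forall>l<j. g x l l 0 = x l l 0" "\<forall>k. j < k \<longrightarrow> k \<le> N \<longrightarrow> g y k k 0 = 0"
proof -
  have "\<exists>g. isom X (tt n) g \<and> (\<forall>x\<in>X. \<forall>l<j. g x l l 0 = x l l 0) \<and> (\<forall>k. j < k \<longrightarrow> k \<le> N \<longrightarrow> g y k k 0 = 0)"
    using N
  proof (induction N)
    case 0
    show ?case by (rule exI[of _ "\<lambda>x. x"]) (simp add: isom_id)
  next
    case (Suc N)
    then obtain g where g: "isom X (tt n) g" "\<And>x l. x \<in> X \<Longrightarrow> l < j \<Longrightarrow> g x l l 0 = x l l 0" "\<And>k. j < k \<Longrightarrow> k \<le> N \<Longrightarrow> g y k k 0 = 0" by auto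
    show ?case
    proof (cases "j < Suc N")
      case True
      have gy: "g y \<in> X" by (rule isom_in[OF g(1) y])
      obtain h where h': "isom X (tt n) h" "\<forall>x\<in>X. \<forall>l. l \<noteq> j \<longrightarrow> l \<noteq> Suc N \<longrightarrow> h x l l 0 = x l l 0" "h (g y) (Suc N) (Suc N) 0 = 0"
        using merge[OF True Suc.prems gy] .
      note h = h'(1) h'(2)[rule_format] h'(3)
      have "h (g y) k k 0 = 0" if "j < k" "k \<le> Suc N" for k
        using h(3) h(2)[OF gy, of k] g(3)[of k] that by (cases "k = Suc N") auto
      then show ?thesis
        using isom_comp[OF h(1) g(1)] h(2)[OF isom_in[OF g(1)]] g(2) True by (intro exI[of _ "\<lambda>x. h (g x)"]) simp
    next
      case False
      then show ?thesis using g by (intro exI[of _ g]) auto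
    qed
  qed
  then obtain g where "isom X (tt n) g" "\<forall>x\<in>X. \<forall>l<j. g x l l 0 = x l l 0" "\<forall>k. j < k \<longrightarrow> k \<le> N \<longrightarrow> g y k k 0 = 0" by blast
  then show ?thesis by (intro that[of g]) simp_all
qed

lemma base0: "base_pt 0 \<in> X" by (rule base_pt_in[OF m]) simp

lemma transitive:
  assumes y: "y \<in> X"
  obtains g where "isom X (tt n) g" "g y = base_pt 0"
proof -
  obtain g where g: "isom X (tt n) g" "\<forall>x\<in>X. \<forall>l<0. g x l l 0 = x l l 0" "\<forall>k. 0 < k \<longrightarrow> k \<le> n \<longrightarrow> g y k k 0 = 0"
    using merge_all[OF y order_refl, where j = 0] .
  have gy: "g y \<in> X" by (rule isom_in[OF g(1) y])
  have "(\<Sum>i\<le>n. g y i i 0) = (\<Sum>i\<le>n. if i = 0 then g y 0 0 0 else 0)" using g(3) by (intro sum.cong refl) auto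
  then have "g y 0 0 0 = 1" using proj_trace[OF m gy] by simp
  then have "g y = base_pt 0" by (intro proj_eq_base_pt[OF m gy]) auto
  then show ?thesis by (rule that[OF g(1)])
qed

lemma tt_01: "x \<in> X \<Longrightarrow> z \<in> X \<Longrightarrow> 0 \<le> tt n x z \<and> tt n x z \<le> 1"
proof -
  assume x: "x \<in> X" and z: "z \<in> X"
  obtain g where g: "isom X (tt n) g" "g x = base_pt 0" using transitive[OF x] .
  have "tt n x z = tt n (base_pt 0) (g z)" using isom_preserves[OF g(1) x z] by (simp add: g(2))
  also have "\<dots> = g z 0 0 0" by (rule tt_base_pt) simp
  finally show ?thesis using proj_diag_nonneg[OF m isom_in[OF g(1) z], of 0] proj_diag_le_1[OF m isom_in[OF g(1) z], of 0] by simp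
qed

text \<open>The composite of a quarter turn in the plane of \<open>D = (y\<^sub>0\<^sub>0 - y\<^sub>1\<^sub>1)/2\<close> and the real part of
  \<open>y\<^sub>0\<^sub>1\<close>, a rotation in the plane of \<open>D\<close> and another coordinate of \<open>y\<^sub>0\<^sub>1\<close>, and the inverse quarter turn
  rotates the entry \<open>y\<^sub>0\<^sub>1\<close> and keeps the diagonal.\<close>
lemma align:
  assumes y: "y \<in> X"
  obtains g where "isom X (tt n) g" "\<forall>x\<in>X. \<forall>l. g x l l 0 = x l l 0" "\<forall>a. 0 < a \<longrightarrow> a < 2 ^ m \<longrightarrow> g y 0 1 a = 0"
proof -
  have "\<exists>g. isom X (tt n) g \<and> (\<forall>x\<in>X. \<forall>l. g x l l 0 = x l l 0) \<and> (\<forall>a. 0 < a \<longrightarrow> a < N \<longrightarrow> g y 0 1 a = 0)" if "N \<le> 2 ^ m" for N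
    using that
  proof (induction N)
    case 0
    show ?case by (rule exI[of _ "\<lambda>x. x"]) (simp add: isom_id)
  next
    case (Suc N)
    then obtain g where g: "isom X (tt n) g" "\<And>x l. x \<in> X \<Longrightarrow> g x l l 0 = x l l 0" "\<And>a. 0 < a \<Longrightarrow> a < N \<Longrightarrow> g y 0 1 a = 0" by auto
    show ?case
    proof (cases "N = 0")
      case True
      then show ?thesis using g by (intro exI[of _ g]) auto
    next
      case False
      obtain C S where CS: "C\<^sup>2 + S\<^sup>2 = 1" "C * g y 0 1 N - S * g y 0 1 0 = 0" by (rule unit_rotation)
      have e0: "Emove m n 0 1 0" and eN: "Emove m n 0 1 N" using Emoves[of 0 1] n1 Suc.prems by auto
      obtain q where "rotates m n 0 1 0 0 (1) q" by (rule EmoveD[OF e0, of 0 "1"]) (use CS in auto)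
      note q = rotatesD[OF this]
      obtain r where "rotates m n 0 1 N C (S) r" by (rule EmoveD[OF eN, of C "S"]) (use CS in auto)
      note r = rotatesD[OF this]
      obtain p where "rotates m n 0 1 0 0 (- 1) p" by (rule EmoveD[OF e0, of 0 "- 1"]) (use CS in auto)
      note p = rotatesD[OF this]
      let ?h = "\<lambda>x. p (r (q x))"
      have h: "isom X (tt n) ?h" by (rule isom_comp[OF p(1) isom_comp[OF r(1) q(1)]])
      have hd: "?h x l l 0 = x l l 0" if x: "x \<in> X" for x l
      proof -
        have qx: "q x \<in> X" and rx: "r (q x) \<in> X" using isom_in[OF q(1) x] isom_in[OF r(1)] by auto
        consider "l = 0" | "l = 1" | "l \<noteq> 0" "l \<noteq> 1" by blast
        then show ?thesis
        proof cases
          case 1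
          show ?thesis unfolding 1 p(3)[OF rx] r(3,4,5)[OF qx] q(3,4,5)[OF x] using False by (simp add: cd_unit_def field_simps)
        next
          case 2
          show ?thesis unfolding 2 p(4)[OF rx] r(3,4,5)[OF qx] q(3,4,5)[OF x] using False by (simp add: cd_unit_def field_simps)
        next
          case 3
          then show ?thesis using p(2)[OF rx] r(2)[OF qx] q(2)[OF x] by simp
        qed
      qed
      have gy: "g y \<in> X" by (rule isom_in[OF g(1) y])
      have qx: "q (g y) \<in> X" and rx: "r (q (g y)) \<in> X" using isom_in[OF q(1) gy] isom_in[OF r(1)] by auto
      have qD: "(q (g y) 0 0 0 - q (g y) 1 1 0) / 2 = g y 0 1 0" unfolding q(3,4)[OF gy] by simp
      have qa: "q (g y) 0 1 a = g y 0 1 a" if "a \<noteq> 0" for a unfolding q(5)[OF gy] using that by (simp add: cd_unit_def)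
      have "?h (g y) 0 1 a = 0" if "0 < a" "a < Suc N" for a
      proof -
        have "?h (g y) 0 1 a = r (q (g y)) 0 1 a" unfolding p(5)[OF rx] using that by (simp add: cd_unit_def)
        also have "\<dots> = (if a = N then 0 else g y 0 1 a)"
          unfolding r(5)[OF qx] qD qa[OF False] CS(2) using that qa[of a] qa[OF False] by (simp add: cd_unit_def)
        also have "\<dots> = 0" using g(3)[of a] that by simp
        finally show ?thesis .
      qed
      then show ?thesis
        using isom_comp[OF h g(1)] hd[OF isom_in[OF g(1)]] g(2) by (intro exI[of _ "\<lambda>x. ?h (g x)"]) simp
    qed
  qed
  from this[OF order_refl] obtain g where "isom X (tt n) g" "\<forall>x\<in>X. \<forall>l. g x l l 0 = x l l 0" "\<forall>a. 0 < a \<longrightarrow> a < 2 ^ m \<longrightarrow> g y 0 1 a = 0" by blast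
  then show ?thesis by (intro that[of g]) simp_all
qed

text \<open>Conjugation by diag(1, -1, 1, ..., 1), which supplies the normal form with -s.\<close>

lemma flip:
  obtains g where "isom X (tt n) g" "\<forall>x\<in>X. \<forall>l. g x l l 0 = x l l 0" "\<forall>x\<in>X. \<forall>a. g x 0 1 a = - x 0 1 a"
proof -
  define O1 where "O1 = (\<lambda>p q :: nat. if p = q then (if p = 1 then - 1 else 1) else 0 :: real)"
  have row: "(\<Sum>q\<le>n. O1 p q * f q) = (if p = 1 then - 1 else 1) * f p" if "p \<le> n" for p f
  proof -
    have "(\<Sum>q\<le>n. O1 p q * f q) = (\<Sum>q\<le>n. if q = p then (if p = 1 then - 1 else 1) * f p else 0)"
      by (intro sum.cong refl) (simp add: O1_def)
    then show ?thesis using that by simp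
  qed
  have s: "O1 p q = O1 q p" for p q by (simp add: O1_def)
  have r: "(\<Sum>i\<le>n. O1 k i * O1 l i) = (if k = l then 1 else 0)" if "k \<le> n" for k l
    unfolding row[OF that] by (simp add: O1_def)
  have "orth n O1" unfolding orth_def using r s by simp
  then have "isom X (tt n) (conjO n O1)" by (rule isom_conjO[OF m])
  moreover have "conjO n O1 x l l 0 = x l l 0" if "x \<in> X" for x l
  proof (cases "l \<le> n")
    case True
    then show ?thesis by (simp add: conjO_nested row)
  next
    case False
    then show ?thesis using proj_outside[OF m that, of l l] by (simp add: conjO_def)
  qed
  moreover have "conjO n O1 x 0 1 a = - x 0 1 a" for x a using n1 by (simp only: conjO_nested le0 row) simp
  ultimately show ?thesis by (intro that[of "conjO n O1"]) auto
qed

text \<open>Once x lives in the upper left 2 x 2 block with real entries, the trace form sees only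
  y_00, y_11 and Re y_01. The second claim is the norm identity for x_01.\<close>

lemma tt_normal:
  assumes x: "x \<in> X" and z: "\<And>k. 1 < k \<Longrightarrow> k \<le> n \<Longrightarrow> x k k 0 = 0" and a: "\<And>a. 0 < a \<Longrightarrow> a < 2 ^ m \<Longrightarrow> x 0 1 a = 0" and y: "y \<in> X"
  shows "tt n x y = y 1 1 0 + x 0 0 0 * (y 0 0 0 - y 1 1 0) + x 0 1 0 * (2 * y 0 1 0)"
    and "(x 0 1 0)\<^sup>2 = x 0 0 0 * (1 - x 0 0 0)"
proof -
  have "(\<Sum>i\<le>n. x i i 0) = (\<Sum>i\<in>{0, 1}. x i i 0)" using n1 z by (intro sum.mono_neutral_right) auto
  then have x11: "x 1 1 0 = 1 - x 0 0 0" using proj_trace[OF m x] by simp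
  have x01: "x 0 1 = (\<lambda>a. x 0 1 0 * cd_unit 0 a)"
  proof
    fix i show "x 0 1 i = x 0 1 0 * cd_unit 0 i"
      using a[of i] hform_supp[OF proj_herm[OF m x], of 0 1] by (cases "i < 2 ^ m") (auto simp: cd_unit_def cd_supp_def)
  qed
  have d0: "dot (\<lambda>a. r * cd_unit 0 a) v = r * v 0" for r v by (simp add: dot_expand cd_unit_def)
  have 00: "dot (x i i) (y i i) = x i i 0 * y i i 0" for i
    by (subst proj_diag[OF m x]) (rule d0)
  have 01: "dot (x 0 1) (y 0 1) = x 0 1 0 * y 0 1 0" by (subst x01) (rule d0)
  have 10: "dot (x 1 0) (y 1 0) = x 0 1 0 * y 0 1 0"
    unfolding proj_conj[OF m x, of 1 0] proj_conj[OF m y, of 1 0] dot_oc by (rule 01)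
  have zz: "dot (x i k) (y i k) = 0" if "i \<le> n" "k \<le> n" "1 < i \<or> 1 < k" for i k
    using proj_entry_zero[OF m x, of i k] z[of i] z[of k] that by (auto simp: dot_def)
  have "tt n x y = (\<Sum>i\<in>{0, 1}. \<Sum>k\<in>{0, 1}. dot (x i k) (y i k))"
  proof -
    have "tt n x y = (\<Sum>i\<le>n. \<Sum>k\<in>{0, 1}. dot (x i k) (y i k))"
      unfolding tt_def using n1 zz by (intro sum.cong refl sum.mono_neutral_right) auto
    also have "\<dots> = (\<Sum>i\<in>{0, 1}. \<Sum>k\<in>{0, 1}. dot (x i k) (y i k))"
      using n1 zz by (intro sum.mono_neutral_right) auto
    finally show ?thesis .
  qed
  also have "\<dots> = dot (x 0 0) (y 0 0) + dot (x 0 1) (y 0 1) + (dot (x 1 0) (y 1 0) + dot (x 1 1) (y 1 1))" by simp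
  also have "\<dots> = y 1 1 0 + x 0 0 0 * (y 0 0 0 - y 1 1 0) + x 0 1 0 * (2 * y 0 1 0)"
    unfolding 00 01 10 x11 by (simp add: algebra_simps)
  finally show "tt n x y = y 1 1 0 + x 0 0 0 * (y 0 0 0 - y 1 1 0) + x 0 1 0 * (2 * y 0 1 0)" .
  have "x 0 1 0 * x 0 1 0 = dot (x 0 1) (x 0 1)" by (subst (3) x01) (simp only: d0)
  also have "\<dots> = x 0 0 0 * x 1 1 0" using n1 by (intro proj_norm[OF m x]) auto
  finally show "(x 0 1 0)\<^sup>2 = x 0 0 0 * (1 - x 0 0 0)" unfolding x11 by (simp add: power2_eq_square)
qed

text \<open>The maps after \<open>transitive\<close> preserve entry (0, 0), hence fix the base
  point, the only point where that entry is 1. At the image of x the entry equals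
  \<open>tt n x z\<close>, which makes it the parameter of the normal form.\<close>

lemma normal_form:
  assumes x: "x \<in> X" and z: "z \<in> X"
  shows "\<exists>s g h. s\<^sup>2 = tt n x z * (1 - tt n x z) \<and> isom X (tt n) g \<and> isom X (tt n) h \<and> g z = base_pt 0 \<and> h z = base_pt 0 \<and>
       (\<forall>y\<in>X. tt n (g x) y = y 1 1 0 + tt n x z * (y 0 0 0 - y 1 1 0) + s * (2 * y 0 1 0)) \<and>
       (\<forall>y\<in>X. tt n (h x) y = y 1 1 0 + tt n x z * (y 0 0 0 - y 1 1 0) - s * (2 * y 0 1 0))"
proof -
  have fix0: "g (base_pt 0) = base_pt 0" if "isom X (tt n) g" "\<And>x. x \<in> X \<Longrightarrow> g x 0 0 0 = x 0 0 0" for g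
    using that(2)[OF base0] by (intro proj_eq_base_pt[OF m isom_in[OF that(1) base0]]) (auto simp: base_pt_def cd_unit_def)
  obtain g1 where g1: "isom X (tt n) g1" "g1 z = base_pt 0" using transitive[OF z] .
  have x1: "g1 x \<in> X" by (rule isom_in[OF g1(1) x])
  obtain g2 where g2': "isom X (tt n) g2" "\<forall>x\<in>X. \<forall>l<1. g2 x l l 0 = x l l 0" "\<forall>k. 1 < k \<longrightarrow> k \<le> n \<longrightarrow> g2 (g1 x) k k 0 = 0"
    using merge_all[OF x1 order_refl, where j = 1] .
  note g2 = g2'(1) g2'(2)[rule_format] g2'(3)[rule_format]
  have x2: "g2 (g1 x) \<in> X" by (rule isom_in[OF g2(1) x1])
  obtain g3 where g3': "isom X (tt n) g3" "\<forall>x\<in>X. \<forall>l. g3 x l l 0 = x l l 0" "\<forall>a. 0 < a \<longrightarrow> a < 2 ^ m \<longrightarrow> g3 (g2 (g1 x)) 0 1 a = 0"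
    using align[OF x2] .
  note g3 = g3'(1) g3'(2)[rule_format] g3'(3)[rule_format]
  obtain g4 where g4': "isom X (tt n) g4" "\<forall>x\<in>X. \<forall>l. g4 x l l 0 = x l l 0" "\<forall>x\<in>X. \<forall>a. g4 x 0 1 a = - x 0 1 a"
    using flip .
  note g4 = g4'(1) g4'(2)[rule_format] g4'(3)[rule_format]
  let ?g = "\<lambda>x. g3 (g2 (g1 x))"
  let ?h = "\<lambda>x. g4 (g3 (g2 (g1 x)))"
  have g: "isom X (tt n) ?g" by (rule isom_comp[OF g3(1) isom_comp[OF g2(1) g1(1)]])
  have h: "isom X (tt n) ?h" by (rule isom_comp[OF g4(1) g])
  have gz: "?g z = base_pt 0" using fix0[OF g2(1)] fix0[OF g3(1)] g2(2) g3(2) by (simp add: g1(2))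
  have hz: "?h z = base_pt 0" using fix0[OF g4(1)] g4(2) by (simp add: gz)
  have gx: "?g x \<in> X" and hx: "?h x \<in> X" using isom_in[OF g x] isom_in[OF h x] .
  have T: "?g x 0 0 0 = tt n x z"
  proof -
    have "tt n x z = tt n (?g x) (base_pt 0)" using isom_preserves[OF g x z] by (simp add: gz)
    also have "\<dots> = ?g x 0 0 0" unfolding tt_commute[of n _ "base_pt 0"] by (rule tt_base_pt) simp
    finally show ?thesis by simp
  qed
  have d: "?g x k k 0 = 0" "?h x k k 0 = 0" if "1 < k" "k \<le> n" for k
    using g2(3)[OF that] g3(2)[OF x2] g4(2)[OF gx] by auto
  note ng = tt_normal[OF gx d(1) g3(3), unfolded T]
  have "?h x 0 1 a = 0" if "0 < a" "a < 2 ^ m" for a using g4(3)[OF gx] g3(3)[OF that] by simp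
  note nh = tt_normal[OF hx d(2) this, unfolded g4(2,3)[OF gx] T]
  show ?thesis
    by (intro exI[of _ "?g x 0 1 0"] exI[of _ ?g] exI[of _ ?h] conjI ballI)
      (use ng nh g h gz hz x in \<open>auto simp: base0\<close>)
qed

end

subsection \<open>The invariant measure on a projective space\<close>

text \<open>Dominated convergence for the difference quotients with steps 1/(k + 1), bounded by B
  through the mean value theorem.\<close>

lemma integral_derivative_zero:
  fixes \<psi> \<psi>' :: "'a \<Rightarrow> real \<Rightarrow> real"
  assumes "prob_space \<mu>" and int: "\<And>\<phi>. integrable \<mu> (\<lambda>y. \<psi> y \<phi>)" and const: "\<And>\<phi>. (\<integral>y. \<psi> y \<phi> \<partial>\<mu>) = K"
    and der: "\<And>y \<phi>. (\<psi> y has_real_derivative \<psi>' y \<phi>) (at \<phi>)"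
    and bd: "\<And>y \<phi>. y \<in> space \<mu> \<Longrightarrow> \<bar>\<psi>' y \<phi>\<bar> \<le> B"
  shows "(\<integral>y. \<psi>' y 0 \<partial>\<mu>) = 0"
proof -
  interpret prob_space \<mu> by fact
  define h where "h k = 1 / real (Suc k)" for k
  have hp: "0 < h k" for k by (simp add: h_def)
  have "h \<longlonglongrightarrow> 0" unfolding h_def[abs_def] using LIMSEQ_inverse_real_of_nat by (simp add: inverse_eq_divide)
  then have h0: "filterlim h (at 0) sequentially" unfolding filterlim_at by (simp add: h_def)
  define s where "s k y = (\<psi> y (0 + h k) - \<psi> y 0) / h k" for k y
  have si: "integrable \<mu> (s k)" for k unfolding s_def using int by auto
  have s0: "(\<integral>y. s k y \<partial>\<mu>) = 0" for k unfolding s_def using int const by simp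
  have lim: "(\<lambda>k. s k y) \<longlonglongrightarrow> \<psi>' y 0" for y
    unfolding s_def using der[of y 0] h0 unfolding DERIV_def by (rule filterlim_compose)
  have sb: "\<bar>s k y\<bar> \<le> B" if "y \<in> space \<mu>" for k y
  proof -
    obtain z where "\<psi> y (h k) - \<psi> y 0 = (h k - 0) * \<psi>' y z" using MVT2[OF hp[of k], of "\<psi> y" "\<psi>' y"] der by blast
    then have "s k y = \<psi>' y z" using hp[of k] by (simp add: s_def field_simps)
    then show ?thesis using bd[OF that] by simp
  qed
  have m: "(\<lambda>y. \<psi>' y 0) \<in> borel_measurable \<mu>"
    by (rule borel_measurable_LIMSEQ_real[where u = s]) (use lim borel_measurable_integrable[OF si] in auto)
  have "(\<lambda>k. \<integral>y. s k y \<partial>\<mu>) \<longlonglongrightarrow> (\<integral>y. \<psi>' y 0 \<partial>\<mu>)"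
    by (rule integral_dominated_convergence[where w = "\<lambda>_. B"]) (use m si lim sb in auto)
  then show ?thesis unfolding s0 by (simp add: LIMSEQ_const_iff)
qed

locale proj_measure = proj_geometry +
  fixes \<mu> :: "hmat measure"
  assumes inv: "invariant_prob (proj_space m n) (proj_dist m n) \<mu>"
begin

lemma proj_dist_eq: "x \<in> X \<Longrightarrow> y \<in> X \<Longrightarrow> proj_dist m n x y = arccos (sqrt (tt n x y))"
  by (simp only: proj_dist_def jtrace_jordan_prod[OF m proj_herm[OF m] proj_herm[OF m]])

lemma cos_proj_dist: "x \<in> X \<Longrightarrow> y \<in> X \<Longrightarrow> cos (proj_dist m n x y) = sqrt (tt n x y)"
proof -
  assume xy: "x \<in> X" "y \<in> X"
  have "0 \<le> sqrt (tt n x y)" and 1: "sqrt (tt n x y) \<le> 1" using tt_01[OF xy] by auto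
  then have "- 1 \<le> sqrt (tt n x y)" by linarith
  then show ?thesis unfolding proj_dist_eq[OF xy] using 1 by (rule cos_arccos)
qed

sublocale invariant_space X "proj_dist m n" \<mu> "tt n" "\<lambda>t. arccos (sqrt t)" "\<lambda>r. (cos r)\<^sup>2"
proof
  fix x y assume xy: "x \<in> X" "y \<in> X"
  show "proj_dist m n x y = arccos (sqrt (tt n x y))" by (rule proj_dist_eq[OF xy])
  show "tt n x y = (cos (proj_dist m n x y))\<^sup>2" using tt_01[OF xy] by (simp add: cos_proj_dist[OF xy])
  show "0 \<le> tt n x y \<and> tt n x y \<le> 1" by (rule tt_01[OF xy])
  show "tt n x y = tt n y x" by (rule tt_commute)
qed (use inv in auto)

lemma diag_measurable: "(\<lambda>y. y j j 0) \<in> borel_measurable \<mu>"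
proof (cases "j \<le> n")
  case True
  have "tt n (base_pt j) = (\<lambda>y. y j j 0)" by (rule ext) (rule tt_base_pt[OF True])
  then show ?thesis using measurable_t[OF base_pt_in[OF m True]] by simp
next
  case False
  then show ?thesis using proj_outside[OF m] by (subst measurable_cong[where g = "\<lambda>_. 0"]) (auto simp: space_\<mu>)
qed

text \<open>Only distances are measurable by construction. A quarter turn carries the coordinate
  into entry (j, j), which is the trace form with a base point; pulling that point back expresses
  the coordinate through \<open>tt\<close> and diagonal entries.\<close>

lemma upper_measurable:
  assumes jk: "j < k" "k \<le> n" and i: "i < 2 ^ m"
  shows "(\<lambda>y. y j k i) \<in> borel_measurable \<mu>"
proof -
  obtain g where "rotates m n j k i 0 1 g" by (rule EmoveD[OF Emoves[OF jk i], of 0 1]) auto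
  note g = rotatesD[OF this]
  have bj: "base_pt j \<in> X" using jk by (intro base_pt_in[OF m]) auto
  then obtain x where x: "x \<in> X" "g x = base_pt j" using g(1) unfolding isom_def bij_betw_def by (metis imageE)
  have e: "y j k i = tt n x y - (y j j 0 + y k k 0) / 2" if y: "y \<in> X" for y
  proof -
    have "tt n x y = tt n (base_pt j) (g y)" using isom_preserves[OF g(1) x(1) y] by (simp add: x(2))
    also have "\<dots> = g y j j 0" using jk by (intro tt_base_pt) auto
    finally show ?thesis unfolding g(3)[OF y] by simp
  qed
  have "(\<lambda>y. tt n x y - (y j j 0 + y k k 0) / 2) \<in> borel_measurable \<mu>"
    using measurable_t[OF x(1)] diag_measurable[of j] diag_measurable[of k] by measurable
  then show ?thesis by (subst measurable_cong[OF e]) (simp_all add: space_\<mu>)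
qed

lemma coord_measurable: "(\<lambda>y. y j k i) \<in> borel_measurable \<mu>"
proof (cases "j \<le> n \<and> k \<le> n \<and> i < 2 ^ m")
  case False
  have "y j k i = 0" if "y \<in> X" for y
    using False proj_outside[OF m that, of j k] hform_supp[OF proj_herm[OF m that], of j k] by (auto simp: cd_supp_def not_le not_less)
  then show ?thesis by (subst measurable_cong[where g = "\<lambda>_. 0"]) (auto simp: space_\<mu>)
next
  case True
  consider "j < k" | "j = k" | "k < j" by linarith
  then show ?thesis
  proof cases
    case 1
    then show ?thesis using True by (intro upper_measurable) auto
  next
    case 2
    have "(\<lambda>y. y k k 0 * cd_unit 0 i) \<in> borel_measurable \<mu>" using diag_measurable[of k] by measurable
    then show ?thesis unfolding 2
      by (subst measurable_cong[where g = "\<lambda>y. y k k 0 * cd_unit 0 i"]) (auto simp: space_\<mu> intro: fun_cong[OF proj_diag[OF m]])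
  next
    case 3
    have e: "y j k i = (if i = 0 then y k j 0 else if i < 2 ^ 3 then - y k j i else 0)" if "y \<in> X" for y
      using fun_cong[OF proj_conj[OF m that, of j k], of i] unfolding cd_conj_eq .
    have "(\<lambda>y. y k j i) \<in> borel_measurable \<mu>" "(\<lambda>y. y k j 0) \<in> borel_measurable \<mu>"
      using True 3 by (auto intro: upper_measurable)
    then have "(\<lambda>y. if i = 0 then y k j 0 else if i < 2 ^ 3 then - y k j i else 0) \<in> borel_measurable \<mu>" by (cases "i = 0"; cases "i < 2 ^ 3") auto
    then show ?thesis by (subst measurable_cong[OF e]) (simp_all add: space_\<mu>)
  qed
qed

interpretation P: prob_space \<mu> by (rule prob)

lemma int_bounded: "f \<in> borel_measurable \<mu> \<Longrightarrow> (\<And>y. y \<in> X \<Longrightarrow> \<bar>f y\<bar> \<le> C) \<Longrightarrow> integrable \<mu> (f :: _ \<Rightarrow> real)"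
  by (rule P.integrable_const_bound[where B = C]) (auto simp: space_\<mu>)

text \<open>Stein's identity: the derivative at angle 0 of the invariance under the rotations of
  \<open>(y\<^sub>0\<^sub>0 - y\<^sub>j\<^sub>j)/2\<close> and \<open>y\<^sub>0\<^sub>j(i)\<close>.\<close>
lemma stein:
  assumes j: "0 < j" "j \<le> n" and i: "i < 2 ^ m"
  shows "integrable \<mu> (\<lambda>y. real p * (y 0 0 0) ^ (p - 1) * (y 0 j i)\<^sup>2 - (y 0 0 0) ^ p * ((y 0 0 0 - y j j 0) / 2))" (is "integrable \<mu> ?F")
    and "(\<integral>y. real p * (y 0 0 0) ^ (p - 1) * (y 0 j i)\<^sup>2 - (y 0 0 0) ^ p * ((y 0 0 0 - y j j 0) / 2) \<partial>\<mu>) = 0"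
proof -
  define A D w where "A y = (y 0 0 0 + y j j 0) / 2" and "D y = (y 0 0 0 - y j j 0) / 2" and "w y = y 0 j i" for y :: hmat
  have mb: "A \<in> borel_measurable \<mu>" "D \<in> borel_measurable \<mu>" "w \<in> borel_measurable \<mu>"
    unfolding A_def D_def w_def using coord_measurable[of 0 0 0] coord_measurable[of j j 0] coord_measurable[of 0 j i] by measurable
  have b: "\<bar>A y\<bar> \<le> 1" "\<bar>D y\<bar> \<le> 1" "\<bar>w y\<bar> \<le> 1" if "y \<in> X" for y
    using proj_coord_bound[OF m that, of 0 0 0] proj_coord_bound[OF m that, of j j 0] proj_coord_bound[OF m that, of 0 j i]
    by (auto simp: A_def D_def w_def abs_le_iff)
  define U where "U y \<phi> = A y + (cos \<phi> * D y + sin \<phi> * w y)" for y \<phi>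
  define V where "V y \<phi> = cos \<phi> * w y - sin \<phi> * D y" for y \<phi>
  have cb: "\<bar>cos \<phi> * u\<bar> \<le> 1" "\<bar>sin \<phi> * u\<bar> \<le> 1" if "\<bar>u\<bar> \<le> 1" for u \<phi> :: real
    using that abs_cos_le_one[of \<phi>] abs_sin_le_one[of \<phi>] by (auto simp: abs_mult intro!: mult_le_one)
  have ub: "\<bar>U y \<phi>\<bar> \<le> 3" "\<bar>V y \<phi>\<bar> \<le> 2" "\<bar>- sin \<phi> * w y - cos \<phi> * D y\<bar> \<le> 2" if "y \<in> X" for y \<phi>
    using cb[OF b(2)[OF that], of \<phi>] cb[OF b(3)[OF that], of \<phi>] b(1)[OF that] unfolding U_def V_def by (auto simp: abs_le_iff)
  \<comment> \<open>The observable y_00^p times coordinate i of y_0j along the rotation: U and V are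
    its rotated factors, and V is the derivative of U in the angle.\<close>
  define \<psi> where "\<psi> y \<phi> = U y \<phi> ^ p * V y \<phi>" for y \<phi>
  define \<psi>' where "\<psi>' y \<phi> = real p * U y \<phi> ^ (p - 1) * V y \<phi> * V y \<phi> + U y \<phi> ^ p * (- sin \<phi> * w y - cos \<phi> * D y)" for y \<phi>
  have Um: "(\<lambda>y. U y \<phi>) \<in> borel_measurable \<mu>" "(\<lambda>y. V y \<phi>) \<in> borel_measurable \<mu>" for \<phi>
    unfolding U_def V_def using mb by measurable
  have int: "integrable \<mu> (\<lambda>y. \<psi> y \<phi>)" for \<phi>
  proof (rule int_bounded[where C = "3 ^ p * 2"])
    show "(\<lambda>y. \<psi> y \<phi>) \<in> borel_measurable \<mu>" unfolding \<psi>_def using Um by measurable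
    show "\<bar>\<psi> y \<phi>\<bar> \<le> 3 ^ p * 2" if "y \<in> X" for y
      unfolding \<psi>_def abs_mult power_abs using ub[OF that] by (intro mult_mono power_mono) auto
  qed
  have der: "(\<psi> y has_real_derivative \<psi>' y \<phi>) (at \<phi>)" for y \<phi>
  proof -
    have "(U y has_real_derivative V y \<phi>) (at \<phi>)" unfolding U_def V_def by (auto intro!: derivative_eq_intros)
    moreover have "(V y has_real_derivative - sin \<phi> * w y - cos \<phi> * D y) (at \<phi>)" unfolding V_def by (auto intro!: derivative_eq_intros)
    ultimately show ?thesis unfolding \<psi>_def \<psi>'_def by (auto intro!: derivative_eq_intros)
  qed
  have bd: "\<bar>\<psi>' y \<phi>\<bar> \<le> real p * 3 ^ (p - 1) * 2 * 2 + 3 ^ p * 2" if "y \<in> X" for y \<phi>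
  proof -
    have "\<bar>\<psi>' y \<phi>\<bar> \<le> \<bar>real p * U y \<phi> ^ (p - 1) * V y \<phi> * V y \<phi>\<bar> + \<bar>U y \<phi> ^ p * (- sin \<phi> * w y - cos \<phi> * D y)\<bar>"
      unfolding \<psi>'_def by (rule abs_triangle_ineq)
    moreover have "\<bar>real p * U y \<phi> ^ (p - 1) * V y \<phi> * V y \<phi>\<bar> \<le> real p * 3 ^ (p - 1) * 2 * 2"
      unfolding abs_mult power_abs using ub[OF that, of \<phi>] by (intro mult_mono power_mono) auto
    moreover have "\<bar>U y \<phi> ^ p * (- sin \<phi> * w y - cos \<phi> * D y)\<bar> \<le> 3 ^ p * 2"
      unfolding abs_mult[of "U y \<phi> ^ p"] power_abs using ub[OF that, of \<phi>] by (intro mult_mono power_mono) auto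
    ultimately show ?thesis by linarith
  qed
  have const: "(\<integral>y. \<psi> y \<phi> \<partial>\<mu>) = (\<integral>y. (y 0 0 0) ^ p * y 0 j i \<partial>\<mu>)" for \<phi>
  proof -
    obtain g where "rotates m n 0 j i (cos \<phi>) (sin \<phi>) g" by (rule EmoveD[OF Emoves[OF j i], of "cos \<phi>" "sin \<phi>"]) auto
    note g = rotatesD[OF this]
    have "(\<integral>y. (g y 0 0 0) ^ p * g y 0 j i \<partial>\<mu>) = (\<integral>y. (y 0 0 0) ^ p * y 0 j i \<partial>\<mu>)"
      using coord_measurable[of 0 0 0] coord_measurable[of 0 j i]
      by (intro isom_integral[OF g(1), where f = "\<lambda>y. (y 0 0 0) ^ p * y 0 j i"]) measurable
    moreover have "(\<integral>y. (g y 0 0 0) ^ p * g y 0 j i \<partial>\<mu>) = (\<integral>y. \<psi> y \<phi> \<partial>\<mu>)"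
    proof (rule Bochner_Integration.integral_cong[OF refl])
      fix y assume "y \<in> space \<mu>"
      then have y: "y \<in> X" by (simp add: space_\<mu>)
      have "g y 0 0 0 = U y \<phi>" unfolding g(3)[OF y] U_def A_def D_def w_def ..
      moreover have "g y 0 j i = V y \<phi>" unfolding g(5)[OF y] V_def D_def w_def by (simp add: cd_unit_def)
      ultimately show "(g y 0 0 0) ^ p * g y 0 j i = \<psi> y \<phi>" by (simp add: \<psi>_def)
    qed
    ultimately show ?thesis by simp
  qed
  have e: "\<psi>' y 0 = ?F y" for y
  proof -
    have "A y + D y = y 0 0 0" unfolding A_def D_def by (simp add: field_simps)
    then have "\<psi>' y 0 = real p * (y 0 0 0) ^ (p - 1) * w y * w y - (y 0 0 0) ^ p * D y" by (simp add: \<psi>'_def U_def V_def)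
    then show ?thesis by (simp add: w_def D_def power2_eq_square)
  qed
  have "(\<integral>y. \<psi>' y 0 \<partial>\<mu>) = 0" by (rule integral_derivative_zero[OF prob int const der]) (use bd in \<open>simp add: space_\<mu>\<close>)
  then show "(\<integral>y. ?F y \<partial>\<mu>) = 0" unfolding e .
  have "(\<lambda>y. \<psi>' y 0) \<in> borel_measurable \<mu>"
    unfolding \<psi>'_def using Um[of 0] mb by measurable
  then have "integrable \<mu> (\<lambda>y. \<psi>' y 0)" by (rule int_bounded) (rule bd)
  then show "integrable \<mu> ?F" unfolding e .
qed

text \<open>Stein's identity is summed over all j and i. The squared coordinates of y_0j add up to
  y_00 y_jj and the y_jj with j \<ge> 1 to 1 - y_00, so only moments of y_00 remain. The Beta
  parameters are half of the real dimensions 2^m and n 2^m.\<close>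

lemma moment_recurrence:
  "(real (2 ^ m) / 2 + real n * real (2 ^ m) / 2 + real p) * (\<integral>y. (y 0 0 0) ^ Suc p \<partial>\<mu>)
    = (real (2 ^ m) / 2 + real p) * (\<integral>y. (y 0 0 0) ^ p \<partial>\<mu>)"
proof -
  define q where "q = real (2 ^ m)"
  define F where "F j i y = real p * (y 0 0 0) ^ (p - 1) * (y 0 j i)\<^sup>2 - (y 0 0 0) ^ p * ((y 0 0 0 - y j j 0) / 2)" for j i and y :: hmat
  define M where "M k y = (y 0 0 0) ^ k" for k and y :: hmat
  have Mi: "integrable \<mu> (M k)" for k
  proof (rule int_bounded[where C = 1])
    show "M k \<in> borel_measurable \<mu>" unfolding M_def using coord_measurable[of 0 0 0] by measurable
    show "\<bar>M k y\<bar> \<le> 1" if "y \<in> X" for y using proj_coord_bound[OF m that, of 0 0 0] by (simp add: M_def power_abs power_le_one)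
  qed
  have "0 = (\<Sum>j\<in>{1..n}. \<Sum>i<2 ^ m. \<integral>y. F j i y \<partial>\<mu>)"
    unfolding F_def using stein(2)[of _ _ p] by (intro sum.neutral[symmetric] ballI) (auto intro!: sum.neutral)
  also have "\<dots> = (\<Sum>j\<in>{1..n}. \<integral>y. (\<Sum>i<2 ^ m. F j i y) \<partial>\<mu>)"
    using stein(1)[of _ _ p] by (intro sum.cong refl Bochner_Integration.integral_sum[symmetric]) (auto simp: F_def)
  also have "\<dots> = (\<integral>y. (\<Sum>j\<in>{1..n}. \<Sum>i<2 ^ m. F j i y) \<partial>\<mu>)"
    using stein(1)[of _ _ p] by (intro Bochner_Integration.integral_sum[symmetric] Bochner_Integration.integrable_sum) (auto simp: F_def)
  also have "\<dots> = (\<integral>y. (p + q / 2) * M p y - (p + q / 2 + real n * q / 2) * M (Suc p) y \<partial>\<mu>)"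
  proof (rule Bochner_Integration.integral_cong[OF refl])
    fix y assume "y \<in> space \<mu>"
    then have y: "y \<in> X" by (simp add: space_\<mu>)
    have pw: "(2::nat) ^ m \<le> 8" using power_increasing[OF m, of "2::nat"] by simp
    have 1: "(\<Sum>i<2 ^ m. (y 0 j i)\<^sup>2) = y 0 0 0 * y j j 0" if "j \<le> n" for j
    proof -
      have "(\<Sum>i<2 ^ m. (y 0 j i)\<^sup>2) = (\<Sum>i<8. (y 0 j i)\<^sup>2)"
        using pw hform_supp[OF proj_herm[OF m y], of 0 j] by (intro sum.mono_neutral_left) (auto simp: cd_supp_def)
      also have "\<dots> = dot (y 0 j) (y 0 j)" by (simp add: dot_def power2_eq_square)
      finally show ?thesis using proj_norm[OF m y, of 0 j] that by simp
    qed
    have 2: "(\<Sum>i<2 ^ m. F j i y) = (p + q / 2) * M p y * y j j 0 - q / 2 * M (Suc p) y" if "j \<le> n" for j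
    proof -
      have "(\<Sum>i<2 ^ m. F j i y) = real p * (y 0 0 0) ^ (p - 1) * (\<Sum>i<2 ^ m. (y 0 j i)\<^sup>2) - q * ((y 0 0 0) ^ p * ((y 0 0 0 - y j j 0) / 2))"
        by (simp add: F_def sum_subtractf sum_distrib_left q_def)
      also have "real p * (y 0 0 0) ^ (p - 1) * (\<Sum>i<2 ^ m. (y 0 j i)\<^sup>2) = real p * M p y * y j j 0"
        unfolding 1[OF that] by (cases p) (simp_all add: M_def)
      finally show ?thesis by (simp add: M_def field_simps)
    qed
    have 3: "(\<Sum>j\<in>{1..n}. y j j 0) = 1 - y 0 0 0"
      using proj_trace[OF m y] sum.atLeast_Suc_atMost[of 0 n "\<lambda>j. y j j 0"] by (simp add: atLeast0AtMost)
    have "(\<Sum>j\<in>{1..n}. \<Sum>i<2 ^ m. F j i y) = (\<Sum>j\<in>{1..n}. (p + q / 2) * M p y * y j j 0 - q / 2 * M (Suc p) y)"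
      by (intro sum.cong refl 2) auto
    also have "\<dots> = (p + q / 2) * M p y * (1 - y 0 0 0) - real n * (q / 2 * M (Suc p) y)"
      unfolding 3[symmetric] by (simp add: sum_subtractf sum_distrib_left)
    also have "\<dots> = (p + q / 2) * M p y - (p + q / 2 + real n * q / 2) * M (Suc p) y" by (simp add: M_def field_simps)
    finally show "(\<Sum>j\<in>{1..n}. \<Sum>i<2 ^ m. F j i y) = (p + q / 2) * M p y - (p + q / 2 + real n * q / 2) * M (Suc p) y" .
  qed
  also have "\<dots> = (p + q / 2) * (\<integral>y. M p y \<partial>\<mu>) - (p + q / 2 + real n * q / 2) * (\<integral>y. M (Suc p) y \<partial>\<mu>)" using Mi by simp
  finally show ?thesis unfolding q_def M_def by (simp add: algebra_simps del: power_Suc)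
qed

lemma proj_zonal: "\<exists>D u. zonal_space X \<mu> (tt n) (real (2 ^ m) / 2) (real n * real (2 ^ m) / 2) D u"
proof -
  \<comment> \<open>Eight components are listed at every level; those from 2^m on vanish.\<close>
  define S where "S = {..n} \<times> {..n} \<times> {..<8::nat}"
  obtain h where h: "bij_betw h {..<card S} S"
    using ex_bij_betw_nat_finite[of S] by (auto simp: S_def atLeast0LessThan)
  define u where "u e y = y (fst (h e)) (fst (snd (h e))) (snd (snd (h e)))" for e and y :: hmat
  have "zonal_space X \<mu> (tt n) (real (2 ^ m) / 2) (real n * real (2 ^ m) / 2) (card S) u"
  proof
    show "0 < real (2 ^ m) / 2" "0 < real n * real (2 ^ m) / 2" using n1 by auto
    show "space \<mu> = X" by (rule space_\<mu>)
    fix x y assume xy: "x \<in> X" "y \<in> X"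
    have "(\<Sum>e<card S. u e x * u e y) = (\<Sum>s\<in>S. x (fst s) (fst (snd s)) (snd (snd s)) * y (fst s) (fst (snd s)) (snd (snd s)))"
      unfolding u_def by (rule sum.reindex_bij_betw[OF h])
    also have "\<dots> = tt n x y" unfolding S_def tt_def dot_def by (simp add: sum.cartesian_product case_prod_unfold)
    finally show "tt n x y = (\<Sum>e<card S. u e x * u e y)" ..
    show "0 \<le> tt n x y \<and> tt n x y \<le> 1" by (rule tt_01[OF xy])
  next
    fix e assume "e < card S"
    show "u e \<in> borel_measurable \<mu>" unfolding u_def by (rule coord_measurable)
    fix x assume "x \<in> X"
    then show "\<bar>u e x\<bar> \<le> 1" unfolding u_def by (rule proj_coord_bound[OF m])
  next
    fix x assume x: "x \<in> X"
    show "tt n x x = 1" unfolding tt_def using proj_trace[OF m x] by (simp add: proj_diag_sum[OF m x])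
    fix i
    have mom: "(\<integral>y. tt n x y ^ k \<partial>\<mu>) = (\<integral>y. (y 0 0 0) ^ k \<partial>\<mu>)" for k
    proof -
      obtain g where g: "isom X (tt n) g" "g x = base_pt 0" using transitive[OF x] .
      have "(\<integral>y. tt n x y ^ k * tt n y x ^ 0 \<partial>\<mu>) = (\<integral>y. tt n (base_pt 0) y ^ k * tt n y (base_pt 0) ^ 0 \<partial>\<mu>)"
        using convolution_isom[OF g(1) x x, of k 0] by (simp add: g(2))
      then show ?thesis by (simp add: tt_base_pt)
    qed
    show "(\<integral>y. tt n x y ^ i \<partial>\<mu>) = beta_exp (real (2 ^ m) / 2) (real n * real (2 ^ m) / 2) (monom 1 i)"
      unfolding mom
    proof (rule beta_moment_unique)
      show "0 < real (2 ^ m) / 2" "0 < real n * real (2 ^ m) / 2" using n1 by auto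
      show "(\<integral>y. (y 0 0 0) ^ 0 \<partial>\<mu>) = 1" using P.prob_space by simp
    qed (rule moment_recurrence)
  next
    fix i j
    show "\<exists>q. degree q \<le> i \<and> (\<forall>x\<in>X. \<forall>z\<in>X. (\<integral>y. tt n x y ^ i * tt n y z ^ j \<partial>\<mu>) = poly q (tt n x z))"
    proof (rule convolution_polynomial[OF base0, where U = "\<lambda>y. y 1 1 0" and V = "\<lambda>y. y 0 0 0 - y 1 1 0" and W = "\<lambda>y. 2 * y 0 1 0" and C = 2])
      show "(\<lambda>y. y 1 1 0) \<in> borel_measurable \<mu>" "(\<lambda>y. y 0 0 0 - y 1 1 0) \<in> borel_measurable \<mu>" "(\<lambda>y. 2 * y 0 1 0) \<in> borel_measurable \<mu>"
        using coord_measurable[of 0 0 0] coord_measurable[of 1 1 0] coord_measurable[of 0 1 0] by auto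
      fix y assume "y \<in> X"
      note b = proj_coord_bound[OF m this, of 0 0 0] proj_coord_bound[OF m this, of 1 1 0] proj_coord_bound[OF m this, of 0 1 0]
      show "\<bar>y 1 1 0\<bar> \<le> 2" "\<bar>y 0 0 0 - y 1 1 0\<bar> \<le> 2" "\<bar>2 * y 0 1 0\<bar> \<le> 2" using b by linarith+
    qed (rule normal_form)
  qed
  then show ?thesis by (intro exI)
qed

lemma proj_rgg:
  assumes "iid_sample X (proj_dist m n) P \<mu> Y" and L: "0 < L" "L < pi / 2"
  shows "rgg_converges X (proj_dist m n) L P Y
     (threshold_coeff (real (2 ^ m) / 2) (real n * real (2 ^ m) / 2) ((cos L)\<^sup>2)) (jac_dim (real (2 ^ m) / 2) (real n * real (2 ^ m) / 2))"
proof -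
  obtain D u where "zonal_space X \<mu> (tt n) (real (2 ^ m) / 2) (real n * real (2 ^ m) / 2) D u" using proj_zonal by (elim exE)
  then interpret Z: zonal_space X \<mu> "tt n" "real (2 ^ m) / 2" "real n * real (2 ^ m) / 2" D u .
  show ?thesis
  proof (rule Z.rgg_converges_threshold[OF assms(1) sets_\<mu>])
    fix x y assume xy: "x \<in> X" "y \<in> X"
    have t: "0 \<le> sqrt (tt n x y)" "sqrt (tt n x y) \<le> 1" "0 \<le> tt n x y" using tt_01[OF xy] by auto
    have t': "- 1 \<le> sqrt (tt n x y)" using t(1) by linarith
    have c: "0 \<le> cos L" using L by (intro cos_ge_zero) auto
    have "proj_dist m n x y \<le> L \<longleftrightarrow> cos L \<le> cos (proj_dist m n x y)"
      unfolding proj_dist_eq[OF xy] using L arccos_bounded[OF t' t(2)] by (subst cos_mono_le_eq) auto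
    also have "\<dots> \<longleftrightarrow> (cos L)\<^sup>2 \<le> (sqrt (tt n x y))\<^sup>2"
      unfolding cos_proj_dist[OF xy] using c t by (metis power2_le_imp_le power_mono)
    finally show "proj_dist m n x y \<le> L \<longleftrightarrow> (cos L)\<^sup>2 \<le> tt n x y" using t by simp
  qed
qed

end

lemma proj_geometry_assoc: "m \<le> 2 \<Longrightarrow> 1 \<le> n \<Longrightarrow> proj_geometry m n"
  by unfold_locales (auto intro: Emove_assoc)

lemma proj_geometry_oct: "proj_geometry 3 2"
  by unfold_locales (auto intro: Emove_oct)

lemma proj_space_rgg:
  assumes "proj_geometry m n" "invariant_prob (proj_space m n) (proj_dist m n) \<mu>"
    "iid_sample (proj_space m n) (proj_dist m n) P \<mu> Y" "0 < L" "L < pi / 2"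
  shows "rgg_converges (proj_space m n) (proj_dist m n) L P Y
     (threshold_coeff (real (2 ^ m) / 2) (real n * real (2 ^ m) / 2) ((cos L)\<^sup>2)) (jac_dim (real (2 ^ m) / 2) (real n * real (2 ^ m) / 2))"
  by (rule proj_measure.proj_rgg) (use assms in \<open>auto simp: proj_measure_def proj_measure_axioms_def\<close>)

section \<open>Explicit eigenvalues and multiplicities\<close>

text \<open>Q is a primitive of -\<kappa> times the weight. Used with s0 = 0 as well, the formula
  determines the constant \<kappa> Beta(a, b) from the boundary values of Q.\<close>

lemma threshold_coeff_0:
  assumes ab: "0 < a" "0 < b" and s0: "0 \<le> s0" "s0 < 1" and cont: "continuous_on {0..1} Q"
    and der: "\<And>s. 0 < s \<Longrightarrow> s < 1 \<Longrightarrow> (Q has_real_derivative - \<kappa> * (s powr (a - 1) * (1 - s) powr (b - 1))) (at s)"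
  shows "\<kappa> * Beta a b * threshold_coeff a b s0 0 = Q s0 - Q 1"
proof -
  have "((\<lambda>s. beta_density a b s * (if s0 \<le> s then poly (jac a b 0) s else 0)) has_integral threshold_coeff a b s0 0) UNIV"
    unfolding threshold_coeff_def by (rule integral_beta_measure[OF ab integrable_beta_poly_tail[OF ab]]) measurable
  then have 1: "((\<lambda>s. (- \<kappa> * Beta a b) * (beta_density a b s * (if s0 \<le> s then poly (jac a b 0) s else 0)))
      has_integral (- \<kappa> * Beta a b) * threshold_coeff a b s0 0) UNIV"
    by (rule has_integral_mult_right)
  have "((\<lambda>s. - \<kappa> * (s powr (a - 1) * (1 - s) powr (b - 1))) has_integral (Q 1 - Q s0)) {s0..1}"
  proof (rule fundamental_theorem_of_calculus_interior)
    show "continuous_on {s0..1} Q" using s0 by (intro continuous_on_subset[OF cont]) auto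
    show "(Q has_vector_derivative - \<kappa> * (s powr (a - 1) * (1 - s) powr (b - 1))) (at s)" if "s \<in> {s0<..<1}" for s
      using der[of s] that s0 by (simp add: has_real_derivative_iff_has_vector_derivative)
  qed (use s0 in auto)
  then have "((\<lambda>s. - \<kappa> * (s powr (a - 1) * (1 - s) powr (b - 1))) has_integral (Q 1 - Q s0)) {s0<..<1}"
    by (simp add: has_integral_Icc_iff_Ioo)
  then have "((\<lambda>s. if s \<in> {s0<..<1} then - \<kappa> * (s powr (a - 1) * (1 - s) powr (b - 1)) else 0) has_integral (Q 1 - Q s0)) UNIV"
    by (subst has_integral_restrict_UNIV)
  then have "((\<lambda>s. (- \<kappa> * Beta a b) * (beta_density a b s * (if s0 \<le> s then poly (jac a b 0) s else 0))) has_integral (Q 1 - Q s0)) UNIV"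
    by (rule has_integral_spike[of "{s0}", rotated 2]) (use s0 beta_pos[OF ab] in \<open>auto simp: beta_density_def\<close>)
  from has_integral_unique[OF 1 this] show ?thesis by simp
qed

lemma threshold_coeff_0_0: "0 < a \<Longrightarrow> 0 < b \<Longrightarrow> threshold_coeff a b 0 0 = 1"
proof -
  assume ab: "0 < a" "0 < b"
  have "((\<lambda>s. beta_density a b s * (if 0 \<le> s then poly (jac a b 0) s else 0)) has_integral threshold_coeff a b 0 0) UNIV"
    unfolding threshold_coeff_def by (rule integral_beta_measure[OF ab integrable_beta_poly_tail[OF ab]]) measurable
  moreover have "(\<lambda>s. beta_density a b s * (if 0 \<le> s then poly (jac a b 0) s else 0)) = beta_density a b"
    by (auto simp: beta_density_def)
  ultimately show ?thesis using has_integral_unique[OF has_integral_beta_density[OF ab]] by auto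
qed

lemma threshold_coeff_Suc:
  assumes "0 < a" "0 < b" "0 < s0" "s0 < 1"
  shows "threshold_coeff a b s0 (Suc k) = s0 powr a * (1 - s0) powr b * jacobiJ (a + 1) (b + 1) k s0 / (b * Beta a b)"
  unfolding threshold_coeff_def using assms by (subst jac_tail_integral) (auto simp: jacobiJ_eq_jac)

lemma square_powr: "0 < (x::real) \<Longrightarrow> (x\<^sup>2) powr (real k / 2) = x ^ k"
proof -
  assume x: "0 < x"
  have "(x\<^sup>2) powr (real k / 2) = (x powr real 2) powr (real k / 2)" by (simp only: powr_realpow[OF x])
  also have "\<dots> = x powr real k" unfolding powr_powr by simp
  finally show ?thesis by (simp only: powr_realpow[OF x])
qed

text \<open>Powers with half-integer exponent in terms of square roots, which avoids a case
  distinction on the parity of n.\<close>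

lemma powr_half_minus_1: "0 < (z::real) \<Longrightarrow> 1 \<le> n \<Longrightarrow> z powr (real n / 2 - 1) = sqrt z ^ (n - 1) / sqrt z"
proof -
  assume z: "0 < z" and n: "1 \<le> n"
  define w where "w = sqrt z"
  have w: "0 < w" "z = w * w" using z by (auto simp: w_def)
  have "z powr (real n / 2) = w ^ n" using square_powr[of w n] w by (simp add: power2_eq_square)
  also have "\<dots> = w ^ (n - 1) * w" using n by (cases n) auto
  finally have "z powr (real n / 2 - 1) = w ^ (n - 1) * w / (w * w)" using z w(2) by (simp add: powr_diff)
  then show ?thesis unfolding w_def[symmetric] using w(1) by simp
qed

lemma sin_power_integral:
  defines "\<Psi> \<equiv> \<lambda>k \<theta>. integral {0..\<theta>} (\<lambda>t. sin t ^ k)"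
  shows "0 < \<theta> \<Longrightarrow> \<theta> < pi \<Longrightarrow> (\<Psi> k has_real_derivative sin \<theta> ^ k) (at \<theta>)"
    and "continuous_on {0..pi} (\<Psi> k)"
proof -
  have 1: "(\<Psi> k has_real_derivative sin \<theta> ^ k) (at \<theta> within {0..pi})" if "\<theta> \<in> {0..pi}" for \<theta>
    unfolding \<Psi>_def by (rule integral_has_real_derivative) (use that in \<open>auto intro!: continuous_intros\<close>)
  then show "continuous_on {0..pi} (\<Psi> k)" by (rule DERIV_continuous_on)
  show "(\<Psi> k has_real_derivative sin \<theta> ^ k) (at \<theta>)" if "0 < \<theta>" "\<theta> < pi"
    using 1[of \<theta>] that by (simp add: at_within_Icc_at)
qed

section \<open>Eigenvalues for the five families\<close>

context
  fixes L :: real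
  assumes L: "0 < L" "L < pi / 2"
begin

lemma cos_sin_L: "0 < cos L" "0 < sin L" "0 < (cos L)\<^sup>2" "(cos L)\<^sup>2 < 1" "1 - (cos L)\<^sup>2 = (sin L)\<^sup>2" "cos L < 1"
proof -
  show c: "0 < cos L" using L by (intro cos_gt_zero) auto
  show s: "0 < sin L" using L by (intro sin_gt_zero) auto
  show e: "1 - (cos L)\<^sup>2 = (sin L)\<^sup>2" by (simp add: sin_squared_eq)
  have "0 < (sin L)\<^sup>2" using s by simp
  then show "(cos L)\<^sup>2 < 1" using e by linarith
  then show "cos L < 1" using power2_less_imp_less[of "cos L" 1] by simp
  show "0 < (cos L)\<^sup>2" using c by simp
qed

lemma threshold_coeff_proj_Suc:
  assumes "1 \<le> q" "1 \<le> r"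
  shows "threshold_coeff (real q / 2) (real r / 2) ((cos L)\<^sup>2) (Suc k)
    = cos L ^ q * sin L ^ r * jacobiJ (real q / 2 + 1) (real r / 2 + 1) k ((cos L)\<^sup>2) / (real r / 2 * Beta (real q / 2) (real r / 2))"
  using assms cos_sin_L by (subst threshold_coeff_Suc) (auto simp: square_powr)

text \<open>The boundary values make Q the survival function of the Beta law, so \<kappa> is 1 /
  Beta; the same constant enters the higher eigenvalues, divided by the second parameter.\<close>

lemma threshold_coeff_proj_poly:
  assumes q: "1 \<le> q" "1 \<le> r" and cont: "continuous_on {0..1} Q" and Q: "Q 0 = 1" "Q 1 = 0"
    and der: "\<And>s. 0 < s \<Longrightarrow> s < 1 \<Longrightarrow> (Q has_real_derivative - \<kappa> * (s powr (real q / 2 - 1) * (1 - s) powr (real r / 2 - 1))) (at s)"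
  shows "threshold_coeff (real q / 2) (real r / 2) ((cos L)\<^sup>2) k =
    (if k = 0 then Q ((cos L)\<^sup>2) else \<kappa> / (real r / 2) * (cos L ^ q * sin L ^ r * jacobiJ (real q / 2 + 1) (real r / 2 + 1) (k - 1) ((cos L)\<^sup>2)))"
proof -
  have ab: "0 < real q / 2" "0 < real r / 2" using q by auto
  have k1: "\<kappa> * Beta (real q / 2) (real r / 2) = 1"
    using threshold_coeff_0[OF ab, of 0 Q \<kappa>] cont der Q by (simp add: threshold_coeff_0_0[OF ab])
  show ?thesis
  proof (cases k)
    case 0
    then show ?thesis using threshold_coeff_0[OF ab, of "(cos L)\<^sup>2" Q \<kappa>] cos_sin_L cont der Q k1 by simp
  next
    case (Suc j)
    have B: "Beta (real q / 2) (real r / 2) = 1 / \<kappa>" using k1 by (cases "\<kappa> = 0") (auto simp: field_simps)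
    show ?thesis unfolding Suc threshold_coeff_proj_Suc[OF q] B by simp
  qed
qed

lemma eig_CP_eq: "1 \<le> n \<Longrightarrow> threshold_coeff 1 (real n) ((cos L)\<^sup>2) k = eig_CP n L k"
proof -
  assume n: "1 \<le> n"
  have "threshold_coeff (real 2 / 2) (real (2 * n) / 2) ((cos L)\<^sup>2) k =
    (if k = 0 then (1 - (cos L)\<^sup>2) ^ n else real n / (real (2 * n) / 2) * (cos L ^ 2 * sin L ^ (2 * n) * jacobiJ (real 2 / 2 + 1) (real (2 * n) / 2 + 1) (k - 1) ((cos L)\<^sup>2)))"
  proof (rule threshold_coeff_proj_poly)
    show "((\<lambda>s. (1 - s) ^ n) has_real_derivative - real n * (s powr (real 2 / 2 - 1) * (1 - s) powr (real (2 * n) / 2 - 1))) (at s)" if "0 < s" "s < 1" for s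
    proof -
      have e: "real (2 * n) / 2 - 1 = real (n - 1)" using n by (simp add: of_nat_diff)
      have p: "(1 - s) powr (real (2 * n) / 2 - 1) = (1 - s) ^ (n - 1)" unfolding e using that by (intro powr_realpow) simp
      have s: "s powr (real 2 / 2 - 1) = 1" using that by simp
      have "((\<lambda>s. (1 - s) ^ n) has_real_derivative real n * (1 - s) ^ (n - 1) * (- 1)) (at s)" by (auto intro!: derivative_eq_intros)
      then show ?thesis unfolding p s by (rule DERIV_cong) simp
    qed
  qed (use n in \<open>auto intro!: continuous_intros\<close>)
  then show ?thesis using n by (simp add: eig_CP_def cos_sin_L power_mult add.commute)
qed

text \<open>Integrating s (1 - s)^(2n-1) by parts gives the survival function (1 - s)^(2n) (1 + 2 n
  s), with 1 / Beta(2, 2n) = 2n (2n + 1).\<close>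

lemma eig_HP_eq: "1 \<le> n \<Longrightarrow> threshold_coeff 2 (2 * real n) ((cos L)\<^sup>2) k = eig_HP n L k"
proof -
  assume n: "1 \<le> n"
  have "threshold_coeff (real 4 / 2) (real (4 * n) / 2) ((cos L)\<^sup>2) k =
    (if k = 0 then (1 - (cos L)\<^sup>2) ^ (2 * n) * (1 + 2 * real n * (cos L)\<^sup>2) else (2 * real n * (2 * real n + 1)) / (real (4 * n) / 2) * (cos L ^ 4 * sin L ^ (4 * n) * jacobiJ (real 4 / 2 + 1) (real (4 * n) / 2 + 1) (k - 1) ((cos L)\<^sup>2)))"
  proof (rule threshold_coeff_proj_poly[where Q = "\<lambda>s. (1 - s) ^ (2 * n) * (1 + 2 * real n * s)"])
    show "((\<lambda>s. (1 - s) ^ (2 * n) * (1 + 2 * real n * s)) has_real_derivative - (2 * real n * (2 * real n + 1)) * (s powr (real 4 / 2 - 1) * (1 - s) powr (real (4 * n) / 2 - 1))) (at s)" if "0 < s" "s < 1" for s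
    proof -
      have e: "real (4 * n) / 2 - 1 = real (2 * n - 1)" using n by (simp add: of_nat_diff)
      have p: "(1 - s) powr (real (4 * n) / 2 - 1) = (1 - s) ^ (2 * n - 1)" unfolding e using that by (intro powr_realpow) simp
      have s: "s powr (real 4 / 2 - 1) = s" using that by simp
      have f: "(1 - s) ^ (2 * n) = (1 - s) ^ (2 * n - 1) * (1 - s)" using power_minus_mult[of "2 * n" "1 - s"] n by simp
      have "((\<lambda>s. (1 - s) ^ (2 * n) * (1 + 2 * real n * s)) has_real_derivative
         real (2 * n) * (1 - s) ^ (2 * n - 1) * (- 1) * (1 + 2 * real n * s) + (1 - s) ^ (2 * n) * (2 * real n)) (at s)"
        by (auto intro!: derivative_eq_intros)
      then show ?thesis unfolding p s f by (rule DERIV_cong) (simp add: algebra_simps)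
    qed
  qed (use n in \<open>auto intro!: continuous_intros\<close>)
  then show ?thesis using n by (simp add: eig_HP_def cos_sin_L power_mult[symmetric] add.commute)
qed

text \<open>1320 = 1 / Beta(4, 8) = 11! / (3! 7!) and 165 = 1320 / 8. The cubic factor is the
  survival function divided by (1 - s)^8.\<close>

lemma eig_OP_eq: "threshold_coeff 4 8 ((cos L)\<^sup>2) k = eig_OP L k"
proof -
  have "threshold_coeff (real 8 / 2) (real 16 / 2) ((cos L)\<^sup>2) k =
    (if k = 0 then (1 - (cos L)\<^sup>2) ^ 8 * (1 + 8 * (cos L)\<^sup>2 + 36 * ((cos L)\<^sup>2) ^ 2 + 120 * ((cos L)\<^sup>2) ^ 3)
      else 1320 / (real 16 / 2) * (cos L ^ 8 * sin L ^ 16 * jacobiJ (real 8 / 2 + 1) (real 16 / 2 + 1) (k - 1) ((cos L)\<^sup>2)))"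
  proof (rule threshold_coeff_proj_poly[where Q = "\<lambda>s. (1 - s) ^ 8 * (1 + 8 * s + 36 * s ^ 2 + 120 * s ^ 3)"])
    show "((\<lambda>s. (1 - s) ^ 8 * (1 + 8 * s + 36 * s ^ 2 + 120 * s ^ 3)) has_real_derivative - 1320 * (s powr (real 8 / 2 - 1) * (1 - s) powr (real 16 / 2 - 1))) (at s)" if "0 < s" "s < 1" for s
    proof -
      have p: "(1 - s) powr (real 16 / 2 - 1) = (1 - s) ^ 7" "s powr (real 8 / 2 - 1) = s ^ 3" using that by simp_all
      have d: "((\<lambda>s. (1 - s) ^ 8 * (1 + 8 * s + 36 * s ^ 2 + 120 * s ^ 3)) has_real_derivative
         8 * (1 - s) ^ 7 * (- 1) * (1 + 8 * s + 36 * s ^ 2 + 120 * s ^ 3) + (1 - s) ^ 8 * (8 + 72 * s + 360 * s ^ 2)) (at s)"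
        by (auto intro!: derivative_eq_intros)
      have e: "8 * w * (- 1) * (1 + 8 * s + 36 * s ^ 2 + 120 * s ^ 3) + ((1 - s) * w) * (8 + 72 * s + 360 * s ^ 2) = - 1320 * (s ^ 3 * w)" for w
        by (simp add: algebra_simps power2_eq_square power3_eq_cube)
      have f: "(1 - s) ^ 8 = (1 - s) * (1 - s) ^ 7" using power_Suc[of "1 - s" 7] by simp
      show ?thesis unfolding p by (rule DERIV_cong[OF d]) (unfold f, rule e)
    qed
  qed (auto intro!: continuous_intros)
  then show ?thesis by (simp add: eig_OP_def cos_sin_L power_mult[symmetric])
qed

text \<open>The substitution s = cos^2 \<theta> turns the weight into a multiple of sin^(n-1), whose
  primitive \<Psi> is kept as an integral.\<close>

lemma eig_RP_eq:
  assumes n: "1 \<le> n"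
  shows "threshold_coeff (1 / 2) (real n / 2) ((cos L)\<^sup>2) k = eig_RP n L k"
proof -
  define \<Psi> where "\<Psi> \<theta> = integral {0..\<theta>} (\<lambda>t. sin t ^ (n - 1))" for \<theta> :: real
  have ab: "0 < (1::real) / 2" "0 < real n / 2" using n by auto
  have cont: "continuous_on {0..1} (\<lambda>s. \<Psi> (arccos (sqrt s)))"
  proof (rule continuous_on_compose2[where g = \<Psi> and t = "{0..pi}"])
    show "continuous_on {0..pi} \<Psi>" unfolding \<Psi>_def[abs_def] by (rule sin_power_integral(2))
    have b: "- 1 \<le> sqrt s" "sqrt s \<le> 1" if "s \<in> {0..1}" for s using that real_sqrt_ge_zero[of s] by (auto intro: order_trans[of _ 0])
    show "continuous_on {0..1} (\<lambda>s. arccos (sqrt s))" using b by (intro continuous_intros) auto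
    show "(\<lambda>s. arccos (sqrt s)) ` {0..1} \<subseteq> {0..pi}" using arccos_bounded[OF b] by auto
  qed
  have der: "((\<lambda>s. \<Psi> (arccos (sqrt s))) has_real_derivative - (1 / 2) * (s powr (1 / 2 - 1) * (1 - s) powr (real n / 2 - 1))) (at s)"
    if s: "0 < s" "s < 1" for s
  proof -
    have r: "0 < sqrt s" "sqrt s < 1" using s by auto
    then have r': "- 1 < sqrt s" by linarith
    have "0 < arccos (sqrt s)" "arccos (sqrt s) < pi" using arccos_lt_bounded[OF r' r(2)] by auto
    then have d: "(\<Psi> has_real_derivative sin (arccos (sqrt s)) ^ (n - 1)) (at (arccos (sqrt s)))"
      unfolding \<Psi>_def[abs_def] by (rule sin_power_integral(1))
    have e: "sin (arccos (sqrt s)) = sqrt (1 - s)" by (subst sin_arccos) (use r r' s in auto)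
    have a: "((\<lambda>s. arccos (sqrt s)) has_real_derivative inverse (- sqrt (1 - (sqrt s)\<^sup>2)) * (inverse (sqrt s) / 2)) (at s)"
      by (rule DERIV_chain2[OF DERIV_arccos[OF r' r(2)] DERIV_real_sqrt[OF s(1)]])
    have p1: "s powr (1 / 2 - 1) = 1 / sqrt s" using powr_half_minus_1[OF s(1), of 1] by simp
    have p2: "(1 - s) powr (real n / 2 - 1) = sqrt (1 - s) ^ (n - 1) / sqrt (1 - s)" using powr_half_minus_1[of "1 - s" n] s n by simp
    have g: "x * (inverse (- v) * (inverse u / 2)) = - (1 / 2) * (1 / u * (x / v))" for x u v :: real
      by (cases "u = 0"; cases "v = 0") (simp_all add: field_simps)
    have "(sqrt s)\<^sup>2 = s" using s by simp
    from DERIV_chain2[OF d[unfolded e] a[unfolded this]] show ?thesis unfolding p1 p2 g .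
  qed
  note t = threshold_coeff_0[OF ab _ _ cont der]
  have full: "1 / 2 * Beta (1 / 2) (real n / 2) = \<Psi> (pi / 2)"
    using t[of 0] by (simp add: threshold_coeff_0_0[OF ab] \<Psi>_def)
  have arc: "arccos (sqrt ((cos L)\<^sup>2)) = L" using cos_sin_L(1) L by (simp add: arccos_cos)
  show ?thesis
  proof (cases k)
    case 0
    have "1 / 2 * Beta (1 / 2) (real n / 2) * threshold_coeff (1 / 2) (real n / 2) ((cos L)\<^sup>2) 0 = \<Psi> L"
      using t[of "(cos L)\<^sup>2"] cos_sin_L unfolding arc by (simp add: \<Psi>_def)
    moreover have "0 < Beta (1 / 2) (real n / 2)" by (rule beta_pos[OF ab])
    ultimately have "threshold_coeff (1 / 2) (real n / 2) ((cos L)\<^sup>2) 0 = \<Psi> L / \<Psi> (pi / 2)"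
      unfolding full[symmetric] by (simp add: field_simps)
    then show ?thesis unfolding 0 eig_RP_def \<Psi>_def by simp
  next
    case (Suc j)
    have "real n / 2 * Beta (1 / 2) (real n / 2) = Gamma (1 / 2) * Gamma ((real n + 2) / 2) / Gamma ((real n + 1) / 2)"
    proof -
      have "Gamma (real n / 2 + 1) = real n / 2 * Gamma (real n / 2)" using ab by (intro Gamma_plus1) (auto elim!: nonpos_Ints_cases)
      moreover have "(real n + 2) / 2 = real n / 2 + 1" "(real n + 1) / 2 = 1 / 2 + real n / 2" by (simp_all add: add_divide_distrib)
      ultimately show ?thesis unfolding Beta_def by (simp only: times_divide_eq_right mult_ac)
    qed
    then show ?thesis unfolding Suc eig_RP_def using threshold_coeff_proj_Suc[of 1 n j] n by (simp add: add.commute)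
  qed
qed

text \<open>The substitution is s = (1 + cos \<theta>)/2, with s (1 - s) = (sin \<theta> / 2)^2.
  This is the origin of the powers of 2, which cancel in the end.\<close>

lemma eig_RS_eq:
  assumes n: "1 \<le> n"
  shows "threshold_coeff (real n / 2) (real n / 2) ((1 + cos L) / 2) k = eig_RS n L k"
proof -
  define \<Psi> where "\<Psi> \<theta> = integral {0..\<theta>} (\<lambda>t. sin t ^ (n - 1))" for \<theta> :: real
  have ab: "0 < real n / 2" using n by auto
  have cont: "continuous_on {0..1} (\<lambda>s. \<Psi> (arccos (2 * s - 1)))"
  proof (rule continuous_on_compose2[where g = \<Psi> and t = "{0..pi}"])
    show "continuous_on {0..pi} \<Psi>" unfolding \<Psi>_def[abs_def] by (rule sin_power_integral(2))
    have b: "- 1 \<le> 2 * s - 1" "2 * s - 1 \<le> 1" if "s \<in> {0..1}" for s :: real using that by auto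
    show "continuous_on {0..1} (\<lambda>s::real. arccos (2 * s - 1))" using b by (intro continuous_intros) auto
    show "(\<lambda>s. arccos (2 * s - 1)) ` {0..1} \<subseteq> {0..pi}" using arccos_bounded[OF b] by auto
  qed
  have der: "((\<lambda>s. \<Psi> (arccos (2 * s - 1))) has_real_derivative - (2 ^ (n - 1)) * (s powr (real n / 2 - 1) * (1 - s) powr (real n / 2 - 1))) (at s)"
    if s: "0 < s" "s < 1" for s
  proof -
    have r: "- 1 < 2 * s - 1" "2 * s - 1 < 1" using s by auto
    have "0 < arccos (2 * s - 1)" "arccos (2 * s - 1) < pi" using arccos_lt_bounded[OF r] by auto
    then have d: "(\<Psi> has_real_derivative sin (arccos (2 * s - 1)) ^ (n - 1)) (at (arccos (2 * s - 1)))"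
      unfolding \<Psi>_def[abs_def] by (rule sin_power_integral(1))
    have q: "sqrt (1 - (2 * s - 1)\<^sup>2) = 2 * (sqrt s * sqrt (1 - s))"
    proof -
      have "1 - (2 * s - 1)\<^sup>2 = 4 * (s * (1 - s))" by (simp add: power2_eq_square algebra_simps)
      then show ?thesis by (simp add: real_sqrt_mult)
    qed
    have e: "sin (arccos (2 * s - 1)) = 2 * (sqrt s * sqrt (1 - s))" using r s by (subst sin_arccos) (auto simp: q)
    have a: "((\<lambda>s. arccos (2 * s - 1)) has_real_derivative inverse (- sqrt (1 - (2 * s - 1)\<^sup>2)) * 2) (at s)"
      by (rule DERIV_chain2[where f = arccos and g = "\<lambda>s. 2 * s - 1", OF DERIV_arccos[OF r]]) (auto intro!: derivative_eq_intros)
    have p: "z powr (real n / 2 - 1) = sqrt z ^ (n - 1) / sqrt z" if "0 < z" for z using powr_half_minus_1[OF that n] .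
    have "(2 * (u * v)) ^ (n - 1) * (inverse (- (2 * (u * v))) * 2) = - (2 ^ (n - 1)) * (u ^ (n - 1) / u * (v ^ (n - 1) / v))"
      if "u \<noteq> 0" "v \<noteq> 0" for u v :: real using that by (simp add: power_mult_distrib field_simps)
    from this[of "sqrt s" "sqrt (1 - s)"] have g: "(2 * (sqrt s * sqrt (1 - s))) ^ (n - 1) * (inverse (- (2 * (sqrt s * sqrt (1 - s)))) * 2)
        = - (2 ^ (n - 1)) * (sqrt s ^ (n - 1) / sqrt s * (sqrt (1 - s) ^ (n - 1) / sqrt (1 - s)))" using s by simp
    have "0 < 1 - s" using s by simp
    from DERIV_chain2[OF d[unfolded e] a[unfolded q]] show ?thesis unfolding p[OF s(1)] p[OF \<open>0 < 1 - s\<close>] g .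
  qed
  note t = threshold_coeff_0[OF ab ab _ _ cont der]
  have B: "0 < Beta (real n / 2) (real n / 2)" by (rule beta_pos[OF ab ab])
  have full: "2 ^ (n - 1) * Beta (real n / 2) (real n / 2) = \<Psi> pi"
    using t[of 0] by (simp add: threshold_coeff_0_0[OF ab ab] \<Psi>_def)
  have s0: "0 < (1 + cos L) / 2" "(1 + cos L) / 2 < 1" using cos_sin_L by auto
  show ?thesis
  proof (cases k)
    case 0
    have q: "2 * ((1 + cos L) / 2) - 1 = cos L" by (simp add: field_simps)
    have "2 ^ (n - 1) * Beta (real n / 2) (real n / 2) * threshold_coeff (real n / 2) (real n / 2) ((1 + cos L) / 2) 0 = \<Psi> (arccos (cos L)) - \<Psi> (arccos 1)"
      using t[OF less_imp_le[OF s0(1)] s0(2)] unfolding q by simp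
    then have "\<Psi> pi * threshold_coeff (real n / 2) (real n / 2) ((1 + cos L) / 2) 0 = \<Psi> L"
      unfolding full using L by (simp add: arccos_cos \<Psi>_def)
    moreover have "0 < \<Psi> pi" unfolding full[symmetric] using B by simp
    ultimately have "threshold_coeff (real n / 2) (real n / 2) ((1 + cos L) / 2) 0 = \<Psi> L / \<Psi> pi" by (simp add: field_simps)
    then show ?thesis unfolding 0 eig_RS_def \<Psi>_def by simp
  next
    case (Suc j)
    have "((1 + cos L) / 2) powr (real n / 2) * (1 - (1 + cos L) / 2) powr (real n / 2) = ((sin L / 2)\<^sup>2) powr (real n / 2)"
    proof -
      have "(1 + cos L) / 2 * (1 - (1 + cos L) / 2) = (1 - (cos L)\<^sup>2) / 4" by (simp add: power2_eq_square field_simps)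
      also have "\<dots> = (sin L / 2)\<^sup>2" by (simp add: power_divide sin_squared_eq)
      finally have e: "(1 + cos L) / 2 * (1 - (1 + cos L) / 2) = (sin L / 2)\<^sup>2" .
      show ?thesis using s0 by (subst powr_mult[symmetric]) (auto simp: e[symmetric])
    qed
    also have "\<dots> = (sin L / 2) ^ n" using cos_sin_L by (intro square_powr) auto
    finally have w: "((1 + cos L) / 2) powr (real n / 2) * (1 - (1 + cos L) / 2) powr (real n / 2) = sin L ^ n / 2 ^ n" by (simp add: power_divide)
    have P: "legendreP (real n + 2) j (cos L) = poly (jac (real n / 2 + 1) (real n / 2 + 1) j) ((1 + cos L) / 2)"
      using cos_sin_L by (subst legendreP_eq_jac) (auto simp: add_divide_distrib)
    have n2: "(2::real) ^ n = 2 * 2 ^ (n - 1)" using n by (cases n) auto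
    have "threshold_coeff (real n / 2) (real n / 2) ((1 + cos L) / 2) (Suc j) = sin L ^ n / 2 ^ n * legendreP (real n + 2) j (cos L) / (real n / 2 * Beta (real n / 2) (real n / 2))"
      unfolding threshold_coeff_def P w[symmetric] using s0 ab by (subst jac_tail_integral) auto
    also have "\<dots> = sin L ^ n / (real n * (2 ^ (n - 1) * Beta (real n / 2) (real n / 2))) * legendreP (real n + 2) j (cos L)"
      unfolding n2 using B n by (simp add: field_simps)
    finally show ?thesis unfolding Suc eig_RS_def full \<Psi>_def by simp
  qed
qed

end

section \<open>Multiplicities for the five families\<close>

lemma pochhammer_fact_ratio: "pochhammer (1 + real p) k = fact (p + k) / fact p"
  using pochhammer_product[of p "p + k" "1::real"] by (simp add: pochhammer_fact[symmetric] field_simps)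

lemma dim_RS_eq: "1 \<le> n \<Longrightarrow> jac_dim (real n / 2) (real n / 2) k = dim_RS n k"
proof (cases k)
  case (Suc j)
  assume "1 \<le> n"
  then obtain p where n: "n = Suc p" by (cases n) auto
  have "pochhammer (real n / 2) (Suc j) \<noteq> 0" using pochhammer_pos[of "real n / 2" "Suc j"] by (simp add: n)
  moreover have a: "real n / 2 + real n / 2 = 1 + real p" by (simp add: n)
  ultimately have "jac_dim (real n / 2) (real n / 2) (Suc j) = pochhammer (1 + real p) j * (real p + 2 * real j + 2) / fact (Suc j)"
    unfolding jac_dim.simps a by (simp add: add.commute del: pochhammer_Suc fact_Suc)
  also have "\<dots> = fact (p + j) / fact p * (real p + 2 * real j + 2) / fact (Suc j)" by (simp only: pochhammer_fact_ratio)
  also have "\<dots> = dim_RS n (Suc j)"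
  proof -
    have "real ((Suc j + n - 1) choose (n - 1)) = fact (Suc (p + j)) / (fact p * fact (Suc j))"
      by (simp add: n binomial_fact add.commute del: fact_Suc)
    moreover have "(fact (Suc (p + j)) :: real) = (real (p + j) + 1) * fact (p + j)" by simp
    moreover have "2 * real (Suc j) + real n - 1 = real p + 2 * real j + 2" "real (Suc j) + real n - 1 = real (p + j) + 1" by (simp_all add: n)
    moreover have "F / f * N / S = N / q * (q * F / (f * S))" if "q \<noteq> 0" for F f N S q :: real using that by simp
    moreover have "real (p + j) + 1 \<noteq> 0" by simp
    ultimately show ?thesis unfolding dim_RS_def by (simp only: if_False nat.distinct(2))
  qed
  finally show ?thesis by (simp only: Suc)
qed (simp add: dim_RS_def)

lemma dim_CP_eq: "1 \<le> n \<Longrightarrow> jac_dim 1 (real n) k = dim_CP n k"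
proof (cases k)
  case (Suc j)
  assume "1 \<le> n"
  then obtain p where n: "n = Suc p" by (cases n) auto
  have "jac_dim 1 (real n) (Suc j) = pochhammer (1 + real p) (Suc j) * pochhammer (1 + real (Suc p)) j * (real p + 2 * real j + 3) / (fact (Suc j) * pochhammer (1 + real 0) (Suc j))"
    by (simp add: n algebra_simps del: pochhammer_Suc fact_Suc)
  also have "\<dots> = (fact (p + Suc j) / fact p) * (fact (p + Suc j) / fact (Suc p)) * (real p + 2 * real j + 3) / (fact (Suc j) * fact (Suc j))"
    by (simp only: pochhammer_fact_ratio) (simp del: fact_Suc)
  also have "\<dots> = dim_CP n (Suc j)"
  proof -
    have "real ((Suc j + n - 1) choose (n - 1)) = fact (p + Suc j) / (fact p * fact (Suc j))"
      by (simp add: n binomial_fact add.commute del: fact_Suc)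
    moreover have "(fact (Suc p) :: real) = (real p + 1) * fact p" by simp
    moreover have "2 * real (Suc j) + real n = real p + 2 * real j + 3" "real n = real p + 1" by (simp_all add: n)
    moreover have "G / f * (G / (q * f)) * N / (S * S) = N / q * (G / (f * S))\<^sup>2" for G f q N S :: real
      by (simp add: divide_inverse power2_eq_square mult_ac)
    ultimately show ?thesis unfolding dim_CP_def by (simp only:)
  qed
  finally show ?thesis by (simp only: Suc)
qed (simp add: dim_CP_def)

lemma dim_HP_eq: "1 \<le> n \<Longrightarrow> jac_dim 2 (2 * real n) k = dim_HP n k"
proof (cases k)
  case (Suc j)
  assume n: "1 \<le> n"
  define p where "p = 2 * n - 1"
  have p: "2 * n = Suc p" "2 * real n = 1 + real p" using n by (auto simp: p_def)
  have a: "2 + 2 * real n = 1 + real (p + 2)" using p(2) by simp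
  have "jac_dim 2 (2 * real n) (Suc j) = pochhammer (1 + real p) (Suc j) * pochhammer (1 + real (p + 2)) j * (1 + real (p + 2) + 2 * real j + 1) / (fact (Suc j) * pochhammer (1 + real 1) (Suc j))"
    unfolding jac_dim.simps a unfolding p(2) by simp
  also have "\<dots> = (fact (p + Suc j) / fact p) * (fact (p + 2 + j) / fact (p + 2)) * (1 + real (p + 2) + 2 * real j + 1) / (fact (Suc j) * fact (1 + Suc j))"
    by (simp only: pochhammer_fact_ratio) simp
  also have "\<dots> = dim_HP n (Suc j)"
  proof -
    have 1: "real ((Suc j + 2 * n - 1) choose (2 * n - 1)) = fact (p + Suc j) / (fact p * fact (Suc j))"
      unfolding p by (subst binomial_fact) (simp_all add: add.commute del: fact_Suc)
    have 2: "real ((Suc j + 2 * n) choose (2 * n)) = fact (p + 2 + j) / (fact (Suc p) * fact (Suc j))"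
      unfolding p by (subst binomial_fact) (simp_all add: add.commute del: fact_Suc)
    have 3: "(fact (p + 2) :: real) = (real p + 2) * fact (Suc p)" "(fact (1 + Suc j) :: real) = (real j + 2) * fact (Suc j)" by simp_all
    have 4: "2 * real (Suc j) + 2 * real n + 1 = 1 + real (p + 2) + 2 * real j + 1" "2 * real n + 1 = real p + 2" "real (Suc j) + 1 = real j + 2"
      using p(2) by simp_all
    have 5: "G / f * (H / (q * f1)) * N / (S * (r * S)) = N / (q * r) * (H / (f1 * S)) * (G / (f * S))" for G f H q f1 N S r :: real
      by (simp add: divide_inverse mult_ac)
    show ?thesis unfolding dim_HP_def 1 2 3 4 by (rule 5)
  qed
  finally show ?thesis by (simp only: Suc)
qed (simp add: dim_HP_def)

lemma dim_OP_eq: "jac_dim 4 8 k = dim_OP k"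
proof (cases k)
  case 0
  have "(7 choose 4) = (35::nat)" by (simp add: numeral_eq_Suc)
  then show ?thesis using 0 by (simp add: dim_OP_def)
next
  case (Suc j)
  have "jac_dim 4 8 (Suc j) = pochhammer (1 + real 7) (Suc j) * pochhammer (1 + real 11) j * (13 + 2 * real j) / (fact (Suc j) * pochhammer (1 + real 3) (Suc j))"
    by (simp add: algebra_simps del: pochhammer_Suc fact_Suc)
  also have "\<dots> = (fact (7 + Suc j) / fact 7) * (fact (11 + j) / fact 11) * (13 + 2 * real j) / (fact (Suc j) * (fact (3 + Suc j) / fact 3))"
    by (simp only: pochhammer_fact_ratio)
  also have "\<dots> = dim_OP (Suc j)"
  proof -
    have 1: "real ((Suc j + 7) choose 4) = fact (7 + Suc j) / (fact 4 * fact (3 + Suc j))"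
      by (subst binomial_fact) (simp_all add: add.commute del: fact_Suc)
    have 2: "real ((Suc j + 10) choose 10) = fact (11 + j) / (fact 10 * fact (Suc j))"
      by (subst binomial_fact) (simp_all add: add.commute del: fact_Suc)
    have 3: "(fact 11 :: real) = 11 * fact 10" "(fact 7 :: real) = 5040" "(fact 4 :: real) = 24" "(fact 3 :: real) = 6"
      by (simp_all add: fact_numeral)
    have 4: "2 * real (Suc j) + 11 = 13 + 2 * real j" by simp
    \<comment> \<open>385 = 5040 * 11 / (24 * 6).\<close>
    have 5: "G / 5040 * (H / (11 * f)) * N / (S * (T / 6)) = N / 385 * (G / (24 * T)) * (H / (f * S))" for G H f N S T :: real
      by (cases "f = 0"; cases "S = 0"; cases "T = 0") (simp_all add: field_simps)
    show ?thesis unfolding dim_OP_def 1 2 3 4 by (rule 5)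
  qed
  finally show ?thesis by (simp only: Suc)
qed

text \<open>The duplication formula merges the Pochhammer symbols with bases n/2 and (n + 1)/2, and
  those with bases 1/2 and 1, into symbols of index 2 k; this is why only even degrees of spherical
  harmonics are seen.\<close>

lemma dim_RP_eq: "2 \<le> n \<Longrightarrow> jac_dim (1 / 2) (real n / 2) k = dim_RP n k"
proof (cases k)
  case (Suc j)
  assume n2: "2 \<le> n"
  then obtain p where n: "n = Suc p" by (cases n) auto
  have d: "pochhammer (2 * z) (2 * Suc j) = 2 ^ (2 * Suc j) * pochhammer z (Suc j) * pochhammer (z + 1 / 2) (Suc j)" for z :: real
    using pochhammer_double[of z "Suc j"] by (simp add: mult_ac del: pochhammer_Suc power_Suc)
  have dv: "x = y / c" if "c * x = y" "c \<noteq> 0" for x y c :: real using that by (simp add: field_simps)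
  have "pochhammer (real n) (2 * Suc j) = fact (p + 2 * Suc j) / fact p"
    using pochhammer_fact_ratio[of p "2 * Suc j"] unfolding n of_nat_Suc .
  moreover have "2 * (real n / 2) = real n" by simp
  ultimately have "2 ^ (2 * Suc j) * (pochhammer (real n / 2) (Suc j) * pochhammer (real n / 2 + 1 / 2) (Suc j)) = fact (p + 2 * Suc j) / fact p"
    using d[of "real n / 2"] by (simp only: mult.assoc)
  then have 1: "pochhammer (real n / 2) (Suc j) * pochhammer (real n / 2 + 1 / 2) (Suc j) = fact (p + 2 * Suc j) / fact p / 2 ^ (2 * Suc j)"
    by (rule dv) simp
  have "2 * (1 / 2) = (1::real)" "1 / 2 + 1 / 2 = (1::real)" by simp_all
  then have "2 ^ (2 * Suc j) * (fact (Suc j) * pochhammer (1 / 2) (Suc j)) = (fact (2 * Suc j) :: real)"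
    using d[of "1 / 2"] by (simp only: pochhammer_fact mult_ac)
  then have 2: "fact (Suc j) * pochhammer (1 / 2) (Suc j) = (fact (2 * Suc j) :: real) / 2 ^ (2 * Suc j)"
    by (rule dv) simp
  have "pochhammer (real n / 2 + 1 / 2) (Suc j) = pochhammer (real n / 2 + 1 / 2) j * (real n / 2 + 1 / 2 + real j)" by (rule pochhammer_Suc)
  moreover have "real n / 2 + 1 / 2 + real j > 0" by (intro add_pos_nonneg add_nonneg_pos) auto
  ultimately have 3: "pochhammer (real n / 2 + 1 / 2) j = pochhammer (real n / 2 + 1 / 2) (Suc j) / (real n / 2 + 1 / 2 + real j)"
    using dv[of "real n / 2 + 1 / 2 + real j"] by (metis less_irrefl mult.commute)
  have "jac_dim (1 / 2) (real n / 2) (Suc j) = pochhammer (real n / 2) (Suc j) * pochhammer (real n / 2 + 1 / 2) j * (1 / 2 + real n / 2 + 2 * real j + 1) / (fact (Suc j) * pochhammer (1 / 2) (Suc j))"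
    by (simp add: add.commute del: pochhammer_Suc fact_Suc)
  also have "\<dots> = fact (p + 2 * Suc j) / fact p / 2 ^ (2 * Suc j) * ((1 / 2 + real n / 2 + 2 * real j + 1) / (real n / 2 + 1 / 2 + real j)) / ((fact (2 * Suc j) :: real) / 2 ^ (2 * Suc j))"
    unfolding 2 3 1[symmetric] by simp
  also have "\<dots> = fact (p + 2 * Suc j) / fact p * ((1 / 2 + real n / 2 + 2 * real j + 1) / (real n / 2 + 1 / 2 + real j)) / fact (2 * Suc j)"
    by simp
  also have "(1 / 2 + real n / 2 + 2 * real j + 1) / (real n / 2 + 1 / 2 + real j) = (4 * real (Suc j) + real n - 1) / (2 * real (Suc j) + real n - 1)"
    by (simp add: n field_simps)
  also have "fact (p + 2 * Suc j) / fact p * ((4 * real (Suc j) + real n - 1) / (2 * real (Suc j) + real n - 1)) / fact (2 * Suc j) = dim_RP n (Suc j)"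
  proof -
    have "real ((2 * Suc j + n - 1) choose (n - 1)) = fact (p + 2 * Suc j) / (fact p * fact (2 * Suc j))"
      unfolding n by (subst binomial_fact) (simp_all add: add.commute del: fact_Suc)
    then show ?thesis unfolding dim_RP_def by (simp add: mult_ac del: fact_Suc)
  qed
  finally show ?thesis by (simp only: Suc)
qed (simp add: dim_RP_def)

theorem theorem3p9:
  fixes L :: real
  assumes "0 < L" and "L < pi / 2"
  shows
    "(\<forall>n\<ge>1. \<forall>(P :: 'w measure) \<mu> Y.
        invariant_prob (sphere_pts n) (sphere_dist n) \<mu> \<and>
        iid_sample (sphere_pts n) (sphere_dist n) P \<mu> Y
        \<longrightarrow> rgg_converges (sphere_pts n) (sphere_dist n) L P Y (eig_RS n L) (dim_RS n)) \<and>
     (\<forall>n\<ge>2. \<forall>(P :: 'w measure) \<mu> Y.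
        invariant_prob (proj_space 0 n) (proj_dist 0 n) \<mu> \<and>
        iid_sample (proj_space 0 n) (proj_dist 0 n) P \<mu> Y
        \<longrightarrow> rgg_converges (proj_space 0 n) (proj_dist 0 n) L P Y (eig_RP n L) (dim_RP n)) \<and>
     (\<forall>n\<ge>2. \<forall>(P :: 'w measure) \<mu> Y.
        invariant_prob (proj_space 1 n) (proj_dist 1 n) \<mu> \<and>
        iid_sample (proj_space 1 n) (proj_dist 1 n) P \<mu> Y
        \<longrightarrow> rgg_converges (proj_space 1 n) (proj_dist 1 n) L P Y (eig_CP n L) (dim_CP n)) \<and>
     (\<forall>n\<ge>2. \<forall>(P :: 'w measure) \<mu> Y.
        invariant_prob (proj_space 2 n) (proj_dist 2 n) \<mu> \<and>
        iid_sample (proj_space 2 n) (proj_dist 2 n) P \<mu> Y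
        \<longrightarrow> rgg_converges (proj_space 2 n) (proj_dist 2 n) L P Y (eig_HP n L) (dim_HP n)) \<and>
     (\<forall>(P :: 'w measure) \<mu> Y.
        invariant_prob (proj_space 3 2) (proj_dist 3 2) \<mu> \<and>
        iid_sample (proj_space 3 2) (proj_dist 3 2) P \<mu> Y
        \<longrightarrow> rgg_converges (proj_space 3 2) (proj_dist 3 2) L P Y (eig_OP L) dim_OP)"
proof -
  have RS: "threshold_coeff (real n / 2) (real n / 2) ((1 + cos L) / 2) = eig_RS n L"
      "jac_dim (real n / 2) (real n / 2) = dim_RS n" if "1 \<le> n" for n
    by (intro ext eig_RS_eq[OF assms] dim_RS_eq that)+
  have RP: "threshold_coeff (1 / 2) (real n / 2) ((cos L)\<^sup>2) = eig_RP n L" "jac_dim (1 / 2) (real n / 2) = dim_RP n" if "2 \<le> n" for n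
    using that by (intro ext eig_RP_eq[OF assms] dim_RP_eq; simp)+
  have CP: "threshold_coeff 1 (real n) ((cos L)\<^sup>2) = eig_CP n L" "jac_dim 1 (real n) = dim_CP n" if "2 \<le> n" for n
    using that by (intro ext eig_CP_eq[OF assms] dim_CP_eq; simp)+
  have HP: "threshold_coeff 2 (2 * real n) ((cos L)\<^sup>2) = eig_HP n L" "jac_dim 2 (2 * real n) = dim_HP n" if "2 \<le> n" for n
    using that by (intro ext eig_HP_eq[OF assms] dim_HP_eq; simp)+
  have OP: "threshold_coeff 4 8 ((cos L)\<^sup>2) = eig_OP L" "jac_dim 4 8 = dim_OP"
    by (intro ext eig_OP_eq[OF assms] dim_OP_eq)+
  \<comment> \<open>The Beta parameters 2^m / 2 and n 2^m / 2 at the levels m = 0 to 3, the last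
    with n = 2.\<close>
  have e: "real (2 ^ 0) / 2 = 1 / 2" "real n * real (2 ^ 0) / 2 = real n / 2" "real (2 ^ 1) / 2 = 1" "real n * real (2 ^ 1) / 2 = real n"
    "real (2 ^ 2) / 2 = 2" "real n * real (2 ^ 2) / 2 = 2 * real n" "real (2 ^ 3) / 2 = 4" "real 2 * real (2 ^ 3) / 2 = 8" for n
    by simp_all
  show ?thesis
  proof (intro conjI allI impI; elim conjE)
    fix n :: nat and P :: "'w measure" and \<mu> Y
    assume n: "1 \<le> n" and "invariant_prob (sphere_pts n) (sphere_dist n) \<mu>" "iid_sample (sphere_pts n) (sphere_dist n) P \<mu> Y"
    then show "rgg_converges (sphere_pts n) (sphere_dist n) L P Y (eig_RS n L) (dim_RS n)"
      unfolding RS[OF n, symmetric] using assms by (rule sphere_rgg)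
  next
    fix n :: nat and P :: "'w measure" and \<mu> Y
    assume n: "2 \<le> n" and *: "invariant_prob (proj_space 0 n) (proj_dist 0 n) \<mu>" "iid_sample (proj_space 0 n) (proj_dist 0 n) P \<mu> Y"
    have "proj_geometry 0 n" using n by (intro proj_geometry_assoc) auto
    from proj_space_rgg[OF this * assms] show "rgg_converges (proj_space 0 n) (proj_dist 0 n) L P Y (eig_RP n L) (dim_RP n)"
      unfolding e RP[OF n] .
  next
    fix n :: nat and P :: "'w measure" and \<mu> Y
    assume n: "2 \<le> n" and *: "invariant_prob (proj_space 1 n) (proj_dist 1 n) \<mu>" "iid_sample (proj_space 1 n) (proj_dist 1 n) P \<mu> Y"
    have "proj_geometry 1 n" using n by (intro proj_geometry_assoc) auto
    from proj_space_rgg[OF this * assms] show "rgg_converges (proj_space 1 n) (proj_dist 1 n) L P Y (eig_CP n L) (dim_CP n)"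
      unfolding e CP[OF n] .
  next
    fix n :: nat and P :: "'w measure" and \<mu> Y
    assume n: "2 \<le> n" and *: "invariant_prob (proj_space 2 n) (proj_dist 2 n) \<mu>" "iid_sample (proj_space 2 n) (proj_dist 2 n) P \<mu> Y"
    have "proj_geometry 2 n" using n by (intro proj_geometry_assoc) auto
    from proj_space_rgg[OF this * assms] show "rgg_converges (proj_space 2 n) (proj_dist 2 n) L P Y (eig_HP n L) (dim_HP n)"
      unfolding e HP[OF n] .
  next
    fix P :: "'w measure" and \<mu> Y
    assume *: "invariant_prob (proj_space 3 2) (proj_dist 3 2) \<mu>" "iid_sample (proj_space 3 2) (proj_dist 3 2) P \<mu> Y"
    from proj_space_rgg[OF proj_geometry_oct * assms] show "rgg_converges (proj_space 3 2) (proj_dist 3 2) L P Y (eig_OP L) dim_OP"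
      unfolding e OP .
  qed
qed

end
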